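(* Let $A$ be a free abelian group. For all integers $i>0$ and $1\le n\le 7$, the natural map $$f_i^n=\sum_{p\mid n}f_i^{n,p}:\ \bigoplus_{p\mid n,\ p\ \text{prime}}L_iSP^{\frac np}(A\otimes\mathbb Z/p)\to H_iC^n(A)$$ is an isomorphism.
   Context: Divided powers. For an abelian group $A$, $\Gamma_*(A)=\bigoplus_{n\ge 0}\Gamma_n(A)$ is the divided power algebra of $A$ over $\mathbb Z$: the commutative ($ab=ba$) graded ring generated by symbols $\gamma_i(x)$ of degree $i\ge 0$, $x\in A$, subject to, for all $x,y\in A$: $\gamma_0(x)=1$; $\gamma_1(x)=x$; $\gamma_s(x)\gamma_t(x)=\binom{s+t}{s}\gamma_{s+t}(x)$; $\gamma_n(x+y)=\sum_{s+t=n}\gamma_s(x)\gamma_t(y)$ for $n\ge1$; $\gamma_n(-x)=(-1)^n\gamma_n(x)$ for $n\ge 1$. Dual de Rham complex. For $n\ge 1$, $C^n(A)$ is the chain complex with $C_i^n(A)=\Lambda^i(A)\otimes\Gamma_{n-i}(A)$, $0\le i\le n$ (zero otherwise), and differential $d_i(b_1\wedge\dots\wedge b_i\otimes X)=\sum_{k=1}^i(-1)^k\, b_1\wedge\dots\wedge\hat b_k\wedge\dots\wedge b_i\otimes b_kX$ for $X\in\Gamma_{n-i}(A)$. $H_iC^n(A)$ is its $i$-th homology. Derived functors of symmetric powers. $SP^n$ is the $n$-th symmetric power functor on abelian groups ($SP^0=\mathbb Z$), and $L_iSP^n(A)=\pi_i(SP^n KP_* )$ is its Dold–Puppe derived functor,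 where $P_*\to A$ is a projective resolution and $K$ is the Dold–Kan functor from chain complexes to simplicial abelian groups. The following known presentation (Mac Lane, Jean) is used to describe it by generators. For $h>0$ let ${}_hA=\{a\in A: ha=0\}$. For $m\ge2$, $\mathrm{Tor}^{[m]}(A)=L_{m-1}\otimes^m(A)$ is generated by expressions $\tau_h(a_1,\dots,a_m)$, $h>0$, $a_j\in{}_hA$, additive in each $a_j$, subject to the slide relations $\tau_{hk}(a_1,\dots,a_m)=\tau_h(ka_1,\dots,ka_{j-1},a_j,ka_{j+1},\dots,ka_m)$ for all $j$ whenever $hka_l=0$ for all $l\ne j$ and $ha_j=0$. The group $L_{m-1}SP^m(A)$ is the quotient of $\mathrm{Tor}^{[m]}(A)$ by the subgroup generated by the $\tau_h(a_1,\dots,a_m)$ with $a_j=a_l$ for some $j\ne l$; the image of $\tau_h(a_1,\dots,a_m)$ is denoted $\beta_h(a_1,\dots,a_m)$. For $i\ge1$, $$L_iSP^m(A)\simeq\big(L_iSP^{i+1}(A)\otimes SP^{m-(i+1)}(A)\big)/Jac_{SP},$$ where $Jac_{SP}$ is the subgroup generated by the elements $\sum_{k=1}^{i+2}(-1)^k\beta_h(x_1,\dots,\hat x_k,\dots,x_{i+2})\otimes x_ky_1\cdots y_{m-i-2}$ with $x_k\in{}_hA$, $y_j\in A$. In particular $L_iSP^m=0$ for $i\ge m$. For a group of the form $A\otimes\mathbb Z/p$, the group $L_iSP^{m}(A\otimes\mathbb Z/p)$ is generated by the classes of $\beta_p(\bar x_1,\dots,\bar x_{i+1})\otimes\bar x_{i+2}\cdots\bar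 x_m$, $\bar x_k\in A\otimes \mathbb Z/p$. The maps. For $A$ free abelian, $p$ a prime dividing $n$ and $i>0$, the homomorphism $f_i^{n,p}:L_iSP^{n/p}(A\otimes\mathbb Z/p)\to H_iC^n(A)$ (which is well defined; it is zero if $i\ge n/p$) sends $\beta_p(\bar x_1,\dots,\bar x_{i+1})\otimes\bar x_{i+2}\cdots\bar x_{n/p}$ to the homology class of the cycle $$\sum_{t=1}^{i+1}(-1)^t\, x_1\wedge\dots\wedge\hat x_t\wedge\dots\wedge x_{i+1}\otimes \Big(\prod_{1\le l\le i+1,\ l\ne t}\gamma_{p-1}(x_l)\Big)\gamma_p(x_t)\,\gamma_p(x_{i+2})\cdots\gamma_p(x_{\frac np})\in\Lambda^i(A)\otimes\Gamma_{n-i}(A),$$ where $x_k\in A$ is any lifting of $\bar x_k\in A\otimes\mathbb Z/p$. *)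

theory Defs
  imports
    "HOL-Algebra.Free_Abelian_Groups"
    "HOL-Algebra.Elementary_Groups"
    "HOL-Algebra.QuotRing"
    "HOL-Library.Multiset"
    "HOL-Library.Poly_Mapping"
    "HOL-Combinatorics.Permutations"
    "HOL-Computational_Algebra.Primes"
begin

text \<open>Abelian groups are groups in the sense of HOL-Algebra and are therefore written
  multiplicatively: \<open>x \<otimes> y\<close> is the sum of the mathematical text, \<open>\<one>\<close> its zero, and
  \<open>x [^] k\<close> the multiple \<open>k x\<close>.\<close>

section \<open>Presentations and free abelian groups\<close>

text \<open>\<open>frag_eval G\<close> extends the inclusion of a subset of \<open>G\<close> to a homomorphism from the free
  abelian group on that subset.\<close>

definition frag_eval :: "('a, 'm) monoid_scheme \<Rightarrow> ('a \<Rightarrow>\<^sub>0 int) \<Rightarrow> 'a" where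
  "frag_eval G c = (\<Otimes>\<^bsub>G\<^esub>x\<in>Poly_Mapping.keys c. x [^]\<^bsub>G\<^esub> Poly_Mapping.lookup c x)"

definition free_abelian :: "('a, 'm) monoid_scheme \<Rightarrow> bool" where
  "free_abelian G \<longleftrightarrow> comm_group G \<and>
     (\<exists>S \<subseteq> carrier G. frag_eval G \<in> iso (free_Abelian_group S) G)"

text \<open>The abelian group with generators \<open>S\<close> and relators \<open>R\<close>, and the class in it of an element
  of the free abelian group on \<open>S\<close>.\<close>

definition presented :: "'s set \<Rightarrow> ('s \<Rightarrow>\<^sub>0 int) set \<Rightarrow> ('s \<Rightarrow>\<^sub>0 int) set monoid" where
  "presented S R = free_Abelian_group S Mod generate (free_Abelian_group S) R"

definition presented_class :: "'s set \<Rightarrow> ('s \<Rightarrow>\<^sub>0 int) set \<Rightarrow> ('s \<Rightarrow>\<^sub>0 int) \<Rightarrow> ('s \<Rightarrow>\<^sub>0 int) set" where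
  "presented_class S R c = generate (free_Abelian_group S) R #>\<^bsub>free_Abelian_group S\<^esub> c"

text \<open>The homomorphism with prescribed values: \<open>(x, y) \<in> V\<close> prescribes that \<open>x\<close> is sent to \<open>y\<close>.
  It is only used when the first components of \<open>V\<close> generate \<open>G\<close>.\<close>

definition hom_with_values ::
    "('a, 'm) monoid_scheme \<Rightarrow> ('b, 'n) monoid_scheme \<Rightarrow> ('a \<times> 'b) set \<Rightarrow> 'a \<Rightarrow> 'b" where
  "hom_with_values G H V =
     (THE f. f \<in> hom G H \<and> f \<in> extensional (carrier G) \<and> (\<forall>(x, y)\<in>V. f x = y))"

definition drop_nth :: "nat \<Rightarrow> 'a list \<Rightarrow> 'a list" where
  "drop_nth k xs = take k xs @ drop (Suc k) xs"


section \<open>Tensor products, exterior powers and symmetric powers over the integers\<close>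

definition tensor_relators ::
    "('a, 'm) monoid_scheme \<Rightarrow> ('b, 'n) monoid_scheme \<Rightarrow> ('a \<times> 'b \<Rightarrow>\<^sub>0 int) set" where
  "tensor_relators G H =
     {frag_of (x \<otimes>\<^bsub>G\<^esub> x', y) - frag_of (x, y) - frag_of (x', y) | x x' y.
        x \<in> carrier G \<and> x' \<in> carrier G \<and> y \<in> carrier H} \<union>
     {frag_of (x, y \<otimes>\<^bsub>H\<^esub> y') - frag_of (x, y) - frag_of (x, y') | x y y'.
        x \<in> carrier G \<and> y \<in> carrier H \<and> y' \<in> carrier H}"

definition tensor ::
    "('a, 'm) monoid_scheme \<Rightarrow> ('b, 'n) monoid_scheme \<Rightarrow> ('a \<times> 'b \<Rightarrow>\<^sub>0 int) set monoid" where
  "tensor G H = presented (carrier G \<times> carrier H) (tensor_relators G H)"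

text \<open>\<open>tensor_class G H\<close> sends the formal sum of the pairs \<open>(x, y)\<close> to the sum of the tensors
  \<open>x \<otimes> y\<close>.\<close>

definition tensor_class ::
    "('a, 'm) monoid_scheme \<Rightarrow> ('b, 'n) monoid_scheme \<Rightarrow> ('a \<times> 'b \<Rightarrow>\<^sub>0 int) \<Rightarrow> ('a \<times> 'b \<Rightarrow>\<^sub>0 int) set" where
  "tensor_class G H = presented_class (carrier G \<times> carrier H) (tensor_relators G H)"

definition words :: "('a, 'm) monoid_scheme \<Rightarrow> nat \<Rightarrow> 'a list set" where
  "words A i = {xs. length xs = i \<and> set xs \<subseteq> carrier A}"

definition ext_relators :: "('a, 'm) monoid_scheme \<Rightarrow> nat \<Rightarrow> ('a list \<Rightarrow>\<^sub>0 int) set" where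
  "ext_relators A i =
     {frag_of (us @ (x \<otimes>\<^bsub>A\<^esub> y) # vs) - frag_of (us @ x # vs) - frag_of (us @ y # vs) | us vs x y.
        us @ x # vs \<in> words A i \<and> y \<in> carrier A} \<union>
     {frag_of xs | xs. xs \<in> words A i \<and> (\<exists>j k. j < k \<and> k < i \<and> xs ! j = xs ! k)}"

definition ext_power :: "('a, 'm) monoid_scheme \<Rightarrow> nat \<Rightarrow> ('a list \<Rightarrow>\<^sub>0 int) set monoid" where
  "ext_power A i = presented (words A i) (ext_relators A i)"

definition wedge :: "('a, 'm) monoid_scheme \<Rightarrow> 'a list \<Rightarrow> ('a list \<Rightarrow>\<^sub>0 int) set" where
  "wedge A xs = presented_class (words A (length xs)) (ext_relators A (length xs)) (frag_of xs)"

text \<open>A commutative monomial \<open>x\<^sub>1 \<cdots> x\<^sub>m\<close> is encoded as the multiset of its factors.\<close>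

definition monomials :: "('a, 'm) monoid_scheme \<Rightarrow> nat \<Rightarrow> 'a multiset set" where
  "monomials A m = {M. size M = m \<and> set_mset M \<subseteq> carrier A}"

definition SP_relators :: "nat \<Rightarrow> ('a, 'm) monoid_scheme \<Rightarrow> ('a multiset \<Rightarrow>\<^sub>0 int) set" where
  "SP_relators m A =
     {frag_of (add_mset (x \<otimes>\<^bsub>A\<^esub> y) M) - frag_of (add_mset x M) - frag_of (add_mset y M) | x y M.
        add_mset x M \<in> monomials A m \<and> y \<in> carrier A}"

definition SP :: "nat \<Rightarrow> ('a, 'm) monoid_scheme \<Rightarrow> ('a multiset \<Rightarrow>\<^sub>0 int) set monoid" where
  "SP m A = presented (monomials A m) (SP_relators m A)"

definition SP_class ::
    "nat \<Rightarrow> ('a, 'm) monoid_scheme \<Rightarrow> ('a multiset \<Rightarrow>\<^sub>0 int) \<Rightarrow> ('a multiset \<Rightarrow>\<^sub>0 int) set" where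
  "SP_class m A = presented_class (monomials A m) (SP_relators m A)"

definition SP_map ::
    "nat \<Rightarrow> ('a, 'm) monoid_scheme \<Rightarrow> ('b, 'n) monoid_scheme \<Rightarrow> ('a \<Rightarrow> 'b) \<Rightarrow>
     ('a multiset \<Rightarrow>\<^sub>0 int) set \<Rightarrow> ('b multiset \<Rightarrow>\<^sub>0 int) set" where
  "SP_map m A B \<phi> = hom_with_values (SP m A) (SP m B)
     {(SP_class m A (frag_of M), SP_class m B (frag_of (image_mset \<phi> M))) | M. M \<in> monomials A m}"


section \<open>The divided power algebra\<close>

text \<open>The symbol \<open>\<gamma>\<^sub>i(x)\<close> is encoded as the pair \<open>(i, x)\<close>. Formal integer combinations of multisets
  of symbols, with the convolution product of \<open>Poly_Mapping\<close>, form the polynomial ring over the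
  integers in these symbols.\<close>

definition gamma_poly_ring :: "('a, 'm) monoid_scheme \<Rightarrow> ((nat \<times> 'a) multiset \<Rightarrow>\<^sub>0 int) ring" where
  "gamma_poly_ring A =
     \<lparr>carrier = {p. \<forall>M \<in> Poly_Mapping.keys p. snd ` set_mset M \<subseteq> carrier A},
      monoid.mult = (*), one = 1, zero = 0, add = (+)\<rparr>"

definition gamma_symbol :: "nat \<Rightarrow> 'a \<Rightarrow> (nat \<times> 'a) multiset \<Rightarrow>\<^sub>0 int" where
  "gamma_symbol i x = frag_of {#(i, x)#}"

text \<open>The relation \<open>\<gamma>\<^sub>1(x) = x\<close> is a notational convention, identifying \<open>x\<close> with the symbol
  \<open>\<gamma>\<^sub>1(x)\<close>; the additivity of \<open>\<gamma>\<^sub>1\<close> that it requires is the case \<open>n = 1\<close> of the fourth line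
  below.\<close>

inductive_set gamma_relators ::
    "('a, 'm) monoid_scheme \<Rightarrow> ((nat \<times> 'a) multiset \<Rightarrow>\<^sub>0 int) set"
  for A :: "('a, 'm) monoid_scheme" where
  "x \<in> carrier A \<Longrightarrow> gamma_symbol 0 x - 1 \<in> gamma_relators A"
| "x \<in> carrier A \<Longrightarrow>
     gamma_symbol s x * gamma_symbol t x - of_nat ((s + t) choose s) * gamma_symbol (s + t) x
       \<in> gamma_relators A"
| "\<lbrakk>x \<in> carrier A; y \<in> carrier A; n \<ge> 1\<rbrakk> \<Longrightarrow>
     gamma_symbol n (x \<otimes>\<^bsub>A\<^esub> y) - (\<Sum>s\<le>n. gamma_symbol s x * gamma_symbol (n - s) y)
       \<in> gamma_relators A"
| "\<lbrakk>x \<in> carrier A; n \<ge> 1\<rbrakk> \<Longrightarrow>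
     gamma_symbol n (inv\<^bsub>A\<^esub> x) - (- 1) ^ n * gamma_symbol n x \<in> gamma_relators A"

definition gamma_ideal :: "('a, 'm) monoid_scheme \<Rightarrow> ((nat \<times> 'a) multiset \<Rightarrow>\<^sub>0 int) set" where
  "gamma_ideal A = Idl\<^bsub>gamma_poly_ring A\<^esub> (gamma_relators A)"

definition Gamma_ring :: "('a, 'm) monoid_scheme \<Rightarrow> ((nat \<times> 'a) multiset \<Rightarrow>\<^sub>0 int) set ring" where
  "Gamma_ring A = gamma_poly_ring A Quot gamma_ideal A"

definition Gamma_class ::
    "('a, 'm) monoid_scheme \<Rightarrow> ((nat \<times> 'a) multiset \<Rightarrow>\<^sub>0 int) \<Rightarrow> ((nat \<times> 'a) multiset \<Rightarrow>\<^sub>0 int) set" where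
  "Gamma_class A p = gamma_ideal A +>\<^bsub>gamma_poly_ring A\<^esub> p"

definition gamma :: "('a, 'm) monoid_scheme \<Rightarrow> nat \<Rightarrow> 'a \<Rightarrow> ((nat \<times> 'a) multiset \<Rightarrow>\<^sub>0 int) set" where
  "gamma A i x = Gamma_class A (gamma_symbol i x)"

text \<open>The homogeneous component of degree \<open>n\<close>, as an abelian group.\<close>

definition Gamma :: "nat \<Rightarrow> ('a, 'm) monoid_scheme \<Rightarrow> ((nat \<times> 'a) multiset \<Rightarrow>\<^sub>0 int) set monoid" where
  "Gamma n A =
     \<lparr>carrier = {Gamma_class A p | p. p \<in> carrier (gamma_poly_ring A) \<and>
                  (\<forall>M \<in> Poly_Mapping.keys p. sum_mset (image_mset fst M) = n)},
      monoid.mult = (\<oplus>\<^bsub>Gamma_ring A\<^esub>), one = \<zero>\<^bsub>Gamma_ring A\<^esub>\<rparr>"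


section \<open>Homology of chain complexes\<close>

text \<open>A nonnegatively graded chain complex is given by its groups \<open>C i\<close> and its differentials
  \<open>d i : C i \<rightarrow> C (i - 1)\<close>, where \<open>d 0\<close> is irrelevant.\<close>

definition cycles :: "(nat \<Rightarrow> 'a monoid) \<Rightarrow> (nat \<Rightarrow> 'a \<Rightarrow> 'a) \<Rightarrow> nat \<Rightarrow> 'a set" where
  "cycles C d i = (if i = 0 then carrier (C 0) else kernel (C i) (C (i - 1)) (d i))"

definition boundaries :: "(nat \<Rightarrow> 'a monoid) \<Rightarrow> (nat \<Rightarrow> 'a \<Rightarrow> 'a) \<Rightarrow> nat \<Rightarrow> 'a set" where
  "boundaries C d i = d (Suc i) ` carrier (C (Suc i))"

definition homology :: "(nat \<Rightarrow> 'a monoid) \<Rightarrow> (nat \<Rightarrow> 'a \<Rightarrow> 'a) \<Rightarrow> nat \<Rightarrow> 'a set monoid" where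
  "homology C d i = ((C i)\<lparr>carrier := cycles C d i\<rparr>) Mod boundaries C d i"

definition homology_class ::
    "(nat \<Rightarrow> 'a monoid) \<Rightarrow> (nat \<Rightarrow> 'a \<Rightarrow> 'a) \<Rightarrow> nat \<Rightarrow> 'a \<Rightarrow> 'a set" where
  "homology_class C d i z = boundaries C d i #>\<^bsub>C i\<^esub> z"


section \<open>The dual de Rham complex\<close>

type_synonym 'a dR = "(('a list \<Rightarrow>\<^sub>0 int) set \<times> ((nat \<times> 'a) multiset \<Rightarrow>\<^sub>0 int) set \<Rightarrow>\<^sub>0 int) set"

definition dR_group :: "('a, 'm) monoid_scheme \<Rightarrow> nat \<Rightarrow> nat \<Rightarrow> 'a dR monoid" where
  "dR_group A n i =
     (let T = tensor (ext_power A i) (Gamma (n - i) A)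
      in if i \<le> n then T else T\<lparr>carrier := {\<one>\<^bsub>T\<^esub>}\<rparr>)"

text \<open>Lists are indexed from \<open>0\<close>, whence the exponent \<open>Suc k\<close> in the sign.\<close>

definition dR_diff :: "('a, 'm) monoid_scheme \<Rightarrow> nat \<Rightarrow> nat \<Rightarrow> 'a dR \<Rightarrow> 'a dR" where
  "dR_diff A n i =
     (if 1 \<le> i \<and> i \<le> n then
        hom_with_values (dR_group A n i) (dR_group A n (i - 1))
          {(tensor_class (ext_power A i) (Gamma (n - i) A) (frag_of (wedge A bs, X)),
            tensor_class (ext_power A (i - 1)) (Gamma (n - (i - 1)) A)
              (\<Sum>k<i. frag_cmul ((- 1) ^ Suc k)
                 (frag_of (wedge A (drop_nth k bs), gamma A 1 (bs ! k) \<otimes>\<^bsub>Gamma_ring A\<^esub> X)))) | bs X.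
            bs \<in> words A i \<and> X \<in> carrier (Gamma (n - i) A)}
      else (\<lambda>_ \<in> carrier (dR_group A n i). \<one>\<^bsub>dR_group A n (i - 1)\<^esub>))"

definition dR_homology :: "('a, 'm) monoid_scheme \<Rightarrow> nat \<Rightarrow> nat \<Rightarrow> 'a dR set monoid" where
  "dR_homology A n i = homology (dR_group A n) (dR_diff A n) i"


section \<open>The Dold-Kan functor and homotopy groups\<close>

text \<open>The Dold-Kan functor \<open>K\<close> is the right adjoint (in fact, inverse) of the normalized chain
  complex functor: \<open>K(P)\<^sub>n\<close> is the group of chain maps from the normalized chains of the standard
  \<open>n\<close>-simplex to \<open>P\<close>. The nondegenerate \<open>k\<close>-simplices of the standard \<open>n\<close>-simplex are the
  subsets \<open>S\<close> of \<open>{0..n}\<close> with \<open>k + 1\<close> elements, and the boundary of \<open>S = {s\<^sub>0 < \<dots> < s\<^sub>k}\<close> is the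
  alternating sum of the \<open>S - {s\<^sub>j}\<close>.\<close>

definition nd_simplices :: "nat \<Rightarrow> nat set set" where
  "nd_simplices n = {S. S \<subseteq> {..n} \<and> S \<noteq> {}}"

definition DK ::
    "(nat \<Rightarrow> 'b monoid) \<Rightarrow> (nat \<Rightarrow> 'b \<Rightarrow> 'b) \<Rightarrow> nat \<Rightarrow> (nat set \<Rightarrow> 'b) monoid" where
  "DK P d n =
     \<lparr>carrier = {c \<in> \<Pi>\<^sub>E S\<in>nd_simplices n. carrier (P (card S - 1)).
        \<forall>S\<in>nd_simplices n. card S \<ge> 2 \<longrightarrow>
          d (card S - 1) (c S) =
            (\<Otimes>\<^bsub>P (card S - 2)\<^esub>s\<in>S.
               c (S - {s}) [^]\<^bsub>P (card S - 2)\<^esub> ((- 1) ^ card {t \<in> S. t < s} :: int))},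
      monoid.mult = (\<lambda>c c'. \<lambda>S\<in>nd_simplices n. c S \<otimes>\<^bsub>P (card S - 1)\<^esub> c' S),
      one = (\<lambda>S\<in>nd_simplices n. \<one>\<^bsub>P (card S - 1)\<^esub>)\<rparr>"

text \<open>The operator \<open>\<theta>\<^sup>* : K(P)\<^sub>n \<rightarrow> K(P)\<^sub>k\<close> of a monotone map \<open>\<theta> : {0..k} \<rightarrow> {0..n}\<close>.\<close>

definition DK_op ::
    "(nat \<Rightarrow> 'b monoid) \<Rightarrow> nat \<Rightarrow> (nat \<Rightarrow> nat) \<Rightarrow> (nat set \<Rightarrow> 'b) \<Rightarrow> (nat set \<Rightarrow> 'b)" where
  "DK_op P k \<theta> c = (\<lambda>T\<in>nd_simplices k. if inj_on \<theta> T then c (\<theta> ` T) else \<one>\<^bsub>P (card T - 1)\<^esub>)"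

definition DK_face ::
    "(nat \<Rightarrow> 'b monoid) \<Rightarrow> nat \<Rightarrow> nat \<Rightarrow> (nat set \<Rightarrow> 'b) \<Rightarrow> (nat set \<Rightarrow> 'b)" where
  "DK_face P n j = DK_op P (n - 1) (\<lambda>t. if t < j then t else Suc t)"

text \<open>The Moore complex of a simplicial abelian group \<open>G\<close> with face operators
  \<open>face n j : G n \<rightarrow> G (n - 1)\<close>; its differential is the remaining face operator
  \<open>face n 0\<close>, and its homology is the sequence of homotopy groups of \<open>G\<close>.\<close>

definition moore_group ::
    "(nat \<Rightarrow> 'g monoid) \<Rightarrow> (nat \<Rightarrow> nat \<Rightarrow> 'g \<Rightarrow> 'g) \<Rightarrow> nat \<Rightarrow> 'g monoid" where
  "moore_group G face n =
     (G n)\<lparr>carrier := {x \<in> carrier (G n). \<forall>j\<in>{1..n}. face n j x = \<one>\<^bsub>G (n - 1)\<^esub>}\<rparr>"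

definition homotopy_group ::
    "(nat \<Rightarrow> 'g monoid) \<Rightarrow> (nat \<Rightarrow> nat \<Rightarrow> 'g \<Rightarrow> 'g) \<Rightarrow> nat \<Rightarrow> 'g set monoid" where
  "homotopy_group G face i = homology (moore_group G face) (\<lambda>n. face n 0) i"

definition homotopy_class ::
    "(nat \<Rightarrow> 'g monoid) \<Rightarrow> (nat \<Rightarrow> nat \<Rightarrow> 'g \<Rightarrow> 'g) \<Rightarrow> nat \<Rightarrow> 'g \<Rightarrow> 'g set" where
  "homotopy_class G face i z = homology_class (moore_group G face) (\<lambda>n. face n 0) i z"


section \<open>Derived functors of symmetric powers\<close>

type_synonym 'b SPK = "((nat set \<Rightarrow> 'b) multiset \<Rightarrow>\<^sub>0 int) set"

definition SPK_group ::
    "(nat \<Rightarrow> 'b monoid) \<Rightarrow> (nat \<Rightarrow> 'b \<Rightarrow> 'b) \<Rightarrow> nat \<Rightarrow> nat \<Rightarrow> 'b SPK monoid" where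
  "SPK_group P d m n = SP m (DK P d n)"

definition SPK_face ::
    "(nat \<Rightarrow> 'b monoid) \<Rightarrow> (nat \<Rightarrow> 'b \<Rightarrow> 'b) \<Rightarrow> nat \<Rightarrow> nat \<Rightarrow> nat \<Rightarrow> 'b SPK \<Rightarrow> 'b SPK" where
  "SPK_face P d m n j = SP_map m (DK P d n) (DK P d (n - 1)) (DK_face P n j)"

text \<open>Derived functors are computed from the canonical resolution \<open>0 \<rightarrow> ker \<rightarrow> \<int>[B] \<rightarrow> B \<rightarrow> 0\<close>, with
  \<open>\<int>[B]\<close> the free abelian group on the set of elements of \<open>B\<close>. This is a free resolution since
  subgroups of free abelian groups are free.\<close>

definition res_group :: "('b, 'm) monoid_scheme \<Rightarrow> nat \<Rightarrow> ('b \<Rightarrow>\<^sub>0 int) monoid" where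
  "res_group B k =
     (let F = free_Abelian_group (carrier B) in
      if k = 0 then F
      else if k = 1 then F\<lparr>carrier := kernel F B (frag_eval B)\<rparr>
      else F\<lparr>carrier := {0}\<rparr>)"

definition res_diff :: "nat \<Rightarrow> ('b \<Rightarrow>\<^sub>0 int) \<Rightarrow> ('b \<Rightarrow>\<^sub>0 int)" where
  "res_diff k c = (if k = 1 then c else 0)"

definition L_SP :: "nat \<Rightarrow> nat \<Rightarrow> ('b, 'm) monoid_scheme \<Rightarrow> ('b \<Rightarrow>\<^sub>0 int) SPK set monoid" where
  "L_SP i m B = homotopy_group (SPK_group (res_group B) res_diff m) (SPK_face (res_group B) res_diff m) i"

text \<open>The elements \<open>\<beta>\<^sub>h(b\<^sub>1, \<dots>, b\<^sub>i\<^sub>+\<^sub>1) \<otimes> y\<^sub>1 \<cdots> y\<^sub>q\<close> of \<open>L\<^sub>i SP\<^sup>m\<close>, where \<open>h b\<^sub>k = 0\<close> and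
  \<open>m = i + 1 + q\<close>. Choose lifts \<open>v\<^sub>k\<close> of \<open>b\<^sub>k\<close> and \<open>w\<^sub>j\<close> of \<open>y\<^sub>j\<close> to \<open>P\<^sub>0\<close>, and \<open>u\<^sub>k\<close> in \<open>P\<^sub>1\<close> with
  \<open>d u\<^sub>k = h v\<^sub>k\<close>. Mac Lane's element \<open>\<tau>\<^sub>h(b\<^sub>1, \<dots>, b\<^sub>i\<^sub>+\<^sub>1)\<close> is then represented in the tensor power of \<open>P\<close>
  by the cycle \<open>\<Sum>\<^sub>t (-1)\<^sup>t u\<^sub>1 \<otimes> \<cdots> \<otimes> v\<^sub>t \<otimes> \<cdots> \<otimes> u\<^sub>i\<^sub>+\<^sub>1\<close> (up to a global sign, this is \<open>1/h\<close> times the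
  boundary of \<open>u\<^sub>1 \<otimes> \<cdots> \<otimes> u\<^sub>i\<^sub>+\<^sub>1\<close>). It is transported to the simplicial group by the Eilenberg-Zilber
  shuffle map and then multiplied by \<open>w\<^sub>1 \<cdots> w\<^sub>q\<close>. The shuffle product of \<open>i\<close> elements of degree \<open>1\<close>
  is the sum over all permutations \<open>\<sigma>\<close> of \<open>{0..<i}\<close> of \<open>sign \<sigma>\<close> times the product over \<open>j\<close> of the
  degeneracies of the \<open>j\<close>-th element along the surjection \<open>{0..i} \<rightarrow> {0,1}\<close> that jumps
  after \<open>\<sigma> j\<close>.\<close>

text \<open>The \<open>i\<close>-simplex of \<open>K(P)\<close> that is the total degeneracy of \<open>v\<close> in \<open>P\<^sub>0\<close>, respectively the
  degeneracy, along the surjection jumping after \<open>k\<close>, of the \<open>1\<close>-simplex corresponding to \<open>u\<close>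
  in \<open>P\<^sub>1\<close>.\<close>

definition DK_vertex :: "(nat \<Rightarrow> 'b monoid) \<Rightarrow> nat \<Rightarrow> 'b \<Rightarrow> (nat set \<Rightarrow> 'b)" where
  "DK_vertex P i v = DK_op P i (\<lambda>_. 0) (\<lambda>S\<in>nd_simplices 0. v)"

definition DK_edge ::
    "(nat \<Rightarrow> 'b monoid) \<Rightarrow> (nat \<Rightarrow> 'b \<Rightarrow> 'b) \<Rightarrow> nat \<Rightarrow> nat \<Rightarrow> 'b \<Rightarrow> (nat set \<Rightarrow> 'b)" where
  "DK_edge P d i k u =
     DK_op P i (\<lambda>t. if t \<le> k then 0 else 1)
       (\<lambda>S\<in>nd_simplices 1. if S = {0, 1} then u else if S = {1} then d 1 u else \<one>\<^bsub>P 0\<^esub>)"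

definition beta_cycle ::
    "(nat \<Rightarrow> 'b monoid) \<Rightarrow> (nat \<Rightarrow> 'b \<Rightarrow> 'b) \<Rightarrow> 'b list \<Rightarrow> 'b list \<Rightarrow> 'b list \<Rightarrow> 'b SPK" where
  "beta_cycle P d us vs ws =
     (let i = length us - 1 in
      SP_class (length us + length ws) (DK P d i)
        (\<Sum>t\<le>i. \<Sum>\<sigma> | \<sigma> permutes {..<i}.
           frag_cmul ((- 1) ^ Suc t * sign \<sigma>)
             (frag_of ({#DK_vertex P i (vs ! t)#}
                + mset (map (\<lambda>j. DK_edge P d i (\<sigma> j) (drop_nth t us ! j)) [0..<i])
                + mset (map (DK_vertex P i) ws)))))"

text \<open>In the canonical resolution the lifts are \<open>v\<^sub>k = [b\<^sub>k]\<close> and \<open>u\<^sub>k = h [b\<^sub>k]\<close>.\<close>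

definition beta :: "('b, 'm) monoid_scheme \<Rightarrow> int \<Rightarrow> 'b list \<Rightarrow> 'b list \<Rightarrow> ('b \<Rightarrow>\<^sub>0 int) SPK set" where
  "beta B h bs ys =
     (let m = length bs + length ys; P = res_group B in
      homotopy_class (SPK_group P res_diff m) (SPK_face P res_diff m) (length bs - 1)
        (beta_cycle P res_diff (map (\<lambda>b. frag_cmul h (frag_of b)) bs) (map frag_of bs) (map frag_of ys)))"


section \<open>The comparison maps\<close>

definition mod_p :: "('a, 'm) monoid_scheme \<Rightarrow> nat \<Rightarrow> ('a \<times> int \<Rightarrow>\<^sub>0 int) set monoid" where
  "mod_p A p = tensor A (integer_mod_group p)"

definition red_p :: "('a, 'm) monoid_scheme \<Rightarrow> nat \<Rightarrow> 'a \<Rightarrow> ('a \<times> int \<Rightarrow>\<^sub>0 int) set" where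
  "red_p A p x = tensor_class A (integer_mod_group p) (frag_of (x, 1))"

text \<open>The cycle of the dual de Rham complex attached to \<open>xs = [x\<^sub>1, \<dots>, x\<^sub>n\<^sub>/\<^sub>p]\<close>. The divided power
  factor is the monomial in the symbols \<open>\<gamma>\<^sub>p\<^sub>-\<^sub>1(x\<^sub>l)\<close> for \<open>l \<le> i + 1\<close>, \<open>l \<noteq> t\<close>, and \<open>\<gamma>\<^sub>p(x\<^sub>l)\<close> for
  the other \<open>l\<close>.\<close>

definition f_cycle :: "('a, 'm) monoid_scheme \<Rightarrow> nat \<Rightarrow> nat \<Rightarrow> nat \<Rightarrow> 'a list \<Rightarrow> 'a dR" where
  "f_cycle A n p i xs =
     tensor_class (ext_power A i) (Gamma (n - i) A)
       (\<Sum>t\<le>i. frag_cmul ((- 1) ^ Suc t)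
          (frag_of (wedge A (drop_nth t (take (Suc i) xs)),
             Gamma_class A (\<Prod>l<length xs.
               gamma_symbol (if l \<le> i \<and> l \<noteq> t then p - 1 else p) (xs ! l)))))"

definition f_component ::
    "('a, 'm) monoid_scheme \<Rightarrow> nat \<Rightarrow> nat \<Rightarrow> nat \<Rightarrow>
     (('a \<times> int \<Rightarrow>\<^sub>0 int) set \<Rightarrow>\<^sub>0 int) SPK set \<Rightarrow> 'a dR set" where
  "f_component A n p i =
     (if i < n div p then
        hom_with_values (L_SP i (n div p) (mod_p A p)) (dR_homology A n i)
          {(beta (mod_p A p) (int p)
              (map (red_p A p) (take (Suc i) xs)) (map (red_p A p) (drop (Suc i) xs)),
            homology_class (dR_group A n) (dR_diff A n) i (f_cycle A n p i xs)) | xs.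
            xs \<in> words A (n div p)}
      else (\<lambda>_ \<in> carrier (L_SP i (n div p) (mod_p A p)). \<one>\<^bsub>dR_homology A n i\<^esub>))"

definition f_source ::
    "('a, 'm) monoid_scheme \<Rightarrow> nat \<Rightarrow> nat \<Rightarrow>
     (nat \<Rightarrow> (('a \<times> int \<Rightarrow>\<^sub>0 int) set \<Rightarrow>\<^sub>0 int) SPK set) monoid" where
  "f_source A n i = sum_group {p. prime p \<and> p dvd n} (\<lambda>p. L_SP i (n div p) (mod_p A p))"

definition f_map ::
    "('a, 'm) monoid_scheme \<Rightarrow> nat \<Rightarrow> nat \<Rightarrow>
     (nat \<Rightarrow> (('a \<times> int \<Rightarrow>\<^sub>0 int) set \<Rightarrow>\<^sub>0 int) SPK set) \<Rightarrow> 'a dR set" where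
  "f_map A n i = (\<lambda>x \<in> carrier (f_source A n i).
     \<Otimes>\<^bsub>dR_homology A n i\<^esub>p\<in>{p. prime p \<and> p dvd n}. f_component A n p i (x p))"

end

theory Submission
 imports Defs
begin

text \<open>All groups are realised as subquotients of one rational object. Over the span of a set of letters,
the tensor product of exterior and polynomial algebra carries the Koszul differential, which moves a
letter from the exterior to the polynomial part and respects the multidegree.

Writing \<open>\<gamma>\<^sub>i(x)\<close> as \<open>x\<^sup>i / i!\<close> turns the dual de Rham complex into the lattice in it that is spanned by
the products of wedges with divided powers of letters (\<open>Gamma_lemb\<close>, \<open>dR_qpres\<close>). For the derived
functors, the letters are a basis adapted to the inclusion of the relations in the canonical
resolution of \<open>A \<otimes> \<int>/p\<close> (\<open>RG_lemb\<close>). The simplicial symmetric power becomes a bar construction over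
the polynomials in the letters of level zero (\<open>DK_lemb\<close>, \<open>L_qpres\<close>), and comparison maps between
resolutions identify its Moore cycles and boundaries with those of the Koszul lattice in which an
exterior letter of \<open>A\<close> has weight \<open>p\<close> (\<open>moore_boundary\<close>). Under these identifications the comparison map
is the projection to the letters of \<open>A\<close> followed by a rescaling that takes the multidegree \<open>w\<close> to
\<open>p w\<close>; on the beta cycles it gives the defining cycles of the comparison map up to boundaries
(\<open>Ff_bet\<close>, \<open>f_component_eq\<close>).

Surjectivity: the Cartan formula shows that the multiplicity of a letter annihilates the homology in
its multidegree, so that the gcd of the multiplicities does. In total degree at most \<open>7\<close> a multidegree
with two letters has gcd \<open>1\<close>, \<open>2\<close> or \<open>3\<close>, whence a cycle is a boundary up to terms \<open>dY / p\<close> with \<open>Y\<close>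
integral of multidegrees divisible by \<open>p\<close> (\<open>gl_cycle\<close>), and these come from the symmetric powers
(\<open>Ff_surjective\<close>). Injectivity: the symmetric degree \<open>n / p\<close> is at most \<open>3\<close> and at least two letters of a
chain whose boundary is taken are exterior, so the rescaling loses no divisibility (\<open>Ff_injective\<close>).
The images for different primes are independent because they have coprime torsion
(\<open>coprime_torsion\<close>).\<close>

section \<open>Rational linear algebra with lattices\<close>

type_synonym 'y vec = "'y \<Rightarrow>\<^sub>0 rat"
abbreviation "keys \<equiv> Poly_Mapping.keys"
abbreviation "two \<equiv> Suc (Suc 0)"
abbreviation "lookup == Poly_Mapping.lookup"

definition sc :: "rat => 'y vec => 'y vec" where
"sc c z=Poly_Mapping.map ((*) c) z"

abbreviation bs :: "'y => 'y vec" where "bs y == Poly_Mapping.single y 1"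

lemma lookup_sc [simp]: "lookup (sc c z) y=c * lookup z y" by(simp add: sc_def Poly_Mapping.map.rep_eq when_def)

lemma pm_eqI: "(!!y. lookup a y=lookup b y) ==> a=b" by(rule poly_mapping_eqI) auto

lemma sc_simps [simp]: "sc 0 z=0" "sc c 0=0" "sc 1 z=z" "sc a (sc b z)=sc (a * b) z" by(auto intro!: pm_eqI)

lemma sc_minus1: "sc (- c) z = - sc c z" by(auto intro!: pm_eqI)

lemma sc_add: "sc c (z + w)=sc c z + sc c w"
and sc_add_left: "sc (a + b) z=sc a z + sc b z"
and sc_diff: "sc c (z - w)=sc c z - sc c w"
and sc_diff_left: "sc (a - b) z=sc a z - sc b z"
and sc_uminus: "sc c (- z) = - sc c z" by(auto intro!: pm_eqI simp: lookup_add lookup_minus algebra_simps)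

lemma sc_sum: "sc c (sum f A)=(\<Sum>a\<in>A. sc c (f a))"
by(induction A rule: infinite_finite_induct) (auto simp: sc_add)

lemma sc_bs: "sc c (bs y)=Poly_Mapping.single y c" by(auto intro!: pm_eqI simp: lookup_single when_def)

definition linmap :: "('y vec => 'z vec) => bool" where
"linmap F \<longleftrightarrow> (\<forall>z w. F (z + w)=F z + F w) & (\<forall>c z. F (sc c z)=sc c (F z))"

named_theorems lin

lemma linmapI: "(!!z w. F (z + w)=F z + F w) ==> (!!c z. F (sc c z)=sc c (F z)) ==> linmap F"
by(auto simp: linmap_def)

lemma linmap_add: "linmap F ==> F (z + w)=F z + F w"
and linmap_sc: "linmap F ==> F (sc c z)=sc c (F z)" by(auto simp: linmap_def)

lemma linmap_0: "linmap F ==> F 0=0" using linmap_sc[of F 0 0] by simp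

lemma linmap_uminus: "linmap F ==> F (- z) = - F z" using linmap_sc[of F "-1" z] by(simp add: sc_minus1)

lemma linmap_diff: "linmap F ==> F (z - w)=F z - F w" using linmap_add[of F z "- w"] by(simp add: linmap_uminus)

lemma linmap_sum: "linmap F ==> F (sum f A)=(\<Sum>a\<in>A. F (f a))"
by(induction A rule: infinite_finite_induct) (auto simp: linmap_0 linmap_add)

lemmas linmap_simps=linmap_add linmap_sc linmap_0 linmap_uminus linmap_diff linmap_sum

lemma linmap_id [lin]: "linmap (%z. z)"
and linmap_zero [lin]: "linmap (%z. 0)" by(auto simp: linmap_def)

lemma linmap_plus [lin]: "linmap F ==> linmap G ==> linmap (%z. F z + G z)"
and linmap_minus [lin]: "linmap F ==> linmap G ==> linmap (%z. F z - G z)"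
and linmap_neg [lin]: "linmap F ==> linmap (%z. - F z)"
and linmap_scale [lin]: "linmap F ==> linmap (%z. sc c (F z))"
by(auto simp: linmap_def sc_add sc_diff sc_uminus algebra_simps)

lemma linmap_sumf [lin]: "(!!a. a:A ==> linmap (F a)) ==> linmap (%z. \<Sum>a\<in>A. F a z)"
by(induction A rule: infinite_finite_induct) (auto intro: lin)

lemma linmap_if [lin]: "(b ==> linmap F) ==> (\<not> b ==> linmap G) ==> linmap (%z. if b then F z else G z)"
by(cases b) auto

lemma linmap_comp: "linmap F ==> linmap G ==> linmap (%z. F (G z))" by(auto simp: linmap_def)

definition lext :: "('y => 'z vec) => 'y vec => 'z vec" where
"lext g z=(\<Sum>y\<in>keys z. sc (lookup z y) (g y))"

lemma lext_superset:
assumes "finite A" "keys z <= A"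
shows "lext g z=(\<Sum>y\<in>A. sc (lookup z y) (g y))"
unfolding lext_def by(rule sum.mono_neutral_left) (use assms in "auto simp: in_keys_iff")

lemma linmap_lext [lin]: "linmap (lext g)"
proof (rule linmapI)
fix z w :: "'a vec"
let ?A = "keys z \<union> keys w"
have "keys (z + w) <= ?A" by(rule keys_add)
thus "lext g (z + w)=lext g z + lext g w" by(simp add: lext_superset[of ?A] lookup_add sc_add_left sum.distrib)
next
fix c :: rat and z :: "'a vec"
have "keys (sc c z) <= keys z" by(auto simp: in_keys_iff)
thus "lext g (sc c z)=sc c (lext g z)" by(simp add: lext_superset[of "keys z"] sc_sum)
qed

lemma linmap_lext' [lin]: "linmap F ==> linmap (%z. lext g (F z))" by(rule linmap_comp[OF linmap_lext])

lemma lext_bs [simp]: "lext g (bs y)=g y" by(simp add: lext_def)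

lemma lext_single [simp]: "lext g (Poly_Mapping.single y c)=sc c (g y)"
using linmap_sc[OF linmap_lext, of g c "bs y"] by(simp add: sc_bs)

lemmas lext_simps=linmap_simps[OF linmap_lext]

lemma lext_0 [simp]: "lext g 0=0" by(rule lext_simps)

lemma expand_bs: "z=(\<Sum>y\<in>keys z. sc (lookup z y) (bs y))"
by(rule pm_eqI) (simp add: sc_bs lookup_sum lookup_single when_def in_keys_iff)

lemma linmap_eq_on:
assumes "linmap F" "linmap G" "!!y. y:keys z ==> F (bs y)=G (bs y)"
shows "F z=G z"
proof -
have "F z=(\<Sum>y\<in>keys z. sc (lookup z y) (F (bs y)))" if "linmap F"
 for F :: "'a vec => 'b vec" by(subst expand_bs) (simp only: linmap_sum[OF that] linmap_sc[OF that])
from this[OF assms(1)] this[OF assms(2)] show ?thesis using assms(3) by(metis (no_types, lifting) sum.cong)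
qed

lemma linmap_eqI:
"linmap F ==> linmap G ==> (!!y. F (bs y)=G (bs y)) ==> F z=G z" by(rule linmap_eq_on)

lemma lext_param [lin]: "(!!y. linmap (%v. g v y)) ==> linmap (%v. lext (g v) z)"
unfolding lext_def by(auto intro!: lin)

lemma keys_lext: "y:keys (lext g z) ==>
 \<exists>x\<in>keys z. y:keys (g x)"
proof -
assume "y:keys (lext g z)"
hence "y:(\<Union>x\<in>keys z. keys (sc (lookup z x) (g x)))" unfolding lext_def using keys_sum by fastforce
thus ?thesis by(auto simp: in_keys_iff)
qed

lemma keys_sc: "keys (sc c z)=(if c=0 then {} else keys z)" by(auto simp: in_keys_iff)

text \<open>The lattice spanned by the multiples \<open>c y\<close> of the basis vectors; the value \<open>c y = 0\<close>
  excludes the basis vector \<open>y\<close>, so that supports and divisibility are one notion.\<close>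

definition lat :: "('y => rat) => 'y vec set" where
"lat c = {z. \<forall>y. \<exists>k::int. lookup z y = of_int k * c y}"

lemma lat_0 [simp]: "0:lat c" by(auto simp: lat_def intro: exI[of _ 0])

lemma lat_add: "z:lat c ==> w:lat c ==> z + w:lat c"
unfolding lat_def mem_Collect_eq lookup_add by(metis of_int_add distrib_right)

lemma lat_sc_int: "z:lat c ==> sc (of_int k) z:lat c"
unfolding lat_def mem_Collect_eq lookup_sc by(metis of_int_mult mult.assoc)

lemma lat_uminus: "z:lat c ==> - z:lat c" using lat_sc_int[of z c "-1"] by(simp add: sc_minus1)

lemma lat_uminus_iff [simp]: "- z:lat c \<longleftrightarrow> z:lat c"
using lat_uminus[of z c] lat_uminus[of "- z" c] by auto

lemma lat_diff: "z:lat c ==> w:lat c ==> z - w:lat c" using lat_add[of z c "- w"] by simp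

lemma lat_sum: "(!!a. a:A ==> f a:lat c) ==> sum f A:lat c"
by(induction A rule: infinite_finite_induct) (auto intro: lat_add)

lemma lat_basis: "sc (c y) (bs y):lat c" unfolding lat_def sc_bs
by(auto simp: lookup_single when_def intro: exI[of _ 1] exI[of _ 0])

lemma lat_basis': "a = of_int k * c y ==> sc a (bs y):lat c" using lat_sc_int[OF lat_basis, of k c y] by simp

lemma lat_bs_iff: "sc a (bs y):lat c \<longleftrightarrow> (\<exists>k::int. a = of_int k * c y)"
unfolding lat_def sc_bs by(auto simp: lookup_single when_def intro: exI[of _ 0])

lemma lat_keys: "z:lat c ==> y:keys z ==> c y ~= 0"
proof
assume z: "z:lat c" and "y:keys z" "c y=0"
moreover obtain k :: int where "lookup z y = of_int k * c y" using z unfolding lat_def by blast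
ultimately show False by(simp add: in_keys_iff)
qed

lemma lat_decomp:
assumes "z:lat c"
obtains k :: "'y => int" where "z=(\<Sum>y\<in>keys z. sc (of_int (k y)) (sc (c y) (bs y)))"
proof -
obtain k :: "'y => int" where "!!y. lookup z y = of_int (k y) * c y" using assms by(auto simp: lat_def) metis
hence "z=(\<Sum>y\<in>keys z. sc (of_int (k y)) (sc (c y) (bs y)))" by(subst expand_bs) (auto intro!: sum.cong)
thus ?thesis by(rule that)
qed

lemma lat_linmap:
assumes "linmap F" "z:lat c"
 "!!y. y:keys z ==> c y ~= 0 ==> sc (c y) (F (bs y)):lat c'"
shows "F z:lat c'"
proof -
obtain k :: "'a => int" where "z=(\<Sum>y\<in>keys z. sc (of_int (k y)) (sc (c y) (bs y)))"
 using lat_decomp[OF assms(2)] .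
hence "F z=F (\<Sum>y\<in>keys z. sc (of_int (k y)) (sc (c y) (bs y)))" by(rule arg_cong)
also have "... = (\<Sum>y\<in>keys z. sc (of_int (k y)) (sc (c y) (F (bs y))))"
 by(simp only: linmap_sum[OF assms(1)] linmap_sc[OF assms(1)])
also have "... : lat c'" using assms(3) lat_keys[OF assms(2)] by(intro lat_sum lat_sc_int) auto
finally show ?thesis .
qed

lemma lat_coarser:
assumes "z:lat c" "!!y. y:keys z ==> c y ~= 0 ==> \<exists>k::int. c y = of_int k * c' y"
shows "z:lat c'" by(rule lat_linmap[OF linmap_id assms(1)]) (unfold lat_bs_iff, rule assms(2))

section \<open>The Koszul complex\<close>

type_synonym 'x kos = "('x list \<times> 'x multiset) \<Rightarrow>\<^sub>0 rat"

definition Mo :: "'x multiset => 'x kos => 'x kos" where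
"Mo m=lext (%(I, u). bs (I, u + m))"

definition cns :: "'x => 'x kos => 'x kos" where
"cns x=lext (%(I, u). bs (x#I, u))"

lemma linmap_Mo [lin]: "linmap F ==> linmap (%z. Mo m (F z))"
and linmap_cns [lin]: "linmap F ==> linmap (%z. cns x (F z))" unfolding Mo_def cns_def by(auto intro: lin)

lemmas linmap_Mo0=linmap_Mo[OF linmap_id] and linmap_cns0=linmap_cns[OF linmap_id]
lemmas Mo_simps=linmap_simps[OF linmap_Mo0] and cns_simps=linmap_simps[OF linmap_cns0]

lemma Mo_bs [simp]: "Mo m (bs (I, u))=bs (I, u + m)"
and cns_bs [simp]: "cns x (bs (I, u))=bs (x#I, u)" by(auto simp: Mo_def cns_def)

lemma Mo_Mo: "Mo m (Mo n z)=Mo (m + n) z"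
by(rule linmap_eqI[of "%z. Mo m (Mo n z)"]) (auto intro!: lin simp: ac_simps)

lemma Mo_empty [simp]: "Mo {#} z=z" by(rule linmap_eqI[of "Mo {#}"]) (auto intro!: lin)

lemma cns_Mo: "cns x (Mo m z)=Mo m (cns x z)" by(rule linmap_eqI[of "%z. cns x (Mo m z)"]) (auto intro!: lin)

fun dl :: "'x list => 'x kos" where
"dl []=0"
| "dl (x#I)=bs (I, {#x#}) - cns x (dl I)"

definition kd :: "'x kos => 'x kos" where
"kd=lext (%(I, u). Mo u (dl I))"

lemma linmap_kd [lin]: "linmap F ==> linmap (%z. kd (F z))" unfolding kd_def by(auto intro: lin)

lemmas linmap_kd0=linmap_kd[OF linmap_id]
lemmas kd_simps=linmap_simps[OF linmap_kd0]

lemma kd_bs [simp]: "kd (bs (I, u))=Mo u (dl I)" by(simp add: kd_def)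

lemma kd_Mo: "kd (Mo m z)=Mo m (kd z)"
by(rule linmap_eqI[of "%z. kd (Mo m z)"]) (auto intro!: lin simp: Mo_Mo ac_simps)

lemma kd_cns: "kd (cns x z)=Mo {#x#} z - cns x (kd z)" by(rule linmap_eqI[of "%z. kd (cns x z)"])
 (auto intro!: lin simp: Mo_simps cns_Mo ac_simps)

lemma kd_dl: "kd (dl I)=0" by(induction I) (auto simp: kd_simps kd_cns cns_simps)

lemma kd_kd: "kd (kd z)=0" by(rule linmap_eqI[of "%z. kd (kd z)"]) (auto intro!: lin simp: kd_Mo kd_dl Mo_simps)

fun il :: "'x::linorder => 'x list => 'x kos" where
"il x []=bs ([x], {#})"
| "il x (y#I)=(if x < y then bs (x#y#I, {#}) else if x=y then 0 else - cns y (il x I))"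

definition Ei :: "'x::linorder => 'x kos => 'x kos" where
"Ei x=lext (%(I, u). Mo u (il x I))"

lemma linmap_Ei [lin]: "linmap F ==> linmap (%z. Ei x (F z))" unfolding Ei_def by(auto intro: lin)

lemmas linmap_Ei0=linmap_Ei[OF linmap_id]
lemmas Ei_simps=linmap_simps[OF linmap_Ei0]

lemma Ei_bs [simp]: "Ei x (bs (I, u))=Mo u (il x I)" by(simp add: Ei_def)

lemma Ei_Mo: "Ei x (Mo m z)=Mo m (Ei x z)"
by(rule linmap_eqI[of "%z. Ei x (Mo m z)"]) (auto intro!: lin simp: Mo_Mo ac_simps)

lemma Ei_cns: "Ei x (cns y z)=(if x < y then cns x (cns y z) else if x=y then 0 else - cns y (Ei x z))"
by(rule linmap_eqI[of "%z. Ei x (cns y z)"])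
 (auto intro!: lin simp: cns_Mo Mo_simps cns_simps)

lemma Ei_il_same: "Ei x (il x I)=0"
proof (induction I)
case (Cons z I)
have E: "il x [z]=Ei x (bs ([z], {#}))" for z by simp
show ?case using Cons by(auto simp: Ei_simps Ei_cns cns_simps not_less)
qed auto

lemma Ei_il_anti: "Ei x (il y I) = - Ei y (il x I)"
proof (cases "x=y")
case False
thus ?thesis
proof (induction I)
 case Nil
 thus ?case by(cases "x < y") auto
next
 case (Cons z I)
 thus ?case by(cases "x < z"; cases "y < z"; cases "x=z"; cases "y=z"; cases "x < y")
   (auto simp: Ei_simps Ei_cns cns_simps not_less)
qed
qed (simp add: Ei_il_same)

lemma Ei_anti: "Ei x (Ei y z) = - Ei y (Ei x z)" by(rule linmap_eqI[of "%z. Ei x (Ei y z)"])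
 (auto intro!: lin simp: Ei_Mo Mo_simps Ei_il_anti[of x y])

lemma double_eq_0: "(z::'y vec) = - z ==> z=0" by(rule pm_eqI) (metis equal_neg_zero lookup_uminus lookup_zero)

definition wt :: "'x list \<times> 'x multiset => 'x multiset" where
"wt y=mset (fst y) + snd y"

lemma wt_simps [simp]: "wt (I, u)=mset I + u" by(simp add: wt_def)

abbreviation srt :: "'x::linorder list => bool" where "srt I == sorted_wrt (<) I"

lemma il_less: "\<forall>y\<in>set I. x < y ==> il x I=bs (x#I, {#})" by(cases I) auto

lemma kd_il: "srt I ==> kd (il x I) + Ei x (dl I)=bs (I, {#x#})"
proof (induction I)
case Nil
thus ?case by(auto simp: Ei_simps cns_simps)
next
case (Cons y I)
have IH: "kd (il x I)=bs (I, {#x#}) - Ei x (dl I)" using Cons by(simp add: algebra_simps)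
have il_I: "x <= y ==> il x I=bs (x#I, {#})" using Cons.prems by(intro il_less) auto
consider "x < y" | "x=y" | "y < x" by force
thus ?case
proof cases
 case 1
 thus ?thesis using il_I by(simp add: Ei_simps Ei_cns cns_simps Mo_simps)
next
 case 2
 thus ?thesis using il_I by(simp add: Ei_simps Ei_cns kd_simps)
next
 case 3
 hence "\<not> x < y" "x ~= y" by auto
 thus ?thesis by(simp add: Ei_simps Ei_cns cns_simps kd_simps kd_cns IH)
qed
qed

text \<open>Integral combinations of basis vectors of exterior degree \<open>n\<close> and total multidegree \<open>w\<close>.\<close>

definition hl :: "nat => 'x::linorder multiset => 'x kos set" where
"hl n w=lat (%(I, u). if srt I & length I=n & mset I + u=w then 1 else 0)"

text \<open>The same for all multidegrees satisfying \<open>Q\<close>, with the coefficient of \<open>e\<^sub>I x\<^sup>u\<close> divisible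
  by the product of the \<open>p x\<close>, \<open>x \<in> I\<close>: the Koszul complex of the lattice spanned by the \<open>p x\<close>-fold
  basis vectors.\<close>

definition kl :: "('x::linorder => int) => ('x multiset => bool) => nat => 'x kos set" where
"kl p Q n=lat (%(I, u). if srt I & length I=n & Q (mset I + u)
              then of_int (prod_mset (image_mset p (mset I))) else 0)"

lemma hl_simps [simp]: "0:hl n w"
and hl_add: "a:hl n w ==> b:hl n w ==> a + b:hl n w"
and hl_diff: "a:hl n w ==> b:hl n w ==> a - b:hl n w"
and hl_uminus: "a:hl n w ==> - a:hl n w" by(auto simp: hl_def intro: lat_add lat_diff lat_uminus)

lemma hl_bs: "srt I ==> length I=n ==> mset I + u=w ==> bs (I, u):hl n w"
unfolding hl_def using lat_basis'[of 1 1 _ "(I, u)"] by simp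

lemma hl_keys: "z:hl n w ==> (I, u):keys z ==> srt I & length I=n & mset I + u=w"
unfolding hl_def by(drule (1) lat_keys) (auto split: if_splits)

lemma hl_linmap:
assumes "linmap F" "z:hl n w"
 "!!I u. srt I ==> length I=n ==> mset I + u=w ==> F (bs (I, u)):lat c"
shows "F z:lat c" using assms(2) unfolding hl_def
by(rule lat_linmap[OF assms(1)]) (use assms(3) in "auto split: if_splits prod.splits")

lemma kl_linmap:
assumes "linmap F" "z:kl p Q n"
 "!!I u. srt I ==> length I=n ==> Q (mset I + u) ==>
   sc (of_int (prod_mset (image_mset p (mset I)))) (F (bs (I, u))):lat c"
shows "F z:lat c" using assms(2) unfolding kl_def
by(rule lat_linmap[OF assms(1)]) (use assms(3) in "auto split: if_splits prod.splits")

lemma kl_keys: "z:kl p Q n ==> (I, u):keys z ==> srt I & length I=n & Q (mset I + u)"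
unfolding kl_def by(drule (1) lat_keys) (auto split: if_splits)

lemma hl_kl:
assumes "z:hl n w" "Q w" shows "sc (of_int (prod_mset (image_mset p w))) z:kl p Q n" unfolding kl_def
proof (rule hl_linmap[OF _ assms(1), where F = "sc _"])
fix I u assume I: "srt I" "length I=n" "mset I + u=w"
have "prod_mset (image_mset p w)=prod_mset (image_mset p u) * prod_mset (image_mset p (mset I))"
 by(simp flip: I(3))
thus "sc (of_int (prod_mset (image_mset p w))) (bs (I, u))
  : lat (%(I, u). if srt I & length I=n & Q (mset I + u) then of_int (prod_mset (image_mset p (mset I))) else 0)"
 using I assms(2) by(intro lat_basis'[of _ "prod_mset (image_mset p u)"]) auto
qed (intro lin)

lemma Mo_hl: "z:hl n w ==> Mo m z:hl n (w + m)" unfolding hl_def[of n "w + m"]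
by(rule hl_linmap[OF linmap_Mo0]) (auto simp: hl_bs simp flip: hl_def)

lemma Mo_kl:
assumes "z:kl p Q n" "!!w. Q w ==> Q' (w + m)" shows "Mo m z:kl p Q' n" unfolding kl_def
proof (rule kl_linmap[OF linmap_Mo0 assms(1)], goal_cases)
case (1 I u)
thus ?case using assms(2) by(auto simp: lat_bs_iff add.assoc[symmetric] intro!: exI[of _ 1])
qed

lemma cns_hl:
assumes "z:hl n w" "!!I u y. (I, u):keys z ==> y:set I ==> x < y"
shows "cns x z:hl (Suc n) (add_mset x w)" using assms(1) unfolding hl_def by(rule lat_linmap[OF linmap_cns0])
  (use assms(2) in "auto split: if_splits simp: lat_bs_iff intro!: exI[of _ 1]")

lemma dl_keys: "(I', u):keys (dl I) ==> set I' <= set I & set_mset u <= set I"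
proof (induction I arbitrary: I' u)
case (Cons x I)
from Cons.prems have "(I', u)=(I, {#x#}) | (I', u):keys (cns x (dl I))" using keys_diff by fastforce
thus ?case by(fastforce simp: cns_def dest!: keys_lext dest: Cons.IH)
qed auto

lemma dl_hl: "srt I ==> length I=Suc n ==> dl I:hl n (mset I)"
proof (induction I arbitrary: n)
case (Cons x I)
show ?case
proof (cases n)
 case 0
 thus ?thesis using Cons.prems by(auto simp: cns_simps intro: hl_bs)
next
 case (Suc k)
 hence "cns x (dl I):hl n (mset (x#I))" using Cons by(auto intro!: cns_hl dest!: dl_keys)
 thus ?thesis using Cons.prems by(auto intro!: hl_diff hl_bs)
qed
qed auto

lemma kd_kl: "z:kl p Q (Suc n) ==> kd z:kl p Q n" unfolding kl_def[of p Q n]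
proof (rule kl_linmap[OF linmap_kd0], assumption, goal_cases)
case (1 I u)
have "sc (of_int (prod_mset (image_mset p (mset I)))) (dl I):kl p (%w. w=mset I) n"
 using 1 by(intro hl_kl dl_hl) auto
from Mo_kl[OF this, of Q u] 1 show ?case by(auto simp: kl_def Mo_simps)
qed

lemma il_keys: "(I', u):keys (il x I) ==> set I'=insert x (set I) & u = {#}"
proof (induction I arbitrary: I' u)
case (Cons y I)
thus ?case by(auto simp: cns_def split: if_splits dest!: keys_lext)
qed auto

lemma il_hl: "srt I ==> length I=n ==> il x I:hl (Suc n) (add_mset x (mset I))"
proof (induction I arbitrary: n)
case (Cons y I)
have "cns y (il x I):hl (Suc n) (add_mset y (add_mset x (mset I)))" if "y < x"
 using Cons that by(cases n) (auto intro!: cns_hl dest!: il_keys)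
thus ?case using Cons.prems less_trans[of x y] by(auto intro!: hl_bs hl_uminus simp: add_mset_commute)
qed (auto intro: hl_bs)

lemma Ei_hl: "z:hl n w ==> Ei x z:hl (Suc n) (add_mset x w)" unfolding hl_def[of "Suc n" "add_mset x w"]
proof (rule hl_linmap[OF linmap_Ei0], assumption, goal_cases)
case (1 I u)
hence "Mo u (il x I):hl (Suc n) (add_mset x (mset I) + u)" by(intro Mo_hl il_hl)
with 1 show ?case by(auto simp: hl_def)
qed

definition ssrt :: "'x::linorder kos => bool" where
"ssrt z \<longleftrightarrow> (\<forall>(I, u)\<in>keys z. srt I)"

lemma kd_Ei:
assumes "ssrt z" shows "kd (Ei x z) + Ei x (kd z)=Mo {#x#} z"
proof (rule linmap_eq_on[where F = "%z. kd (Ei x z) + Ei x (kd z)"], goal_cases)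
case (3 y)
obtain I u where y: "y=(I, u)" by fastforce
with 3 assms have I: "srt I" by(auto simp: ssrt_def)
have "kd (Ei x (bs y)) + Ei x (kd (bs y))=Mo u (kd (il x I) + Ei x (dl I))" by(simp add: y kd_Mo Ei_Mo Mo_simps)
also have "... = Mo {#x#} (bs y)" by(simp add: y kd_il[OF I])
finally show ?case .
qed (auto intro!: lin)

text \<open>Prepending the least variable of the coefficient when it precedes the exterior part is a
  contraction of the Koszul complex.\<close>

definition sl :: "'x::linorder list \<times> 'x multiset => 'x kos" where
"sl=(%(I, u). if u ~= {#} & (I=[] | Min (set_mset u) < hd I)
     then bs (Min (set_mset u)#I, u - {#Min (set_mset u)#}) else 0)"

definition ks :: "'x::linorder kos => 'x kos" where
"ks=lext sl"

lemma linmap_ks [lin]: "linmap F ==> linmap (%z. ks (F z))" unfolding ks_def by(auto intro: lin)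

lemmas linmap_ks0=linmap_ks[OF linmap_id]
lemmas ks_simps=linmap_simps[OF linmap_ks0]

lemma ks_bs [simp]: "ks (bs y)=sl y" by(simp add: ks_def)

lemma hd_less_iff: "srt I ==> (I=[] | m < hd I) \<longleftrightarrow> (\<forall>y\<in>set I. m < y)"
by(cases I) auto

lemma Min_mset_eqI: "x \<in># u ==> (!!y. y \<in># u ==> x <= y) ==> Min (set_mset u)=x" by(intro Min_eqI) auto

lemma sl_hl: "srt I ==> length I=n ==> sl (I, u):hl (Suc n) (mset I + u)"
by(auto simp: sl_def hd_less_iff intro!: hl_bs)

lemma ks_hl: "z:hl n w ==> ks z:hl (Suc n) w" unfolding hl_def[of "Suc n" w]
by(rule hl_linmap[OF linmap_ks0]) (auto simp: sl_hl simp flip: hl_def)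

lemma kd_ks_basis:
assumes I: "srt I"
shows "kd (ks (bs (I, u))) + ks (kd (bs (I, u)))=bs (I, u) - (if I=[] & u = {#} then bs ([], {#}) else 0)"
proof -
let ?m = "Min (set_mset u)"
show ?thesis
proof (cases "u ~= {#} & (I=[] | ?m < hd I)")
 case True
 hence m: "?m \<in># u" "\<forall>y\<in>set I. ?m < y" "!!y. y \<in># u ==> ?m <= y"
  using hd_less_iff[OF I] by auto
 have *: "ks (Mo u z)=cns ?m (Mo (u - {#?m#}) z)"
  if "!!J v. (J, v):keys z ==> set J <= set I & set_mset v <= set I" for z
 proof (rule linmap_eq_on[of "%z. ks (Mo u z)"])
  fix y assume "y:keys z"
  moreover obtain J v where "y=(J, v)" by fastforce
  ultimately have y: "y=(J, v)" "set J <= set I" "set_mset v <= set I" using that by auto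
  have "Min (set_mset (v + u))=?m" using m y by(intro Min_mset_eqI) (auto intro: less_imp_le)
  moreover have "J=[] | ?m < hd J" using y m by(cases J) auto
  ultimately show "ks (Mo u (bs y))=cns ?m (Mo (u - {#?m#}) (bs y))"
   using m(1) by(cases "u = {#}") (auto simp: y sl_def)
 qed (intro lin)+
 have "kd (ks (bs (I, u)))=bs (I, u) - cns ?m (Mo (u - {#?m#}) (dl I))"
  using True m(1) by(simp add: sl_def Mo_simps cns_Mo)
 moreover have "ks (kd (bs (I, u)))=cns ?m (Mo (u - {#?m#}) (dl I))" using *[of "dl I"] dl_keys[of _ _ I] by simp
 ultimately show ?thesis using True by auto
next
 case False
 show ?thesis
 proof (cases I)
  case Nil
  thus ?thesis using False by(simp add: sl_def ks_simps Mo_simps kd_simps)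
 next
  case (Cons x J)
  have "x <= y" if "y \<in># u" for y
  proof -
   from that have u: "u ~= {#}" by auto
   have "\<not> Min_mset u < x" using False Cons u by simp
   moreover have "Min_mset u <= y" using that by simp
   ultimately show ?thesis by order
  qed
  hence x: "!!y. y \<in># u ==> x <= y" "\<forall>y\<in>set J. x < y" "srt J" using I Cons by simp_all
  have "Min (set_mset (add_mset x u))=x" using x by(intro Min_mset_eqI) auto
  hence 1: "ks (bs (J, add_mset x u))=bs (x#J, u)" using hd_less_iff[OF x(3), of x] x(2) by(simp add: sl_def)
  have "ks (cns x (Mo u z))=0"
   if "!!J' v. (J', v):keys z ==> set_mset v <= set J" for z
  proof (rule linmap_eq_on[of "%z. ks (cns x (Mo u z))" "%_. 0"])
   fix y assume "y:keys z"
   moreover obtain J' v where "y=(J', v)" by fastforce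
   ultimately have y: "y=(J', v)" "set_mset v <= set J" using that by auto
   have "\<not> Min (set_mset (v + u)) < x" if "v + u ~= {#}"
   proof -
    have "Min_mset (v + u) \<in># v + u" using that by(intro Min_in) auto
    moreover have "x <= a" if "a \<in># v + u" for a using that x(1,2) y(2) by(auto intro: less_imp_le)
    ultimately show ?thesis by(simp only: not_less)
   qed
   thus "ks (cns x (Mo u (bs y)))=0" unfolding y by(auto simp del: set_mset_union simp: sl_def)
  qed (intro lin)+
  hence "ks (cns x (Mo u (dl J)))=0" by(metis dl_keys)
  moreover have "sl (I, u)=0" unfolding sl_def prod.case using False by(rule if_not_P)
  ultimately show ?thesis using Cons 1 by(simp add: ks_simps kd_simps Mo_simps cns_Mo)
 qed
qed
qed

lemma kd_ks:
assumes "z:hl n w" "n > 0 | w ~= {#}"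
shows "kd (ks z) + ks (kd z)=z"
proof (rule linmap_eq_on[of "%z. kd (ks z) + ks (kd z)" "%z. z"])
fix y assume y: "y:keys z"
obtain I u where Iu: "y=(I, u)" by fastforce
hence "srt I" "\<not> (I=[] & u = {#})" using y hl_keys[OF assms(1), of I u] assms(2) by auto
thus "kd (ks (bs y)) + ks (kd (bs y))=bs y" unfolding Iu by(subst kd_ks_basis) auto
qed (intro lin)+

lemma kd_ks_kl:
assumes "z:kl p Q n" "n > 0 | \<not> Q {#}"
shows "kd (ks z) + ks (kd z)=z"
proof (rule linmap_eq_on[of "%z. kd (ks z) + ks (kd z)" "%z. z"])
fix y assume y: "y:keys z"
obtain I u where Iu: "y=(I, u)" by fastforce
hence "srt I" "\<not> (I=[] & u = {#})" using y kl_keys[OF assms(1), of I u] assms(2) by auto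
thus "kd (ks (bs y)) + ks (kd (bs y))=bs y" unfolding Iu by(subst kd_ks_basis) auto
qed (intro lin)+

text \<open>Projection onto the multidegrees satisfying \<open>P\<close>.\<close>

definition res :: "('x multiset => bool) => 'x kos => 'x kos" where
"res P=lext (%y. if P (wt y) then bs y else 0)"

lemma linmap_res [lin]: "linmap F ==> linmap (%z. res P (F z))" unfolding res_def by(auto intro: lin)

lemmas linmap_res0=linmap_res[OF linmap_id]
lemmas res_simps=linmap_simps[OF linmap_res0]

lemma res_bs [simp]: "res P (bs y)=(if P (wt y) then bs y else 0)" by(simp add: res_def)

lemma res_id: "(!!y. y:keys z ==> P (wt y)) ==> res P z=z"
by(rule linmap_eq_on[of "res P" "%z. z"]) (auto intro!: lin)

lemma res_zero: "(!!y. y:keys z ==> \<not> P (wt y)) ==> res P z=0"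
by(rule linmap_eq_on[of "res P" "%z. 0"]) (auto intro!: lin)

lemma res_split: "res P z + res (%w. \<not> P w) z=z"
by(rule linmap_eqI[of "%z. res P z + res (%w. \<not> P w) z" "%z. z"]) (auto intro!: lin)

lemma lookup_res: "lookup (res P z) y=(if P (wt y) then lookup z y else 0)"
proof -
have "lookup (res P z) y=(\<Sum>x\<in>keys z. if x=y then (if P (wt y) then lookup z y else 0) else 0)"
 unfolding res_def lext_def lookup_sum by(rule sum.cong) (auto simp: lookup_single when_def)
also have "... = (if P (wt y) then lookup z y else 0)" by(auto simp: in_keys_iff)
finally show ?thesis .
qed

lemma res_lat: "z:lat c ==> res P z:lat c" by(auto simp: lat_def lookup_res intro: exI[of _ 0])

lemma keys_res: "y:keys (res P z) \<longleftrightarrow> y:keys z & P (wt y)"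
by(auto simp: in_keys_iff lookup_res)

lemma dl_wt: "y:keys (dl I) ==> wt y=mset I"
proof (induction I arbitrary: y)
case (Cons x I)
hence "y=(I, {#x#}) | y:keys (cns x (dl I))" using keys_diff by fastforce
thus ?case using Cons.IH by(fastforce simp: cns_def dest!: keys_lext)
qed auto

lemma res_Mo: "res P (Mo m z)=Mo m (res (%w. P (w + m)) z)"
by(rule linmap_eqI[of "%z. res P (Mo m z)"]) (auto intro!: lin simp: Mo_simps wt_def ac_simps)

lemma kd_res: "kd (res P z)=res P (kd z)"
proof (rule linmap_eqI[of "%z. kd (res P z)"])
fix y :: "'a list \<times> 'a multiset"
obtain I u where y: "y=(I, u)" by fastforce
have "res (%w. P (w + u)) (dl I)=(if P (mset I + u) then dl I else 0)"
 by(auto intro!: res_id res_zero dest!: dl_wt)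
thus "kd (res P (bs y))=res P (kd (bs y))" by(auto simp: y res_Mo kd_simps Mo_simps)
qed (intro lin)+

text \<open>If the unit multiples come first in the order, the contraction only loses a factor \<open>q\<close>, and
  only on the multidegrees free of units.\<close>

lemma kl_cycle:
fixes p :: "'x::linorder => int"
assumes z: "z:kl p Q n" "kd z=0" and n: "n > 0"
 and p: "!!x. p x=1 | p x=q" "!!x y. x < y ==> p y=1 ==> p x=1" and q: "q ~= 0" "q ~= 1"
obtains y' y where "y':kl p Q (Suc n)" "y:kl p (%w. Q w & (\<forall>x\<in>#w. p x=q)) (Suc n)"
 "z=kd y' + sc (1 / of_int q) (kd y)"
proof -
let ?G = "%w. \<forall>x\<in>#w. p x=q"
let ?c = "%(I, u). if srt I & length I=Suc n & Q (mset I + u) then of_int (prod_mset (image_mset p (mset I))) else (0::rat)"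
define y' where "y'=ks (res (%w. \<not> ?G w) z)"
define y where "y=sc (of_int q) (ks (res ?G z))"
have "ks (res (%w. \<not> ?G w) z):lat ?c"
proof (rule lat_linmap[OF linmap_ks0 res_lat[OF z(1)[unfolded kl_def]]], goal_cases)
 case (1 y)
 obtain I u where y: "y=(I, u)" by fastforce
 have *: "srt I" "length I=n" "Q (mset I + u)" using 1 y by(auto split: if_splits)
 obtain x where x: "x \<in># mset I + u" "p x=1" using 1(1) p(1) q by(auto simp: y keys_res)
 show ?case
 proof (cases "u ~= {#} & (I=[] | Min (set_mset u) < hd I)")
  case True
  let ?m = "Min (set_mset u)"
  have m: "?m \<in># u" "\<forall>y\<in>set I. ?m < y" "!!y. y \<in># u ==> ?m <= y"
   using True hd_less_iff[OF *(1)] by auto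
  hence "?m <= x" using x by(auto intro: less_imp_le)
  hence "p ?m=1" using p(2)[of ?m x] x by(cases "?m=x") auto
  thus ?thesis using True * m by(auto simp: y sl_def lat_bs_iff intro!: exI[of _ 1])
 qed (auto simp: y sl_def)
qed
hence y': "y':kl p Q (Suc n)" by(simp add: y'_def kl_def)
have "sc (of_int q) (ks (res ?G z)):lat ?c"
proof (rule lat_linmap[OF linmap_scale[OF linmap_ks0] res_lat[OF z(1)[unfolded kl_def]]], goal_cases)
 case (1 y)
 obtain I u where y: "y=(I, u)" by fastforce
 have *: "srt I" "length I=n" "Q (mset I + u)" using 1 y by(auto split: if_splits)
 show ?case
 proof (cases "u ~= {#} & (I=[] | Min (set_mset u) < hd I)")
  case True
  let ?m = "Min (set_mset u)"
  have m: "?m \<in># u" "\<forall>y\<in>set I. ?m < y" "!!y. y \<in># u ==> ?m <= y"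
   using True hd_less_iff[OF *(1)] by auto
  hence "p ?m=q" using 1(1) by(auto simp: y keys_res)
  thus ?thesis using True * m by(auto simp: y sl_def lat_bs_iff intro!: exI[of _ 1])
 qed (auto simp: y sl_def)
qed
hence "y:kl p Q (Suc n)" by(simp add: y_def kl_def)
moreover have "res ?G y=y"
proof (rule res_id)
 fix k assume "k:keys y"
 then obtain I u where "(I, u):keys (res ?G z)" "k:keys (sl (I, u))"
  using q by(auto simp: y_def keys_sc ks_def dest!: keys_lext)
 moreover from this(2) have "wt k=mset I + u" by(auto simp: sl_def split: if_splits)
 ultimately show "?G (wt k)" by(simp add: keys_res)
qed
moreover have "?G (wt k)" if "k:keys y" for k using keys_res[of k ?G y] that \<open>res ?G y=y\<close> by simp
ultimately have y: "y:kl p (%w. Q w & ?G w) (Suc n)"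
 unfolding kl_def by - (rule lat_coarser, auto split: if_splits intro!: exI[of _ 1])
have "z=kd (ks (res (%w. \<not> ?G w) z + res ?G z))"
 using kd_ks_kl[OF z(1)] n z(2) res_split[of ?G z] by(simp add: ks_simps(3) add.commute)
also have "... = kd y' + sc (1 / of_int q) (kd y)" using q by(simp add: y'_def y_def ks_simps kd_simps)
finally show ?thesis using that y y' by blast
qed

section \<open>Simplicial polynomials and the bar construction\<close>

type_synonym 'x pol = "(nat \<times> 'x) multiset \<Rightarrow>\<^sub>0 rat"

lemma sc_mult_left: "sc c z * w=sc c (z * w)"
and sc_mult_right: "z * sc c w=sc c (z * w)" for z w :: "'a::comm_monoid_add \<Rightarrow>\<^sub>0 rat"
by(simp_all add: sc_def mult_map_scale_conv_mult ac_simps)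

lemma linmap_mult_left [lin]: "linmap F ==> linmap (%z. F z * w)"
and linmap_mult_right [lin]: "linmap F ==> linmap (%z. w * F z)" for w :: "'a::comm_monoid_add \<Rightarrow>\<^sub>0 rat"
by(auto simp: linmap_def sc_mult_left sc_mult_right algebra_simps)

lemma bs_mult: "bs a * bs b=bs (a + b)" for a :: "'a::comm_monoid_add" by(simp add: mult_single)

text \<open>The algebra homomorphism that moves the variables of level \<open>l\<close> to level \<open>\<alpha> l\<close>, or to zero.\<close>

definition subm :: "(nat => nat option) => (nat \<times> 'x) multiset => 'x pol" where
"subm \<alpha> N=(if \<forall>y\<in>#N. \<alpha> (fst y) ~= None then bs (image_mset (%y. (the (\<alpha> (fst y)), snd y)) N) else 0)"

definition sub :: "(nat => nat option) => 'x pol => 'x pol" where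
"sub \<alpha> = lext (subm \<alpha>)"

lemma linmap_sub [lin]: "linmap F ==> linmap (%z. sub \<alpha> (F z))" unfolding sub_def by(auto intro: lin)

lemmas linmap_sub0=linmap_sub[OF linmap_id]
lemmas sub_simps=linmap_simps[OF linmap_sub0]

lemma sub_bs [simp]: "sub \<alpha> (bs N)=subm \<alpha> N" by(simp add: sub_def)

lemma sub_mult: "sub \<alpha> (f * g)=sub \<alpha> f * sub \<alpha> g"
proof (rule linmap_eqI[of "%f. sub \<alpha> (f * g)"])
fix M show "sub \<alpha> (bs M * g)=sub \<alpha> (bs M) * sub \<alpha> g"
 by(rule linmap_eqI[of "%g. sub \<alpha> (bs M * g)"])
   (auto intro!: lin simp: bs_mult subm_def simp del: sub_bs simp: sub_def)
qed (intro lin)+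

lemma sub_1 [simp]: "sub \<alpha> 1=1"
using sub_bs[of \<alpha> "{#}"] by(simp add: subm_def del: sub_bs flip: single_one)

lemma sub_sub: "sub \<alpha> (sub \<beta> f)=sub (%l. Option.bind (\<beta> l) \<alpha>) f"
proof (rule linmap_eqI[of "%f. sub \<alpha> (sub \<beta> f)"])
fix N :: "(nat \<times> 'a) multiset"
show "sub \<alpha> (sub \<beta> (bs N))=sub (%l. Option.bind (\<beta> l) \<alpha>) (bs N)"
proof (cases "\<forall>y\<in>#N. \<beta> (fst y) ~= None")
 case True
 hence "image_mset (%y. (the (\<alpha> (the (\<beta> (fst y)))), snd y)) N =
   image_mset (%y. (the (Option.bind (\<beta> (fst y)) \<alpha>), snd y)) N" by(intro image_mset_cong) auto
 with True show ?thesis by(force simp: subm_def image_mset.compositionality comp_def sub_simps)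
next
 case False
 hence "\<not> (\<forall>y\<in>#N. Option.bind (\<beta> (fst y)) \<alpha> ~= None)" by force
 with False show ?thesis by(simp only: sub_bs subm_def sub_simps if_False)
qed
qed (intro lin)+

lemma sub_cong: "(!!l. \<alpha> l = \<beta> l) ==> sub \<alpha> f=sub \<beta> f" by presburger

definition tf :: "nat => nat => nat => nat option" where
"tf n j l=(let l'=(if l <= j then l else l - 1) in if l' < n then Some l' else None)"

definition kf :: "nat => nat => nat => nat option" where
"kf n k l=(let l'=(if l=k then Suc k else l) in if l' <= n then Some l' else None)"

text \<open>The face operators of the bar construction on \<open>n\<close>-simplices, its extra degeneracy, and the
  augmentation.\<close>

abbreviation "fac n j == sub (tf n j)"
abbreviation "sg == sub (%l. Some (Suc l))"
abbreviation "ep == sub (%l. None)"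

definition V :: "'x multiset => 'x pol => 'x pol" where
"V m f=bs (image_mset (Pair 0) m) * f"

lemma linmap_V [lin]: "linmap F ==> linmap (%z. V m (F z))" unfolding V_def by(intro lin)

lemmas linmap_V0=linmap_V[OF linmap_id]
lemmas V_simps=linmap_simps[OF linmap_V0]

lemma V_V: "V m (V n f)=V (m + n) f" by(simp add: V_def bs_mult flip: mult.assoc)

lemma V_empty [simp]: "V {#} f=f" by(simp add: V_def)

lemma V_bs [simp]: "V m (bs N)=bs (image_mset (Pair 0) m + N)" by(simp add: V_def bs_mult)

lemma sub_V: "\<alpha> 0=Some 0 ==> sub \<alpha> (V m f)=V m (sub \<alpha> f)"
by(simp add: V_def sub_mult subm_def image_mset.compositionality comp_def)

definition lev0 :: "(nat \<times> 'x) multiset => 'x multiset" where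
"lev0 N=image_mset snd (filter_mset (%y. fst y=0) N)"

definition dn :: "(nat \<times> 'x) multiset => (nat \<times> 'x) multiset" where
"dn N=image_mset (%y. (fst y - 1, snd y)) (filter_mset (%y. fst y ~= 0) N)"

abbreviation "lvs n N == (\<forall>y\<in>#N. fst y <= n)"
abbreviation "lv N == image_mset snd N"

lemma lev0_plus: "lev0 (image_mset (Pair 0) m + N)=m + lev0 N"
by(simp add: lev0_def filter_mset_image_mset image_mset.compositionality comp_def)

lemma dn_plus: "dn (image_mset (Pair 0) m + N)=dn N" by(simp add: dn_def filter_mset_image_mset)

lemma sg_bs: "sg (bs N)=bs (image_mset (%y. (Suc (fst y), snd y)) N)" by(simp add: subm_def)

lemma lev0_sg: "lev0 (image_mset (%y. (Suc (fst y), snd y)) N) = {#}"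
and dn_sg: "dn (image_mset (%y. (Suc (fst y), snd y)) N)=N"
by(auto simp: lev0_def dn_def filter_mset_image_mset image_mset.compositionality comp_def)

lemma bs_split: "bs N=V (lev0 N) (sg (bs (dn N)))"
proof -
have "N=filter_mset (%y. fst y=0) N + filter_mset (%y. fst y ~= 0) N" by(rule multiset_partition)
also have "filter_mset (%y. fst y=0) N=image_mset (Pair 0) (lev0 N)"
proof -
 have "image_mset (%y. (0, snd y)) (filter_mset (%y. fst y=0) N)=image_mset (%y. y) (filter_mset (%y. fst y=0) N)"
  by(rule image_mset_cong) (auto simp: prod_eq_iff)
 thus ?thesis by(simp add: lev0_def image_mset.compositionality comp_def)
qed
also have "filter_mset (%y. fst y ~= 0) N=image_mset (%y. (Suc (fst y), snd y)) (dn N)"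
proof -
 have "image_mset (%y. (Suc (fst y - 1), snd y)) (filter_mset (%y. fst y ~= 0) N)=image_mset (%y. y) (filter_mset (%y. fst y ~= 0) N)"
  by(rule image_mset_cong) (auto simp: prod_eq_iff)
 thus ?thesis by(simp add: dn_def image_mset.compositionality comp_def)
qed
finally show ?thesis by(simp only: sg_bs V_bs)
qed

lemma lvs_dn: "lvs (Suc n) N ==> lvs n (dn N)" by(auto simp: dn_def)

lemma lv_split: "lv N=lev0 N + lv (dn N)"
proof -
have "lv N=lv (filter_mset (%y. fst y=0) N) + lv (filter_mset (%y. fst y ~= 0) N)"
 by(metis image_mset_union multiset_partition)
thus ?thesis by(simp add: lev0_def dn_def image_mset.compositionality comp_def)
qed

text \<open>Maps linear over the polynomials of level \<open>0\<close> agree if they agree on the image of the extra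
  degeneracy, which consists of the polynomials without level \<open>0\<close>.\<close>

lemma V_linear_eq:
assumes lin: "linmap F" "linmap G"
 and V: "!!m f. F (V m f)=V' m (F f)" "!!m f. G (V m f)=V' m (G f)"
 and U: "!!N. N:keys f ==> lvs (Suc n) N"
 and eq: "!!N. lvs n N ==> F (sg (bs N))=G (sg (bs N))"
shows "F f=G f"
proof (rule linmap_eq_on[OF lin])
fix N assume "N:keys f"
hence "F (sg (bs (dn N)))=G (sg (bs (dn N)))" using U by(intro eq lvs_dn)
thus "F (bs N)=G (bs N)" by(subst (1 2) bs_split) (simp only: V)
qed

definition ul :: "nat => 'x multiset => 'x pol set" where
"ul n w=lat (%N. if lvs n N & lv N=w then 1 else 0)"

definition pl :: "('x => int) => ('x multiset => bool) => nat => 'x pol set" where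
"pl p Q n=lat (%N. if lvs n N & Q (lv N) then of_int (prod_mset (image_mset p (lv (dn N)))) else 0)"

lemma ul_simps [simp]: "0:ul n w"
and ul_add: "a:ul n w ==> b:ul n w ==> a + b:ul n w"
and ul_diff: "a:ul n w ==> b:ul n w ==> a - b:ul n w"
and ul_uminus: "a:ul n w ==> - a:ul n w"
and ul_sc: "a:ul n w ==> sc (of_int k) a:ul n w"
and ul_sum: "(!!j. j:J ==> f j:ul n w) ==> sum f J:ul n w"
by(auto simp: ul_def intro: lat_add lat_diff lat_uminus lat_sum lat_sc_int)

lemma ul_bs: "lvs n N ==> lv N=w ==> bs N:ul n w" unfolding ul_def using lat_basis'[of 1 1 _ N] by simp

lemma ul_keys: "z:ul n w ==> N:keys z ==> lvs n N & lv N=w"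
unfolding ul_def by(drule (1) lat_keys) (auto split: if_splits)

lemma pl_keys: "z:pl p Q n ==> N:keys z ==> lvs n N & Q (lv N)"
unfolding pl_def by(drule (1) lat_keys) (auto split: if_splits)

lemma ul_linmap:
assumes "linmap F" "z:ul n w" "!!N. lvs n N ==> lv N=w ==> F (bs N):lat c"
shows "F z:lat c" using assms(2) unfolding ul_def
by(rule lat_linmap[OF assms(1)]) (use assms(3) in "auto split: if_splits")

lemma pl_linmap:
assumes "linmap F" "z:pl p Q n"
 "!!N. lvs n N ==> Q (lv N) ==> sc (of_int (prod_mset (image_mset p (lv (dn N))))) (F (bs N)):lat c"
shows "F z:lat c" using assms(2) unfolding pl_def
by(rule lat_linmap[OF assms(1)]) (use assms(3) in "auto split: if_splits")

lemma ul_pl: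
assumes "z:ul n w" "Q w" shows "sc (of_int (prod_mset (image_mset p w))) z:pl p Q n" unfolding pl_def
proof (rule ul_linmap[OF _ assms(1), where F = "sc _"], goal_cases)
case (2 N)
have "prod_mset (image_mset p w)=prod_mset (image_mset p (lev0 N)) * prod_mset (image_mset p (lv (dn N)))"
 by(simp flip: 2(2) add: lv_split[of N])
thus ?case using 2 assms(2) by(intro lat_basis'[of _ "prod_mset (image_mset p (lev0 N))"]) auto
qed (intro lin)

lemma V_ul: "z:ul n w ==> V m z:ul n (w + m)" unfolding ul_def[of n "w + m"] by(rule ul_linmap[OF linmap_V0])
  (auto intro!: ul_bs simp: image_mset.compositionality comp_def simp flip: ul_def)

lemma V_pl:
assumes "z:pl p Q n" "!!w. Q w ==> Q' (w + m)" shows "V m z:pl p Q' n" unfolding pl_def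
proof (rule pl_linmap[OF linmap_V0 assms(1)], goal_cases)
case (1 N)
have "lv (image_mset (Pair 0) m + N)=lv N + m" by(simp add: image_mset.compositionality comp_def)
thus ?case using assms(2)[OF 1(2)] 1
 by(auto simp: lat_bs_iff dn_plus add.commute[of m] simp del: image_mset_union intro!: exI[of _ 1])
qed

lemma sub_ul:
assumes "z:ul n w" "!!l l'. l <= n ==> \<alpha> l=Some l' ==> l' <= n'" shows "sub \<alpha> z:ul n' w"
unfolding ul_def by(rule ul_linmap[OF linmap_sub0 assms(1)])
  (use assms(2) in "fastforce intro!: ul_bs simp: subm_def image_mset.compositionality comp_def simp flip: ul_def")

text \<open>Homogeneous integral maps that are linear over level \<open>0\<close> preserve the divisibility
  condition.\<close>

lemma pl_preserved:
assumes "linmap F" "!!m f. F (V m f)=V m (F f)" "!!w f. f:ul n w ==> F f:ul n' w" and f: "f:pl p Q n"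
shows "F f:pl p Q n'" unfolding pl_def
proof (rule pl_linmap[OF assms(1) f], goal_cases)
case (1 N)
let ?R = "image_mset (%y. (Suc (fst y), snd y)) (dn N)"
have R: "bs N=V (lev0 N) (bs ?R)" by(subst bs_split) (simp only: sg_bs)
have "lvs n ?R" using 1(1) by(auto simp: dn_def)
moreover have lvR: "lv ?R=lv (dn N)" by(simp add: image_mset.compositionality comp_def)
ultimately have "sc (of_int (prod_mset (image_mset p (lv (dn N))))) (F (bs ?R)):pl p (%w. w=lv (dn N)) n'"
 by(intro ul_pl assms(3) ul_bs) auto
moreover have "Q (lv (dn N) + lev0 N)" using 1(2) lv_split[of N] by(simp add: add.commute)
ultimately have "V (lev0 N) (sc (of_int (prod_mset (image_mset p (lv (dn N))))) (F (bs ?R))):pl p Q n'"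
 by(intro V_pl[where Q = "%w. w=lv (dn N)"]) auto
thus ?case unfolding pl_def[symmetric] R assms(2) by(simp add: V_simps(2))
qed

lemma pl_kl:
assumes "linmap F" "!!m f. F (V m f)=Mo m (F f)" "!!w f. f:ul n w ==> F f:hl n' w" and f: "f:pl p Q n"
shows "F f:kl p Q n'" unfolding kl_def
proof (rule pl_linmap[OF assms(1) f], goal_cases)
case (1 N)
let ?R = "image_mset (%y. (Suc (fst y), snd y)) (dn N)"
have R: "bs N=V (lev0 N) (bs ?R)" by(subst bs_split) (simp only: sg_bs)
have "lvs n ?R" using 1(1) by(auto simp: dn_def)
moreover have lvR: "lv ?R=lv (dn N)" by(simp add: image_mset.compositionality comp_def)
ultimately have "sc (of_int (prod_mset (image_mset p (lv (dn N))))) (F (bs ?R)):kl p (%w. w=lv (dn N)) n'"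
 by(intro hl_kl assms(3) ul_bs) auto
moreover have "Q (lv (dn N) + lev0 N)" using 1(2) lv_split[of N] by(simp add: add.commute)
ultimately have "Mo (lev0 N) (sc (of_int (prod_mset (image_mset p (lv (dn N))))) (F (bs ?R))):kl p Q n'"
 by(intro Mo_kl[where Q = "%w. w=lv (dn N)"]) auto
thus ?case unfolding kl_def[symmetric] R assms(2) by(simp add: Mo_simps(2))
qed

lemma kl_pl:
assumes "linmap F" "!!m f. F (Mo m f)=V m (F f)" "!!w f. f:hl n w ==> F f:ul n' w" and f: "f:kl p Q n"
shows "F f:pl p Q n'" unfolding pl_def
proof (rule kl_linmap[OF assms(1) f], goal_cases)
case (1 I u)
have R: "bs (I, u)=Mo u (bs (I, {#}))" by simp
have "sc (of_int (prod_mset (image_mset p (mset I)))) (F (bs (I, {#}))):pl p (%w. w=mset I) n'"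
 using 1 by(intro ul_pl assms(3) hl_bs) auto
hence "V u (sc (of_int (prod_mset (image_mset p (mset I)))) (F (bs (I, {#})))):pl p Q n'"
 using 1(3) by(intro V_pl[where Q = "%w. w=mset I"]) auto
thus ?case unfolding pl_def[symmetric] R assms(2) by(simp add: V_simps(2))
qed

subsection \<open>The bar differential\<close>

definition bd :: "nat \<Rightarrow> 'x pol \<Rightarrow> 'x pol" where
"bd n f = (\<Sum>j\<le>Suc n. sc ((- 1) ^ j) (fac (Suc n) j f))"

lemma linmap_bd [lin]: "linmap F ==> linmap (%z. bd n (F z))" unfolding bd_def by(intro lin)

lemmas linmap_bd0=linmap_bd[OF linmap_id]
lemmas bd_simps=linmap_simps[OF linmap_bd0]

lemma bd_V: "bd n (V m f)=V m (bd n f)" by(simp add: bd_def sub_V tf_def V_simps)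

lemma bd_ul: "f:ul (Suc n) w ==> bd n f:ul n w" unfolding bd_def
by(intro ul_sum) (auto intro!: ul_sc[of _ _ _ "(- 1) ^ _", simplified] sub_ul simp: tf_def Let_def split: if_splits)

lemma fac_sg0: "fac (Suc n) 0 (sg f)=sub (%l. if l <= n then Some l else None) f"
unfolding sub_sub by(rule sub_cong) (auto simp: tf_def)

lemma fac_sg: "fac (Suc (Suc n)) (Suc j) (sg f)=sg (fac (Suc n) j f)"
unfolding sub_sub by(rule sub_cong) (auto simp: tf_def Let_def)

lemma fac_sg1: "fac (Suc 0) (Suc 0) (sg f)=ep f" unfolding sub_sub by(rule sub_cong) (auto simp: tf_def Let_def)

lemma sub_id_le: "(!!N. N:keys f ==> lvs n N) ==> sub (%l. if l <= n then Some l else None) f=f"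
proof (rule linmap_eq_on[of "sub _" "%z. z"])
fix N assume "!!N. N:keys f ==> lvs n N" "N:keys f"
hence "lvs n N" by simp
hence "image_mset (%y. (the (if fst y <= n then Some (fst y) else None), snd y)) N=image_mset (%y. y) N"
 by(intro image_mset_cong) auto
thus "sub (%l. if l <= n then Some l else None) (bs N)=bs N"
 using \<open>lvs n N\<close> by(auto simp: subm_def)
qed (intro lin)+

definition U :: "nat => 'x pol => bool" where
"U n f \<longleftrightarrow> (\<forall>N\<in>keys f. lvs n N)"

lemma U_ul: "f:ul n w ==> U n f" using ul_keys[of f n w] by(fastforce simp: U_def)

lemma U_pl: "f:pl p Q n ==> U n f" using pl_keys[of f p Q n] by(fastforce simp: U_def)

lemma U_bs: "lvs n N ==> U n (bs N)" by(simp add: U_def)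

lemma bd_sg:
assumes "U (Suc n) f" shows "bd (Suc n) (sg f) = f - sg (bd n f)"
proof -
have "bd (Suc n) (sg f) = fac (Suc (Suc n)) 0 (sg f)
  + (\<Sum>j\<le>Suc n. sc ((- 1) ^ Suc j) (fac (Suc (Suc n)) (Suc j) (sg f)))"
 unfolding bd_def by(subst sum.atMost_Suc_shift) simp
also have "\<dots> = f - sg (bd n f)"
 using assms by(simp only: fac_sg0 fac_sg) (simp add: sub_id_le U_def bd_def sub_simps sc_minus1 sum_negf)
finally show ?thesis .
qed

lemma bd_sg0: "U 0 f ==> bd 0 (sg f)=f - ep f"
unfolding bd_def by(simp add: fac_sg1 fac_sg0[of 0, simplified] sc_minus1 sub_id_le[of f 0, simplified] U_def)

lemma bd_bd_basis: "lvs (Suc (Suc n)) N ==> bd n (bd (Suc n) (bs N))=0"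
proof (induction n arbitrary: N)
case 0
have "bd 0 (bd (Suc 0) f)=0" if "U two f" for f :: "'a pol"
proof (rule V_linear_eq[where F = "%f. bd 0 (bd (Suc 0) f)" and V'=V and n = "Suc 0"], goal_cases)
 case (6 M)
 have M: "U (Suc 0) (bs M)" using 6 by(simp add: U_def)
 have "bd (0) (bd (Suc 0) (sg (bs M)))=bd 0 (bs M) - bd 0 (sg (bd 0 (bs M)))" by(simp only: bd_sg[OF M] bd_simps)
 also have "bd 0 (bs M):ul 0 (lv M)" using 6 by(intro bd_ul ul_bs) auto
 hence "bd 0 (sg (bd 0 (bs M)))=bd 0 (bs M) - ep (bd 0 (bs M))" by(intro bd_sg0 U_ul)
 also have "ep (bd 0 (bs M))=0"
 proof -
  have "ep (fac (Suc 0) j (bs M))=ep (bs M)" if "j <= 1 & M = {#} | M ~= {#}" for j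
  proof (cases "M = {#}")
   case False
   thus ?thesis unfolding sub_sub by(auto simp: subm_def bind_eq_None_conv)
  qed (simp add: subm_def)
  hence "ep (fac (Suc 0) j (bs M))=ep (bs M)" if "j <= 1" for j using that by blast
  thus ?thesis by(simp add: bd_def sub_simps sc_minus1 del: sub_bs)
 qed
 finally show ?case by simp
qed (use that in "auto intro!: lin simp: bd_V V_simps U_def")
thus ?case using 0 by(simp add: U_def)
next
case (Suc n)
have "bd (Suc n) (bd (Suc (Suc n)) f)=0" if "U (Suc (Suc (Suc n))) f" for f :: "'a pol"
proof (rule V_linear_eq[where F = "%f. bd (Suc n) (bd (Suc (Suc n)) f)" and V'=V and n = "Suc (Suc n)"], goal_cases)
 case (6 M)
 have "bd (Suc n) (bs M):ul (Suc n) (lv M)" using 6 by(intro bd_ul ul_bs) auto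
 with 6 Suc.IH[of M] show ?case by(simp only: bd_sg[OF U_bs] bd_sg[OF U_ul] bd_simps) (simp add: sub_simps)
qed (use that in "auto intro!: lin simp: bd_V V_simps U_def")
thus ?case using Suc.prems by(simp add: U_def)
qed

lemma bd_bd: "U (Suc (Suc n)) f ==> bd n (bd (Suc n) f)=0"
by(rule linmap_eq_on[of "%f. bd n (bd (Suc n) f)" "%_. 0"]) (auto intro!: lin bd_bd_basis simp: U_def)

subsection \<open>Comparison of the bar construction with the Koszul complex\<close>

lemma lext_one [simp]: "lext g 1=g {#}" by(metis lext_bs single_one)

primrec ph :: "nat => 'x::linorder pol => 'x kos" where
"ph 0=lext (%N. if lvs 0 N then bs ([], lev0 N) else 0)"
| "ph (Suc n)=lext (%N. Mo (lev0 N) (ks (ph n (bs (dn N)))))"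

lemma linmap_ph [lin]: "linmap F ==> linmap (%z. ph n (F z))" by(cases n) (auto intro!: lin)

lemmas linmap_ph0=linmap_ph[OF linmap_id]
lemmas ph_simps=linmap_simps[OF linmap_ph0]

lemma ph_V: "ph n (V m f)=Mo m (ph n f)"
proof (rule linmap_eqI[of "%f. ph n (V m f)"])
fix N :: "(nat \<times> 'a) multiset"
show "ph n (V m (bs N))=Mo m (ph n (bs N))"
 by(cases n) (simp_all add: lev0_plus dn_plus Mo_Mo Mo_simps ball_Un add.commute[of "lev0 N" m])
qed (intro lin)+

lemma ph_sg: "ph (Suc n) (sg f)=ks (ph n f)" by(rule linmap_eqI[of "%f. ph (Suc n) (sg f)"])
  (auto intro!: lin simp: lev0_sg dn_sg sg_bs simp del: sub_bs)

lemma lvs0_lev0: "lvs 0 N ==> image_mset (Pair 0) (lev0 N)=N"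
proof -
assume N: "lvs 0 N"
hence "filter_mset (%y. fst y=0) N=filter_mset (%_. True) N" by(intro filter_mset_cong) auto
hence "lev0 N=lv N" by(simp add: lev0_def)
moreover have "image_mset (%y. (0, snd y)) N=image_mset (%y. y) N"
 using N by(intro image_mset_cong) (auto simp: prod_eq_iff)
ultimately show ?thesis by(simp add: image_mset.compositionality comp_def)
qed

lemma ph_bs_hl: "lvs n N ==> ph n (bs N):hl n (lv N)"
proof (induction n arbitrary: N)
case 0
have "lv N=lv (image_mset (Pair (0::nat)) (lev0 N))" by(simp only: lvs0_lev0[OF 0])
hence "lev0 N=lv N" by(simp add: image_mset.compositionality comp_def)
with 0 show ?case by(auto intro!: hl_bs)
next
case (Suc n)
have "Mo (lev0 N) (ks (ph n (bs (dn N)))):hl (Suc n) (lv (dn N) + lev0 N)"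
 using Suc by(intro Mo_hl ks_hl Suc.IH lvs_dn)
thus ?case by(simp add: lv_split[of N] add.commute)
qed

lemma ph_hl: "f:ul n w ==> ph n f:hl n w"
unfolding hl_def by(rule ul_linmap[OF linmap_ph0]) (auto simp: ph_bs_hl simp flip: hl_def)

lemma ph_kl: "f:pl p Q n ==> ph n f:kl p Q n" by(rule pl_kl[OF linmap_ph0 ph_V ph_hl])

lemma ph_bd_basis: "lvs (Suc n) N ==> kd (ph (Suc n) (bs N))=ph n (bd n (bs N))"
proof (induction n arbitrary: N)
case 0
show ?case
proof (rule V_linear_eq[where F = "%f. kd (ph (Suc 0) f)" and V'=Mo and n=0], goal_cases)
 case (6 M)
 have ep: "ep (bs M)=(if M = {#} then bs {#} else 0)" by(auto simp: subm_def)
 have "ph 0 (bs M)=bs ([], lev0 M)" using 6 by simp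
 moreover have "M = {#} \<longleftrightarrow> lev0 M = {#}" using lvs0_lev0[of M] 6 by(metis image_mset_is_empty_iff)
 ultimately have "kd (ks (ph 0 (bs M)))=ph 0 (bs M) - ph 0 (ep (bs M))"
  using kd_ks_basis[of "[]" "lev0 M"] unfolding ep by(auto simp: ph_simps ks_simps Mo_simps lev0_def)
 thus ?case using 6 by(simp only: ph_sg bd_sg0[OF U_bs] ph_simps)
qed (use 0 in "auto intro!: lin simp: ph_V bd_V kd_Mo simp del: ph.simps")
next
case (Suc n)
show ?case
proof (rule V_linear_eq[where F = "%f. kd (ph (Suc (Suc n)) f)" and V'=Mo and n = "Suc n"], goal_cases)
 case (6 M)
 have "kd (ks (ph (Suc n) (bs M)))=ph (Suc n) (bs M) - ks (kd (ph (Suc n) (bs M)))"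
  using kd_ks[OF ph_bs_hl[OF 6]] by(simp add: algebra_simps)
 thus ?case using Suc.IH[OF 6] by(simp only: ph_sg bd_sg[OF U_bs[OF 6]] ph_simps)
qed (use Suc.prems in "auto intro!: lin simp: ph_V bd_V kd_Mo simp del: ph.simps")
qed

lemma ph_bd: "U (Suc n) f ==> kd (ph (Suc n) f)=ph n (bd n f)"
by(rule linmap_eq_on[of "%f. kd (ph (Suc n) f)"]) (auto intro!: lin ph_bd_basis simp: U_def simp del: ph.simps)

primrec psl :: "nat => 'x list => 'x pol" where
"psl 0 I=1"
| "psl (Suc n) I=sg (lext (%(J, u). V u (psl n J)) (dl I))"

definition ps :: "nat => 'x kos => 'x pol" where
"ps n=lext (%(J, u). V u (psl n J))"

lemma linmap_ps [lin]: "linmap F ==> linmap (%z. ps n (F z))" unfolding ps_def by(auto intro!: lin)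

lemmas linmap_ps0=linmap_ps[OF linmap_id]
lemmas ps_simps=linmap_simps[OF linmap_ps0]

lemma ps_Mo: "ps n (Mo m z)=V m (ps n z)"
by(rule linmap_eqI[of "%z. ps n (Mo m z)"]) (auto intro!: lin simp: ps_def V_V add.commute)

lemma ps_bs: "ps n (bs (I, u))=V u (psl n I)" by(simp add: ps_def)

lemma psl_Suc: "psl (Suc n) I=sg (ps n (dl I))" by(simp add: ps_def)

lemma sg_ul: "f:ul n w ==> sg f:ul (Suc n) w" by(rule sub_ul) auto

lemma psl_ul: "srt I ==> length I=n ==> psl n I:ul n (mset I)"
proof (induction n arbitrary: I)
case 0
thus ?case using ul_bs[of "{#}" 0 "{#}"] by simp
next
case (Suc n)
have "ps n (dl I):ul n (mset I)" unfolding ul_def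
proof (rule hl_linmap[OF linmap_ps0 dl_hl[OF Suc.prems]], goal_cases)
 case (1 J u)
 thus ?case using V_ul[OF Suc.IH[of J], of u] by(simp add: ps_bs ul_def)
qed
thus ?case unfolding psl_Suc by(rule sg_ul)
qed

lemma ps_ul: "z:hl n w ==> ps n z:ul n w" unfolding ul_def
proof (rule hl_linmap[OF linmap_ps0], assumption, goal_cases)
case (1 J u)
thus ?case using V_ul[OF psl_ul[of J], of n u] by(simp add: ps_bs ul_def)
qed

lemma ps_pl: "z:kl p Q n ==> ps n z:pl p Q n" by(rule kl_pl[OF linmap_ps0 ps_Mo ps_ul])

lemma bd_psl: "srt I ==> length I=Suc n ==> bd n (psl (Suc n) I)=ps n (dl I)"
proof (induction n arbitrary: I)
case 0
then obtain x where I: "I=[x]" by(cases I) auto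
have "ps 0 (dl I):ul 0 (mset I)" using 0 by(intro ps_ul dl_hl)
moreover have "ep (ps 0 (dl I))=0"
 by(simp add: I cns_simps ps_bs V_def flip: single_one) (simp add: bs_mult subm_def)
ultimately show ?case unfolding psl_Suc by(simp add: bd_sg0[OF U_ul])
next
case (Suc n)
have d: "dl I:hl (Suc n) (mset I)" using Suc.prems by(intro dl_hl)
have *: "bd n (ps (Suc n) z)=ps n (kd z)" if "z:hl (Suc n) (mset I)" for z
proof (rule linmap_eq_on[of "%z. bd n (ps (Suc n) z)"])
 fix y assume y: "y:keys z"
 obtain J u where Ju: "y=(J, u)" by fastforce
 thus "bd n (ps (Suc n) (bs y))=ps n (kd (bs y))"
  using hl_keys[OF that] y by(simp add: ps_bs bd_V Suc.IH ps_Mo del: psl.simps)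
qed (intro lin)+
show ?case unfolding psl_Suc[of "Suc n"] bd_sg[OF U_ul[OF ps_ul[OF d]]] *[OF d] kd_dl
 by(simp add: ps_simps sub_simps)
qed

lemma bd_ps: "z:kl p Q (Suc n) ==> bd n (ps (Suc n) z)=ps n (kd z)"
and bd_ps_hl: "z:hl (Suc n) w ==> bd n (ps (Suc n) z)=ps n (kd z)"
proof -
have *: "bd n (ps (Suc n) z)=ps n (kd z)"
 if "!!I u. (I, u):keys z ==> srt I & length I=Suc n" for z :: "'x::linorder kos"
proof (rule linmap_eq_on[of "%z. bd n (ps (Suc n) z)"])
 fix y assume y: "y:keys z"
 obtain J u where Ju: "y=(J, u)" by fastforce
 thus "bd n (ps (Suc n) (bs y))=ps n (kd (bs y))"
  using that y by(simp add: ps_bs bd_V bd_psl ps_Mo del: psl.simps)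
qed (intro lin)+
show "z:kl p Q (Suc n) ==> bd n (ps (Suc n) z)=ps n (kd z)" by(rule *) (auto dest!: kl_keys)
show "z:hl (Suc n) w ==> bd n (ps (Suc n) z)=ps n (kd z)" by(rule *) (auto dest!: hl_keys)
qed

primrec hm :: "nat => 'x::linorder pol => 'x pol" where
"hm 0=(%f. 0)"
| "hm (Suc n)=lext (%N. V (lev0 N) (sg (let e=sg (bs (dn N)) in
  e - ps (Suc n) (ph (Suc n) e) - hm n (bd n e))))"

lemma linmap_hm [lin]: "linmap F ==> linmap (%z. hm n (F z))" by(cases n) (auto intro!: lin)

lemmas linmap_hm0=linmap_hm[OF linmap_id]
lemmas hm_simps=linmap_simps[OF linmap_hm0]

lemma hm_V: "hm n (V m f)=V m (hm n f)"
proof (rule linmap_eqI[of "%f. hm n (V m f)"])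
fix N :: "(nat \<times> 'a) multiset"
show "hm n (V m (bs N))=V m (hm n (bs N))" by(cases n) (auto simp: lev0_plus dn_plus V_V V_simps)
qed (intro lin)+

lemma hm_sg: "hm (Suc n) (sg (bs N))=sg (sg (bs N) - ps (Suc n) (ph (Suc n) (sg (bs N))) - hm n (bd n (sg (bs N))))"
unfolding hm.simps sg_bs lext_bs by(simp add: Let_def lev0_sg dn_sg sg_bs del: sub_bs ph.simps)

lemma hm_ul: "f:ul n w ==> hm n f:ul (Suc n) w"
proof (induction n arbitrary: f w)
case (Suc n)
show ?case unfolding ul_def[of "Suc (Suc n)"]
proof (rule ul_linmap[OF linmap_hm0 Suc.prems], goal_cases)
 case (1 N)
 have e: "sg (bs (dn N)):ul (Suc n) (lv (dn N))" using 1 by(intro sg_ul ul_bs lvs_dn) auto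
 have "hm (Suc n) (bs N)=V (lev0 N) (hm (Suc n) (sg (bs (dn N))))" by(subst bs_split) (simp only: hm_V)
 also have "sg (bs (dn N)) - ps (Suc n) (ph (Suc n) (sg (bs (dn N)))) - hm n (bd n (sg (bs (dn N))))
   : ul (Suc n) (lv (dn N))" using e by(intro ul_diff ps_ul ph_hl Suc.IH bd_ul)
 hence "V (lev0 N) (hm (Suc n) (sg (bs (dn N)))):ul (Suc (Suc n)) (lv (dn N) + lev0 N)"
  unfolding hm_sg by(intro V_ul sg_ul)
 finally show ?case using 1(2) lv_split[of N] by(simp add: ul_def add.commute)
qed
qed auto

lemma hm_pl: "f:pl p Q n ==> hm n f:pl p Q (Suc n)" by(rule pl_preserved[OF linmap_hm0 hm_V hm_ul])

lemma ps_ph_0: "U 0 f ==> ps 0 (ph 0 f)=f" by(rule linmap_eq_on[of "%f. ps 0 (ph 0 f)" "%f. f"])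
  (auto intro!: lin simp: U_def ps_bs lvs0_lev0 V_def)

text \<open>Both composites of comparison maps between resolutions are homotopic to the identity; here
  the homotopy is built degree by degree with the extra degeneracy.\<close>

lemma hm_homotopy_basis:
"lvs (Suc n) N ==> bd (Suc n) (hm (Suc n) (bs N)) + hm n (bd n (bs N))=bs N - ps (Suc n) (ph (Suc n) (bs N))"
proof (induction n arbitrary: N)
case 0
show ?case
proof (rule V_linear_eq[where F = "%f. bd (Suc 0) (hm (Suc 0) f) + hm 0 (bd 0 f)" and V'=V and n=0], goal_cases)
 case (6 M)
 let ?e = "sg (bs M)"
 let ?g = "?e - ps (Suc 0) (ph (Suc 0) ?e) - hm 0 (bd 0 ?e)"
 have e: "?e:ul (Suc 0) (lv M)" using 6 by(intro sg_ul ul_bs) auto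
 hence g: "?g:ul (Suc 0) (lv M)" by(intro ul_diff ps_ul ph_hl hm_ul bd_ul)
 have "bd 0 ?g=bd 0 ?e - ps 0 (ph 0 (bd 0 ?e))"
  using bd_ps_hl[OF ph_hl[OF e]] ph_bd[OF U_ul[OF e]] by(simp only: bd_simps) (simp add: bd_simps)
 also have "... = 0" using ps_ph_0[OF U_ul[OF bd_ul[OF e]]] by simp
 finally have "bd (Suc 0) (hm (Suc 0) ?e)=?g" unfolding hm_sg bd_sg[OF U_ul[OF g]] by(simp add: sub_simps)
 thus ?case by(simp add: algebra_simps)
qed (use 0 in "auto intro!: lin simp: ph_V bd_V hm_V ps_Mo V_simps simp del: ph.simps hm.simps")
next
case (Suc n)
have IH: "bd (Suc n) (hm (Suc n) f) + hm n (bd n f)=f - ps (Suc n) (ph (Suc n) f)" if "U (Suc n) f" for f :: "'a pol"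
 by(rule linmap_eq_on[of "%f. bd (Suc n) (hm (Suc n) f) + hm n (bd n f)"])
   (use that in "auto intro!: lin Suc.IH simp: U_def simp del: ph.simps hm.simps")
show ?case
proof (rule V_linear_eq[where F = "%f. bd (Suc (Suc n)) (hm (Suc (Suc n)) f) + hm (Suc n) (bd (Suc n) f)" and V'=V and n = "Suc n"], goal_cases)
 case (6 M)
 let ?e = "sg (bs M)"
 let ?g = "?e - ps (Suc (Suc n)) (ph (Suc (Suc n)) ?e) - hm (Suc n) (bd (Suc n) ?e)"
 have e: "?e:ul (Suc (Suc n)) (lv M)" using 6 by(intro sg_ul ul_bs) auto
 hence g: "?g:ul (Suc (Suc n)) (lv M)" by(intro ul_diff ps_ul ph_hl hm_ul bd_ul)
 have be: "bd (Suc n) ?e:ul (Suc n) (lv M)" by(intro bd_ul e)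
 have 1: "bd (Suc n) (ps (Suc (Suc n)) (ph (Suc (Suc n)) ?e))=ps (Suc n) (ph (Suc n) (bd (Suc n) ?e))"
  using bd_ps_hl[OF ph_hl[OF e]] ph_bd[OF U_ul[OF e]] by metis
 have 2: "bd (Suc n) (hm (Suc n) (bd (Suc n) ?e))=bd (Suc n) ?e - ps (Suc n) (ph (Suc n) (bd (Suc n) ?e))"
  using IH[OF U_ul[OF be]] bd_bd[OF U_ul[OF e]] by(simp only: hm_simps add_0_right)
 have "bd (Suc n) ?g=0" unfolding bd_simps(5) 1 2 by simp
 hence "bd (Suc (Suc n)) (hm (Suc (Suc n)) ?e)=?g"
  unfolding hm_sg bd_sg[OF U_ul[OF g]] by(simp only: sub_simps diff_0_right)
 thus ?case by(simp only: diff_add_cancel)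
qed (use Suc.prems in "auto intro!: lin simp: ph_V bd_V hm_V ps_Mo V_simps simp del: ph.simps hm.simps")
qed

lemma hm_homotopy:
"U (Suc n) f ==> bd (Suc n) (hm (Suc n) f) + hm n (bd n f)=f - ps (Suc n) (ph (Suc n) f)"
by(rule linmap_eq_on[of "%f. bd (Suc n) (hm (Suc n) f) + hm n (bd n f)"])
  (auto intro!: lin hm_homotopy_basis simp: U_def simp del: ph.simps hm.simps)

subsection \<open>The projection onto the Moore complex\<close>

definition pr :: "nat => 'x pol => 'x pol" where
"pr n f=foldr (%k f. f - sub (kf n k) f) [1..<Suc n] f"

lemma linmap_foldr: "(!!k. linmap (F k)) ==> linmap (%f. foldr F ls f)"
proof (induction ls)
case (Cons k ls)
thus ?case using linmap_comp[of "F k" "foldr F ls"] by simp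
qed (simp add: linmap_id id_def)

lemma linmap_pr [lin]: "linmap F ==> linmap (%z. pr n (F z))"
unfolding pr_def by(rule linmap_comp[OF linmap_foldr]) (auto intro!: lin)

lemmas linmap_pr0=linmap_pr[OF linmap_id]
lemmas pr_simps=linmap_simps[OF linmap_pr0]

lemma foldr_V: "\<forall>k\<in>set ls. k > 0 ==>
 foldr (%k f. f - sub (kf n k) f) ls (V m f)=V m (foldr (%k f. f - sub (kf n k) f) ls f)"
by(induction ls) (auto simp: sub_V kf_def V_simps)

lemma pr_V: "pr n (V m f)=V m (pr n f)" unfolding pr_def by(rule foldr_V) auto

lemma pr_ul: "f:ul n w ==> pr n f:ul n w"
proof -
have "f:ul n w ==> foldr (%k f. f - sub (kf n k) f) ls f:ul n w" for ls
 by(induction ls) (auto intro!: ul_diff sub_ul simp: kf_def Let_def split: if_splits)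
thus "f:ul n w ==> pr n f:ul n w" by(simp add: pr_def)
qed

lemma pr_pl: "f:pl p Q n ==> pr n f:pl p Q n" by(rule pl_preserved[OF linmap_pr0 pr_V pr_ul])

lemma kf_fac: "1 <= k ==> k <= n ==>
 sub (kf n k) f=sub (%l. if l < k then Some l else if l < n then Some (Suc l) else None) (fac n k f)"
unfolding sub_sub by(rule sub_cong) (auto simp: kf_def tf_def Let_def)

lemma pr_moore:
assumes "!!k. 1 <= k ==> k <= n ==> fac n k f=0"
shows "pr n f=f"
proof -
have *: "foldr (%k f. f - sub (kf n k) f) ls f=f" if "\<forall>k\<in>set ls. 1 <= k & k <= n" for ls
 using that by(induction ls) (auto simp: kf_fac assms sub_simps)
show ?thesis unfolding pr_def by(rule *) auto
qed

text \<open>A face identifies a level with the next one. It therefore kills \<open>1 - T\<close> for the operator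
  \<open>T\<close> that moves this level to the next one, even after lower levels have been moved.\<close>

lemma fac_pr_aux:
assumes "1 <= j" "j <= n" "!!l. l >= j ==> \<alpha> l=Some l" "\<forall>k\<in>set ls. k < j"
shows "fac n j (sub \<alpha> (foldr (%k f. f - sub (kf n k) f) ls (g - sub (kf n j) g)))=0" using assms(3,4)
proof (induction ls arbitrary: \<alpha>)
case Nil
have "fac n j (sub \<alpha> (sub (kf n j) g))=fac n j (sub \<alpha> g)" unfolding sub_sub
proof (rule sub_cong, goal_cases)
 case (1 l)
 show ?case using assms(1,2) Nil(1)[of j] Nil(1)[of "Suc j"] Nil(1)[of l] by(auto simp: kf_def tf_def Let_def)
qed
thus ?case by(simp add: sub_simps)
next
case (Cons k ls)
have "!!l. l >= j ==> Option.bind (kf n k l) \<alpha> = (if l <= n then Some l else None)"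
 using Cons.prems by(auto simp: kf_def Let_def)
let ?\<beta> = "%l. if l <= n then Option.bind (kf n k l) \<alpha> else Some l"
have "fac n j (sub \<alpha> (sub (kf n k) f))=fac n j (sub ?\<beta> f)" for f :: "'a pol" unfolding sub_sub
 by(rule sub_cong) (use assms(1,2) Cons.prems in "auto simp: kf_def tf_def Let_def")
moreover have "fac n j (sub ?\<beta> (foldr (%k f. f - sub (kf n k) f) ls (g - sub (kf n j) g)))=0"
 using Cons.prems by(intro Cons.IH) (auto simp: kf_def Let_def)
ultimately show ?case using Cons by(simp add: sub_simps)
qed

lemma fac_pr:
assumes "1 <= j" "j <= n" shows "fac n j (pr n f)=0"
proof -
have "[1..<Suc n]=[1..<j]@[j..<Suc n]" using upt_add_eq_append[of 1 j "Suc n - j"] assms by simp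
also have "[j..<Suc n]=j#[Suc j..<Suc n]" using assms by(intro upt_conv_Cons) auto
finally have "[1..<Suc n]=[1..<j]@j#[Suc j..<Suc n]" .
moreover define g where "g=foldr (%k f. f - sub (kf n k) f) [Suc j..<Suc n] f"
ultimately have "pr n f=foldr (%k f. f - sub (kf n k) f) [1..<j] (g - sub (kf n j) g)"
 by(simp add: pr_def del: upt_Suc)
also have "... = sub Some (foldr (%k f. f - sub (kf n k) f) [1..<j] (g - sub (kf n j) g))"
 by(rule linmap_eqI[of "%f. f" "sub Some"]) (auto intro!: lin simp: subm_def)
also have "fac n j ... = 0" by(rule fac_pr_aux) (use assms in auto)
finally show ?thesis .
qed

lemma foldr_sg: "foldr (%k f. f - sub (kf (Suc n) k) f) (map Suc ls) (sg f)
 = sg (foldr (%k f. f - sub (kf n k) f) ls f)"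
proof (induction ls)
case (Cons k ls)
have "sub (kf (Suc n) (Suc k)) (sg f)=sg (sub (kf n k) f)" for f :: "'a pol"
 unfolding sub_sub by(rule sub_cong) (auto simp: kf_def Let_def)
with Cons show ?case by(simp add: sub_simps)
qed auto

lemma pr_sg: "pr (Suc n) (sg f)=sg (pr n f) - sub (kf (Suc n) 1) (sg (pr n f))"
proof -
have "[1..<Suc (Suc n)]=1#map Suc [1..<Suc n]" by(simp add: map_Suc_upt upt_conv_Cons del: upt_Suc)
thus ?thesis by(simp only: pr_def foldr.simps comp_apply foldr_sg)
qed

lemma fac_pr_bd_basis: "lvs (Suc n) N ==> fac (Suc n) 0 (pr (Suc n) (bs N))=pr n (bd n (bs N))"
proof (induction n arbitrary: N)
case 0
show ?case
proof (rule V_linear_eq[where F = "%f. fac (Suc 0) 0 (pr (Suc 0) f)" and V'=V and n=0], goal_cases)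
 case (6 M)
 have "sub (kf (Suc 0) 1) (sg (bs M))=ep (bs M)" unfolding sub_sub by(rule sub_cong) (auto simp: kf_def)
 moreover have "fac (Suc 0) 0 (ep (bs M))=ep (bs M)" by(cases "M = {#}") (auto simp: subm_def sub_simps)
 moreover have "fac (Suc 0) 0 (sg (bs M))=bs M" unfolding fac_sg0 using 6 by(intro sub_id_le) auto
 moreover have "pr 0 f=f" for f :: "'a pol" by(simp add: pr_def)
 ultimately show ?case unfolding pr_sg bd_sg0[OF U_bs[OF 6]] by(simp only: sub_simps)
qed (use 0 in "auto intro!: lin simp: pr_V bd_V sub_V tf_def")
next
case (Suc n)
show ?case
proof (rule V_linear_eq[where F = "%f. fac (Suc (Suc n)) 0 (pr (Suc (Suc n)) f)" and V'=V and n = "Suc n"], goal_cases)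
 case (6 M)
 let ?g = "pr (Suc n) (bs M)"
 have g: "?g:ul (Suc n) (lv M)" using 6 by(intro pr_ul ul_bs) auto
 have "fac (Suc (Suc n)) 0 (sub (kf (Suc (Suc n)) 1) (sg f))=sg (fac (Suc n) 0 f)" for f :: "'a pol"
  unfolding sub_sub by(rule sub_cong) (auto simp: kf_def tf_def Let_def)
 hence "fac (Suc (Suc n)) 0 (pr (Suc (Suc n)) (sg (bs M)))=?g - sg (fac (Suc n) 0 ?g)"
  unfolding pr_sg sub_simps fac_sg0 using U_ul[OF g] by(subst sub_id_le) (auto simp: U_def)
 moreover have "sub (kf (Suc n) 1) (sg (fac (Suc n) 0 ?g))=0"
 proof -
  have "sub (kf (Suc n) 1) (sg (fac (Suc n) 0 f)) =
    sub (%l. if l=0 then kf (Suc n) 1 1 else if l <= n then Some (Suc l) else None) (fac (Suc n) 1 f)" for f :: "'a pol"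
   unfolding sub_sub by(rule sub_cong) (auto simp: kf_def tf_def Let_def)
  thus ?thesis using fac_pr[of 1 "Suc n" "bs M"] by(simp add: sub_simps)
 qed
 ultimately show ?case using Suc.IH[OF 6] unfolding bd_sg[OF U_bs[OF 6]] pr_simps pr_sg by(simp add: sub_simps)
qed (use Suc.prems in "auto intro!: lin simp: pr_V bd_V sub_V tf_def")
qed

lemma fac_pr_bd: "U (Suc n) f ==> fac (Suc n) 0 (pr (Suc n) f)=pr n (bd n f)"
by(rule linmap_eq_on[of "%f. fac (Suc n) 0 (pr (Suc n) f)"]) (auto intro!: lin fac_pr_bd_basis simp: U_def)

definition moore :: "nat => 'x pol => bool" where
"moore n f \<longleftrightarrow> (\<forall>j. 1 <= j & j <= n --> fac n j f=0)"

lemma moore_bd: "moore (Suc n) f ==> bd n f=fac (Suc n) 0 f"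
unfolding bd_def moore_def by(subst sum.atMost_Suc_shift) (auto simp: sub_simps)

lemma moore_pr: "moore n (pr n f)" by(simp add: moore_def fac_pr)

text \<open>Both composites of the comparison maps are homotopic to the identity, and the projection onto the
  Moore complex turns the bounding chain obtained from this into one of that complex.\<close>

theorem moore_boundary:
assumes f: "f:pl p Q (Suc n)" "moore (Suc n) f" "fac (Suc n) 0 f=0"
 and y: "y:kl p Q (Suc (Suc n))" "ph (Suc n) f=kd y"
obtains g where "g:pl p Q (Suc (Suc n))" "moore (Suc (Suc n)) g" "fac (Suc (Suc n)) 0 g=f"
proof
let ?h = "ps (Suc (Suc n)) y + hm (Suc n) f"
have h: "?h:pl p Q (Suc (Suc n))" using ps_pl[OF y(1)] hm_pl[OF f(1)] unfolding pl_def by(rule lat_add)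
show "pr (Suc (Suc n)) ?h:pl p Q (Suc (Suc n))" by(intro pr_pl h)
show "moore (Suc (Suc n)) (pr (Suc (Suc n)) ?h)" by(rule moore_pr)
have "bd (Suc n) ?h=ps (Suc n) (ph (Suc n) f) + bd (Suc n) (hm (Suc n) f)"
 using bd_ps[OF y(1)] y(2) by(simp add: bd_simps)
also have "... = f" using hm_homotopy[OF U_pl[OF f(1)]] moore_bd[OF f(2)] f(3) by(simp add: hm_simps)
finally show "fac (Suc (Suc n)) 0 (pr (Suc (Suc n)) ?h)=f"
 using fac_pr_bd[OF U_pl[OF h]] pr_moore[of "Suc n" f] f(2) by(simp add: moore_def)
qed

section \<open>The divided power lattice and the Cartan homotopy\<close>

definition mfact :: "'x multiset => rat" where
"mfact u=(\<Prod>x\<in>set_mset u. fact (count u x))"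

lemma mfact_pos [simp]: "mfact u > 0" by(auto simp: mfact_def intro!: prod_pos)

lemma mfact_nz [simp]: "mfact u ~= 0" by(metis mfact_pos less_irrefl)

lemma mfact_empty [simp]: "mfact {#} = 1" by(simp add: mfact_def)

lemma mfact_add: "mfact (add_mset x u) = of_nat (Suc (count u x)) * mfact u"
proof -
have "mfact (add_mset x u)=fact (Suc (count u x)) * (\<Prod>y\<in>set_mset u - {x}. fact (count u y))"
 unfolding mfact_def set_mset_add_mset_insert
 by(subst prod.insert_remove) (auto intro!: prod.cong split: if_splits)
moreover have "mfact u=fact (count u x) * (\<Prod>y\<in>set_mset u - {x}. fact (count u y))" unfolding mfact_def
 by(cases "x \<in># u") (auto simp: prod.remove not_in_iff)
ultimately show ?thesis by(simp add: algebra_simps)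
qed

lemma mfact_mset:
"distinct I ==> mfact (v + mset I)=mfact v * (\<Prod>x\<in>set I. of_nat (count (v + mset I) x))"
proof (induction I)
case (Cons x I)
have "(\<Prod>y\<in>set I. of_nat (count (v + mset (x#I)) y))=(\<Prod>y\<in>set I. of_nat (count (v + mset I) y) :: rat)"
 using Cons.prems by(intro prod.cong) auto
thus ?case using Cons by(simp add: mfact_add algebra_simps)
qed simp

definition gl :: "('x::linorder multiset => bool) => nat => 'x kos set" where
"gl Q n=lat (%(I, u). if srt I & length I=n & Q (mset I + u) then 1 / mfact u else 0)"

lemma gl_linmap:
assumes "linmap F" "z:gl Q n"
 "!!I u. srt I ==> length I=n ==> Q (mset I + u) ==> sc (1 / mfact u) (F (bs (I, u))):lat c"
shows "F z:lat c" using assms(2) unfolding gl_def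
by(rule lat_linmap[OF assms(1)]) (use assms(3) in "auto split: if_splits prod.splits")

lemma gl_keys: "z:gl Q n ==> (I, u):keys z ==> srt I & length I=n & Q (mset I + u)"
unfolding gl_def by(drule (1) lat_keys) (auto split: if_splits)

lemma gl_mono: "z:gl Q n ==> (!!w. Q w ==> Q' w) ==> z:gl Q' n"
unfolding gl_def by(rule lat_coarser) (auto split: if_splits intro!: exI[of _ 1])

lemma kl_mono: "z:kl p Q n ==> (!!w. Q w ==> Q' w) ==> z:kl p Q' n"
unfolding kl_def by(rule lat_coarser) (auto split: if_splits intro!: exI[of _ 1])

lemma gl_0 [simp]: "0:gl Q n"
and gl_add: "a:gl Q n ==> b:gl Q n ==> a + b:gl Q n"
and gl_diff: "a:gl Q n ==> b:gl Q n ==> a - b:gl Q n"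
and gl_uminus: "a:gl Q n ==> - a:gl Q n"
and gl_sum: "(!!j. j:J ==> f j:gl Q n) ==> sum f J:gl Q n"
and gl_sc: "a:gl Q n ==> sc (of_int k) a:gl Q n"
by(auto simp: gl_def intro: lat_add lat_diff lat_uminus lat_sum lat_sc_int)

lemma kl_0 [simp]: "0:kl p Q n"
and kl_add: "a:kl p Q n ==> b:kl p Q n ==> a + b:kl p Q n"
and kl_diff: "a:kl p Q n ==> b:kl p Q n ==> a - b:kl p Q n"
and kl_uminus: "a:kl p Q n ==> - a:kl p Q n"
and kl_sum: "(!!j. j:J ==> f j:kl p Q n) ==> sum f J:kl p Q n"
and kl_sc: "a:kl p Q n ==> sc (of_int k) a:kl p Q n"
by(auto simp: kl_def intro: lat_add lat_diff lat_uminus lat_sum lat_sc_int)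

lemma gl_basis: "srt I ==> length I=n ==> Q (mset I + u) ==> c = of_int k / mfact u ==> sc c (bs (I, u)):gl Q n"
unfolding gl_def by(auto simp: lat_bs_iff)

lemma hl_size1:
assumes "z:hl n w" "size w=Suc n" "Q (w + u)"
shows "sc (1 / mfact u) (Mo u z):gl Q n" unfolding gl_def
proof (rule hl_linmap[where F = "%z. sc (1 / mfact u) (Mo u z)", OF _ assms(1)], goal_cases)
case (2 I v)
have "size (mset I + v)=Suc n" using 2(3) assms(2) by simp
hence "size v=1" using 2(2) by simp
then obtain y where v: "v = {#y#}" using size_1_singleton_mset by blast
have "sc (1 / mfact u) (bs (I, add_mset y u)):gl Q n"
 using 2 assms(3) by(intro gl_basis[where k = "int (Suc (count u y))"]) (auto simp: mfact_add v simp del: of_nat_Suc)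
thus ?case by(simp add: gl_def v)
qed (intro lin)

lemma hl_size0:
assumes "z:hl n w" "size w=n" "Q (w + u)"
shows "sc (1 / mfact u) (Mo u z):gl Q n" unfolding gl_def
proof (rule hl_linmap[where F = "%z. sc (1 / mfact u) (Mo u z)", OF _ assms(1)], goal_cases)
case (2 I v)
have "size (mset I + v)=n" using 2(3) assms(2) by simp
hence v: "v = {#}" using 2(2) by simp
show ?case using 2 assms(3) gl_basis[of I n Q u _ 1] by(auto simp: gl_def v)
qed (intro lin)

lemma kd_gl: "z:gl Q (Suc n) ==> kd z:gl Q n" unfolding gl_def[of Q n]
proof (rule gl_linmap[OF linmap_kd0], assumption, goal_cases)
case (1 I u)
thus ?case using hl_size1[OF dl_hl[of I n], of Q u] by(simp add: gl_def)
qed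

lemma Ei_gl:
assumes "z:gl Q n" "!!w. Q w ==> Q' (add_mset x w)" shows "Ei x z:gl Q' (Suc n)" unfolding gl_def
proof (rule gl_linmap[OF linmap_Ei0 assms(1)], goal_cases)
case (1 I u)
thus ?case using hl_size0[OF il_hl[of I n x], of Q' u] assms(2) by(simp add: gl_def)
qed

lemma gl_ssrt: "z:gl Q n ==> ssrt z" by(auto simp: ssrt_def dest: gl_keys)

definition pd :: "'x => 'x kos => 'x kos" where
"pd x=lext (%(I, u). sc (of_nat (count u x)) (bs (I, u - {#x#})))"

lemma linmap_pd [lin]: "linmap F ==> linmap (%z. pd x (F z))" unfolding pd_def by(auto intro: lin)

lemmas linmap_pd0=linmap_pd[OF linmap_id]
lemmas pd_simps=linmap_simps[OF linmap_pd0]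

lemma pd_bs [simp]: "pd x (bs (I, u))=sc (of_nat (count u x)) (bs (I, u - {#x#}))" by(simp add: pd_def)

lemma pd_cns: "pd x (cns y z)=cns y (pd x z)"
by(rule linmap_eqI[of "%z. pd x (cns y z)"]) (auto intro!: lin simp: cns_simps)

lemma pd_Mo: "pd x (Mo u z)=Mo u (pd x z) + sc (of_nat (count u x)) (Mo (u - {#x#}) z)"
proof (rule linmap_eqI[of "%z. pd x (Mo u z)"])
fix y :: "'a list \<times> 'a multiset"
obtain I v where y: "y=(I, v)" by fastforce
have 1: "sc (of_nat (count v x)) (bs (I, v + u - {#x#}))=sc (of_nat (count v x)) (bs (I, v - {#x#} + u))"
 by(cases "x \<in># v") (auto simp: not_in_iff)
have 2: "sc (of_nat (count u x)) (bs (I, v + u - {#x#}))=sc (of_nat (count u x)) (bs (I, v + (u - {#x#})))"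
 by(cases "x \<in># u") (auto simp: not_in_iff)
show "pd x (Mo u (bs y))=Mo u (pd x (bs y)) + sc (of_nat (count u x)) (Mo (u - {#x#}) (bs y))"
 by(simp add: y Mo_simps sc_add_left 1 2)
qed (intro lin)+

lemma pd_dl_notin: "x ~: set I ==> pd x (dl I)=0" by(induction I) (auto simp: pd_simps pd_cns cns_simps)

lemma Ei_pd_dl: "srt I ==> Ei x (pd x (dl I))=(if x:set I then bs (I, {#}) else 0)"
proof (induction I)
case (Cons y I)
consider "x < y" | "x=y" | "y < x" by force
thus ?case
proof cases
 case 1
 hence "x ~: set (y#I)" using Cons.prems by force
 thus ?thesis using pd_dl_notin[of x "y#I"] by(simp add: Ei_simps del: dl.simps)
next
 case 2
 thus ?thesis using Cons.prems by(simp add: pd_simps pd_cns Ei_simps Ei_cns il_less)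
next
 case 3
 hence "\<not> x < y" "x ~= y" by auto
 thus ?thesis using Cons by(auto simp: pd_simps pd_cns Ei_simps Ei_cns cns_simps)
qed
qed (auto simp: pd_simps Ei_simps)

text \<open>The Cartan formula: \<open>e\<^sub>x \<partial>\<^sub>x\<close> is a homotopy between zero and the degree in \<open>x\<close>.\<close>

lemma cartan_basis:
assumes "srt I"
shows "kd (Ei x (pd x (bs (I, u)))) + Ei x (pd x (kd (bs (I, u))))=sc (of_nat (count (mset I + u) x)) (bs (I, u))"
proof -
have "ssrt (pd x (bs (I, u)))" using assms by(auto simp: ssrt_def keys_sc split: if_splits)
hence "kd (Ei x (pd x (bs (I, u))))=Mo {#x#} (pd x (bs (I, u))) - Ei x (kd (pd x (bs (I, u))))"
 using kd_Ei[of "pd x (bs (I, u))" x] by(simp add: algebra_simps)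
moreover have "Mo {#x#} (pd x (bs (I, u)))=sc (of_nat (count u x)) (bs (I, u))"
 by(cases "x \<in># u") (auto simp: Mo_simps not_in_iff)
moreover have "Ei x (pd x (kd (bs (I, u))))=Mo u (if x:set I then bs (I, {#}) else 0) + Ei x (kd (pd x (bs (I, u))))"
 by(simp add: pd_Mo Ei_simps Ei_Mo Ei_pd_dl[OF assms] kd_simps)
ultimately have "kd (Ei x (pd x (bs (I, u)))) + Ei x (pd x (kd (bs (I, u)))) =
  sc (of_nat (count u x)) (bs (I, u)) + Mo u (if x:set I then bs (I, {#}) else 0)" by simp
also have "... = sc (of_nat (count u x)) (bs (I, u)) + sc (of_nat (count (mset I) x)) (bs (I, u))"
 using strict_sorted_imp_sorted assms distinct_count_atmost_1[of I]
 by(auto simp: Mo_simps strict_sorted_iff count_mset_0_iff)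
finally show ?thesis by(simp add: sc_add_left add.commute)
qed

lemma Ei_pd_gl:
assumes "z:gl Q n" shows "Ei x (pd x z):gl Q (Suc n)" unfolding gl_def
proof (rule gl_linmap[where F = "%z. Ei x (pd x z)", OF _ assms], goal_cases)
case (2 I u)
show ?case
proof (cases "x \<in># u")
 case True
 then obtain v where v: "u=add_mset x v" by(metis mset_add)
 have "sc (1 / mfact u) (pd x (bs (I, u)))=sc (1 / mfact v) (bs (I, v))" by(simp add: v mfact_add)
 also have "... : gl (%w. w=mset I + v) n" using 2 by(intro gl_basis[where k=1]) auto
 finally have "Ei x (sc (1 / mfact u) (pd x (bs (I, u)))):gl Q (Suc n)"
  using 2(3) v by(intro Ei_gl[where Q = "%w. w=mset I + v"]) simp_all
 thus ?thesis by(simp add: Ei_simps gl_def)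
qed (simp add: not_in_iff Ei_simps)
qed (intro lin)

definition mgcd :: "'x multiset => nat" where
"mgcd w=Gcd (count w ` set_mset w)"

lemma bezout_finite:
fixes f :: "'x => nat"
assumes "finite T" shows "\<exists>c::'x => int. (\<Sum>x\<in>T. c x * int (f x))=int (Gcd (f ` T))" using assms
proof (induction T)
case (insert x T)
then obtain c :: "'x => int" where c: "(\<Sum>x\<in>T. c x * int (f x))=int (Gcd (f ` T))" by blast
obtain a b where ab: "a * int (f x) + b * int (Gcd (f ` T))=gcd (int (f x)) (int (Gcd (f ` T)))"
 using bezout_int[of "int (f x)" "int (Gcd (f ` T))"] by blast
let ?c = "%y. if y=x then a else b * c y"
have "(\<Sum>y\<in>T. ?c y * int (f y))=(\<Sum>y\<in>T. b * (c y * int (f y)))"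
 using insert by(intro sum.cong) auto
hence "(\<Sum>y\<in>insert x T. ?c y * int (f y))=a * int (f x) + b * (\<Sum>x\<in>T. c x * int (f x))"
 using insert by(simp add: sum_distrib_left)
also have "... = int (Gcd (f ` insert x T))" using c ab by(simp add: gcd_int_int_eq)
finally show ?case by(rule exI[of _ ?c])
qed simp

lemma gl_cycle_multidegree:
assumes z: "z:gl Q n" "kd z=0"
obtains y where "y:gl (%v. v=w & Q v) (Suc n)" "sc (of_nat (mgcd w)) (res (%v. v=w) z)=kd y"
proof -
obtain c :: "'a => int" where c: "(\<Sum>x\<in>set_mset w. c x * int (count w x))=int (mgcd w)"
 using bezout_finite[of "set_mset w" "count w"] by(auto simp: mgcd_def)
define h where "h=(%z. \<Sum>x\<in>set_mset w. sc (of_int (c x)) (Ei x (pd x z)))"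
let ?z = "res (%v. v=w) z"
have z': "?z:gl (%v. v=w & Q v) n"
 using res_lat[of z _ "%v. v=w"] z(1) keys_res[of _ "%v. v=w" z] unfolding gl_def
 by - (rule lat_coarser, auto split: if_splits intro!: exI[of _ 1])
have "kd (h z') + h (kd z')=sc (of_nat (mgcd w)) z'" if "z'=?z" for z'
proof (rule linmap_eq_on[of "%z. kd (h z) + h (kd z)"])
 fix y assume y: "y:keys z'"
 obtain I u where Iu: "y=(I, u)" by fastforce
 with y that have w: "mset I + u=w" and I: "srt I" using gl_keys[OF z(1)] by(auto simp: keys_res)
 have "kd (h (bs y)) + h (kd (bs y))=(\<Sum>x\<in>set_mset w. sc (of_int (c x))
   (kd (Ei x (pd x (bs (I, u)))) + Ei x (pd x (kd (bs (I, u))))))"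
  by(simp add: h_def Iu kd_simps sc_add sum.distrib del: kd_bs pd_bs)
 also have "... = (\<Sum>x\<in>set_mset w. sc (of_int (c x * int (count w x))) (bs (I, u)))"
  by(simp only: cartan_basis[OF I] w sc_simps) simp
 also have "... = sc (of_int (\<Sum>x\<in>set_mset w. c x * int (count w x))) (bs (I, u))"
  by(auto intro!: pm_eqI simp: lookup_sum lookup_single sum_distrib_right)
 finally show "kd (h (bs y)) + h (kd (bs y))=sc (of_nat (mgcd w)) (bs y)" by(simp add: c Iu)
qed (auto intro!: lin simp: h_def)
moreover have "kd ?z=0" by(simp add: kd_res z(2) res_simps)
moreover have "h 0=0" by(simp add: h_def pd_simps Ei_simps)
ultimately have "sc (of_nat (mgcd w)) ?z=kd (h ?z)" by simp
moreover have "h ?z:gl (%v. v=w & Q v) (Suc n)" unfolding h_def by(intro gl_sum gl_sc Ei_pd_gl z')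
ultimately show ?thesis using that by blast
qed

lemma res_sum: "z=(\<Sum>w\<in>wt ` keys z. res (%v. v=w) z)"
proof (rule pm_eqI)
fix y
have "lookup (\<Sum>w\<in>wt ` keys z. res (%v. v=w) z) y =
  (\<Sum>w\<in>wt ` keys z. if wt y=w then lookup z y else 0)" by(simp add: lookup_sum lookup_res)
also have "... = lookup z y" by(auto simp: in_keys_iff)
finally show "lookup z y=lookup (\<Sum>w\<in>wt ` keys z. res (%v. v=w) z) y" by simp
qed

lemma mgcd_repeat: "\<exists>w'. w=repeat_mset (mgcd w) w'"
proof (cases "w = {#}")
case False
have "mgcd w dvd count w x" for x by(cases "x \<in># w") (auto simp: mgcd_def not_in_iff)
hence e: "mgcd w * (count w x div mgcd w)=count w x" for x by simp
moreover have "finite {x. 0 < count w x div mgcd w}"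
 by(rule finite_subset[of _ "set_mset w"]) (auto simp: not_in_iff div_greater_zero_iff intro: ccontr)
ultimately have "w=repeat_mset (mgcd w) (Abs_multiset (%x. count w x div mgcd w))" by(intro multiset_eqI) simp
thus ?thesis by blast
qed (auto intro!: exI[of _ "{#}"])

lemma mgcd_card: "mgcd w * card (set_mset w) <= size w"
proof -
have "mgcd w * card (set_mset w)=(\<Sum>x\<in>set_mset w. mgcd w)" by simp
also have "... <= (\<Sum>x\<in>set_mset w. count w x)" by(intro sum_mono dvd_imp_le) (auto simp: mgcd_def)
finally show ?thesis by(simp add: size_multiset_overloaded_eq)
qed

lemma mgcd_pos: "w ~= {#} ==> mgcd w > 0"
proof (rule gr0I)
assume "w ~= {#}" "mgcd w=0"
moreover from this(1) obtain x where "x \<in># w" by(rule multiset_nonemptyE)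
ultimately have "x \<in># w" "count w x=0" unfolding mgcd_def Gcd_0_iff by blast+
thus False by(metis count_eq_zero_iff)
qed

lemma mgcd_dvd: "mgcd w dvd size w"
proof -
obtain w' where "w=repeat_mset (mgcd w) w'" using mgcd_repeat by blast
hence "size w=mgcd w * size w'" by(metis size_repeat_mset)
thus ?thesis by simp
qed

text \<open>In total degree at most \<open>7\<close> a multidegree with at least two variables has gcd at most \<open>3\<close>,
  so that a cycle of positive degree is, up to a boundary, a sum of \<open>1/p\<close>-fold boundaries with \<open>p\<close>
  prime.\<close>

lemma gl_cycle:
assumes z: "z:gl Q n" "kd z=0" and n: "n > 0" and Q: "!!w. Q w ==> size w=N" and N: "0 < N" "N <= 7"
obtains y0 Y where "y0:gl Q (Suc n)"
 "!!p. Y p:gl (%w. Q w & (\<exists>w'. w=repeat_mset p w')) (Suc n)"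
 "z=kd y0 + (\<Sum>p\<in>{p. prime p & p dvd N}. sc (1 / of_nat p) (kd (Y p)))"
proof -
let ?P = "{p. prime p & p dvd N}"
have "\<forall>w. \<exists>y. y:gl (%v. v=w & Q v) (Suc n) & sc (of_nat (mgcd w)) (res (%v. v=w) z)=kd y"
 using gl_cycle_multidegree[OF z] by metis
then obtain y where y: "!!w. y w:gl (%v. v=w & Q v) (Suc n)"
 and zy: "!!w. sc (of_nat (mgcd w)) (res (%v. v=w) z)=kd (y w)" by metis
define W where "W=wt ` keys z"
have W: "finite W" "!!w. w:W ==> Q w" "!!w. w:W ==> w ~= {#}" using gl_keys[OF z(1)] n by(force simp: W_def)+
have g: "mgcd w=1 | mgcd w:?P" if w: "w:W" "y w ~= 0" for w
proof -
 from w(2) have "keys (y w) ~= {}" by simp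
 then obtain I u where "(I, u):keys (y w)" by(metis ex_in_conv surj_pair)
 hence I: "srt I" "length I=Suc n" "mset I + u=w" "Q w" using gl_keys[OF y[of w]] by auto
 hence "Suc n=card (set I)" using distinct_card[of I] by(simp add: strict_sorted_iff)
 also have "... <= card (set_mset w)" using I by(intro card_mono) auto
 finally have "mgcd w * 2 <= mgcd w * card (set_mset w)" using n by simp
 also have "... <= 7" using mgcd_card[of w] Q[OF I(4)] N by simp
 finally have "mgcd w : {1, 2, 3}" using mgcd_pos[OF W(3)[OF w(1)]] by auto
 moreover have "mgcd w dvd N" using mgcd_dvd[of w] Q[OF I(4)] by simp
 ultimately show ?thesis by auto
qed
have fP: "finite ?P" using N by simp
define y0 where "y0=(\<Sum>w | w:W & mgcd w=1. y w)"
define Y where "Y=(%p. \<Sum>w | w:W & mgcd w=p. y w)"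
have r: "res (%v. v=w) z=sc (1 / of_nat (mgcd w)) (kd (y w))" if "w:W" for w
 using mgcd_pos[OF W(3)[OF that]] by(simp flip: zy)
have z_eq: "z=(\<Sum>w\<in>W. sc (1 / of_nat (mgcd w)) (kd (y w)))"
 by(subst res_sum, fold W_def) (intro sum.cong refl r)
also have "... = (\<Sum>w\<in>(\<Union>p\<in>insert 1 ?P. {w. w:W & mgcd w=p}). sc (1 / of_nat (mgcd w)) (kd (y w)))"
proof (rule sum.mono_neutral_right)
 show "\<forall>w\<in>W - (\<Union>p\<in>insert 1 ?P. {w:W. mgcd w=p}). sc (1 / of_nat (mgcd w)) (kd (y w))=0"
 proof
  fix w assume "w:W - (\<Union>p\<in>insert 1 ?P. {w:W. mgcd w=p})"
  hence "y w=0" using g[of w] by blast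
  thus "sc (1 / of_nat (mgcd w)) (kd (y w))=0" by(simp add: kd_simps(3))
 qed
qed (use W in auto)
also have "... = (\<Sum>p\<in>insert 1 ?P. \<Sum>w\<in>{w. w:W & mgcd w=p}. sc (1 / of_nat (mgcd w)) (kd (y w)))"
proof (rule sum.UNION_disjoint, goal_cases)
 case 1
 show ?case using fP by(rule finite.insertI)
next
 case 2
 show ?case by(intro ballI finite_subset[OF _ W(1)]) blast
next
 case 3
 show ?case by blast
qed
also have "... = (\<Sum>p\<in>insert 1 ?P. sc (1 / of_nat p) (kd (Y p)))"
 by(intro sum.cong refl) (simp add: Y_def kd_simps sc_sum)
also have "... = kd y0 + (\<Sum>p\<in>?P. sc (1 / of_nat p) (kd (Y p)))"
 by(subst sum.insert[OF fP]) (simp_all add: y0_def Y_def)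
finally have "z=kd y0 + (\<Sum>p\<in>?P. sc (1 / of_nat p) (kd (Y p)))" .
moreover have "y0:gl Q (Suc n)" unfolding y0_def by(intro gl_sum gl_mono[OF y]) auto
moreover have "Y p:gl (%w. Q w & (\<exists>w'. w=repeat_mset p w')) (Suc n)" for p
 unfolding Y_def using mgcd_repeat by(intro gl_sum gl_mono[OF y]) auto
ultimately show ?thesis using that by blast
qed

subsection \<open>Rescaling multidegrees\<close>

text \<open>The map from the multidegree \<open>w\<close> part of the symmetric power complex to the multidegree \<open>p w\<close>
  part of the divided power complex is, up to the scalar \<open>kap p w\<close>, multiplication by \<open>x\<^bsup>(p-1)w\<^esup>\<close>
  and therefore commutes with the differential.\<close>

definition kap :: "nat => 'x multiset => rat" where
"kap p w=(\<Prod>x\<in>set_mset w. of_nat (count w x)) / mfact (repeat_mset p w)"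

definition chi :: "nat => ('x multiset => bool) => 'x kos => 'x kos" where
"chi p G=lext (%(I, u). if G (mset I + u)
  then sc (kap p (mset I + u)) (bs (I, u + repeat_mset (p - 1) (mset I + u))) else 0)"

lemma linmap_chi [lin]: "linmap F ==> linmap (%z. chi p G (F z))" unfolding chi_def by(auto intro: lin)

lemmas linmap_chi0=linmap_chi[OF linmap_id]
lemmas chi_simps=linmap_simps[OF linmap_chi0]

lemma chi_bs: "chi p G (bs (I, u))=(if G (mset I + u)
  then sc (kap p (mset I + u)) (bs (I, u + repeat_mset (p - 1) (mset I + u))) else 0)" by(simp add: chi_def)

lemma chi_wt:
"(!!y. y:keys z ==> wt y=w) ==>
 chi p G z=(if G w then sc (kap p w) (Mo (repeat_mset (p - 1) w) z) else 0)"
by(rule linmap_eq_on[of "chi p G"]) (auto intro!: lin simp: chi_def wt_def)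

lemma chi_kd: "chi p G (kd z)=kd (chi p G z)"
proof (rule linmap_eqI[of "%z. chi p G (kd z)"])
fix y :: "'a list \<times> 'a multiset"
obtain I u where y: "y=(I, u)" by fastforce
have "wt k=mset I + u" if "k:keys (kd (bs y))" for k using that by(auto simp: y Mo_def dest!: keys_lext dl_wt)
hence "chi p G (kd (bs y))=(if G (mset I + u) then sc (kap p (mset I + u)) (Mo (repeat_mset (p - 1) (mset I + u)) (kd (bs y))) else 0)"
 by(rule chi_wt)
thus "chi p G (kd (bs y))=kd (chi p G (bs y))" by(auto simp: y chi_def kd_simps Mo_Mo add.commute)
qed (intro lin)+

lemma repeat_Suc_mset: "p > 0 ==> repeat_mset p w=w + repeat_mset (p - 1) w" by(cases p) auto

lemma kap_coeff:
assumes "distinct I" "p > 0"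
shows "of_nat p ^ length I * kap p (mset I + u) =
 (\<Prod>x\<in>set_mset (mset I + u) - set I. of_nat (count (mset I + u) x)) / mfact (u + repeat_mset (p - 1) (mset I + u))"
proof -
let ?w = "mset I + u" and ?v = "u + repeat_mset (p - 1) (mset I + u)"
have v: "repeat_mset p ?w=?v + mset I" unfolding repeat_Suc_mset[OF assms(2)] by simp
have "mfact (repeat_mset p ?w)=mfact ?v * (\<Prod>x\<in>set I. of_nat (count (repeat_mset p ?w) x))"
 unfolding v by(rule mfact_mset[OF assms(1)])
also have "(\<Prod>x\<in>set I. of_nat (count (repeat_mset p ?w) x)) = of_nat p ^ length I * (\<Prod>x\<in>set I. of_nat (count ?w x) :: rat)"
 by(simp only: count_repeat_mset of_nat_mult prod.distrib prod_constant distinct_card[OF assms(1)])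
finally have 1: "mfact (repeat_mset p ?w)=mfact ?v * (of_nat p ^ length I * (\<Prod>x\<in>set I. of_nat (count ?w x)))" .
have 2: "(\<Prod>x\<in>set_mset ?w. of_nat (count ?w x))=(\<Prod>x\<in>set_mset ?w - set I. of_nat (count ?w x)) * (\<Prod>x\<in>set I. of_nat (count ?w x) :: rat)"
 by(rule prod.subset_diff) auto
have nz: "(\<Prod>x\<in>set I. of_nat (count ?w x) :: rat) ~= 0"
 by(auto simp: prod_zero_iff simp flip: of_nat_add)
show ?thesis unfolding kap_def 1 2 using nz assms(2) by(simp add: field_simps)
qed

lemma srt_distinct: "srt I ==> distinct I" by(simp add: strict_sorted_iff)

locale rescale =
fixes p :: nat and pp :: "'x::linorder => int" and G Q Q' :: "'x multiset => bool"
assumes p: "p > 0" and G_def: "!!w. G w \<longleftrightarrow> (\<forall>x\<in>#w. pp x=int p)"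
 and Q': "!!w. Q w ==> G w ==> Q' (repeat_mset p w)"
begin

lemma G_prod: "G w ==> mset I <=# w ==> prod_mset (image_mset pp (mset I))=int p ^ length I"
proof (induction I)
case (Cons x I)
have "x \<in># w" "mset I <=# w - {#x#}" using insert_subset_eq_iff[of x "mset I" w] Cons.prems(2) by auto
moreover from this(2) have "mset I <=# w" using diff_subset_eq_self subset_mset.trans by blast
ultimately show ?case using Cons G_def[of w] by auto
qed simp

lemma chi_gl:
assumes "z:kl pp Q n" shows "chi p G z:gl Q' n" unfolding gl_def
proof (rule kl_linmap[OF linmap_chi0 assms], goal_cases)
case (1 I u)
show ?case
proof (cases "G (mset I + u)")
 case True
 have "sc (of_nat p ^ length I * kap p (mset I + u)) (bs (I, u + repeat_mset (p - 1) (mset I + u))):gl Q' n"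
  using 1 Q'[OF 1(3) True] kap_coeff[OF srt_distinct[OF 1(1)] p, of u] repeat_Suc_mset[OF p, of "mset I + u"]
  by(intro gl_basis[where k = "\<Prod>x\<in>set_mset (mset I + u) - set I. int (count (mset I + u) x)"])
    (simp_all add: ac_simps)
 thus ?thesis using True G_prod[OF True, of I] by(simp add: chi_def gl_def)
qed (simp add: chi_def)
qed

lemma chi_surj:
assumes y: "y:gl (%v. \<exists>w. v=repeat_mset p w & Q w & G w) n"
 and c: "!!w I. Q w ==> distinct I ==> length I=n ==> mset I <=# w ==> \<forall>x\<in>set_mset w - set I. count w x=1"
obtains z where "z:kl pp (%w. Q w & G w) n" "chi p G z=y"
proof -
let ?c = "%(I, u). if srt I & length I=n & (\<exists>w. mset I + u=repeat_mset p w & Q w & G w) then 1 / mfact u else (0::rat)"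
obtain k :: "_ => int" where k: "y=(\<Sum>j\<in>keys y. sc (of_int (k j)) (sc (?c j) (bs j)))"
 using lat_decomp[OF y[unfolded gl_def]] .
have "\<exists>z. z:kl pp (%w. Q w & G w) n & chi p G z=sc (?c j) (bs j)" if j: "j:keys y" for j
proof -
 obtain I v where Iv: "j=(I, v)" by fastforce
 obtain w where w: "srt I" "length I=n" "mset I + v=repeat_mset p w" "Q w" "G w"
  using gl_keys[OF y j[unfolded Iv]] by blast
 have sub: "mset I <=# w"
 proof (rule mset_subset_eqI)
  fix x
  have c1: "count (mset I) x <= 1" using srt_distinct[OF w(1)] by(simp add: distinct_count_atmost_1)
  have c2: "count w x >= 1" if "x:set I"
  proof -
   have "x \<in># repeat_mset p w" using that by(simp flip: w(3))
   hence "p * count w x > 0" by(metis count_repeat_mset count_greater_zero_iff)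
   thus ?thesis by(cases "count w x") auto
  qed
  show "count (mset I) x <= count w x"
  proof (cases "x:set I")
   case True
   thus ?thesis using c1 c2 by linarith
  qed (simp add: count_mset_0_iff[THEN iffD2])
 qed
 then obtain u where u: "w=mset I + u" by(metis subset_mset.le_iff_add)
 have v: "v=u + repeat_mset (p - 1) w"
 proof -
  have "mset I + v=mset I + (u + repeat_mset (p - 1) w)"
   using w(3) repeat_Suc_mset[OF p, of w] u by(simp add: add.assoc)
  thus ?thesis by simp
 qed
 have "(\<Prod>x\<in>set_mset w - set I. of_nat (count w x) :: rat)=(\<Prod>x\<in>set_mset w - set I. 1)"
  using c[OF w(4) srt_distinct[OF w(1)] w(2) sub] by(intro prod.cong refl) simp
 hence "of_nat p ^ n * kap p w=1 / mfact v"
  using kap_coeff[OF srt_distinct[OF w(1)] p, of u] w(2) unfolding u[symmetric] v[symmetric] by simp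
 moreover have "chi p G (bs (I, u))=sc (kap p w) (bs (I, v))"
  using w(5) unfolding chi_bs u[symmetric] v[symmetric] by simp
 moreover have "?c j=1 / mfact v" using w by(auto simp: Iv)
 ultimately have "chi p G (sc (of_nat p ^ n) (bs (I, u)))=sc (?c j) (bs j)" by(simp only: chi_simps sc_simps Iv)
 moreover have "sc (of_nat p ^ n) (bs (I, u)):kl pp (%w. Q w & G w) n"
  using w G_prod[OF w(5) sub] unfolding kl_def u by(auto simp: lat_bs_iff intro!: exI[of _ 1])
 ultimately show ?thesis by blast
qed
hence "\<forall>j\<in>keys y. \<exists>z. z:kl pp (%w. Q w & G w) n & chi p G z=sc (?c j) (bs j)" by blast
from bchoice[OF this] obtain f where "\<forall>j\<in>keys y. f j:kl pp (%w. Q w & G w) n & chi p G (f j)=sc (?c j) (bs j)" ..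
hence f: "!!j. j:keys y ==> f j:kl pp (%w. Q w & G w) n"
  "!!j. j:keys y ==> chi p G (f j)=sc (?c j) (bs j)" by blast+
have "chi p G (\<Sum>j\<in>keys y. sc (of_int (k j)) (f j))=y"
 by(subst k) (simp add: chi_simps f(2) cong: sum.cong)
moreover have "(\<Sum>j\<in>keys y. sc (of_int (k j)) (f j)):kl pp (%w. Q w & G w) n"
 by(intro kl_sum kl_sc f(1))
ultimately show ?thesis using that by blast
qed

lemma kap_nz: "kap p w ~= 0" by(auto simp: kap_def prod_zero_iff)

lemma chi_inj:
assumes "chi p G z=0" "!!y. y:keys z ==> G (wt y)"
shows "z=0"
proof -
define ci :: "'x kos => 'x kos" where "ci=lext (%(J, v). let w=(THE w. repeat_mset p w=mset J + v) in
  sc (1 / kap p w) (bs (J, w - mset J)))"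
have "ci (chi p G z)=z"
proof (rule linmap_eq_on[of "%z. ci (chi p G z)" "%z. z"])
 fix y assume "y:keys z"
 obtain I u where y: "y=(I, u)" by fastforce
 hence G: "G (mset I + u)" using assms(2)[OF \<open>y:_\<close>] by simp
 let ?w = "mset I + u"
 have r: "mset I + (u + repeat_mset (p - 1) ?w)=repeat_mset p ?w"
  unfolding repeat_Suc_mset[OF p] by(simp add: add.assoc)
 have "(THE w. repeat_mset p w=repeat_mset p ?w)=?w"
 proof (rule the_equality)
  fix w assume "repeat_mset p w=repeat_mset p ?w"
  hence "p * count w x=p * count ?w x" for x by(metis count_repeat_mset)
  thus "w=?w" using p by(intro multiset_eqI) simp
 qed simp
 hence "(THE w. repeat_mset p w=mset I + (u + repeat_mset (p - 1) ?w))=?w" unfolding r .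
 hence "ci (bs (I, u + repeat_mset (p - 1) ?w))=sc (1 / kap p ?w) (bs (I, u))" by(simp add: ci_def)
 thus "ci (chi p G (bs y))=bs y" using G kap_nz[of ?w] by(simp add: y chi_def ci_def linmap_sc[OF linmap_lext])
qed (auto simp: ci_def intro!: lin)
thus ?thesis using assms(1) by(simp add: ci_def)
qed

lemma chi_res: "chi p G (res G z)=chi p G z"
by(rule linmap_eqI[of "%z. chi p G (res G z)"]) (auto intro!: lin simp: chi_def)

lemma chi_keys:
assumes "z:kl pp Q n" "y:keys (chi p G z)"
shows "\<exists>w. wt y=repeat_mset p w & Q w & G w"
proof -
from keys_lext[OF assms(2)[unfolded chi_def]]
obtain k where k: "k:keys z" "y:keys (chi p G (bs k))" unfolding chi_def lext_bs by(rule bexE)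
obtain I u where Iu: "k=(I, u)" by fastforce
have y: "y=(I, u + repeat_mset (p - 1) (mset I + u))" "G (mset I + u)"
 using k(2) by(auto simp: Iu chi_bs keys_sc split: if_splits)
have "Q (mset I + u)" using kl_keys[OF assms(1)] k(1) Iu by auto
moreover have "wt y=repeat_mset p (mset I + u)"
 unfolding y(1) repeat_Suc_mset[OF p, of "mset I + u"] wt_simps by(simp only: add.assoc)
ultimately show ?thesis using y(2) by blast
qed

lemma chi_reflects_boundary:
assumes z: "z:kl pp Q n" and y: "y:gl Q' (Suc n)" "chi p G z=kd y"
 and c: "!!w I. Q w ==> distinct I ==> length I=Suc n ==> mset I <=# w ==> \<forall>x\<in>set_mset w - set I. count w x=1"
obtains x where "x:kl pp (%w. Q w & G w) (Suc n)" "kd x=res G z"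
proof -
define P where "P=(%v. \<exists>w. v=repeat_mset p w & Q w & G w)"
have ry: "res P y:gl P (Suc n)" using res_lat[of y _ P] y(1) keys_res[of _ P y] unfolding gl_def
 by - (rule lat_coarser, auto split: if_splits intro!: exI[of _ 1])
obtain x where x: "x:kl pp (%w. Q w & G w) (Suc n)" "chi p G x=res P y"
 unfolding P_def by(rule chi_surj[OF ry[unfolded P_def] c])
have "kd (res P y)=res P (chi p G z)" by(simp add: kd_res y(2))
also have "... = chi p G z" unfolding P_def by(rule res_id) (rule chi_keys[OF z])
finally have h: "kd (res P y)=chi p G z" .
have "chi p G (kd x - res G z)=0" unfolding chi_simps(5) chi_kd x(2) chi_res h by simp
moreover have "G (wt k)" if "k:keys (kd x - res G z)" for k
proof -
 have "k:keys (kd x) | k:keys (res G z)" using subsetD[OF keys_diff that] by(simp only: Un_iff)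
 thus ?thesis
 proof
  assume "k:keys (kd x)"
  moreover obtain I u where "k=(I, u)" by fastforce
  ultimately show ?thesis using kl_keys[OF kd_kl[OF x(1)], of I u] by simp
 next
  assume "k:keys (res G z)"
  thus ?thesis by(rule keys_res[THEN iffD1, THEN conjunct2])
 qed
qed
ultimately have "kd x - res G z=0" by(rule chi_inj)
thus ?thesis using that x(1) by simp
qed

end

section \<open>Exterior products of vectors with polynomial coefficients\<close>

type_synonym 'x mpoly = "'x multiset \<Rightarrow>\<^sub>0 rat"

definition MP :: "'x mpoly => 'x kos => 'x kos" where
"MP P z=lext (%u. Mo u z) P"

definition lp :: "'x vec => 'x mpoly" where
"lp v=lext (%x. bs {#x#}) v"

definition Ev :: "'x::linorder vec => 'x kos => 'x kos" where
"Ev v z=lext (%x. Ei x z) v"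

lemma linmap_MP [lin]: "linmap F ==> linmap (%z. MP P (F z))"
and linmap_MP' [lin]: "linmap F' ==> linmap (%P. MP (F' P) z)" unfolding MP_def by(auto intro!: lin)

lemma linmap_lp [lin]: "linmap F ==> linmap (%v. lp (F v))" unfolding lp_def by(auto intro!: lin)

lemma linmap_Ev [lin]: "linmap F ==> linmap (%z. Ev v (F z))"
and linmap_Ev' [lin]: "linmap F' ==> linmap (%v. Ev (F' v) z)" unfolding Ev_def by(auto intro!: lin)

lemmas MP_simps=linmap_simps[OF linmap_MP[OF linmap_id]]
lemmas MP_simps'=linmap_simps[OF linmap_MP'[OF linmap_id]]
lemmas Ev_simps=linmap_simps[OF linmap_Ev[OF linmap_id]]
lemmas Ev_simps'=linmap_simps[OF linmap_Ev'[OF linmap_id]]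
lemmas lp_simps=linmap_simps[OF linmap_lp[OF linmap_id]]

lemma MP_bs [simp]: "MP (bs u) z=Mo u z" by(simp add: MP_def)
lemma lp_bs [simp]: "lp (bs x)=bs {#x#}" by(simp add: lp_def)
lemma Ev_bs [simp]: "Ev (bs x) z=Ei x z" by(simp add: Ev_def)

lemma MP_1 [simp]: "MP 1 z=z" by(simp add: MP_def)

lemma MP_mult: "MP (P * R) z=MP P (MP R z)"
proof (rule linmap_eqI[of "%P. MP (P * R) z"])
fix u show "MP (bs u * R) z=MP (bs u) (MP R z)"
 by(rule linmap_eqI[of "%R. MP (bs u * R) z"]) (auto intro!: lin simp: bs_mult Mo_Mo)
qed (intro lin)+

lemma MP_commute: "MP P (MP R z)=MP R (MP P z)" by(simp add: mult.commute flip: MP_mult)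

lemma Ev_MP: "Ev v (MP P z)=MP P (Ev v z)"
proof (rule linmap_eqI[of "%v. Ev v (MP P z)"])
fix x show "Ev (bs x) (MP P z)=MP P (Ev (bs x) z)"
 by(rule linmap_eqI[of "%P. Ev (bs x) (MP P z)"]) (auto intro!: lin linmap_comp[of "Ei x"] simp: Ei_Mo)
qed (intro lin linmap_comp[of "MP P"])+

lemma kd_MP: "kd (MP P z)=MP P (kd z)"
by(rule linmap_eqI[of "%P. kd (MP P z)"]) (auto intro!: lin linmap_comp[of kd] simp: kd_Mo)

lemma Ev_anti: "Ev v (Ev w z) = - Ev w (Ev v z)"
proof (rule linmap_eqI[of "%v. Ev v (Ev w z)"])
fix x show "Ev (bs x) (Ev w z) = - Ev w (Ev (bs x) z)" by(rule linmap_eqI[of "%w. Ev (bs x) (Ev w z)"])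
   (auto intro!: lin linmap_comp[of "Ei x"] simp: Ei_anti[of x])
qed (intro lin linmap_comp[of "Ev w"])+

lemma Ev_sq [simp]: "Ev v (Ev v z)=0" by(rule double_eq_0) (rule Ev_anti)

lemma ssrt_simps: "ssrt 0" "ssrt a ==> ssrt b ==> ssrt (a + b)" "ssrt a ==> ssrt (sc c a)"
using keys_add[of a b] by(auto simp: ssrt_def keys_sc)

lemma ssrt_sum: "(!!x. x:A ==> ssrt (f x)) ==> ssrt (sum f A)"
by(induction A rule: infinite_finite_induct) (auto intro: ssrt_simps)

lemma ssrt_lext: "(!!x. x:keys z ==> ssrt (g x)) ==> ssrt (lext g z)"
unfolding lext_def by(intro ssrt_sum ssrt_simps)

lemma ssrt_Mo: "ssrt z ==> ssrt (Mo u z)" unfolding Mo_def by(rule ssrt_lext) (auto simp: ssrt_def)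

lemma ssrt_MP: "ssrt z ==> ssrt (MP P z)" unfolding MP_def by(intro ssrt_lext ssrt_Mo)

lemma ssrt_Ev: "ssrt z ==> ssrt (Ev v z)" unfolding Ev_def
proof (intro ssrt_lext)
fix x assume z: "ssrt z"
show "ssrt (Ei x z)" unfolding Ei_def
proof (rule ssrt_lext)
 fix y assume "y:keys z"
 then obtain I u where y: "y=(I, u)" "srt I" using z by(cases y) (auto simp: ssrt_def)
 have "ssrt (il x I)" using hl_keys[OF il_hl[OF y(2) refl, of x]] by(auto simp: ssrt_def)
 thus "ssrt (case y of (I, u) => Mo u (il x I))" using y by(simp add: ssrt_Mo)
qed
qed

lemma kd_Ev: "ssrt z ==> kd (Ev v z)=MP (lp v) z - Ev v (kd z)"
proof (rule linmap_eqI[of "%v. kd (Ev v z)"])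
fix x assume "ssrt z"
thus "kd (Ev (bs x) z)=MP (lp (bs x)) z - Ev (bs x) (kd z)" using kd_Ei[of z x] by(simp add: algebra_simps)
qed (auto intro!: lin linmap_comp[of kd] linmap_comp[of "%P. MP P z"])

definition Qe :: "'x::linorder vec list => 'x mpoly => 'x kos" where
"Qe bl P=foldr Ev bl (MP P (bs ([], {#})))"

lemma Qe_simps [simp]: "Qe [] P=MP P (bs ([], {#}))" "Qe (b#bl) P=Ev b (Qe bl P)" by(simp_all add: Qe_def)

lemma linmap_Qe [lin]: "linmap F ==> linmap (%P. Qe bl (F P))" by(induction bl) (auto intro!: lin)

lemma linmap_Qe_nth [lin]: "linmap F ==> linmap (%v. Qe (us@F v#vs) P)" by(induction us) (auto intro!: lin)

lemma Qe_MP: "Qe bl (P * R)=MP P (Qe bl R)" by(induction bl) (auto simp: MP_mult Ev_MP)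

lemma ssrt_Qe [simp]: "ssrt (Qe bl P)" by(induction bl) (auto intro!: ssrt_Ev ssrt_MP simp: ssrt_def[of "bs _"])

lemma Qe_front: "Qe (us@x#vs) P=sc ((- 1) ^ length us) (Ev x (Qe (us@vs) P))"
proof (induction us)
case (Cons u us)
hence "Qe ((u#us)@x#vs) P=sc ((- 1) ^ length us) (Ev u (Ev x (Qe (us@vs) P)))" by(simp add: Ev_simps)
thus ?case by(simp add: Ev_anti[of u x] sc_uminus sc_minus1)
qed simp

lemma Qe_repeat: "Qe (us@x#vs@x#ws) P=0"
using Qe_front[of us x "vs@x#ws" P] Qe_front[of "us@vs" x ws P] by(simp add: Ev_simps)

lemma Qe_not_distinct:
assumes "\<not> distinct xs" shows "Qe (map f xs) P=0"
proof -
obtain us y vs ws where "xs=us@[y]@vs@[y]@ws" using not_distinct_decomp[OF assms] by blast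
thus ?thesis using Qe_repeat[of "map f us" "f y" "map f vs" "map f ws" P] by simp
qed

lemma drop_nth_Cons [simp]: "drop_nth 0 (x#xs)=xs" "drop_nth (Suc t) (x#xs)=x#drop_nth t xs"
by(simp_all add: drop_nth_def)

lemma length_drop_nth: "t < length xs ==> length (drop_nth t xs)=length xs - 1" by(simp add: drop_nth_def)

lemma kd_Qe: "kd (Qe bl P)=(\<Sum>t<length bl. sc ((- 1) ^ t) (Qe (drop_nth t bl) (lp (bl ! t) * P)))"
proof (induction bl)
case Nil
thus ?case by(simp add: kd_MP Mo_simps MP_simps)
next
case (Cons b bl)
show ?case
 by(simp add: kd_Ev Cons Ev_simps Ev_MP sum.lessThan_Suc_shift Qe_MP sc_minus1 sum_negf del: sum.lessThan_Suc)
qed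

subsection \<open>Divided powers of vectors\<close>

definition gp :: "nat => 'x vec => 'x mpoly" where
"gp a v=sc (1 / fact a) (lp v ^ a)"

lemma gp_0 [simp]: "gp 0 v=1" by(simp add: gp_def)

lemma gp_1: "gp (Suc 0) v=lp v" by(simp add: gp_def)

lemma lp_gp: "lp v * gp a v=sc (of_nat (Suc a)) (gp (Suc a) v)"
by(simp add: gp_def sc_mult_right field_simps del: of_nat_Suc)

lemma of_nat_mult_sc: "of_nat k * z=sc (of_nat k) z" for z :: "'a::comm_monoid_add \<Rightarrow>\<^sub>0 rat"
by(induction k) (auto simp: sc_add_left algebra_simps)

lemma gp_add: "gp a (v + w) = (\<Sum>s\<le>a. gp s v * gp (a - s) w)"
proof -
have "gp a (v + w) = sc (1 / fact a) (\<Sum>s\<le>a. of_nat (a choose s) * lp v ^ s * lp w ^ (a - s))"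
 by(simp add: gp_def lp_simps binomial_ring)
also have "\<dots> = (\<Sum>s\<le>a. gp s v * gp (a - s) w)" unfolding sc_sum
proof (rule sum.cong)
 fix s assume "s \<in> {..a}"
 hence "of_nat (a choose s) / fact a = (1 / fact s) * (1 / fact (a - s) :: rat)" by(simp add: binomial_fact)
 thus "sc (1 / fact a) (of_nat (a choose s) * lp v ^ s * lp w ^ (a - s)) = gp s v * gp (a - s) w"
  by(simp add: gp_def of_nat_mult_sc sc_mult_left sc_mult_right ac_simps)
qed simp
finally show ?thesis .
qed

lemma gp_uminus:
fixes v :: "'x vec" shows "gp a (- v)=sc ((- 1) ^ a) (gp a v)"
proof -
have "(- z) ^ a=sc ((- 1) ^ a) (z ^ a)" for z :: "'x mpoly"
 by(induction a) (auto simp: sc_mult_left sc_mult_right sc_minus1 sc_uminus)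
thus ?thesis by(simp add: gp_def lp_simps mult.commute)
qed

lemma bs_power: "bs u ^ a=bs (repeat_mset a u)" for u :: "'x multiset" by(induction a) (auto simp: bs_mult)

lemma gp_bs: "gp a (bs x)=sc (1 / fact a) (bs (replicate_mset a x))"
proof -
have "repeat_mset a {#x#} = replicate_mset a x" by(induction a) auto
thus ?thesis by(simp add: gp_def bs_power)
qed

lemma gp_zero: "gp a 0=(if a=0 then 1 else 0)" by(simp add: gp_def lp_simps power_0_left)

lemma gp_mult: "gp a v * gp b v=sc (of_nat ((a + b) choose a)) (gp (a + b) v)"
proof -
have "of_nat ((a + b) choose a) / fact (a + b)=(1 / fact a) * (1 / fact b :: rat)"
 using binomial_fact[of a "a + b", where 'a=rat] by simp
thus ?thesis by(simp add: gp_def sc_mult_left sc_mult_right power_add ac_simps)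
qed

definition vecs :: "'x set => 'x vec set" where
"vecs X=lat (%x. if x:X then 1 else 0)"

lemma vecs_0 [simp]: "0:vecs X" by(simp add: vecs_def)
lemma vecs_add: "v:vecs X ==> w:vecs X ==> v + w:vecs X" by(simp add: vecs_def lat_add)
lemma vecs_uminus: "v:vecs X ==> - v:vecs X" by(simp add: vecs_def)
lemma vecs_bs: "x:X ==> bs x:vecs X" unfolding vecs_def using lat_basis'[of 1 1 _ x] by simp

lemma vecs_induct [consumes 1, case_names zero basis add uminus]:
fixes v :: "'x vec"
assumes v: "v:vecs X" and "P 0" "!!x. x:X ==> P (bs x)"
 and add: "!!v w. P v ==> P w ==> P (v + w)" and um: "!!v. P v ==> P (- v)"
shows "P v"
proof -
have nat: "P (sc (of_nat k) v)" if "P v" for k v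
 by(induction k) (auto simp: sc_add_left intro!: add that assms(2))
have int: "P (sc (of_int k) v)" if "P v" for k v
proof (cases "k >= 0")
 case True
 thus ?thesis using nat[OF that, of "nat k"] by simp
next
 case False
 hence "sc (of_int k) v = - sc (of_nat (nat (- k))) v" by(simp flip: sc_minus1)
 thus ?thesis using um[OF nat[OF that]] by simp
qed
have sum: "(!!a. a:A ==> P (f a)) ==> P (sum f A)" for f :: "'x => 'x vec" and A
 by(induction A rule: infinite_finite_induct) (auto intro: add assms(2))
obtain k :: "'x => int" where "v=(\<Sum>y\<in>keys v. sc (of_int (k y)) (sc (if y:X then 1 else 0) (bs y)))"
 using lat_decomp[OF v[unfolded vecs_def]] .
moreover have "P (\<Sum>y\<in>keys v. sc (of_int (k y)) (sc (if y:X then 1 else 0) (bs y)))"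
 by(intro sum int) (auto intro: assms)
ultimately show ?thesis by simp
qed

text \<open>The integral part of total degree \<open>N\<close> and exterior degree \<open>n\<close> of the dual de Rham complex
  of the free abelian group on \<open>X\<close>.\<close>

abbreviation "deg X N == (%w. size w=N & set_mset w <= X)"
abbreviation "dR X N n == gl (deg X N) n"

lemma MP_gp_dR:
assumes "v \<in> vecs X" "z \<in> dR X N n" shows "MP (gp a v) z \<in> dR X (N + a) n" using assms
proof (induction v arbitrary: a N z rule: vecs_induct)
case zero
thus ?case by(auto simp: gp_zero MP_simps')
next
case (basis x)
show ?case unfolding gl_def gp_bs MP_simps'
proof (rule gl_linmap[where F = "\<lambda>z. sc (1 / fact a) (MP (bs (replicate_mset a x)) z)", OF _ basis(2)], goal_cases)
 case (2 I u)
 let ?c = "count u x"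
 have "mfact (replicate_mset a x + u) * fact ?c = mfact u * fact (?c + a)"
  by(induction a) (auto simp: mfact_add algebra_simps)
 moreover have "of_nat ((?c + a) choose a) = fact (?c + a) / (fact a * fact ?c :: rat)"
  using binomial_fact[of a "?c + a", where 'a = rat] by simp
 ultimately have "mfact (replicate_mset a x + u) * fact ?c = (mfact u * fact a * of_nat ((?c + a) choose a)) * fact ?c"
  by simp
 hence "mfact (u + replicate_mset a x) = mfact u * fact a * of_nat ((?c + a) choose a)"
  unfolding mult_cancel_right by(simp add: add.commute)
 hence "1 / mfact u * (1 / fact a) = of_int (int ((?c + a) choose a)) / mfact (u + replicate_mset a x)" by simp
 hence "sc (1 / mfact u * (1 / fact a)) (bs (I, u + replicate_mset a x)) \<in> dR X (N + a) n"
  using 2 basis(1) by(intro gl_basis[where k = "int ((count u x + a) choose a)"]) auto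
 thus ?case by(simp add: gl_def)
qed (intro lin)
next
case (add v w)
have "MP (gp a (v + w)) z = (\<Sum>s\<le>a. MP (gp s v) (MP (gp (a - s) w) z))"
 by(simp add: gp_add MP_simps' MP_mult)
also have "\<dots> \<in> dR X (N + a) n"
proof (intro gl_sum)
 fix s assume "s \<in> {..a}"
 hence "N + (a - s) + s = N + a" by simp
 thus "MP (gp s v) (MP (gp (a - s) w) z) \<in> dR X (N + a) n"
  using add.IH(1)[OF add.IH(2)[OF add.prems, of "a - s"], of s] by simp
qed
finally show ?case .
next
case (uminus v)
thus ?case using gl_sc[OF uminus.IH[OF uminus.prems], of "(- 1) ^ a" a] by(simp add: gp_uminus MP_simps')
qed

lemma Ev_dR:
assumes "v:vecs X" "z:dR X N n" shows "Ev v z:dR X (Suc N) (Suc n)" using assms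
proof (induction v rule: vecs_induct)
case (basis x)
thus ?case by(auto intro!: Ei_gl)
qed (auto simp: Ev_simps' intro: gl_add gl_uminus)

lemma one_dR: "bs ([], {#}):dR X 0 0" using gl_basis[of "[]" 0 "deg X 0" "{#}" 1 1] by simp

lemma prod_list_cons: "prod_list (map f (us@x#vs))=f x * prod_list (map f (us@vs))"
for f :: "_ => 'a::comm_monoid_mult" by(simp add: ac_simps)

definition gpl :: "(nat \<times> 'x vec) list => 'x mpoly" where
"gpl l=prod_list (map (%(a, v). gp a v) l)"

lemma Qe_dR:
assumes "set bl <= vecs X" "snd ` set l <= vecs X"
shows "Qe bl (gpl l):dR X (length bl + sum_list (map fst l)) (length bl)" using assms(1)
proof (induction bl)
case Nil
show ?case using assms(2)
proof (induction l)
 case (Cons q l)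
 thus ?case using MP_gp_dR[of "snd q" X "MP (gpl l) (bs ([], {#}))" "sum_list (map fst l)" 0 "fst q"]
  by(auto simp: gpl_def MP_mult add.commute split: prod.splits)
qed (use one_dR in "auto simp: gpl_def")
qed (auto intro!: Ev_dR)

subsection \<open>The cycles of the comparison map\<close>

definition Rf :: "nat => 'x vec list => 'x vec list => 'x mpoly" where
"Rf p bl ws=prod_list (map (gp (p - 1)) bl) * prod_list (map (gp p) ws)"

definition ff :: "nat => 'x::linorder vec list => 'x vec list => 'x kos" where
"ff p bl ws=sc (- 1 / of_nat p) (kd (Qe bl (Rf p bl ws)))"

lemma Rf_gpl: "Rf p bl ws=gpl (map (Pair (p - 1)) bl@map (Pair p) ws)" by(simp add: Rf_def gpl_def comp_def)

lemma drop_nth_decomp: "t < length xs ==> xs=take t xs@xs ! t#drop (Suc t) xs" by(rule id_take_nth_drop)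

lemma ff_eq:
assumes "p > 0"
shows "ff p bl ws=(\<Sum>t<length bl. sc ((- 1) ^ Suc t)
 (Qe (drop_nth t bl) (gpl ((p, bl ! t)#map (Pair (p - 1)) (drop_nth t bl)@map (Pair p) ws))))"
unfolding ff_def kd_Qe sc_sum
proof (rule sum.cong)
fix t assume "t : {..<length bl}"
hence t: "bl=take t bl@bl ! t#drop (Suc t) bl" by(intro drop_nth_decomp) simp
have "Rf p bl ws=gp (p - 1) (bl ! t) * Rf p (drop_nth t bl) ws"
 unfolding Rf_def drop_nth_def by(subst t, subst prod_list_cons) (simp add: ac_simps)
hence "lp (bl ! t) * Rf p bl ws=sc (of_nat p) (gp p (bl ! t) * Rf p (drop_nth t bl) ws)"
 using lp_gp[of "bl ! t" "p - 1"] assms by(simp add: mult.assoc[symmetric] sc_mult_left)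
thus "sc (- 1 / of_nat p) (sc ((- 1) ^ t) (Qe (drop_nth t bl) (lp (bl ! t) * Rf p bl ws))) =
  sc ((- 1) ^ Suc t) (Qe (drop_nth t bl) (gpl ((p, bl ! t)#map (Pair (p - 1)) (drop_nth t bl)@map (Pair p) ws)))"
 using assms by(simp add: linmap_sc[OF linmap_Qe[OF linmap_id]] Rf_gpl gpl_def field_simps)
qed simp

lemma ff_dR:
assumes "p > 0" "set bl <= vecs X" "set ws <= vecs X" "bl ~= []"
shows "ff p bl ws:dR X (p * (length bl + length ws)) (length bl - 1)" unfolding ff_eq[OF assms(1)]
proof (intro gl_sum)
fix t assume "t : {..<length bl}"
hence t: "t < length bl" by simp
have "set (drop_nth t bl) <= vecs X" "bl ! t:vecs X"
 using assms(2) t nth_mem[OF t] set_take_subset[of t bl] set_drop_subset[of "Suc t" bl] by(auto simp: drop_nth_def)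
moreover from this have "snd ` set ((p, bl ! t)#map (Pair (p - 1)) (drop_nth t bl)@map (Pair p) ws) <= vecs X"
 using assms(3) by auto
ultimately have "Qe (drop_nth t bl) (gpl ((p, bl ! t)#map (Pair (p - 1)) (drop_nth t bl)@map (Pair p) ws))
  : dR X (length bl - 1 + (p + (length bl - 1) * (p - 1) + length ws * p)) (length bl - 1)"
 using Qe_dR[of "drop_nth t bl" X "(p, bl ! t)#map (Pair (p - 1)) (drop_nth t bl)@map (Pair p) ws"]
 by(simp add: length_drop_nth[OF t] comp_def sum_list_triv add.assoc)
moreover have "length bl - 1 + (p + (length bl - 1) * (p - 1) + length ws * p)=p * (length bl + length ws)"
 using assms(1,4) by(cases bl; cases p) (auto simp: algebra_simps)
ultimately show "sc ((- 1) ^ Suc t) (Qe (drop_nth t bl) (gpl ((p, bl ! t)#map (Pair (p - 1)) (drop_nth t bl)@map (Pair p) ws)))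
  : dR X (p * (length bl + length ws)) (length bl - 1)"
 using gl_sc[of _ "deg X (p * (length bl + length ws))" "length bl - 1" "(- 1) ^ Suc t"] by simp
qed

lemma kd_ff: "kd (ff p bl ws)=0" by(simp add: ff_def kd_simps kd_kd)

text \<open>If \<open>dY = p Y'\<close>, the polarization of \<open>x \<mapsto> d(x \<gamma>\<^bsub>p-1\<^esub>(x) Y) / p\<close> is a boundary. The two
  bidegrees \<open>(1, p-1)\<close> and \<open>(p-1, 1)\<close>, which are all for \<open>p \<le> 3\<close>, contribute one bracket each.\<close>

definition D1 :: "nat => 'x::linorder vec => 'x vec => 'x kos => 'x kos" where
"D1 b x x' Y=Ev x (MP (gp b x') Y) + Ev x' (MP (gp (b - 1) x' * lp x) Y)"

lemma kd_D1:
assumes Y: "ssrt Y" "ssrt Y'" "kd Y=sc (of_nat p) Y'" "kd Y'=0" and p: "p >= 2"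
shows "sc (1 / of_nat p) (kd (D1 (p - 1) x x' Y)) =
 kd (Ev x (MP (gp (p - 1) x') Y) - Ev x (Ev x' (MP (gp (p - 2) x') Y')))"
proof -
obtain b where pb: "p=Suc (Suc b)" using p by(metis add_2_eq_Suc le_Suc_ex)
have g: "lp x' * gp b x'=sc (of_nat (Suc b)) (gp (Suc b) x')" by(rule lp_gp)
let ?A = "MP (lp x * gp (Suc b) x') Y" and ?B = "Ev x (MP (gp (Suc b) x') Y')" and ?C = "Ev x' (MP (lp x * gp b x') Y')"
have s: "!!P. ssrt (MP P Y)" "!!P. ssrt (MP P Y')" using Y by(auto intro: ssrt_MP)
have 1: "kd (Ev x (MP (gp (Suc b) x') Y))=?A - sc (of_nat p) ?B"
 by(simp add: kd_Ev s kd_MP Y MP_mult MP_simps Ev_simps)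
have 2: "kd (Ev x' (MP (gp b x' * lp x) Y))=sc (of_nat (Suc b)) ?A - sc (of_nat p) ?C"
proof -
 have "MP (lp x') (MP (gp b x' * lp x) Y)=MP (lp x' * gp b x' * lp x) Y" by(simp add: MP_mult)
 also have "... = sc (of_nat (Suc b)) ?A"
  unfolding g by(simp add: sc_mult_left sc_mult_right MP_simps' mult.commute)
 finally show ?thesis by(simp add: kd_Ev s kd_MP Y MP_simps Ev_simps mult.commute[of "lp x"])
qed
have 3: "kd (Ev x (Ev x' (MP (gp b x') Y')))=?C - sc (of_nat (Suc b)) ?B"
proof -
 have "MP (lp x') (MP (gp b x') Y')=sc (of_nat (Suc b)) (MP (gp (Suc b) x') Y')"
  unfolding MP_mult[symmetric] g by(simp add: MP_simps')
 moreover define Z where "Z=MP (gp b x') Y'"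
 moreover have "ssrt Z" "kd Z=0" using Y by(simp_all add: Z_def ssrt_MP kd_MP MP_simps)
 hence "kd (Ev x (Ev x' Z))=MP (lp x) (Ev x' Z) - Ev x (MP (lp x') Z)" by(simp add: kd_Ev ssrt_Ev Ev_simps)
 ultimately show ?thesis by(simp add: Ev_simps MP_mult Ev_MP)
qed
have "kd (D1 (p - 1) x x' Y)=sc (of_nat p) (?A - ?B - ?C)"
proof -
 have "kd (D1 (p - 1) x x' Y)=(?A - sc (of_nat p) ?B) + (sc (of_nat (Suc b)) ?A - sc (of_nat p) ?C)"
  using 1 2 by(simp add: D1_def pb kd_simps(1))
 also have "... = sc (of_nat p) (?A - ?B - ?C)"
  by(rule pm_eqI) (simp add: pb lookup_add lookup_minus algebra_simps)
 finally show ?thesis .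
qed
hence "sc (1 / of_nat p) (kd (D1 (p - 1) x x' Y))=?A - ?B - ?C" using p by simp
also have "... = kd (Ev x (MP (gp (p - 1) x') Y) - Ev x (Ev x' (MP (gp (p - 2) x') Y')))"
proof -
 have "kd (Ev x (MP (gp (p - 1) x') Y) - Ev x (Ev x' (MP (gp (p - 2) x') Y'))) =
   (?A - sc (of_nat p) ?B) - (?C - sc (of_nat (Suc b)) ?B)" using 1 3 by(simp add: pb kd_simps)
 also have "... = ?A - ?B - ?C" by(rule pm_eqI) (simp add: pb lookup_add lookup_minus algebra_simps)
 finally show ?thesis by(rule sym)
qed
finally show ?thesis .
qed

lemma polarization:
assumes "p=2 | p=3"
shows "Ev (x + x') (MP (gp (p - 1) (x + x')) Y) - Ev x (MP (gp (p - 1) x) Y) - Ev x' (MP (gp (p - 1) x') Y) =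
 (if p=2 then D1 (p - 1) x x' Y else D1 (p - 1) x x' Y + D1 (p - 1) x' x Y)"
proof -
have e2: "gp 2 (x + x')=gp 2 x + lp x * lp x' + gp 2 x'" by(simp add: gp_add numeral_2_eq_2 gp_1)
show ?thesis using assms
 by(auto simp: D1_def gp_1 lp_simps MP_simps' Ev_simps Ev_simps' e2 mult.commute[of "lp x'"])
qed

text \<open>Multiadditive maps modulo a subgroup vanish if they vanish on lists of basis vectors.\<close>

lemma multiadditive_vanish:
fixes X :: "'x set" and D :: "'x vec list => 'y vec"
assumes B: "0:B" "!!a b. a:B ==> b:B ==> a + b:B" "!!a. a:B ==> - a:B"
 and add: "!!us x y vs. set us <= vecs X ==> set vs <= vecs X ==> x:vecs X ==> y:vecs X ==>
  length us + length vs + 1=m ==> D (us@(x + y)#vs) - D (us@x#vs) - D (us@y#vs):B"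
 and basis: "!!l. set l <= X ==> length l=m ==> D (map bs l):B"
 and xs: "set xs <= vecs X" "length xs=m"
shows "D xs:B"
proof -
have "set us <= vecs X ==> set l <= X ==> length us + length l=m ==> D (us@map bs l):B" for us l
proof (induction us arbitrary: l rule: rev_induct)
 case Nil
 thus ?case by(simp add: basis)
next
 case (snoc v us)
 let ?vs = "map bs l"
 have vs: "set ?vs <= vecs X" using snoc.prems by(auto intro: vecs_bs)
 have len: "length us + length ?vs + 1=m" using snoc.prems by simp
 have us: "set us <= vecs X" using snoc.prems by simp
 have D_add: "D (us@(x + y)#?vs) - D (us@x#?vs) - D (us@y#?vs):B"
  if "x:vecs X" "y:vecs X" for x y using that by(intro add us vs len)
 have D_0: "D (us@0#?vs):B" using B(3)[OF D_add[of 0 0]] by simp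
 have "v:vecs X" using snoc.prems by simp
 hence "v:vecs X & D (us@v#?vs):B"
 proof (induction v rule: vecs_induct)
  case zero
  thus ?case using D_0 by simp
 next
  case (basis x)
  thus ?case using snoc.IH[of "x#l"] us snoc.prems by(simp add: vecs_bs)
 next
  case (add v w)
  hence "(D (us@(v + w)#?vs) - D (us@v#?vs) - D (us@w#?vs)) + D (us@v#?vs) + D (us@w#?vs):B"
   by(intro B(2) D_add) auto
  thus ?case using add by(auto intro: vecs_add)
 next
  case (uminus v)
  hence "D (us@(v + - v)#?vs) - D (us@v#?vs) - D (us@(- v)#?vs):B" by(intro D_add) (auto intro: vecs_uminus)
  hence "D (us@0#?vs) + - (D (us@0#?vs) - D (us@v#?vs) - D (us@(- v)#?vs)) + - D (us@v#?vs):B"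
   using uminus by(intro B(2) B(3) D_0) auto
  thus ?case using uminus by(simp add: vecs_uminus)
 qed
 thus ?case by simp
qed
from this[of xs "[]"] xs show ?thesis by simp
qed

lemma image_kd_simps:
assumes B: "B=kd ` gl Q n"
shows "0:B" "!!a b. a:B ==> b:B ==> a + b:B" "!!a. a:B ==> - a:B"
 "!!a b. a:B ==> b:B ==> a - b:B" "!!a k. a:B ==> sc (of_int k) a:B"
proof -
show "0:B" unfolding B by(rule image_eqI[of _ _ 0]) (auto simp: kd_simps)
show "a + b:B" if "a:B" "b:B" for a b using that unfolding B by(auto simp flip: kd_simps(1) intro: gl_add)
show "- a:B" if "a:B" for a using that unfolding B by(auto simp flip: kd_simps(4) intro: gl_uminus)
show "a - b:B" if "a:B" "b:B" for a b using that unfolding B by(auto simp flip: kd_simps(5) intro: gl_diff)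
show "sc (of_int k) a:B" if "a:B" for a k using that unfolding B by(auto simp flip: kd_simps(2) intro: gl_sc)
qed

lemma Qe_Rf_dR:
assumes "p > 0" "set bl <= vecs X" "set ws <= vecs X"
shows "Qe bl (Rf p bl ws):dR X (p * (length bl + length ws)) (length bl)"
proof -
let ?l = "map (Pair (p - 1)) bl@map (Pair p) ws"
have "snd ` set ?l <= vecs X" using assms by auto
hence "Qe bl (gpl ?l):dR X (length bl + sum_list (map fst ?l)) (length bl)" by(rule Qe_dR[OF assms(2)])
moreover have "length bl + sum_list (map fst ?l)=p * (length bl + length ws)"
 using assms(1) by(cases p) (auto simp: comp_def sum_list_triv algebra_simps)
ultimately show ?thesis by(simp add: Rf_gpl)
qed

lemma ff_add_exterior:
assumes p: "p=2 | p=3" and X: "set us <= vecs X" "set vs <= vecs X" "set ws <= vecs X" "x:vecs X" "x':vecs X"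
 and ne: "us@vs ~= []"
shows "ff p (us@(x + x')#vs) ws - ff p (us@x#vs) ws - ff p (us@x'#vs) ws
 : kd ` dR X (p * (length us + length vs + 1 + length ws)) (Suc (length us + length vs))"
 (is "_:kd ` ?C")
proof -
let ?L = "us@vs"
define Y where "Y=Qe ?L (Rf p ?L ws)"
define Y' where "Y' = - ff p ?L ws"
define T where "T=(%x. Ev x (MP (gp (p - 1) x) Y))"
have p0: "p > 0" "p >= 2" using p by auto
have L: "set ?L <= vecs X" using X by auto
have "Rf p (us@x#vs) ws=gp (p - 1) x * Rf p ?L ws" for x by(simp add: Rf_def ac_simps)
hence ff: "ff p (us@x#vs) ws=sc (- ((- 1) ^ length us)) (sc (1 / of_nat p) (kd (T x)))" for x
 by(simp add: ff_def Qe_front T_def Y_def Qe_MP kd_simps MP_simps Ev_MP)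
have Y: "ssrt Y" "ssrt Y'" "kd Y=sc (of_nat p) Y'" "kd Y'=0"
proof -
 show "ssrt Y" by(simp add: Y_def)
 show "ssrt Y'" unfolding Y'_def by(rule gl_ssrt[OF gl_uminus[OF ff_dR[OF p0(1) L X(3) ne]]])
 show "kd Y=sc (of_nat p) Y'" using p0 by(simp add: Y_def Y'_def ff_def sc_minus1)
 show "kd Y'=0" by(simp add: Y'_def kd_simps kd_ff)
qed
have YdR: "Y:dR X (p * (length ?L + length ws)) (length ?L)" unfolding Y_def using p0 L X by(intro Qe_Rf_dR)
have Y'dR: "Y':dR X (p * (length ?L + length ws)) (length ?L - 1)"
 unfolding Y'_def using p0 L X ne by(intro gl_uminus ff_dR)
have D: "sc (1 / of_nat p) (kd (D1 (p - 1) x x' Y)):kd ` ?C" if "x:vecs X" "x':vecs X" for x x'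
proof -
 have e: "Suc (p * (length ?L + length ws) + (p - 1))=p * (length us + length vs + 1 + length ws)"
   "Suc (Suc (p * (length ?L + length ws) + (p - 2)))=p * (length us + length vs + 1 + length ws)"
   "Suc (Suc (length ?L - 1))=Suc (length us + length vs)" "length ?L=length us + length vs"
  using p ne by(auto simp: algebra_simps)
 have "Ev x (MP (gp (p - 1) x') Y):dR X (Suc (p * (length ?L + length ws) + (p - 1))) (Suc (length ?L))"
  using that YdR by(intro Ev_dR MP_gp_dR)
 note 1=this[unfolded e(1), unfolded e(4)]
 have "Ev x (Ev x' (MP (gp (p - 2) x') Y')):dR X (Suc (Suc (p * (length ?L + length ws) + (p - 2)))) (Suc (Suc (length ?L - 1)))"
  using that Y'dR by(intro Ev_dR MP_gp_dR)
 note 2=this[unfolded e(2,3)]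
 have "Ev x (MP (gp (p - 1) x') Y) - Ev x (Ev x' (MP (gp (p - 2) x') Y')):?C" by(rule gl_diff[OF 1 2])
 thus ?thesis unfolding kd_D1[OF Y p0(2)] by(rule imageI)
qed
have "T (x + x') - T x - T x'=(if p=2 then D1 (p - 1) x x' Y else D1 (p - 1) x x' Y + D1 (p - 1) x' x Y)"
 unfolding T_def by(rule polarization[OF p])
note pol=this
have "sc (1 / of_nat p) (kd (T (x + x') - T x - T x')):kd ` ?C"
proof (cases "p=2")
 case True
 show ?thesis unfolding pol if_P[OF True] by(rule D[OF X(4,5)])
next
 case False
 show ?thesis unfolding pol if_not_P[OF False] kd_simps(1) sc_add
  by(rule image_kd_simps(2)[OF refl D[OF X(4,5)] D[OF X(5,4)]])
qed
hence "sc (of_int (- ((- 1) ^ length us))) (sc (1 / of_nat p) (kd (T (x + x') - T x - T x'))):kd ` ?C"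
 by(rule image_kd_simps(5)[OF refl])
moreover have "sc (of_int (- ((- 1) ^ length us))) (sc (1 / of_nat p) (kd (T (x + x') - T x - T x'))) =
  ff p (us@(x + x')#vs) ws - ff p (us@x#vs) ws - ff p (us@x'#vs) ws" unfolding ff kd_simps sc_diff by simp
ultimately show ?thesis by simp
qed

lemma ff_MP: "ff p bl (us@w#vs)=MP (gp p w) (ff p bl (us@vs))"
proof -
have "Rf p bl (us@w#vs)=gp p w * Rf p bl (us@vs)" by(simp add: Rf_def ac_simps)
thus ?thesis by(simp add: ff_def Qe_MP kd_MP MP_simps)
qed

lemma ff_add_symmetric:
assumes p: "p=2 | p=3" and X: "set bl <= vecs X" "set us <= vecs X" "set vs <= vecs X" "w:vecs X" "w':vecs X"
 and ne: "bl ~= []"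
shows "ff p bl (us@(w + w')#vs) - ff p bl (us@w#vs) - ff p bl (us@w'#vs)
 : kd ` dR X (p * (length bl + length us + length vs + 1)) (length bl)"
 (is "_:kd ` ?C")
proof -
define f where "f=ff p bl (us@vs)"
have p0: "p > 0" using p by auto
have f: "f:dR X (p * (length bl + length us + length vs)) (length bl - 1)"
 unfolding f_def using ff_dR[OF p0 X(1), of "us@vs"] X ne by(simp add: add.assoc)
have D: "MP (lp w * gp (p - 1) w') f:kd ` ?C" if "w:vecs X" "w':vecs X" for w w'
proof -
 have k: "kd (Ev w (MP (gp (p - 1) w') f))=MP (lp w * gp (p - 1) w') f"
  using gl_ssrt[OF f] by(simp add: kd_Ev ssrt_MP kd_MP f_def kd_ff MP_simps Ev_simps MP_mult)
 have "Ev w (MP (gp (p - 1) w') f):dR X (Suc (p * (length bl + length us + length vs) + (p - 1))) (Suc (length bl - 1))"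
  using that f by(intro Ev_dR MP_gp_dR)
 moreover have "Suc (p * (length bl + length us + length vs) + (p - 1))=p * (length bl + length us + length vs + 1)"
  "Suc (length bl - 1)=length bl" using p ne by(auto simp: algebra_simps)
 ultimately have "Ev w (MP (gp (p - 1) w') f):?C" by(simp only:)
 from imageI[OF this, of kd] show ?thesis unfolding k .
qed
have "gp p (w + w') - gp p w - gp p w' =
  (if p=2 then lp w * gp (p - 1) w' else lp w * gp (p - 1) w' + lp w' * gp (p - 1) w)"
proof -
 have "gp 2 (w + w')=gp 2 w + lp w * lp w' + gp 2 w'" by(simp add: gp_add numeral_2_eq_2 gp_1)
 moreover have "gp 3 (w + w')=gp 3 w + gp 2 w * lp w' + lp w * gp 2 w' + gp 3 w'"
  by(simp add: gp_add numeral_3_eq_3 numeral_2_eq_2 gp_1)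
 ultimately show ?thesis using p by(auto simp: gp_1 mult.commute)
qed
note pol=this
have "ff p bl (us@(w + w')#vs) - ff p bl (us@w#vs) - ff p bl (us@w'#vs) =
  MP (gp p (w + w') - gp p w - gp p w') f" by(simp only: ff_MP f_def MP_simps'(5))
also have "... : kd ` ?C"
proof (cases "p=2")
 case True
 show ?thesis unfolding pol if_P[OF True] by(rule D[OF X(4,5)])
next
 case False
 show ?thesis unfolding pol if_not_P[OF False] MP_simps'(1)
  by(rule image_kd_simps(2)[OF refl D[OF X(4,5)] D[OF X(5,4)]])
qed
finally show ?thesis .
qed

definition gg :: "nat => ('x multiset => bool) => 'x::linorder vec list => 'x vec list => 'x kos" where
"gg p G bl ws=sc (- (of_nat p ^ (length bl - 1))) (chi p G (kd (Qe bl (prod_list (map lp ws)))))"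

lemma gg_add_exterior: "gg p G (us@(x + x')#vs) ws=gg p G (us@x#vs) ws + gg p G (us@x'#vs) ws"
using linmap_add[OF linmap_Qe_nth[OF linmap_id], of us x x' vs] by(simp add: gg_def kd_simps chi_simps sc_add)

lemma gg_add_symmetric: "gg p G bl (us@(w + w')#vs)=gg p G bl (us@w#vs) + gg p G bl (us@w'#vs)"
by(simp add: gg_def lp_simps algebra_simps linmap_add[OF linmap_Qe[OF linmap_id]] kd_simps chi_simps sc_add)

lemma set_mset_repeat_mset: "set_mset (repeat_mset n A)=(if n=0 then {} else set_mset A)" by(induction n) auto

lemma prod_list_bs: "prod_list (map (%x. bs (f x)) l)=bs (sum_list (map f l))" for f :: "'a => 'x multiset"
by(induction l) (auto simp: bs_mult)

lemma prod_list_sc_bs: "prod_list (map (%x. sc c (bs (f x))) l)=sc (c ^ length l) (bs (sum_list (map f l)))" for f :: "'a => 'x multiset"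
by(induction l) (auto simp: bs_mult sc_mult_left sc_mult_right mult.commute)

lemma sum_list_replicate_mset: "sum_list (map (replicate_mset a) l)=repeat_mset a (mset l)"
proof (induction l)
case (Cons x l)
have "replicate_mset a x=repeat_mset a {#x#}" by(induction a) auto
thus ?case using Cons repeat_mset_distrib_add_mset[of a x "mset l"] by simp
qed simp

lemma Qe_bs_hl: "Qe (map bs J) 1:hl (length J) (mset J)" by(induction J) (auto intro!: Ei_hl hl_bs)

lemma Qe_bs_Mo: "Qe (map bs J) (bs v)=Mo v (Qe (map bs J) 1)" using Qe_MP[of "map bs J" "bs v" 1] by simp

lemma Qe_bs_wt: "y:keys (Qe (map bs J) (bs v)) ==> wt y=mset J + v"
using hl_keys[OF Mo_hl[OF Qe_bs_hl[of J], of v]] by(cases y) (auto simp: Qe_bs_Mo)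

text \<open>On basis vectors the two cycles are multiples of the same boundary; the congruence
  \<open>(2p - 1)!/((p - 1)! p!) \<equiv> 1\<close> modulo \<open>p\<close> is what makes them agree.\<close>

lemma ff_gg_basis:
assumes p: "prime p" and X: "set J <= X" "set l <= X" and G: "!!w. set_mset w <= X ==> G w"
 and J: "length J=Suc i" "i > 0"
 and small: "l=[] | (p=2 & length J=2 & length l=1)"
shows "ff p (map bs J) (map bs l) - gg p G (map bs J) (map bs l):kd ` dR X (p * (length J + length l)) (Suc i)"
proof (cases "distinct J")
case False
hence "Qe (map bs J) P=0" for P by(rule Qe_not_distinct)
thus ?thesis using image_kd_simps(1)[OF refl] by(simp add: ff_def gg_def kd_simps chi_simps)
next
case True
have p0: "p > 0" using p by(rule prime_gt_0_nat)
let ?W = "mset J + mset l" and ?v = "mset l + repeat_mset (p - 1) (mset J + mset l)"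
let ?n = "fact (p - 1) ^ length J * fact p ^ length l :: rat"
let ?c = "\<Prod>x\<in>set_mset ?W - set J. of_nat (count ?W x) :: rat"
have v_eq: "?v=repeat_mset (p - 1) (mset J) + repeat_mset p (mset l)"
 using repeat_Suc_mset[OF p0, of "mset l"] by simp
have GW: "G ?W" using X by(intro G) auto
have R: "Rf p (map bs J) (map bs l)=sc (1 / ?n) (bs ?v)"
 unfolding Rf_def map_map comp_def gp_bs prod_list_sc_bs sum_list_replicate_mset v_eq
 by(simp add: sc_mult_left sc_mult_right bs_mult field_simps)
have f: "ff p (map bs J) (map bs l)=kd (sc (- 1 / of_nat p / ?n) (Qe (map bs J) (bs ?v)))"
 unfolding ff_def R by(simp add: kd_simps linmap_sc[OF linmap_Qe[OF linmap_id]])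
have "prod_list (map lp (map bs l))=bs (mset l)" using prod_list_bs[of "%x. {#x#}" l] by(simp add: comp_def)
moreover have "chi p G (Qe (map bs J) (bs (mset l)))=sc (kap p ?W) (Qe (map bs J) (bs ?v))"
 using chi_wt[of "Qe (map bs J) (bs (mset l))" ?W p G] Qe_bs_wt[of _ J "mset l"] GW
 by(simp add: Qe_bs_Mo[of J] Mo_Mo add.commute)
ultimately have g: "gg p G (map bs J) (map bs l)=kd (sc (- (of_nat p ^ i * kap p ?W)) (Qe (map bs J) (bs ?v)))"
 using J by(simp add: gg_def chi_kd kd_simps)
have k: "of_nat p ^ i * kap p ?W=?c / mfact ?v / of_nat p"
 using kap_coeff[OF True p0, of "mset l"] p0 J by(simp add: field_simps)
have "\<exists>k::int. ?c - mfact ?v / ?n = of_int k * of_nat p"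
proof -
 have m: "mfact (repeat_mset a (mset J))=fact a ^ length J" for a
 proof -
  have "mfact (repeat_mset a (mset J))=(\<Prod>x\<in>set_mset (repeat_mset a (mset J)). fact a)"
   unfolding mfact_def
  proof (intro prod.cong refl)
   fix x assume "x \<in># repeat_mset a (mset J)"
   hence "a * count (mset J) x > 0" by(metis count_greater_zero_iff count_repeat_mset)
   thus "(fact (count (repeat_mset a (mset J)) x) :: rat)=fact a"
    using distinct_count_atmost_1[of J] True by(auto split: if_splits)
  qed
  also have "... = fact a ^ card (set_mset (repeat_mset a (mset J)))" by simp
  also have "... = fact a ^ length J" using distinct_card[OF True] by(cases "a=0") (auto simp: set_mset_repeat_mset)
  finally show ?thesis .
 qed
 consider "l=[]" | a b where "p=2" "J=[a, b]" "l=[a] | l=[b]" | a b c where "p=2" "J=[a, b]" "l=[c]" "c ~= a" "c ~= b"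
  using small by(fastforce simp: length_Suc_conv numeral_2_eq_2)
 thus ?thesis
 proof cases
  case 1
  thus ?thesis using m[of "p - 1"] by(auto intro!: exI[of _ 0])
 next
  case 2
  hence "a ~= b" using True by auto
  with 2 show ?thesis by(auto simp: mfact_add numeral_2_eq_2 intro!: exI[of _ "-1"])
 next
  case 3
  hence "a ~= b" using True by auto
  with 3 show ?thesis by(auto simp: mfact_add numeral_2_eq_2 insert_Diff_if intro!: exI[of _ 0])
 qed
qed
then obtain k :: int where "?c - mfact ?v / ?n = of_int k * of_nat p" ..
hence "?c=mfact ?v / ?n + of_int k * of_nat p" by(simp add: algebra_simps)
hence "- 1 / of_nat p / ?n - (- (of_nat p ^ i * kap p ?W)) = of_int k * (1 / mfact ?v)"
 unfolding k using p0 by(simp add: field_simps)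
hence h1: "ff p (map bs J) (map bs l) - gg p G (map bs J) (map bs l)=kd (sc (of_int k) (sc (1 / mfact ?v) (Qe (map bs J) (bs ?v))))"
 unfolding f g kd_simps(5)[symmetric] sc_diff_left[symmetric] sc_simps by simp
have h2: "sc (1 / mfact ?v) (Mo ?v (Qe (map bs J) 1)):dR X (p * (length J + length l)) (Suc i)"
proof (rule hl_size0[OF Qe_bs_hl[of J, unfolded J(1)]])
 show "deg X (p * (length J + length l)) (mset J + ?v)"
  using X p0 by(cases p) (auto simp: set_mset_repeat_mset algebra_simps split: if_splits)
qed (use J in simp)
show ?thesis unfolding h1 Qe_bs_Mo[of J ?v] by(intro imageI gl_sc h2)
qed

text \<open>The cycles defining the comparison map are, up to boundaries, the images under
  \<^term>\<open>chi\<close> of the cycles representing the classes \<open>\<beta>\<close>.\<close>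

theorem ff_gg:
assumes p: "prime p" "p=2 | p=3" and X: "set xs <= vecs X" and G: "!!w. set_mset w <= X ==> G w"
 and len: "length xs=m" "0 < i" "i < m" "p * m <= 7"
shows "ff p (take (Suc i) xs) (drop (Suc i) xs) - gg p G (take (Suc i) xs) (drop (Suc i) xs)
 : kd ` dR X (p * m) (Suc i)"
proof (rule multiadditive_vanish[where X=X and m=m and B = "kd ` dR X (p * m) (Suc i)" and
  D = "%xs. ff p (take (Suc i) xs) (drop (Suc i) xs) - gg p G (take (Suc i) xs) (drop (Suc i) xs)", OF _ _ _ _ _ X len(1)],
  goal_cases)
case (4 us x y vs)
show ?case
proof (cases "length us <= i")
 case True
 let ?vs = "take (i - length us) vs" and ?ws = "drop (i - length us) vs"
 have "set ?vs <= vecs X" "set ?ws <= vecs X"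
  using 4 set_take_subset[of "i - length us" vs] set_drop_subset[of "i - length us" vs] by auto
 moreover have e: "length us + length ?vs + 1 + length ?ws=m" "length us + length ?vs=i" using 4 len True by auto
 moreover from this have "us@?vs ~= []" using len by auto
 ultimately have "ff p (us@(x + y)#?vs) ?ws - ff p (us@x#?vs) ?ws - ff p (us@y#?vs) ?ws:kd ` dR X (p * m) (Suc i)"
  using ff_add_exterior[OF p(2) 4(1) _ _ 4(3,4), of ?vs ?ws] unfolding e by blast
 thus ?thesis using True by(simp add: Suc_diff_le gg_add_exterior algebra_simps)
next
 case False
 let ?bl = "take (Suc i) us" and ?us = "drop (Suc i) us"
 have "set ?bl <= vecs X" "set ?us <= vecs X"
  using 4 set_take_subset[of "Suc i" us] set_drop_subset[of "Suc i" us] by auto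
 moreover have e: "length ?bl + length ?us + length vs + 1=m" "length ?bl=Suc i" using 4 False by auto
 moreover have "?bl ~= []" using False by(cases us) auto
 ultimately have "ff p ?bl (?us@(x + y)#vs) - ff p ?bl (?us@x#vs) - ff p ?bl (?us@y#vs):kd ` dR X (p * m) (Suc i)"
  using ff_add_symmetric[OF p(2) _ _ 4(2,3,4), of ?bl ?us] unfolding e(1) unfolding e(2) by blast
 thus ?thesis using False by(simp add: gg_add_symmetric algebra_simps)
qed
next
case (5 l)
have m: "m <= 3" using len(4) p(2) by auto
have "drop (Suc i) l=[] | (p=2 & length (take (Suc i) l)=2 & length (drop (Suc i) l)=1)"
proof (cases "Suc i=m")
 case True
 thus ?thesis using 5 by simp
next
 case False
 hence "i=1" "m=3" using len m by auto
 thus ?thesis using 5 len(4) p(2) by auto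
qed
hence "ff p (map bs (take (Suc i) l)) (map bs (drop (Suc i) l)) - gg p G (map bs (take (Suc i) l)) (map bs (drop (Suc i) l))
  : kd ` dR X (p * (length (take (Suc i) l) + length (drop (Suc i) l))) (Suc i)"
 using 5 len G set_take_subset[of "Suc i" l] set_drop_subset[of "Suc i" l] by(intro ff_gg_basis p(1)) auto
moreover have "length (take (Suc i) l) + length (drop (Suc i) l)=m" using 5 len by auto
ultimately show ?case by(simp add: take_map drop_map)
qed (rule image_kd_simps[OF refl]; assumption)+

section \<open>Presented groups as lattices\<close>

abbreviation "FA S == free_Abelian_group S"
abbreviation "gen S R == generate (FA S) R"

definition castq :: "('s \<Rightarrow>\<^sub>0 int) => 's vec" where
"castq c=Poly_Mapping.map of_int c"

lemma lookup_castq [simp]: "lookup (castq c) s = of_int (lookup c s)"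
by(simp add: castq_def Poly_Mapping.map.rep_eq when_def)

lemma castq_simps [simp]: "castq 0=0" "castq (a + b)=castq a + castq b" "castq (a - b)=castq a - castq b"
"castq (- a) = - castq a" "castq (frag_cmul k a)=sc (of_int k) (castq a)" "castq (frag_of s)=bs s"
by(auto intro!: pm_eqI simp: lookup_add lookup_minus lookup_single when_def)

lemma keys_castq [simp]: "keys (castq c)=keys c" by(auto simp: in_keys_iff)

definition ev :: "('s => 'y vec) => ('s \<Rightarrow>\<^sub>0 int) => 'y vec" where
"ev l c=lext l (castq c)"

lemma ev_simps [simp]: "ev l 0=0" "ev l (a + b)=ev l a + ev l b" "ev l (a - b)=ev l a - ev l b"
"ev l (- a) = - ev l a" "ev l (frag_cmul k a)=sc (of_int k) (ev l a)" "ev l (frag_of s)=l s"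
by(simp_all add: ev_def lext_simps)

lemma ev_sum: "ev l (sum f A)=(\<Sum>a\<in>A. ev l (f a))" by(induction A rule: infinite_finite_induct) auto

lemma frag_cmul_diff_right: "frag_cmul k (a - b)=frag_cmul k a - frag_cmul k b"
by(rule poly_mapping_eqI) (simp add: lookup_minus algebra_simps)

text \<open>An embedding of a commutative group onto a lattice.\<close>

definition lemb :: "('g, 'm) monoid_scheme => ('g => 'y vec) => ('y => rat) => bool" where
"lemb G l c \<longleftrightarrow> comm_group G & (\<forall>x\<in>carrier G. \<forall>y\<in>carrier G. l (x \<otimes>\<^bsub>G\<^esub> y)=l x + l y) &
  inj_on l (carrier G) & l ` carrier G=lat c"

lemma lembD:
assumes "lemb G l c"
shows lemb_comm: "comm_group G" and lemb_group: "group G"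
 and lemb_mult: "x:carrier G ==> y:carrier G ==> l (x \<otimes>\<^bsub>G\<^esub> y)=l x + l y"
 and lemb_inj: "x:carrier G ==> y:carrier G ==> l x=l y ==> x=y"
 and lemb_lat: "x:carrier G ==> l x:lat c"
 and lemb_image: "l ` carrier G=lat c"
proof -
have *: "comm_group G" "\<forall>x\<in>carrier G. \<forall>y\<in>carrier G. l (x \<otimes>\<^bsub>G\<^esub> y)=l x + l y"
 "inj_on l (carrier G)" "l ` carrier G=lat c" using assms unfolding lemb_def by blast+
show "comm_group G" "l ` carrier G=lat c" by(rule *)+
show "group G" by(rule comm_group.axioms(2)[OF *(1)])
show "x:carrier G ==> y:carrier G ==> l (x \<otimes>\<^bsub>G\<^esub> y)=l x + l y" using *(2) by blast
show "x:carrier G ==> y:carrier G ==> l x=l y ==> x=y" using *(3) by(simp add: inj_on_def)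
show "x:carrier G ==> l x:lat c" using *(4) by blast
qed

lemma lemb_obtain:
assumes "lemb G l c" "z:lat c" obtains x where "x:carrier G" "l x=z"
proof -
have "z:l ` carrier G" unfolding lemb_image[OF assms(1)] by(rule assms(2))
thus ?thesis using that by(elim imageE) simp
qed

lemma lemb_one: assumes "lemb G l c" shows "l \<one>\<^bsub>G\<^esub> = 0"
proof -
interpret group G by(rule lemb_group[OF assms])
show ?thesis using lemb_mult[OF assms, of "\<one>\<^bsub>G\<^esub>" "\<one>\<^bsub>G\<^esub>"] by simp
qed

lemma lemb_inv: assumes "lemb G l c" "x:carrier G" shows "l (inv\<^bsub>G\<^esub> x) = - l x"
proof -
interpret group G by(rule lemb_group[OF assms(1)])
show ?thesis using lemb_mult[OF assms(1), of x "inv\<^bsub>G\<^esub> x"] assms(2) lemb_one[OF assms(1)]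
 by(simp add: eq_neg_iff_add_eq_0 add.commute)
qed

lemma lemb_eq_one_iff:
assumes "lemb G l c" "x:carrier G" shows "x = \<one>\<^bsub>G\<^esub> \<longleftrightarrow> l x=0"
proof -
interpret group G by(rule lemb_group[OF assms(1)])
show ?thesis
proof
 assume "l x=0"
 thus "x = \<one>\<^bsub>G\<^esub>" by(intro lemb_inj[OF assms one_closed]) (simp only: lemb_one[OF assms(1)])
qed (simp add: lemb_one[OF assms(1)])
qed

lemma lemb_nat_pow: assumes "lemb G l c" "x:carrier G" shows "l (x [^]\<^bsub>G\<^esub> (k::nat))=sc (of_nat k) (l x)"
proof -
interpret group G by(rule lemb_group[OF assms(1)])
show ?thesis by(induction k) (auto simp: lemb_one[OF assms(1)] lemb_mult[OF assms(1)] assms(2) sc_add_left)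
qed

lemma lemb_int_pow: assumes "lemb G l c" "x:carrier G" shows "l (x [^]\<^bsub>G\<^esub> (k::int))=sc (of_int k) (l x)"
proof -
interpret group G by(rule lemb_group[OF assms(1)])
show ?thesis
proof (cases "k < 0")
 case True
 hence "l (x [^]\<^bsub>G\<^esub> k) = - sc (of_nat (nat (- k))) (l x)"
  by(simp only: int_pow_def2 if_True lemb_nat_pow[OF assms] lemb_inv[OF assms(1) nat_pow_closed[OF assms(2)]])
 also have "... = sc (of_int k) (l x)" using True by(simp add: sc_minus1)
 finally show ?thesis .
next
 case False
 hence "(of_nat (nat k) :: rat) = of_int k" by simp
 moreover have "l (x [^]\<^bsub>G\<^esub> k)=sc (of_nat (nat k)) (l x)"
  using False by(simp only: int_pow_def2 if_False lemb_nat_pow[OF assms])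
 ultimately show ?thesis by(simp only:)
qed
qed

lemma lemb_full_subgroup:
fixes l :: "'g => 'y vec"
assumes G: "lemb G l c" and K: "subgroup K G"
 and b: "!!y. c y ~= 0 ==> \<exists>t\<in>K. l t=sc (c y) (bs y)"
shows "K=carrier G"
proof
interpret comm_group G by(rule lemb_comm[OF G])
show "K <= carrier G" using K by(rule subgroup.subset)
show "carrier G <= K"
proof
 fix x assume x: "x:carrier G"
 have int: "\<exists>t\<in>K. l t=sc (of_int k) z" if z: "\<exists>t\<in>K. l t=z" for k z
 proof -
  obtain t where t: "t:K" "l t=z" using z by blast
  hence "t [^]\<^bsub>G\<^esub> k:K" using subgroup_int_pow_closed[OF K] by blast
  moreover have "t:carrier G" using t K subgroup.subset by blast
  ultimately show ?thesis using lemb_int_pow[OF G, of t k] t by blast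
 qed
 have sum: "\<exists>t\<in>K. l t=sum f A" if "!!a. a:A ==> \<exists>t\<in>K. l t=f a" for f :: "'y => 'y vec" and A
  using that
 proof (induction A rule: infinite_finite_induct)
  case (insert a A)
  obtain s t where "s:K" "t:K" "l s=f a" "l t=sum f A" using insert by blast
  moreover hence "l (s \<otimes>\<^bsub>G\<^esub> t)=f a + sum f A"
   using lemb_mult[OF G] subgroup.subset[OF K] by(metis subsetD)
  ultimately show ?case using insert(1,2) subgroup.m_closed[OF K] by(metis sum.insert)
 qed (use subgroup.one_closed[OF K] lemb_one[OF G] in auto)
 obtain k :: "'y => int" where k: "l x=(\<Sum>y\<in>keys (l x). sc (of_int (k y)) (sc (c y) (bs y)))"
  using lat_decomp[OF lemb_lat[OF G x]] .
 have "\<exists>t\<in>K. l t=l x" by(subst k) (intro sum int b lat_keys[OF lemb_lat[OF G x]])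
 then obtain t where "t:K" "l t=l x" by blast
 thus "x:K" using lemb_inj[OF G _ x, of t] K subgroup.subset by blast
qed
qed

text \<open>Transport of a linear map of lattices to the embedded groups.\<close>

definition trm :: "('h, 'm) monoid_scheme => ('h => 'z vec) => 'z vec => 'h" where
"trm H m z=inv_into (carrier H) m z"

lemma trm_in: "lemb H m d ==> z:lat d ==> trm H m z:carrier H"
and trm_eq: "lemb H m d ==> z:lat d ==> m (trm H m z)=z"
unfolding trm_def by(metis inv_into_into lemb_image, metis f_inv_into_f lemb_image)

lemma trm_emb: "lemb H m d ==> x:carrier H ==> trm H m (m x)=x" by(metis lemb_inj lemb_lat trm_eq trm_in)

lemma trm_hom:
assumes G: "lemb G l c" and H: "lemb H m d" and F: "linmap F" "!!z. z:lat c ==> F z:lat d"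
shows "(%x. trm H m (F (l x))):hom G H"
proof (rule homI)
have F': "F (l x):lat d" if "x:carrier G" for x using F(2) lemb_lat[OF G that] by blast
interpret G: group G by(rule lemb_group[OF G])
interpret H: group H by(rule lemb_group[OF H])
show "trm H m (F (l x)):carrier H" if "x:carrier G" for x using trm_in[OF H F'[OF that]] .
show "trm H m (F (l (x \<otimes>\<^bsub>G\<^esub> y)))=trm H m (F (l x)) \<otimes>\<^bsub>H\<^esub> trm H m (F (l y))"
 if "x:carrier G" "y:carrier G" for x y
 by(rule lemb_inj[OF H]) (use that in "simp_all add: trm_in[OF H] trm_eq[OF H] F' lemb_mult[OF H] lemb_mult[OF G] linmap_add[OF F(1)]
  lat_add")
qed

lemma hom_eq_on_generators:
assumes G: "group G" and H: "group H" and f: "f:hom G H" and g: "g:hom G H"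
 and T: "generate G T=carrier G" "T <= carrier G" "!!x. x:T ==> f x=g x" and x: "x:carrier G"
shows "f x=g x"
proof -
interpret G: group G by(rule G)
interpret f: group_hom G H f using G H f by(simp add: group_hom_def group_hom_axioms_def)
interpret g: group_hom G H g using G H g by(simp add: group_hom_def group_hom_axioms_def)
have "x:generate G T" using x T by simp
thus ?thesis
proof (induction rule: generate.induct)
 case (inv h)
 thus ?case using T by(simp add: subsetD)
next
 case (eng h k)
 thus ?case using G.generate_in_carrier[OF T(2)] by(simp add: f.hom_mult g.hom_mult)
qed (use T in auto)
qed

lemma hom_with_values_eq:
assumes G: "group G" and H: "group H" and f: "f:hom G H" "!!x y. (x, y):VV ==> f x=y"
 and VV: "fst ` VV <= carrier G" "generate G (fst ` VV)=carrier G"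
shows "hom_with_values G H VV=restrict f (carrier G)" unfolding hom_with_values_def
proof (rule the_equality)
interpret G: group G by(rule G)
have "restrict f (carrier G):hom G H" using f(1) by(auto simp: hom_def Pi_iff)
thus "restrict f (carrier G):hom G H & restrict f (carrier G):extensional (carrier G) &
  (\<forall>(x, y)\<in>VV. restrict f (carrier G) x=y)" using f(2) VV(1) by force
fix g assume g: "g:hom G H & g:extensional (carrier G) & (\<forall>(x, y)\<in>VV. g x=y)"
show "g=restrict f (carrier G)"
proof (rule extensionalityI)
 fix x assume x: "x:carrier G"
 have "g x=f x" by(rule hom_eq_on_generators[OF G H _ f(1) VV(2) VV(1) _ x]) (use g f(2) in force)+
 thus "g x=restrict f (carrier G) x" using x by simp
qed (use g in auto)
qed

subsection \<open>Presentations\<close>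

locale presentation =
fixes S :: "'s set" and R :: "('s \<Rightarrow>\<^sub>0 int) set"
assumes R: "!!r. r:R ==> keys r <= S"
begin

lemma R_sub: "R <= carrier (FA S)" using R by auto

interpretation F: comm_group "FA S" by(rule abelian_free_Abelian_group)

lemma gen_subgroup: "subgroup (gen S R) (FA S)" by(rule F.generate_is_subgroup[OF R_sub])

lemma gen_normal: "gen S R \<lhd> FA S" by(rule F.subgroup_imp_normal[OF gen_subgroup])

lemma gen_keys: "c:gen S R ==> keys c <= S"
using subsetD[OF subgroup.subset[OF gen_subgroup]] by(simp only: carrier_free_Abelian_group_iff)

lemma gen_0: "0:gen S R" using subgroup.one_closed[OF gen_subgroup] by simp

lemma gen_add: "a:gen S R ==> b:gen S R ==> a + b:gen S R"
using subgroup.m_closed[OF gen_subgroup, of a b] by simp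

lemma gen_uminus: "a:gen S R ==> - a:gen S R"
using subgroup.m_inv_closed[OF gen_subgroup, of a] gen_keys[of a] by simp

lemma gen_diff: "a:gen S R ==> b:gen S R ==> a - b:gen S R" using gen_add[OF _ gen_uminus, of a b] by simp

lemma gen_cmul: "c:gen S R ==> frag_cmul k c:gen S R"
proof -
assume c: "c:gen S R"
have n: "frag_cmul (int n) c:gen S R" for n
 by(induction n) (auto simp: gen_0 frag_cmul_distrib intro!: gen_add c)
show ?thesis
proof (cases "k >= 0")
 case True
 thus ?thesis using n[of "nat k"] by simp
next
 case False
 thus ?thesis using gen_uminus[OF n[of "nat (- k)"]] by simp
qed
qed

lemma gen_R: "r:R ==> r:gen S R" by(rule generate.incl)

lemma in_class: "c':presented_class S R c \<longleftrightarrow> c' - c:gen S R"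
unfolding presented_class_def r_coset_def by(auto simp: algebra_simps intro: bexI[of _ "c' - c"])

lemma class_eq_iff: "presented_class S R c=presented_class S R c' \<longleftrightarrow> c - c':gen S R"
proof
assume "presented_class S R c=presented_class S R c'"
moreover have "c:presented_class S R c" by(simp add: in_class gen_0)
ultimately show "c - c':gen S R" by(simp add: in_class)
next
assume h: "c - c':gen S R"
have "d - c:gen S R \<longleftrightarrow> d - c':gen S R" for d
 using gen_add[OF _ h, of "d - c"] gen_diff[OF _ h, of "d - c'"] by auto
thus "presented_class S R c=presented_class S R c'" by(auto simp: in_class)
qed

lemma presented_comm_group: "comm_group (presented S R)"
unfolding presented_def by(rule F.abelian_FactGroup[OF gen_subgroup])

lemma carrier_presented: "carrier (presented S R)=presented_class S R ` {c. keys c <= S}"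
unfolding presented_def carrier_FactGroup by(auto simp: presented_class_def)

lemma presented_mult: "keys a <= S ==> keys b <= S ==>
 presented_class S R a \<otimes>\<^bsub>presented S R\<^esub> presented_class S R b=presented_class S R (a + b)"
unfolding presented_def using normal.rcos_sum[OF gen_normal, of a b] by(simp add: presented_class_def)

lemma presented_one: "\<one>\<^bsub>presented S R\<^esub> = presented_class S R 0"
unfolding presented_def by(auto simp: in_class)

lemma presented_generate: "generate (presented S R) (presented_class S R ` frag_of ` S)=carrier (presented S R)"
proof
interpret P: comm_group "presented S R" by(rule presented_comm_group)
have sub: "presented_class S R ` frag_of ` S <= carrier (presented S R)" unfolding carrier_presented by auto
thus "generate (presented S R) (presented_class S R ` frag_of ` S) <= carrier (presented S R)"
 by(rule P.generate_incl)
have K: "subgroup (generate (presented S R) (presented_class S R ` frag_of ` S)) (presented S R)"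
 by(rule P.generate_is_subgroup[OF sub])
have "keys c <= S & presented_class S R c:generate (presented S R) (presented_class S R ` frag_of ` S)"
 if "keys c <= S" for c using that
proof (induction c rule: frag_induction)
 case zero
 show ?case using subgroup.one_closed[OF K] by(simp add: presented_one)
next
 case (one x)
 thus ?case by(auto intro: generate.incl)
next
 case (diff a b)
 have "presented_class S R (- b) \<otimes>\<^bsub>presented S R\<^esub> presented_class S R b = \<one>\<^bsub>presented S R\<^esub>"
  using diff by(simp add: presented_mult presented_one)
 hence "inv\<^bsub>presented S R\<^esub> presented_class S R b=presented_class S R (- b)"
  using diff by(intro P.inv_equality) (auto simp: carrier_presented)
 hence "presented_class S R a \<otimes>\<^bsub>presented S R\<^esub> presented_class S R (- b)
   : generate (presented S R) (presented_class S R ` frag_of ` S)"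
  using diff K by(metis subgroup.m_closed subgroup.m_inv_closed)
 thus ?case using diff keys_diff[of a b] by(auto simp: presented_mult)
qed
thus "carrier (presented S R) <= generate (presented S R) (presented_class S R ` frag_of ` S)"
 by(auto simp: carrier_presented)
qed

definition spn :: "'s set => ('s \<Rightarrow>\<^sub>0 int) set" where
"spn Y = {c. \<exists>b. keys b <= Y & c - b:gen S R}"

lemma spn_0: "0:spn Y" unfolding spn_def using gen_0 by(auto intro!: exI[of _ 0])

lemma spn_of: "y:Y ==> frag_of y:spn Y" unfolding spn_def using gen_0 by(auto intro!: exI[of _ "frag_of y"])

lemma spn_add: "a:spn Y ==> b:spn Y ==> a + b:spn Y"
proof -
assume "a:spn Y" "b:spn Y"
then obtain a' b' where "keys a' <= Y" "a - a':gen S R" "keys b' <= Y" "b - b':gen S R" by(auto simp: spn_def)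
thus ?thesis unfolding spn_def using gen_add[of "a - a'" "b - b'"] keys_add[of a' b']
 by(auto intro!: exI[of _ "a' + b'"] simp: algebra_simps)
qed

lemma spn_uminus: "a:spn Y ==> - a:spn Y"
proof -
assume "a:spn Y"
then obtain a' where "keys a' <= Y" "a - a':gen S R" by(auto simp: spn_def)
thus ?thesis
 unfolding spn_def using gen_uminus[of "a - a'"] by(auto intro!: exI[of _ "- a'"] simp: algebra_simps)
qed

lemma spn_cong: "c - c':gen S R ==> c':spn Y ==> c:spn Y"
proof -
assume h: "c - c':gen S R" "c':spn Y"
then obtain b where "keys b <= Y" "c' - b:gen S R" by(auto simp: spn_def)
thus ?thesis unfolding spn_def using gen_add[OF h(1), of "c' - b"] by(auto intro!: exI[of _ b])
qed

lemma spn_diff: "a:spn Y ==> b:spn Y ==> a - b:spn Y" using spn_add[OF _ spn_uminus, of a Y b] by simp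

lemma spn_cmul: "a:spn Y ==> frag_cmul k a:spn Y"
proof -
assume "a:spn Y"
then obtain b where b: "keys b <= Y" "a - b:gen S R" unfolding spn_def by blast
hence "keys (frag_cmul k b) <= Y" "frag_cmul k a - frag_cmul k b:gen S R"
 using keys_cmul[of k b] gen_cmul[of "a - b" k] by(auto simp: frag_cmul_diff_right)
thus ?thesis unfolding spn_def by blast
qed

lemma spn_all:
assumes "!!s. s:S ==> frag_of s:spn Y" "keys c <= S" shows "c:spn Y"
using assms(2) by(induction c rule: frag_induction) (auto intro: spn_0 spn_diff assms(1))

definition pe :: "('s => 'y vec) => ('s \<Rightarrow>\<^sub>0 int) set => 'y vec" where
"pe l C=ev l (SOME c. c:C)"

lemma gen_ev:
assumes "!!r. r:R ==> ev l r=0" "c:gen S R" shows "ev l c=0" using assms(2)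
proof (induction rule: generate.induct)
case (inv h)
hence "inv\<^bsub>FA S\<^esub> h = - h" using R by simp
thus ?case using assms(1) inv by simp
qed (use assms(1) in auto)

lemma pe_class:
assumes "!!r. r:R ==> ev l r=0" shows "pe l (presented_class S R c)=ev l c"
proof -
have "c:presented_class S R c" by(simp add: in_class gen_0)
moreover define d where "d=(SOME c'. c':presented_class S R c)"
ultimately have "d:presented_class S R c" by(metis someI)
hence "ev l (d - c)=0" using gen_ev[OF assms] by(simp only: in_class)
thus ?thesis by(simp add: pe_def d_def)
qed

text \<open>If the generators reduce to a set \<open>Y\<close> whose images are nonzero multiples of distinct basis
  vectors, evaluation embeds the presented group.\<close>

lemma presented_lemb:
assumes kill: "!!r. r:R ==> ev l r=0"
 and Y: "Y <= S" "inj_on \<kappa> Y" "!!y. y:Y ==> l y=sc (c (\<kappa> y)) (bs (\<kappa> y))"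
 and c: "!!k. c k ~= 0 \<longleftrightarrow> k : \<kappa> ` Y"
 and red: "!!s. s:S ==> frag_of s:spn Y"
shows "lemb (presented S R) (pe l) c"
proof -
have look: "lookup (ev l b) k=(if k : \<kappa> ` Y then of_int (lookup b (inv_into Y \<kappa> k)) * c k else 0)"
 if b: "keys b <= Y" for b k
proof -
 have "lookup (ev l b) k=(\<Sum>y\<in>keys b. of_int (lookup b y) * lookup (l y) k)"
  unfolding ev_def lext_def lookup_sum by simp
 also have "... = (\<Sum>y\<in>keys b. if \<kappa> y=k then of_int (lookup b y) * c k else 0)"
  using b Y(3) by(intro sum.cong refl) (auto simp: lookup_single when_def subset_iff)
 also have "... = (if k : \<kappa> ` Y then of_int (lookup b (inv_into Y \<kappa> k)) * c k else 0)"
 proof (cases "k : \<kappa> ` Y")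
  case True
  then obtain y where y: "y:Y" "k = \<kappa> y" by blast
  have "(\<Sum>y'\<in>keys b. if \<kappa> y'=k then of_int (lookup b y') * c k else 0) =
    (\<Sum>y'\<in>keys b. if y'=y then of_int (lookup b y') * c k else 0)"
   using b y Y(2) by(intro sum.cong refl if_cong) (auto dest: inj_onD)
  thus ?thesis using True y Y(2) by(simp add: in_keys_iff)
 next
  case False
  hence "\<kappa> y ~= k" if "y:keys b" for y using that b by blast
  thus ?thesis using False by simp
 qed
 finally show ?thesis .
qed
have obt: "\<exists>b. keys b <= Y & C=presented_class S R b & pe l C=ev l b"
 if C: "C:carrier (presented S R)" for C
proof -
 obtain d where d: "keys d <= S" "C=presented_class S R d" using C unfolding carrier_presented by(elim imageE) simp
 then obtain b where b: "keys b <= Y" "d - b:gen S R" using spn_all[OF red d(1)] unfolding spn_def by blast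
 have "C=presented_class S R b" unfolding d(2) class_eq_iff by(rule b(2))
 thus ?thesis using b(1) pe_class[OF kill, of b] by auto
qed
interpret P: comm_group "presented S R" by(rule presented_comm_group)
have mult: "pe l (C \<otimes>\<^bsub>presented S R\<^esub> D)=pe l C + pe l D"
 if "C:carrier (presented S R)" "D:carrier (presented S R)" for C D
 using that by(auto simp: carrier_presented presented_mult pe_class[OF kill])
have "inj_on (pe l) (carrier (presented S R))"
proof (rule inj_onI)
 fix C D assume CD: "C:carrier (presented S R)" "D:carrier (presented S R)" "pe l C=pe l D"
 obtain a b where ab: "keys a <= Y" "C=presented_class S R a" "pe l C=ev l a"
  "keys b <= Y" "D=presented_class S R b" "pe l D=ev l b" using obt[OF CD(1)] obt[OF CD(2)] by blast
 have "lookup a y=lookup b y" for y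
 proof (cases "y:Y")
  case True
  have "lookup (ev l a) (\<kappa> y)=lookup (ev l b) (\<kappa> y)" using CD(3) ab by simp
  thus ?thesis using True Y(2) c[of "\<kappa> y"] by(simp add: look ab)
 next
  case False
  hence "y ~: keys a" "y ~: keys b" using ab by blast+
  thus ?thesis by(simp add: in_keys_iff)
 qed
 hence "a=b" by(intro poly_mapping_eqI) auto
 thus "C=D" using ab by simp
qed
moreover have "pe l ` carrier (presented S R)=lat c"
proof
 show "pe l ` carrier (presented S R) <= lat c"
 proof clarify
  fix C assume "C:carrier (presented S R)"
  then obtain b where "keys b <= Y" "pe l C=ev l b" using obt by blast
  thus "pe l C:lat c" by(auto simp: lat_def look intro: exI[of _ 0])
 qed
 show "lat c <= pe l ` carrier (presented S R)"
 proof
  fix z assume z: "z:lat c"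
  obtain k :: "_ => int" where k: "z=(\<Sum>y\<in>keys z. sc (of_int (k y)) (sc (c y) (bs y)))"
   using lat_decomp[OF z] .
  define b where "b=(\<Sum>y\<in>keys z. frag_cmul (k y) (frag_of (inv_into Y \<kappa> y)))"
  have inv: "inv_into Y \<kappa> y:Y" "\<kappa> (inv_into Y \<kappa> y)=y" if "y:keys z" for y
   using lat_keys[OF z that] c by(auto intro: inv_into_into f_inv_into_f)
  have "keys b <= S" unfolding b_def using inv Y(1) keys_cmul by(intro order.trans[OF keys_sum]) fastforce
  moreover have "ev l b=z" unfolding b_def by(subst (2) k) (simp add: ev_sum inv Y(3) cong: sum.cong)
  ultimately have "z=pe l (presented_class S R b)" "presented_class S R b:carrier (presented S R)"
   using pe_class[OF kill, of b] by(simp_all add: carrier_presented)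
  thus "z:pe l ` carrier (presented S R)" by(rule image_eqI)
 qed
qed
ultimately show ?thesis using mult presented_comm_group by(simp add: lemb_def)
qed

text \<open>The same with the basis indexed by the lattice.\<close>

corollary presented_lemb_indexed:
 assumes kill: "!!r. r:R ==> ev l r=0"
   and g: "!!k. c k ~= 0 ==> g k:S & l (g k)=sc (c k) (bs k)"
   and red: "!!s. s:S ==> frag_of s:spn (g ` {k. c k ~= 0})"
 shows "lemb (presented S R) (pe l) c"
proof -
 let ?K = "{k. c k ~= 0}"
 have inj: "inj_on g ?K"
 proof (rule inj_onI)
   fix k k' assume k: "k:?K" "k':?K" "g k=g k'"
   hence "c k ~= 0" "c k' ~= 0" by simp_all
   hence "l (g k)=sc (c k) (bs k)" "l (g k')=sc (c k') (bs k')" using g by blast+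
   hence "sc (c k) (bs k)=sc (c k') (bs k')" unfolding k(3) by(rule trans[OF sym])
   hence "c k=lookup (sc (c k') (bs k')) k" by(metis lookup_sc lookup_single_eq mult.right_neutral)
   moreover have "lookup (sc (c k') (bs k')) k=0" if "k ~= k'" using that by(simp add: lookup_single_not_eq)
   ultimately show "k=k'" using \<open>c k ~= 0\<close> by(metis (no_types))
 qed
 have inv: "inv_into ?K g (g k)=k" if "c k ~= 0" for k
   using inv_into_f_f[OF inj] that by simp
 show ?thesis
 proof (rule presented_lemb[where \<kappa> = "inv_into ?K g" and Y = "g ` ?K"])
   show "g ` ?K <= S" using g by blast
   show "inj_on (inv_into ?K g) (g ` ?K)" by(rule inj_on_inv_into) simp
   show "l y=sc (c (inv_into ?K g y)) (bs (inv_into ?K g y))" if y: "y:g ` ?K" for y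
   proof -
     obtain k where k: "y=g k" "c k ~= 0" using y by blast
     show ?thesis unfolding k(1) inv[OF k(2)] using g[OF k(2)] by(rule conjunct2)
   qed
   show "c k ~= 0 \<longleftrightarrow> k:inv_into ?K g ` g ` ?K" for k
   proof
     assume "c k ~= 0"
     hence "k=inv_into ?K g (g k)" "g k:g ` ?K" using inv[of k] by(metis, blast)
     thus "k:inv_into ?K g ` g ` ?K" by(rule image_eqI)
   next
     assume "k:inv_into ?K g ` g ` ?K"
     thus "c k ~= 0" using inv by auto
   qed
 qed (rule kill red; assumption)+
qed

end

section \<open>Exterior powers and divided powers of a free abelian group\<close>

lemma Qe_bs_srt: "srt J ==> Qe (map bs J) 1=bs (J, {#})" by(induction J) (auto simp: il_less)

locale latgroup =
fixes A :: "('a, 'm) monoid_scheme" and cv :: "'a => 'x::linorder vec" and X :: "'x set"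
assumes cv: "lemb A cv (%x. if x:X then 1 else 0)"
begin

sublocale A: comm_group A by(rule lemb_comm[OF cv])

lemma cv_vecs: "a:carrier A ==> cv a:vecs X" unfolding vecs_def by(rule lemb_lat[OF cv])

lemma cv_list_vecs: "set xs <= carrier A ==> set (map cv xs) <= vecs X" using cv_vecs by auto

definition be :: "'x => 'a" where "be x=trm A cv (bs x)"

lemma be: "x:X ==> be x:carrier A" "x:X ==> cv (be x)=bs x"
using trm_in[OF cv] trm_eq[OF cv] vecs_bs[of x X] by(auto simp: be_def vecs_def)

lemma be_list: "set J <= X ==> set (map be J) <= carrier A" "set J <= X ==> map cv (map be J)=map bs J"
using be by auto

lemma basis_induct [consumes 1, case_names one basis mult inv]:
assumes a: "a:carrier A" and one: "P \<one>\<^bsub>A\<^esub>" and basis: "!!x. x:X ==> P (be x)"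
 and mult: "!!a b. a:carrier A ==> b:carrier A ==> P a ==> P b ==> P (a \<otimes>\<^bsub>A\<^esub> b)"
 and inv: "!!a. a:carrier A ==> P a ==> P (inv\<^bsub>A\<^esub> a)"
shows "P a"
proof -
let ?K = "{a:carrier A. P a}"
have "subgroup ?K A" by(rule A.subgroupI) (use one mult inv in auto)
hence "?K=carrier A" by(rule lemb_full_subgroup[OF cv]) (use basis be in "auto split: if_splits")
thus ?thesis using a by blast
qed

subsection \<open>Exterior powers\<close>

lemma ext_presentation: "presentation (words A i) (ext_relators A i)"
proof
fix r assume "r:ext_relators A i"
thus "keys r <= words A i" unfolding ext_relators_def
proof (elim UnE CollectE exE conjE)
 fix us vs x y assume r: "r=frag_of (us@(x \<otimes>\<^bsub>A\<^esub> y)#vs) - frag_of (us@x#vs) - frag_of (us@y#vs)"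
  and w: "us@x#vs:words A i" "y:carrier A"
 hence "us@(x \<otimes>\<^bsub>A\<^esub> y)#vs:words A i" "us@y#vs:words A i" by(auto simp: words_def)
 thus ?thesis using w(1) keys_diff[of "frag_of (us@(x \<otimes>\<^bsub>A\<^esub> y)#vs) - frag_of (us@x#vs)" "frag_of (us@y#vs)"]
   keys_diff[of "frag_of (us@(x \<otimes>\<^bsub>A\<^esub> y)#vs)" "frag_of (us@x#vs)"] by(auto simp: r)
qed auto
qed

sublocale ext: presentation "words A i" "ext_relators A i" for i by(rule ext_presentation)

definition le :: "'a list => 'x kos" where "le xs=Qe (map cv xs) 1"

lemma le_kill: "r:ext_relators A i ==> ev le r=0" unfolding ext_relators_def
proof (elim UnE CollectE exE conjE)
fix us vs x y assume r: "r=frag_of (us@(x \<otimes>\<^bsub>A\<^esub> y)#vs) - frag_of (us@x#vs) - frag_of (us@y#vs)"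
 and w: "us@x#vs:words A i" "y:carrier A"
hence "cv (x \<otimes>\<^bsub>A\<^esub> y)=cv x + cv y" by(intro lemb_mult[OF cv]) (auto simp: words_def)
thus "ev le r=0" using linmap_add[OF linmap_Qe_nth[OF linmap_id], of "map cv us" "cv x" "cv y" "map cv vs" 1]
 by(simp add: r le_def)
next
fix xs j k assume r: "r=frag_of xs" "xs:words A i" and "j < k" "k < i" "xs ! j=xs ! k"
hence "j < length xs" "k < length xs" "j ~= k" "xs ! j=xs ! k" by(auto simp: words_def)
hence "\<not> distinct xs" by(metis nth_eq_iff_index_eq)
thus "ev le r=0" by(simp add: r le_def Qe_not_distinct)
qed

lemma ext_rel_add: "us@x#vs:words A i ==> y:carrier A ==>
 frag_of (us@(x \<otimes>\<^bsub>A\<^esub> y)#vs) - frag_of (us@x#vs) - frag_of (us@y#vs):gen (words A i) (ext_relators A i)"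
by(rule ext.gen_R) (auto simp: ext_relators_def)

lemma ext_rel_repeat: "xs:words A i ==> \<not> distinct xs ==> frag_of xs:gen (words A i) (ext_relators A i)"
proof (rule ext.gen_R)
assume xs: "xs:words A i" "\<not> distinct xs"
then obtain j k where "j < length xs" "k < length xs" "j ~= k" "xs ! j=xs ! k" by(auto simp: distinct_conv_nth)
hence "\<exists>j k. j < k & k < length xs & xs ! j=xs ! k" by(metis linorder_neqE_nat)
thus "frag_of xs:ext_relators A i" using xs by(auto simp: ext_relators_def words_def)
qed

lemma ext_swap:
assumes "us@x#y#vs:words A i"
shows "frag_of (us@x#y#vs) + frag_of (us@y#x#vs):gen (words A i) (ext_relators A i)"
proof -
let ?G = "gen (words A i) (ext_relators A i)"
have w: "x:carrier A" "y:carrier A" "set us <= carrier A" "set vs <= carrier A" "length us + length vs + 2=i"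
 using assms by(auto simp: words_def)
define f where "f=(%a b. frag_of (us@a#b#vs))"
let ?z = "x \<otimes>\<^bsub>A\<^esub> y"
have add1: "f (x \<otimes>\<^bsub>A\<^esub> y) b - f x b - f y b:?G" if "b:carrier A" for b
 unfolding f_def using w that by(intro ext_rel_add) (auto simp: words_def)
have add2: "f a (x \<otimes>\<^bsub>A\<^esub> y) - f a x - f a y:?G" if "a:carrier A" for a
 using ext_rel_add[of "us@[a]" x vs i y] w that by(simp add: words_def f_def)
have rep: "f a a:?G" if "a:carrier A" for a
 unfolding f_def using w that by(intro ext_rel_repeat) (auto simp: words_def)
have "f x y + f y x=f ?z ?z - (f ?z ?z - f x ?z - f y ?z) - (f x ?z - f x x - f x y) - (f y ?z - f y x - f y y) - f x x - f y y"
 by simp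
also have "... : ?G" using w by(intro ext.gen_diff add1 add2 rep A.m_closed)
finally show ?thesis by(simp add: f_def)
qed

lemma ext_insort:
assumes "srt J" "x ~: set J" "set us <= carrier A" "insert x (set J) <= X" "length us + length J + 1=i"
shows "\<exists>k. frag_of (us@be x#map be J) - frag_cmul k (frag_of (us@map be (insort x J))):gen (words A i) (ext_relators A i)"
using assms
proof (induction J arbitrary: us)
case Nil
thus ?case using ext.gen_0 by(intro exI[of _ 1]) simp
next
case (Cons y J)
show ?case
proof (cases "x < y")
 case True
 thus ?thesis using ext.gen_0 by(intro exI[of _ 1]) (simp add: less_imp_le)
next
 case False
 hence ins: "insort x (y#J)=y#insort x J" using Cons.prems by auto
 have "\<exists>k. frag_of ((us@[be y])@be x#map be J) - frag_cmul k (frag_of ((us@[be y])@map be (insort x J))):gen (words A i) (ext_relators A i)"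
  using Cons.prems be by(intro Cons.IH) auto
 then obtain k where k: "frag_of (us@be y#be x#map be J) - frag_cmul k (frag_of (us@map be (insort x (y#J)))):gen (words A i) (ext_relators A i)"
  unfolding ins by auto
 have "frag_of (us@be x#be y#map be J) + frag_of (us@be y#be x#map be J):gen (words A i) (ext_relators A i)"
  using Cons.prems be by(intro ext_swap) (auto simp: words_def)
 from ext.gen_diff[OF this k] show ?thesis
  by(intro exI[of _ "- k"]) (simp add: algebra_simps flip: minus_frag_cmul)
qed
qed

lemma ext_sort:
assumes "distinct J" "set us <= carrier A" "set J <= X" "length us + length J=i"
shows "\<exists>k. frag_of (us@map be J) - frag_cmul k (frag_of (us@map be (sort J))):gen (words A i) (ext_relators A i)"
using assms
proof (induction J arbitrary: us)
case Nil
thus ?case using ext.gen_0 by(intro exI[of _ 1]) simp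
next
case (Cons x J)
have "\<exists>k. frag_of ((us@[be x])@map be J) - frag_cmul k (frag_of ((us@[be x])@map be (sort J))):gen (words A i) (ext_relators A i)"
 using Cons.prems be by(intro Cons.IH) auto
then obtain k where k: "frag_of (us@be x#map be J) - frag_cmul k (frag_of (us@be x#map be (sort J))):gen (words A i) (ext_relators A i)"
 by auto
obtain k' where k': "frag_of (us@be x#map be (sort J)) - frag_cmul k' (frag_of (us@map be (insort x (sort J)))):gen (words A i) (ext_relators A i)"
 using ext_insort[of "sort J" x us i] Cons.prems by(auto simp: strict_sorted_iff)
have "f - frag_cmul k g + frag_cmul k (g - frag_cmul k' h)=f - frag_cmul (k * k') h" for f g h :: "'a list \<Rightarrow>\<^sub>0 int"
 by(rule poly_mapping_eqI) (simp add: lookup_add lookup_minus algebra_simps)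
with ext.gen_add[OF k ext.gen_cmul[OF k', of k]] show ?case by(intro exI[of _ "k * k'"]) simp
qed

lemma ext_reduce:
assumes "xs:words A i"
shows "frag_of xs:ext.spn i (map be ` {J. srt J & length J=i & set J <= X})"
proof -
let ?Y = "map be ` {J. srt J & length J=i & set J <= X}"
have "set us <= carrier A ==> set J <= X ==> length us + length J=i ==> frag_of (us@map be J):ext.spn i ?Y" for us J
proof (induction us arbitrary: J rule: rev_induct)
 case Nil
 show ?case
 proof (cases "distinct J")
  case True
  then obtain k where k: "frag_of (map be J) - frag_cmul k (frag_of (map be (sort J))):gen (words A i) (ext_relators A i)"
   using ext_sort[of J "[]" i] Nil by auto
  have "srt (sort J)" using True by(simp add: strict_sorted_iff)
  hence "frag_cmul k (frag_of (map be (sort J))):ext.spn i ?Y" using Nil by(intro ext.spn_cmul ext.spn_of) auto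
  thus ?thesis using ext.spn_cong[OF k] by simp
 next
  case False
  hence "frag_of (map be J):gen (words A i) (ext_relators A i)"
   using Nil be_list(1)[OF Nil(2)] by(intro ext_rel_repeat) (auto simp: words_def distinct_map)
  thus ?thesis using ext.spn_cong[of "frag_of (map be J)" 0] ext.spn_0 by simp
 qed
next
 case (snoc v us)
 have us: "set us <= carrier A" and len: "length us + length J + 1=i" using snoc.prems by auto
 have J: "set (map be J) <= carrier A" by(rule be_list(1)[OF snoc.prems(2)])
 have add: "frag_of (us@(a \<otimes>\<^bsub>A\<^esub> b)#map be J) - (frag_of (us@a#map be J) + frag_of (us@b#map be J))
   : gen (words A i) (ext_relators A i)" if "a:carrier A" "b:carrier A" for a b
  using ext_rel_add[of us a "map be J" i b] that us J len by(simp add: words_def algebra_simps)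
 have one: "frag_of (us @ \<one>\<^bsub>A\<^esub> # map be J):ext.spn i ?Y"
 proof -
  have "frag_of (us @ \<one>\<^bsub>A\<^esub> # map be J) - 0:gen (words A i) (ext_relators A i)"
   using ext.gen_uminus[OF add[of "\<one>\<^bsub>A\<^esub>" "\<one>\<^bsub>A\<^esub>"]] by simp
  thus ?thesis by(rule ext.spn_cong) (rule ext.spn_0)
 qed
 have "v:carrier A" using snoc.prems by simp
 hence "frag_of (us@v#map be J):ext.spn i ?Y"
 proof (induction v rule: basis_induct)
  case (basis x)
  thus ?case using snoc.IH[of "x#J"] us len snoc.prems(2) by simp
 next
  case (mult a b)
  thus ?case by(intro ext.spn_cong[OF add] ext.spn_add)
 next
  case (inv a)
  let ?f = "%a. frag_of (us@a#map be J)"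
  have "?f (inv\<^bsub>A\<^esub> a) - (?f \<one>\<^bsub>A\<^esub> - ?f a):gen (words A i) (ext_relators A i)"
   using ext.gen_uminus[OF add[of a "inv\<^bsub>A\<^esub> a"]] inv by(simp add: algebra_simps)
  thus ?case by(rule ext.spn_cong) (intro ext.spn_diff one inv)
 qed (rule one)
 thus ?case by simp
qed
from this[of xs "[]"] assms show ?thesis by(simp add: words_def)
qed

definition lext_c :: "nat => 'x list \<times> 'x multiset => rat" where
"lext_c i=(%(J, u). if srt J & length J=i & set J <= X & u = {#} then 1 else 0)"

text \<open>Sorted wedges of basis elements span, and their images are distinct basis vectors.\<close>

lemma ext_lemb: "lemb (ext_power A i) (ext.pe le) (lext_c i)" unfolding ext_power_def
proof (rule ext.presented_lemb_indexed[where g = "%(J, u). map be J"])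
fix k :: "'x list \<times> 'x multiset" assume "lext_c i k ~= 0"
then obtain J where J: "k=(J, {#})" "srt J" "length J=i" "set J <= X"
 by(auto simp: lext_c_def split: if_splits prod.splits)
moreover have "le (map be J)=bs (J, {#})" unfolding le_def be_list(2)[OF J(4)] by(rule Qe_bs_srt[OF J(2)])
ultimately show "(case k of (J, u) => map be J):words A i & le (case k of (J, u) => map be J)=sc (lext_c i k) (bs k)"
 using be_list(1)[OF J(4)] by(simp add: words_def lext_c_def)
next
fix s assume s: "s:words A i"
have "(%(J, u). map be J) ` {k. lext_c i k ~= 0} = map be ` {J. srt J & length J=i & set J <= X}"
proof -
 have "{k. lext_c i k ~= 0} = (%J. (J, {#})) ` {J. srt J & length J=i & set J <= X}"
  by(auto simp: lext_c_def split: if_splits)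
 thus ?thesis by(simp add: image_image)
qed
thus "frag_of s:ext.spn i ((%(J, u). map be J) ` {k. lext_c i k ~= 0})" using ext_reduce[OF s] by simp
qed (rule le_kill)

lemma wedge_emb: "xs:words A i ==> ext.pe le (wedge A xs)=Qe (map cv xs) 1"
and wedge_in: "xs:words A i ==> wedge A xs:carrier (ext_power A i)"
proof -
assume xs: "xs:words A i"
hence l: "length xs=i" by(simp add: words_def)
show "ext.pe le (wedge A xs)=Qe (map cv xs) 1"
 unfolding wedge_def l using ext.pe_class[of i le, OF le_kill] by(simp add: le_def)
show "wedge A xs:carrier (ext_power A i)"
 unfolding wedge_def l ext_power_def ext.carrier_presented using xs by auto
qed

end

subsection \<open>Divided powers\<close>

lemma frag_sum_eq: "p=(\<Sum>M\<in>keys p. frag_cmul (lookup p M) (frag_of M))"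
proof (rule poly_mapping_eqI)
fix k
have "lookup (\<Sum>M\<in>keys p. frag_cmul (lookup p M) (frag_of M)) k =
  (\<Sum>M\<in>keys p. if M=k then lookup p k else 0)" unfolding lookup_sum by(rule sum.cong) auto
also have "... = lookup p k" by(simp add: in_keys_iff)
finally show "lookup p k=lookup (\<Sum>M\<in>keys p. frag_cmul (lookup p M) (frag_of M)) k" ..
qed

lemma frag_cmul_eq: "frag_cmul k a = of_int k * a" for a :: "'m::comm_monoid_add \<Rightarrow>\<^sub>0 int"
proof -
have n: "frag_cmul (int n) a = of_nat n * a" for n by(induction n) (auto simp: frag_cmul_distrib algebra_simps)
show ?thesis
proof (cases "k >= 0")
 case True
 thus ?thesis using n[of "nat k"] by simp
next
 case False
 hence "frag_cmul k a = - frag_cmul (int (nat (- k))) a" by simp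
 also have "... = - (of_nat (nat (- k)) * a)" unfolding n ..
 also have "... = of_int k * a" using False by simp
 finally show ?thesis .
qed
qed

lemma frag_cmul_mult: "frag_cmul k a * b=frag_cmul k (a * b)"
and frag_mult_cmul: "a * frag_cmul k b=frag_cmul k (a * b)" for a b :: "'m::comm_monoid_add \<Rightarrow>\<^sub>0 int"
by(simp_all add: frag_cmul_eq ac_simps)

context latgroup
begin

abbreviation "PR == gamma_poly_ring A"

lemma PR_simps [simp]: "p \<otimes>\<^bsub>PR\<^esub> q=p * q" "p \<oplus>\<^bsub>PR\<^esub> q=p + q" "\<one>\<^bsub>PR\<^esub> = 1" "\<zero>\<^bsub>PR\<^esub> = 0"
by(simp_all add: gamma_poly_ring_def)

lemma PR_carrier: "p:carrier PR \<longleftrightarrow> (\<forall>M\<in>keys p. snd ` set_mset M <= carrier A)"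
by(simp add: gamma_poly_ring_def)

lemma PR_closed: "0:carrier PR" "1:carrier PR"
"p:carrier PR ==> q:carrier PR ==> p + q:carrier PR"
"p:carrier PR ==> q:carrier PR ==> p * q:carrier PR"
"p:carrier PR ==> - p:carrier PR"
proof -
show "p:carrier PR ==> q:carrier PR ==> p + q:carrier PR" using keys_add[of p q] unfolding PR_carrier by blast
show "p:carrier PR ==> q:carrier PR ==> p * q:carrier PR"
 using keys_mult[of p q] unfolding PR_carrier by fastforce
qed (auto simp: PR_carrier)

lemma PR_cring: "cring PR"
proof (rule cringI)
show "abelian_group PR"
proof (rule abelian_groupI)
 fix p assume "p:carrier PR"
 thus "\<exists>q\<in>carrier PR. q \<oplus>\<^bsub>PR\<^esub> p = \<zero>\<^bsub>PR\<^esub>"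
  using PR_closed(5) by(intro bexI[of _ "- p"]) auto
qed (auto intro: PR_closed simp: ac_simps)
show "Group.comm_monoid PR" by(rule comm_monoidI) (auto intro: PR_closed simp: ac_simps)
qed (auto simp: algebra_simps)

sublocale PR: cring PR by(rule PR_cring)

lemma PR_minus: "p:carrier PR ==> \<ominus>\<^bsub>PR\<^esub> p = - p"
using PR_closed(5)[of p] PR.minus_equality[of "- p" p] by simp

definition GI where "GI=gamma_ideal A"

lemma symbol_carrier: "a:carrier A ==> gamma_symbol i a:carrier PR" by(auto simp: PR_carrier gamma_symbol_def)

lemma PR_closed_more: "p:carrier PR ==> q:carrier PR ==> p - q:carrier PR"
"(of_nat n :: (nat \<times> 'a) multiset \<Rightarrow>\<^sub>0 int):carrier PR" "p:carrier PR ==> p ^ n:carrier PR"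
"(!!k. k:K ==> f k:carrier PR) ==> sum f K:carrier PR"
"(!!k. k:K ==> f k:carrier PR) ==> prod f K:carrier PR"
"p:carrier PR ==> frag_cmul k p:carrier PR"
proof -
show "p:carrier PR ==> q:carrier PR ==> p - q:carrier PR"
 using PR_closed(3)[of p "- q"] PR_closed(5)[of q] by simp
show "(of_nat n :: (nat \<times> 'a) multiset \<Rightarrow>\<^sub>0 int):carrier PR"
 by(induction n) (auto intro: PR_closed)
show "p:carrier PR ==> p ^ n:carrier PR" by(induction n) (auto intro: PR_closed)
show "(!!k. k:K ==> f k:carrier PR) ==> sum f K:carrier PR"
 by(induction K rule: infinite_finite_induct) (auto intro: PR_closed)
show "(!!k. k:K ==> f k:carrier PR) ==> prod f K:carrier PR"
 by(induction K rule: infinite_finite_induct) (auto intro: PR_closed)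
show "p:carrier PR ==> frag_cmul k p:carrier PR" using keys_cmul[of k p] by(auto simp: PR_carrier)
qed

lemma gamma_relators_carrier: "gamma_relators A <= carrier PR"
proof
fix r assume "r:gamma_relators A"
thus "r:carrier PR" by cases (auto intro!: PR_closed PR_closed_more symbol_carrier)
qed

lemma GI_ideal: "ideal GI PR"
unfolding GI_def gamma_ideal_def by(rule PR.genideal_ideal[OF gamma_relators_carrier])

lemma GI_rel: "r:gamma_relators A ==> r:GI"
unfolding GI_def gamma_ideal_def using PR.genideal_self[OF gamma_relators_carrier] by blast

lemma GI_carrier: "p:GI ==> p:carrier PR" using ideal.Icarr[OF GI_ideal] .

lemma GI_closed: "0:GI" "p:GI ==> q:GI ==> p + q:GI" "p:GI ==> - p:GI"
"p:GI ==> q:carrier PR ==> p * q:GI" "p:GI ==> q:carrier PR ==> q * p:GI"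
"p:GI ==> q:GI ==> p - q:GI"
proof -
interpret I: ideal GI PR by(rule GI_ideal)
show "0:GI" using additive_subgroup.zero_closed[OF I.is_additive_subgroup] by simp
show add: "p:GI ==> q:GI ==> p + q:GI" for p q using I.a_closed[of p q] by simp
show um: "p:GI ==> - p:GI" for p using I.a_inv_closed[of p] PR_minus[OF GI_carrier, of p] by simp
show "p:GI ==> q:carrier PR ==> p * q:GI" using I.I_r_closed[of p q] by simp
show "p:GI ==> q:carrier PR ==> q * p:GI" using I.I_l_closed[of p q] by simp
show "p:GI ==> q:GI ==> p - q:GI" using add[of p "- q"] um[of q] by simp
qed

lemma in_Gamma_class: "q:Gamma_class A p \<longleftrightarrow> q - p:GI"
unfolding Gamma_class_def GI_def[symmetric] a_r_coset_def' by(auto simp: algebra_simps intro: bexI[of _ "q - p"])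

lemma Gamma_class_eq_iff: "Gamma_class A p=Gamma_class A q \<longleftrightarrow> p - q:GI"
proof
assume "Gamma_class A p=Gamma_class A q"
moreover have "p:Gamma_class A p" by(simp add: in_Gamma_class GI_closed)
ultimately show "p - q:GI" by(simp add: in_Gamma_class)
next
assume h: "p - q:GI"
have "d - p:GI \<longleftrightarrow> d - q:GI" for d
 using GI_closed(2)[OF _ h, of "d - p"] GI_closed(6)[OF _ h, of "d - q"] by auto
thus "Gamma_class A p=Gamma_class A q" by(auto simp: in_Gamma_class)
qed

lemma Gamma_class_add:
"p:carrier PR ==> q:carrier PR ==> Gamma_class A p \<oplus>\<^bsub>Gamma_ring A\<^esub> Gamma_class A q=Gamma_class A (p + q)"
unfolding Gamma_ring_def Gamma_class_def GI_def[symmetric]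
using abelian_subgroup.a_rcos_sum[OF abelian_subgroupI3[OF ideal.axioms(1)[OF GI_ideal] PR.is_abelian_group], of p q]
by(simp add: FactRing_def)

lemma Gamma_class_mult:
"p:carrier PR ==> q:carrier PR ==> Gamma_class A p \<otimes>\<^bsub>Gamma_ring A\<^esub> Gamma_class A q=Gamma_class A (p * q)"
unfolding Gamma_ring_def Gamma_class_def GI_def[symmetric]
using ideal.rcoset_mult_add[OF GI_ideal, of p q] by(simp add: FactRing_def)

lemma Gamma_class_zero: "\<zero>\<^bsub>Gamma_ring A\<^esub> = Gamma_class A 0"
unfolding Gamma_ring_def FactRing_def GI_def[symmetric] by(auto simp: in_Gamma_class)

text \<open>Evaluation in rational polynomials, \<open>\<gamma>\<^sub>i(a)\<close> going to \<open>a\<^sup>i/i!\<close>.\<close>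

definition emm :: "(nat \<times> 'a) multiset => 'x mpoly" where
"emm M=prod_mset (image_mset (%(i, a). gp i (cv a)) M)"

definition em :: "((nat \<times> 'a) multiset \<Rightarrow>\<^sub>0 int) => 'x mpoly" where "em=ev emm"

lemma em_simps [simp]: "em 0=0" "em (a + b)=em a + em b" "em (a - b)=em a - em b"
"em (- a) = - em a" "em (frag_cmul k a)=sc (of_int k) (em a)" "em (frag_of M)=emm M" by(simp_all add: em_def)

lemma em_1 [simp]: "em 1=1" using em_simps(6)[of "{#}"] by(simp add: emm_def flip: single_one)

lemma em_symbol [simp]: "em (gamma_symbol i a)=gp i (cv a)" by(simp add: gamma_symbol_def emm_def)

lemma em_sum: "em (sum f K)=(\<Sum>k\<in>K. em (f k))" by(simp add: em_def ev_sum)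

lemma em_mult [simp]: "em (p * q)=em p * em q"
proof -
have 1: "em (frag_of M * frag_of N)=emm M * emm N" for M N by(simp add: mult_single emm_def)
have "em (p * q)=em ((\<Sum>M\<in>keys p. frag_cmul (lookup p M) (frag_of M)) * (\<Sum>N\<in>keys q. frag_cmul (lookup q N) (frag_of N)))"
 by(simp flip: frag_sum_eq)
also have "... = (\<Sum>M\<in>keys p. sc (of_int (lookup p M)) (emm M)) * (\<Sum>N\<in>keys q. sc (of_int (lookup q N)) (emm N))"
 by(simp add: sum_product em_sum frag_cmul_mult frag_mult_cmul 1 sc_mult_left sc_mult_right mult.commute)
also have "... = em p * em q" by(subst (3) frag_sum_eq, subst (5) frag_sum_eq) (simp add: em_sum)
finally show ?thesis .
qed

lemma em_of_nat [simp]: "em (of_nat n) = of_nat n" by(induction n) auto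
lemma em_neg1_power [simp]: "em ((- 1) ^ n)=(- 1) ^ n" by(induction n) auto

lemma em_prod: "em (prod f K)=(\<Prod>k\<in>K. em (f k))" by(induction K rule: infinite_finite_induct) auto

lemma neg1_power_mult: "(- 1) ^ n * z=sc ((- 1) ^ n) z" for z :: "'x mpoly"
by(induction n) (auto simp: sc_minus1)

lemma em_rel: "r \<in> gamma_relators A \<Longrightarrow> em r = 0"
proof (cases rule: gamma_relators.cases, assumption)
fix x s t assume "x \<in> carrier A" "r = gamma_symbol s x * gamma_symbol t x - of_nat ((s + t) choose s) * gamma_symbol (s + t) x"
thus ?thesis by(simp add: gp_mult of_nat_mult_sc)
next
fix x y n assume "x \<in> carrier A" "y \<in> carrier A" "r = gamma_symbol n (x \<otimes>\<^bsub>A\<^esub> y) - (\<Sum>s\<le>n. gamma_symbol s x * gamma_symbol (n - s) y)"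
thus ?thesis by(simp add: em_sum lemb_mult[OF cv] gp_add)
next
fix x n assume "x \<in> carrier A" "r = gamma_symbol n (inv\<^bsub>A\<^esub> x) - (- 1) ^ n * gamma_symbol n x"
thus ?thesis by(simp add: lemb_inv[OF cv] gp_uminus neg1_power_mult)
qed simp

lemma em_GI: "p:GI ==> em p=0"
proof -
let ?K = "{p:carrier PR. em p=0}"
have "ideal ?K PR"
proof (rule idealI)
 show "subgroup ?K (add_monoid PR)"
 proof (rule group.subgroupI)
  show "group (add_monoid PR)" by(rule PR.a_group)
  show "inv\<^bsub>add_monoid PR\<^esub> p:?K" if "p:?K" for p
   using that PR_minus[of p] PR_closed(5)[of p] by(simp add: a_inv_def)
 qed (auto intro: PR_closed exI[of _ 0])
qed (use PR_closed in "auto intro: PR.ring_axioms")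
moreover have "gamma_relators A <= ?K" using em_rel gamma_relators_carrier by blast
ultimately have "GI <= ?K" unfolding GI_def gamma_ideal_def by(rule PR.genideal_minimal)
thus "p:GI ==> em p=0" by blast
qed

definition gmon :: "'x multiset => (nat \<times> 'a) multiset \<Rightarrow>\<^sub>0 int" where
"gmon u=(\<Prod>x\<in>set_mset u. gamma_symbol (count u x) (be x))"

definition tdeg :: "(nat \<times> 'a) multiset => nat" where "tdeg M=sum_mset (image_mset fst M)"

lemma GI_prod_cong:
assumes "finite T" "!!x. x:T ==> f x - g x:GI" "!!x. x:T ==> f x:carrier PR" "!!x. x:T ==> g x:carrier PR"
shows "prod f T - prod g T:GI" using assms
proof (induction T)
case (insert x T)
have "f x * prod f T - g x * prod g T=(f x - g x) * prod f T + g x * (prod f T - prod g T)" by(simp add: algebra_simps)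
also have "... : GI" using insert by(intro GI_closed(2) GI_closed(4,5) PR_closed_more) auto
finally show ?case using insert by simp
qed (auto simp: GI_closed)

lemma gmon_superset:
assumes "finite T" "set_mset u <= T" "T <= X"
shows "(\<Prod>x\<in>T. gamma_symbol (count u x) (be x)) - gmon u:GI"
proof -
have "(\<Prod>x\<in>T. gamma_symbol (count u x) (be x)) - (\<Prod>x\<in>T. if x \<in># u then gamma_symbol (count u x) (be x) else 1):GI"
proof (rule GI_prod_cong[OF assms(1)])
 fix x assume x: "x:T"
 hence "gamma_symbol 0 (be x) - 1:GI" using assms(3) be by(intro GI_rel gamma_relators.intros) auto
 thus "gamma_symbol (count u x) (be x) - (if x \<in># u then gamma_symbol (count u x) (be x) else 1):GI"
  by(auto simp: GI_closed not_in_iff)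
qed (use assms be in "auto intro!: symbol_carrier PR_closed")
also have "(\<Prod>x\<in>T. if x \<in># u then gamma_symbol (count u x) (be x) else 1)=gmon u"
 unfolding gmon_def using assms by(simp add: prod.If_cases Int_absorb1 flip: prod.inter_restrict)
finally show ?thesis .
qed

lemma gmon_carrier: "set_mset u <= X ==> gmon u:carrier PR"
unfolding gmon_def using be by(intro PR_closed_more symbol_carrier) auto

lemma gmon_mult:
assumes "set_mset u <= X" "set_mset v <= X"
shows "\<exists>k::int. gmon u * gmon v - frag_cmul k (gmon (u + v)):GI"
proof -
let ?T = "set_mset (u + v)"
define g where "g=(%u x. gamma_symbol (count u x) (be x))"
define k where "k=(\<Prod>x\<in>?T. int ((count u x + count v x) choose count u x))"
have T: "finite ?T" "?T <= X" using assms by auto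
have gc: "g u x:carrier PR" if "x:?T" for u x using that T be by(auto simp: g_def intro!: symbol_carrier)
have gm: "prod (g w) ?T - gmon w:GI" if "set_mset w <= ?T" for w unfolding g_def using T that by(intro gmon_superset)
have pc: "prod (g w) ?T:carrier PR" for w using gc by(intro PR_closed_more)
have "prod (g u) ?T * prod (g v) ?T - gmon u * gmon v =
  (prod (g u) ?T - gmon u) * prod (g v) ?T + gmon u * (prod (g v) ?T - gmon v)" by(simp add: algebra_simps)
also have "... : GI" using gm[of u] gm[of v] pc assms by(intro GI_closed(2) GI_closed(4,5) gmon_carrier) auto
finally have 1: "prod (g u) ?T * prod (g v) ?T - gmon u * gmon v:GI" .
have "prod (%x. g u x * g v x) ?T - prod (%x. of_nat ((count u x + count v x) choose count u x) * g (u + v) x) ?T:GI"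
proof (rule GI_prod_cong)
 fix x assume x: "x:?T"
 thus "g u x * g v x - of_nat ((count u x + count v x) choose count u x) * g (u + v) x:GI"
  using T be by(auto simp: g_def intro!: GI_rel gamma_relators.intros(2))
qed (use gc in "auto intro!: PR_closed(4) PR_closed_more(2)")
moreover have "prod (%x. of_nat ((count u x + count v x) choose count u x) * g (u + v) x) ?T=frag_cmul k (prod (g (u + v)) ?T)"
 by(simp add: prod.distrib k_def frag_cmul_eq)
ultimately have 2: "prod (g u) ?T * prod (g v) ?T - frag_cmul k (prod (g (u + v)) ?T):GI"
 by(simp add: prod.distrib)
have "gmon u * gmon v - frag_cmul k (gmon (u + v)) =
  (prod (g u) ?T * prod (g v) ?T - frag_cmul k (prod (g (u + v)) ?T)) -
  (prod (g u) ?T * prod (g v) ?T - gmon u * gmon v) + of_int k * (prod (g (u + v)) ?T - gmon (u + v))"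
 by(simp add: frag_cmul_eq algebra_simps)
also have "... : GI"
proof (rule GI_closed(2)[OF GI_closed(6)[OF 2 1] GI_closed(5)[OF gm]])
 show "(of_int k :: (nat \<times> 'a) multiset \<Rightarrow>\<^sub>0 int):carrier PR"
  using PR_closed_more(6)[OF PR_closed(2), of k] by(simp add: frag_cmul_eq)
qed simp
finally show ?thesis by blast
qed

definition gsp :: "nat => ((nat \<times> 'a) multiset \<Rightarrow>\<^sub>0 int) set" where
"gsp n = {p. \<exists>b::'x multiset \<Rightarrow>\<^sub>0 int. keys b <= {u. size u=n & set_mset u <= X} &
  p - (\<Sum>u\<in>keys b. frag_cmul (lookup b u) (gmon u)):GI}"

lemma gsp_alt: "p:gsp n \<longleftrightarrow> (\<exists>UU (c::'x multiset => int). finite UU & UU <= {u. size u=n & set_mset u <= X} &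
  p - (\<Sum>u\<in>UU. frag_cmul (c u) (gmon u)):GI)"
proof
assume "p:gsp n"
thus "\<exists>UU (c::'x multiset => int). finite UU & UU <= {u. size u=n & set_mset u <= X} &
  p - (\<Sum>u\<in>UU. frag_cmul (c u) (gmon u)):GI" unfolding gsp_def using finite_keys by blast
next
assume "\<exists>UU (c::'x multiset => int). finite UU & UU <= {u. size u=n & set_mset u <= X} &
  p - (\<Sum>u\<in>UU. frag_cmul (c u) (gmon u)):GI"
then obtain UU and c :: "'x multiset => int" where UU: "finite UU" "UU <= {u. size u=n & set_mset u <= X}"
 "p - (\<Sum>u\<in>UU. frag_cmul (c u) (gmon u)):GI" by blast
define b where "b=(\<Sum>u\<in>UU. frag_cmul (c u) (frag_of u))"
have l: "lookup b u=(if u:UU then c u else 0)" for u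
proof -
 have "lookup b u=(\<Sum>v\<in>UU. if v=u then c u else 0)" unfolding b_def lookup_sum by(rule sum.cong) auto
 thus ?thesis using UU(1) by simp
qed
have "(\<Sum>u\<in>keys b. frag_cmul (lookup b u) (gmon u))=(\<Sum>u\<in>UU. frag_cmul (c u) (gmon u))"
 by(rule sum.mono_neutral_cong_left[OF UU(1)]) (auto simp: in_keys_iff l split: if_splits)
moreover have "keys b <= UU" by(auto simp: in_keys_iff l split: if_splits)
ultimately show "p:gsp n" unfolding gsp_def using UU by(auto intro!: exI[of _ b])
qed

lemma gsp_cong: "p - q:GI ==> q:gsp n ==> p:gsp n"
proof -
assume h: "p - q:GI" "q:gsp n"
then obtain b :: "'x multiset \<Rightarrow>\<^sub>0 int" where b: "keys b <= {u. size u=n & set_mset u <= X}"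
 "q - (\<Sum>u\<in>keys b. frag_cmul (lookup b u) (gmon u)):GI" unfolding gsp_def by blast
from GI_closed(2)[OF h(1) b(2)] b(1) show ?thesis unfolding gsp_def by(auto intro!: exI[of _ b])
qed

lemma gsp_0: "0:gsp n" unfolding gsp_def using GI_closed(1) by(auto intro!: exI[of _ 0])

lemma gsp_gmon: "size u=n ==> set_mset u <= X ==> gmon u:gsp n"
unfolding gsp_def using GI_closed(1) by(auto intro!: exI[of _ "frag_of u"])

lemma gsp_sum_form:
assumes "finite UU" "UU <= {u. size u=n & set_mset u <= X}"
shows "(\<Sum>u\<in>UU. frag_cmul (c u) (gmon u)):gsp n"
unfolding gsp_alt using assms GI_closed(1) by(auto intro!: exI[of _ UU] exI[of _ c])

lemma gsp_add: "p:gsp n ==> q:gsp n ==> p + q:gsp n"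
proof -
assume "p:gsp n" "q:gsp n"
then obtain UU VV and c d :: "'x multiset => int" where
 UU: "finite UU" "UU <= {u. size u=n & set_mset u <= X}" "p - (\<Sum>u\<in>UU. frag_cmul (c u) (gmon u)):GI" and
 VV: "finite VV" "VV <= {u. size u=n & set_mset u <= X}" "q - (\<Sum>u\<in>VV. frag_cmul (d u) (gmon u)):GI"
 unfolding gsp_alt by blast
define e where "e=(%u. (if u:UU then c u else 0) + (if u:VV then d u else 0))"
have "(\<Sum>u\<in>UU. frag_cmul (c u) (gmon u))=(\<Sum>u\<in>UU \<union> VV. frag_cmul (if u:UU then c u else 0) (gmon u))"
 "(\<Sum>u\<in>VV. frag_cmul (d u) (gmon u))=(\<Sum>u\<in>UU \<union> VV. frag_cmul (if u:VV then d u else 0) (gmon u))"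
 using UU(1) VV(1) by(auto intro!: sum.mono_neutral_cong_left)
hence "(\<Sum>u\<in>UU \<union> VV. frag_cmul (e u) (gmon u))=(\<Sum>u\<in>UU. frag_cmul (c u) (gmon u)) + (\<Sum>u\<in>VV. frag_cmul (d u) (gmon u))"
 by(simp add: e_def frag_cmul_distrib sum.distrib)
moreover have "(p + q) - ((\<Sum>u\<in>UU. frag_cmul (c u) (gmon u)) + (\<Sum>u\<in>VV. frag_cmul (d u) (gmon u))):GI"
 using GI_closed(2)[OF UU(3) VV(3)] by(simp add: algebra_simps)
ultimately have "(p + q) - (\<Sum>u\<in>UU \<union> VV. frag_cmul (e u) (gmon u)):GI" by simp
thus ?thesis by(rule gsp_cong[OF _ gsp_sum_form]) (use UU VV in auto)
qed

lemma gsp_cmul: "p:gsp n ==> frag_cmul k p:gsp n"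
proof -
assume "p:gsp n"
then obtain UU and c :: "'x multiset => int" where
 UU: "finite UU" "UU <= {u. size u=n & set_mset u <= X}" "p - (\<Sum>u\<in>UU. frag_cmul (c u) (gmon u)):GI"
 unfolding gsp_alt by blast
have "of_int k * (p - (\<Sum>u\<in>UU. frag_cmul (c u) (gmon u))):GI"
 using UU(3) PR_closed_more(6)[OF PR_closed(2), of k] by(intro GI_closed(5)) (auto simp: frag_cmul_eq)
moreover have "of_int k * (p - (\<Sum>u\<in>UU. frag_cmul (c u) (gmon u)))=frag_cmul k p - (\<Sum>u\<in>UU. frag_cmul (k * c u) (gmon u))"
 by(simp add: frag_cmul_eq right_diff_distrib sum_distrib_left mult.assoc)
ultimately have "frag_cmul k p - (\<Sum>u\<in>UU. frag_cmul (k * c u) (gmon u)):GI" by simp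
thus ?thesis by(rule gsp_cong[OF _ gsp_sum_form[OF UU(1,2)]])
qed

lemma gsp_uminus: "p:gsp n ==> - p:gsp n" using gsp_cmul[of p n "-1"] by simp

lemma gsp_sum: "(!!k. k:K ==> f k:gsp n) ==> sum f K:gsp n"
by(induction K rule: infinite_finite_induct) (auto intro: gsp_0 gsp_add)

lemma gsp_mult:
assumes "p:gsp n" "q:gsp m" "p:carrier PR" shows "p * q:gsp (n + m)"
proof -
obtain UU VV and c d :: "'x multiset => int" where
 UU: "finite UU" "UU <= {u. size u=n & set_mset u <= X}" "p - (\<Sum>u\<in>UU. frag_cmul (c u) (gmon u)):GI" and
 VV: "finite VV" "VV <= {u. size u=m & set_mset u <= X}" "q - (\<Sum>u\<in>VV. frag_cmul (d u) (gmon u)):GI"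
 using assms unfolding gsp_alt by blast
let ?p = "\<Sum>u\<in>UU. frag_cmul (c u) (gmon u)" and ?q = "\<Sum>u\<in>VV. frag_cmul (d u) (gmon u)"
have q: "?q:carrier PR" using VV by(intro PR_closed_more gmon_carrier) auto
have "p * q - ?p * ?q=p * (q - ?q) + (p - ?p) * ?q" by(simp add: algebra_simps)
also have "... : GI" using UU VV assms q by(intro GI_closed(2) GI_closed(4,5)) auto
finally have "p * q - ?p * ?q:GI" .
moreover have "?p * ?q=(\<Sum>u\<in>UU. \<Sum>v\<in>VV. frag_cmul (c u * d v) (gmon u * gmon v))"
 by(simp add: sum_product frag_cmul_mult frag_mult_cmul mult.commute)
moreover have "(\<Sum>u\<in>UU. \<Sum>v\<in>VV. frag_cmul (c u * d v) (gmon u * gmon v)):gsp (n + m)"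
proof (intro gsp_sum gsp_cmul)
 fix u v assume "u:UU" "v:VV"
 hence uv: "set_mset u <= X" "set_mset v <= X" "size u=n" "size v=m" using UU VV by auto
 obtain k :: int where "gmon u * gmon v - frag_cmul k (gmon (u + v)):GI" using gmon_mult[OF uv(1,2)] ..
 thus "gmon u * gmon v:gsp (n + m)" by(rule gsp_cong) (use uv in "auto intro!: gsp_cmul gsp_gmon")
qed
ultimately have "p * q - (\<Sum>u\<in>UU. \<Sum>v\<in>VV. frag_cmul (c u * d v) (gmon u * gmon v)):GI"
 "(\<Sum>u\<in>UU. \<Sum>v\<in>VV. frag_cmul (c u * d v) (gmon u * gmon v)):gsp (n + m)" by simp_all
thus ?thesis by(rule gsp_cong)
qed

lemma gsp_one: "1:gsp 0" using gsp_gmon[of "{#}" 0] by(simp add: gmon_def)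

lemma gsp_symbol_0: "a:carrier A ==> gamma_symbol 0 a:gsp 0"
by(rule gsp_cong[OF GI_rel gsp_one]) (rule gamma_relators.intros)

lemma gsp_symbol: "a \<in> carrier A \<Longrightarrow> gamma_symbol n a \<in> gsp n"
proof (induction a arbitrary: n rule: basis_induct)
case one
show ?case
proof (induction n rule: less_induct)
 case (less n)
 let ?f = "\<lambda>s. gamma_symbol s \<one>\<^bsub>A\<^esub>"
 show ?case
 proof (cases "n = 0")
  case False
  then obtain m where n: "n = Suc m" by(cases n) auto
  have rel: "?f n - (\<Sum>s\<le>n. ?f s * ?f (n - s)) \<in> GI"
   using GI_rel[OF gamma_relators.intros(3)[of "\<one>\<^bsub>A\<^esub>" A "\<one>\<^bsub>A\<^esub>" n]] n by simp
  have f0: "?f 0 - 1 \<in> GI" by(intro GI_rel gamma_relators.intros) simp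
  have fc: "?f s \<in> carrier PR" for s by(intro symbol_carrier) simp
  have "(\<Sum>s\<le>n. ?f s * ?f (n - s)) = ?f 0 * ?f n + (\<Sum>s<m. ?f (Suc s) * ?f (m - s)) + ?f n * ?f 0"
   unfolding n by(simp only: sum.atMost_Suc_shift) (simp add: lessThan_Suc_atMost[symmetric])
  hence "?f n - (- (\<Sum>s<m. ?f (Suc s) * ?f (m - s))) =
    - (?f n - (\<Sum>s\<le>n. ?f s * ?f (n - s))) - (?f 0 - 1) * ?f n - ?f n * (?f 0 - 1)"
   by(simp add: algebra_simps)
  also have "\<dots> \<in> GI" by(rule GI_closed(6)[OF GI_closed(6)[OF GI_closed(3)[OF rel] GI_closed(4)[OF f0 fc]] GI_closed(5)[OF f0 fc]])
  finally have key: "?f n - (- (\<Sum>s<m. ?f (Suc s) * ?f (m - s))) \<in> GI" .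
  have "?f (Suc s) * ?f (m - s) \<in> gsp n" if "s < m" for s
   using gsp_mult[OF less less, of "Suc s" "m - s"] that fc n by simp
  hence "- (\<Sum>s<m. ?f (Suc s) * ?f (m - s)) \<in> gsp n" by(intro gsp_uminus gsp_sum) simp
  with key show ?thesis by(rule gsp_cong)
 qed (use gsp_symbol_0 in simp)
qed
next
case (basis x)
show ?case
proof (cases "n = 0")
 case False
 hence "gmon (replicate_mset n x) = gamma_symbol n (be x)" by(simp add: gmon_def)
 thus ?thesis using gsp_gmon[of "replicate_mset n x" n] basis by(simp add: subset_iff)
qed (use basis be gsp_symbol_0 in auto)
next
case (mult a b)
show ?case
proof (cases "n = 0")
 case False
 have st: "gamma_symbol s a * gamma_symbol (n - s) b \<in> gsp n" if "s \<le> n" for s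
  using gsp_mult[OF mult.IH, of s "n - s"] that mult.hyps symbol_carrier by simp
 have "gamma_symbol n (a \<otimes>\<^bsub>A\<^esub> b) - (\<Sum>s\<le>n. gamma_symbol s a * gamma_symbol (n - s) b) \<in> GI"
  using False mult.hyps by(intro GI_rel gamma_relators.intros(3)) auto
 thus ?thesis by(rule gsp_cong) (intro gsp_sum st, simp)
qed (use mult.hyps gsp_symbol_0 in auto)
next
case (inv a)
show ?case
proof (cases "n = 0")
 case False
 have "(- 1) ^ n * gamma_symbol n a = frag_cmul ((- 1) ^ n) (gamma_symbol n a)" by(simp add: frag_cmul_eq)
 hence "(- 1) ^ n * gamma_symbol n a \<in> gsp n" using gsp_cmul[OF inv.IH, of "(- 1) ^ n" n] by simp
 moreover have "gamma_symbol n (inv\<^bsub>A\<^esub> a) - (- 1) ^ n * gamma_symbol n a \<in> GI"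
  using False inv.hyps by(intro GI_rel gamma_relators.intros(4)) auto
 ultimately show ?thesis using gsp_cong by blast
qed (use inv.hyps gsp_symbol_0 in auto)
qed

lemma gsp_monomial: "snd ` set_mset M <= carrier A ==> frag_of M:gsp (tdeg M)"
proof (induction M)
case empty
thus ?case using gsp_one by(simp add: tdeg_def)
next
case (add y M)
obtain i a where y: "y=(i, a)" by fastforce
have "gamma_symbol i a * frag_of M:gsp (i + tdeg M)"
 using add by(intro gsp_mult gsp_symbol symbol_carrier) (auto simp: y)
thus ?case by(simp add: gamma_symbol_def mult_single y tdeg_def)
qed

lemma gsp_homogeneous:
assumes "p:carrier PR" "!!M. M:keys p ==> tdeg M=n" shows "p:gsp n"
by(subst frag_sum_eq) (use assms gsp_monomial in "force simp: PR_carrier intro!: gsp_sum gsp_cmul")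

definition lg :: "((nat \<times> 'a) multiset \<Rightarrow>\<^sub>0 int) set => 'x mpoly" where "lg C=em (SOME p. p:C)"

lemma lg_class [simp]: "lg (Gamma_class A p)=em p"
proof -
have "p:Gamma_class A p" by(simp add: in_Gamma_class GI_closed)
moreover define d where "d=(SOME q. q:Gamma_class A p)"
ultimately have "d:Gamma_class A p" by(metis someI)
hence "em (d - p)=0" using em_GI by(simp only: in_Gamma_class)
thus ?thesis by(simp add: lg_def d_def)
qed

definition lg_c :: "nat => 'x multiset => rat" where
"lg_c n u=(if size u=n & set_mset u <= X then 1 / mfact u else 0)"

lemma em_gmon: "set_mset u <= X ==> em (gmon u)=sc (1 / mfact u) (bs u)"
proof -
assume u: "set_mset u <= X"
have "em (gmon u)=(\<Prod>x\<in>set_mset u. sc (1 / fact (count u x)) (bs (replicate_mset (count u x) x)))"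
 unfolding gmon_def em_prod using u be(2) by(intro prod.cong) (auto simp: gp_bs)
also have "... = sc (\<Prod>x\<in>set_mset u. 1 / fact (count u x)) (bs (\<Sum>x\<in>set_mset u. replicate_mset (count u x) x))"
proof -
 have "(\<Prod>x\<in>T. sc (f x) (bs (g x)))=sc (\<Prod>x\<in>T. f x) (bs (\<Sum>x\<in>T. g x))" if "finite T" for T and f :: "'x => rat" and g :: "'x => 'x multiset"
  using that by(induction T) (auto simp: sc_mult_left sc_mult_right bs_mult mult.commute)
 thus ?thesis by simp
qed
also have "(\<Sum>x\<in>set_mset u. replicate_mset (count u x) x)=u"
 by(rule multiset_eqI) (simp add: count_sum not_in_iff)
finally show ?thesis by(simp add: mfact_def prod_dividef)
qed

lemma gmon_degree: "set_mset u <= X ==> M:keys (gmon u) ==> tdeg M=size u"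
proof -
have 1: "gmon u=frag_of (\<Sum>x\<in>set_mset u. {#(count u x, be x)#})"
proof -
 have "(\<Prod>x\<in>T. frag_of (f x))=frag_of (\<Sum>x\<in>T. f x)" if "finite T" for T and f :: "'x => (nat \<times> 'a) multiset"
  using that by(induction T) (auto simp: mult_single)
 thus ?thesis by(simp add: gmon_def gamma_symbol_def)
qed
have "tdeg (\<Sum>x\<in>T. {#(count u x, be x)#})=(\<Sum>x\<in>T. count u x)" if "finite T" for T
 using that by(induction T) (auto simp: tdeg_def)
thus "M:keys (gmon u) ==> tdeg M=size u" by(simp add: 1 size_multiset_overloaded_eq)
qed

lemma Gamma_carrier: "carrier (Gamma n A) = {Gamma_class A p |p. p:carrier PR & (\<forall>M\<in>keys p. tdeg M=n)}"
by(simp add: Gamma_def tdeg_def)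

lemma Gamma_mult: "p:carrier PR ==> q:carrier PR ==>
 Gamma_class A p \<otimes>\<^bsub>Gamma n A\<^esub> Gamma_class A q=Gamma_class A (p + q)"
by(simp add: Gamma_def Gamma_class_add)

lemma Gamma_one: "\<one>\<^bsub>Gamma n A\<^esub> = Gamma_class A 0" by(simp add: Gamma_def Gamma_class_zero)

lemma gsp_em_0:
assumes "p:gsp n" "em p=0" shows "p:GI"
proof -
obtain b :: "'x multiset \<Rightarrow>\<^sub>0 int" where b: "keys b <= {u. size u=n & set_mset u <= X}"
 "p - (\<Sum>u\<in>keys b. frag_cmul (lookup b u) (gmon u)):GI" using assms(1) unfolding gsp_def by blast
have "0=em p" using assms(2) by simp
also have "em p=(\<Sum>u\<in>keys b. sc (of_int (lookup b u)) (em (gmon u)))"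
 using em_GI[OF b(2)] by(simp add: em_sum)
also have "... = (\<Sum>u\<in>keys b. sc (of_int (lookup b u)) (sc (1 / mfact u) (bs u)))"
 using b(1) em_gmon by(intro sum.cong refl) auto
finally have 0: "0=(\<Sum>u\<in>keys b. sc (of_int (lookup b u)) (sc (1 / mfact u) (bs u)))" .
have "lookup b v=0" for v
proof -
 have "0=lookup (\<Sum>u\<in>keys b. sc (of_int (lookup b u)) (sc (1 / mfact u) (bs u))) v"
  by(simp only: 0[symmetric] lookup_zero)
 also have "... = (\<Sum>u\<in>keys b. if u=v then of_int (lookup b v) / mfact v else 0)"
  unfolding lookup_sum by(rule sum.cong) (auto simp: lookup_single when_def)
 also have "... = of_int (lookup b v) / mfact v" by(simp add: in_keys_iff)
 finally show ?thesis by simp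
qed
hence "b=0" by(intro poly_mapping_eqI) simp
thus ?thesis using b(2) by simp
qed

text \<open>The relators hold for \<open>a\<^sup>i/i!\<close>, and they reduce every element to products of divided powers of basis
 elements, whose images are multiples of distinct monomials.\<close>

lemma Gamma_lemb: "lemb (Gamma n A) lg (lg_c n)"
proof -
let ?H = "{p. p:carrier PR & (\<forall>M\<in>keys p. tdeg M=n)}"
have H: "0:?H" "p:?H ==> q:?H ==> p + q:?H" "p:?H ==> q:?H ==> p - q:?H" "p:?H ==> - p:?H" for p q
 using keys_add[of p q] keys_diff[of p q] by(auto intro: PR_closed PR_closed_more)
have "comm_group (Gamma n A)"
proof (rule comm_groupI)
 show "x \<otimes>\<^bsub>Gamma n A\<^esub> y:carrier (Gamma n A)" if xy: "x:carrier (Gamma n A)" "y:carrier (Gamma n A)" for x y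
 proof -
  obtain p q where pq: "x=Gamma_class A p" "p:?H" "y=Gamma_class A q" "q:?H"
   using xy unfolding Gamma_carrier by blast
  hence "x \<otimes>\<^bsub>Gamma n A\<^esub> y=Gamma_class A (p + q)" by(simp add: Gamma_mult)
  with H(2)[OF pq(2,4)] show ?thesis unfolding Gamma_carrier by blast
 qed
 show "\<one>\<^bsub>Gamma n A\<^esub> : carrier (Gamma n A)" using H(1) unfolding Gamma_carrier Gamma_one by blast
 show "\<exists>y\<in>carrier (Gamma n A). y \<otimes>\<^bsub>Gamma n A\<^esub> x = \<one>\<^bsub>Gamma n A\<^esub>" if x: "x:carrier (Gamma n A)" for x
 proof -
  obtain p where p: "x=Gamma_class A p" "p:?H" using x unfolding Gamma_carrier by blast
  hence "Gamma_class A (- p) \<otimes>\<^bsub>Gamma n A\<^esub> x = \<one>\<^bsub>Gamma n A\<^esub>"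
   using PR_closed(5)[of p] by(simp add: Gamma_mult Gamma_one)
  thus ?thesis using H(4)[OF p(2)] unfolding Gamma_carrier by blast
 qed
qed (auto simp: Gamma_carrier Gamma_mult Gamma_one PR_closed ac_simps)
moreover have "\<forall>x\<in>carrier (Gamma n A). \<forall>y\<in>carrier (Gamma n A). lg (x \<otimes>\<^bsub>Gamma n A\<^esub> y)=lg x + lg y"
 by(auto simp: Gamma_carrier Gamma_mult)
moreover have "inj_on lg (carrier (Gamma n A))"
proof (rule inj_onI)
 fix x y assume xy: "x:carrier (Gamma n A)" "y:carrier (Gamma n A)" "lg x=lg y"
 then obtain p q where pq: "x=Gamma_class A p" "p:?H" "y=Gamma_class A q" "q:?H" unfolding Gamma_carrier by blast
 have "em (p - q)=0" using xy(3) pq by simp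
 moreover have "p - q:gsp n" using H(3)[OF pq(2,4)] by(intro gsp_homogeneous) auto
 ultimately show "x=y" using gsp_em_0 pq by(simp add: Gamma_class_eq_iff)
qed
moreover have "lg ` carrier (Gamma n A)=lat (lg_c n)"
proof
 show "lg ` carrier (Gamma n A) <= lat (lg_c n)"
 proof clarify
  fix x assume "x:carrier (Gamma n A)"
  then obtain p where p: "x=Gamma_class A p" "p:?H" unfolding Gamma_carrier by blast
  hence "p:gsp n" by(intro gsp_homogeneous) auto
  then obtain b :: "'x multiset \<Rightarrow>\<^sub>0 int" where b: "keys b <= {u. size u=n & set_mset u <= X}"
   "p - (\<Sum>u\<in>keys b. frag_cmul (lookup b u) (gmon u)):GI" unfolding gsp_def by blast
  have "em p=(\<Sum>u\<in>keys b. sc (of_int (lookup b u)) (em (gmon u)))"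
   using em_GI[OF b(2)] by(simp add: em_sum)
  also have "... : lat (lg_c n)"
   using b(1) em_gmon by(intro lat_sum lat_sc_int) (auto simp: lat_bs_iff lg_c_def intro!: exI[of _ 1])
  finally show "lg x:lat (lg_c n)" by(simp add: p)
 qed
 show "lat (lg_c n) <= lg ` carrier (Gamma n A)"
 proof
  fix z assume z: "z:lat (lg_c n)"
  obtain k :: "_ => int" where k: "z=(\<Sum>u\<in>keys z. sc (of_int (k u)) (sc (lg_c n u) (bs u)))"
   using lat_decomp[OF z] .
  have u: "size u=n" "set_mset u <= X" if "u:keys z" for u
   using lat_keys[OF z that] by(auto simp: lg_c_def split: if_splits)
  let ?p = "\<Sum>u\<in>keys z. frag_cmul (k u) (gmon u)"
  have "?p:?H"
  proof (rule CollectI, intro conjI ballI)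
   show "?p:carrier PR" using u by(intro PR_closed_more gmon_carrier)
   fix M assume "M:keys ?p"
   then obtain v where v: "v:keys z" "M:keys (frag_cmul (k v) (gmon v))"
    using keys_sum[of "%u. frag_cmul (k u) (gmon u)" "keys z"] by blast
   hence "M:keys (gmon v)" using keys_cmul by blast
   with v(1) show "tdeg M=n" using gmon_degree[OF u(2)] u(1) by simp
  qed
  moreover have "em ?p=z" by(subst (2) k) (use u in "auto simp: em_sum em_gmon lg_c_def intro!: sum.cong")
  ultimately show "z:lg ` carrier (Gamma n A)"
   unfolding Gamma_carrier by(intro image_eqI[of _ _ "Gamma_class A ?p"]) auto
 qed
qed
ultimately show ?thesis by(simp add: lemb_def)
qed

lemma Gamma_class_in: "p:carrier PR ==> (!!M. M:keys p ==> tdeg M=n) ==> Gamma_class A p:carrier (Gamma n A)"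
unfolding Gamma_carrier by blast

lemma gamma_mult_emb:
assumes "b:carrier A" "Y:carrier (Gamma n A)"
shows "gamma A 1 b \<otimes>\<^bsub>Gamma_ring A\<^esub> Y:carrier (Gamma (Suc n) A)"
 "lg (gamma A 1 b \<otimes>\<^bsub>Gamma_ring A\<^esub> Y)=lp (cv b) * lg Y"
proof -
obtain p where p: "Y=Gamma_class A p" "p:carrier PR" "\<forall>M\<in>keys p. tdeg M=n"
 using assms(2) unfolding Gamma_carrier by blast
have s: "gamma_symbol 1 b:carrier PR" using assms(1) by(rule symbol_carrier)
have eq: "gamma A 1 b \<otimes>\<^bsub>Gamma_ring A\<^esub> Y=Gamma_class A (gamma_symbol 1 b * p)"
 unfolding gamma_def p by(rule Gamma_class_mult[OF s p(2)])
show "lg (gamma A 1 b \<otimes>\<^bsub>Gamma_ring A\<^esub> Y)=lp (cv b) * lg Y"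
 unfolding eq by(simp add: p(1) gp_1)
show "gamma A 1 b \<otimes>\<^bsub>Gamma_ring A\<^esub> Y:carrier (Gamma (Suc n) A)" unfolding eq
proof (rule Gamma_class_in)
 fix M assume "M:keys (gamma_symbol 1 b * p)"
 then obtain N where "M = {#(1, b)#} + N" "N:keys p"
  using keys_mult[of "gamma_symbol 1 b" p] by(auto simp: gamma_symbol_def)
 thus "tdeg M=Suc n" using p(3) by(auto simp: tdeg_def)
qed (rule PR_closed(4)[OF s p(2)])
qed

end

section \<open>Subquotients of lattices\<close>

definition addsub :: "'v::ab_group_add set => bool" where
"addsub Z \<longleftrightarrow> 0:Z & (\<forall>z\<in>Z. \<forall>w\<in>Z. z - w:Z)"

lemma addsubD:
assumes "addsub Z"
shows "0:Z" "z:Z ==> w:Z ==> z - w:Z" "z:Z ==> - z:Z" "z:Z ==> w:Z ==> z + w:Z"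
proof -
show 0: "0:Z" and d: "z:Z ==> w:Z ==> z - w:Z" for z w using assms by(auto simp: addsub_def)
show um: "z:Z ==> - z:Z" for z using d[OF 0, of z] by simp
show "z:Z ==> w:Z ==> z + w:Z" using d[of z "- w"] um[of w] by simp
qed

lemma addsub_lat: "addsub (lat c)" by(auto simp: addsub_def intro: lat_diff)

lemma addsub_cycles: "linmap F ==> addsub {z:lat c. F z=0}"
by(auto simp: addsub_def linmap_0 linmap_diff intro: lat_diff)

lemma addsub_image: "linmap F ==> addsub M ==> addsub (F ` M)"
proof -
assume F: "linmap F" and M: "addsub M"
have "F x - F y:F ` M" if "x:M" "y:M" for x y
 using addsubD(2)[OF M that] linmap_diff[OF F, of x y] by(metis image_eqI)
moreover have "0:F ` M" using addsubD(1)[OF M] linmap_0[OF F] by(metis image_eqI)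
ultimately show ?thesis by(auto simp: addsub_def)
qed

text \<open>\<open>qpres Q cls Z B\<close>: the group \<open>Q\<close> is the quotient \<open>Z / B\<close>, the class of \<open>z\<close> being \<open>cls z\<close>.\<close>

definition qpres :: "('q, 'm) monoid_scheme => ('v::ab_group_add => 'q) => 'v set => 'v set => bool" where
"qpres Q cls Z B \<longleftrightarrow> comm_group Q & addsub Z & carrier Q=cls ` Z &
  (\<forall>z\<in>Z. \<forall>w\<in>Z. cls z \<otimes>\<^bsub>Q\<^esub> cls w=cls (z + w)) & (\<forall>z\<in>Z. \<forall>w\<in>Z. cls z=cls w \<longleftrightarrow> z - w:B)"

lemma qpresD:
assumes "qpres Q cls Z B"
shows qpres_comm: "comm_group Q" and qpres_addsub: "addsub Z" and qpres_carrier: "carrier Q=cls ` Z"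
 and qpres_mult: "z:Z ==> w:Z ==> cls z \<otimes>\<^bsub>Q\<^esub> cls w=cls (z + w)"
 and qpres_eq: "z:Z ==> w:Z ==> cls z=cls w \<longleftrightarrow> z - w:B"
 and qpres_in: "z:Z ==> cls z:carrier Q" using assms unfolding qpres_def by blast+

lemma qpres_one: assumes "qpres Q cls Z B" shows "\<one>\<^bsub>Q\<^esub> = cls 0"
proof -
interpret comm_group Q by(rule qpres_comm[OF assms])
have z: "0:Z" by(rule addsubD[OF qpres_addsub[OF assms]])
have "cls 0 \<otimes>\<^bsub>Q\<^esub> cls 0=cls 0" using qpres_mult[OF assms z z] by simp
thus ?thesis using qpres_in[OF assms z] by(metis one_unique r_cancel_one)
qed

lemma qpres_obtain: assumes "qpres Q cls Z B" "x:carrier Q" obtains z where "z:Z" "x=cls z"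
using assms(2) qpres_carrier[OF assms(1)] by blast

text \<open>A map of lattices respecting the subgroups induces a homomorphism.\<close>

definition qmap :: "('v => 'q) => 'v set => ('w => 'r) => ('v => 'w) => 'q => 'r" where
"qmap cls Z cls' F x=cls' (F (SOME z. z:Z & cls z=x))"

lemma qmap_cls:
assumes Q: "qpres Q cls Z B" and R: "qpres R cls' Z' B'"
 and F: "!!z w. F (z - w)=F z - F w" "!!z. z:Z ==> F z:Z'" "!!z. z:B ==> F z:B'" and z: "z:Z"
shows "qmap cls Z cls' F (cls z)=cls' (F z)"
proof -
define w where "w=(SOME w. w:Z & cls w=cls z)"
have "w:Z & cls w=cls z" unfolding w_def by(rule someI[of _ z]) (use z in simp)
hence w: "w:Z" "w - z:B" using qpres_eq[OF Q, of w z] z by auto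
have "F w - F z:B'" using F(3)[OF w(2)] F(1) by simp
thus ?thesis unfolding qmap_def w_def[symmetric] using qpres_eq[OF R F(2)[OF w(1)] F(2)[OF z]] by simp
qed

lemma qmap_hom:
assumes Q: "qpres Q cls Z B" and R: "qpres R cls' Z' B'"
 and F: "!!z w. F (z - w)=F z - F w" "!!z. z:Z ==> F z:Z'" "!!z. z:B ==> F z:B'"
shows "qmap cls Z cls' F:hom Q R"
proof (rule homI)
note e=qmap_cls[OF Q R F(1) F(2) F(3)]
have F0: "F 0=0" using F(1)[of 0 0] by simp
have Fm: "F (- w) = - F w" for w using F(1)[of 0 w] F0 by simp
have Fp: "F (z + w)=F z + F w" for z w using F(1)[of z "- w"] Fm by simp
show "qmap cls Z cls' F x:carrier R" if "x:carrier Q" for x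
 using qpres_obtain[OF Q that] e qpres_in[OF R F(2)] by metis
show "qmap cls Z cls' F (x \<otimes>\<^bsub>Q\<^esub> y)=qmap cls Z cls' F x \<otimes>\<^bsub>R\<^esub> qmap cls Z cls' F y"
 if x: "x:carrier Q" and y: "y:carrier Q" for x y
proof -
 obtain z where z: "z:Z" "x=cls z" using qpres_obtain[OF Q x] .
 obtain w where w: "w:Z" "y=cls w" using qpres_obtain[OF Q y] .
 have "z + w:Z" using addsubD(4)[OF qpres_addsub[OF Q]] z w by blast
 thus ?thesis using z w by(simp add: qpres_mult[OF Q] e qpres_mult[OF R F(2) F(2)] Fp)
qed
qed

text \<open>A subquotient of an embedded group.\<close>

definition lcls :: "('g, 'm) monoid_scheme => ('g => 'y vec) => 'y vec set => 'y vec => 'g set" where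
"lcls G l B z = {x:carrier G. l x - z:B}"

lemma r_coset_lcls:
assumes G: "lemb G l c" and B: "addsub B" "BG = {x:carrier G. l x:B}" and x: "x:carrier G"
shows "BG #>\<^bsub>G\<^esub> x=lcls G l B (l x)"
proof -
interpret comm_group G by(rule lemb_comm[OF G])
show ?thesis
proof (intro equalityI subsetI)
 fix y assume "y:BG #>\<^bsub>G\<^esub> x"
 then obtain h where "h:BG" "y=h \<otimes>\<^bsub>G\<^esub> x" unfolding r_coset_def by blast
 thus "y:lcls G l B (l x)" using x by(simp add: lcls_def B lemb_mult[OF G])
next
 fix y assume "y:lcls G l B (l x)"
 hence y: "y:carrier G" "l y - l x:B" by(auto simp: lcls_def)
 have h: "y \<otimes>\<^bsub>G\<^esub> inv\<^bsub>G\<^esub> x:BG" using y x by(simp add: B lemb_mult[OF G] lemb_inv[OF G])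
 have "y=(y \<otimes>\<^bsub>G\<^esub> inv\<^bsub>G\<^esub> x) \<otimes>\<^bsub>G\<^esub> x" using y x by(simp add: m_assoc)
 thus "y:BG #>\<^bsub>G\<^esub> x" unfolding r_coset_def using h by blast
qed
qed

lemma subquotient_qpres:
assumes G: "lemb G l c" and Z: "addsub Z" "Z <= lat c" "ZG = {x:carrier G. l x:Z}"
 and B: "addsub B" "B <= Z" "BG = {x:carrier G. l x:B}"
shows "qpres (G\<lparr>carrier := ZG\<rparr> Mod BG) (lcls G l B) Z B"
proof -
interpret comm_group G by(rule lemb_comm[OF G])
have sub: "subgroup {x:carrier G. l x:M} G" if "addsub M" for M
 by(rule subgroupI) (use addsubD[OF that] lemb_one[OF G] in "auto simp: lemb_inv[OF G] lemb_mult[OF G]")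
let ?G = "G\<lparr>carrier := ZG\<rparr>"
have ZG: "subgroup ZG G" and BG: "subgroup BG G" using sub Z(1,3) B(1,3) by simp_all
have cg: "comm_group ?G"
 by(rule group.group_comm_groupI[OF subgroup.subgroup_is_group[OF ZG is_group]]) (use Z(3) m_comm in auto)
then interpret G': comm_group ?G .
have BZ: "BG <= ZG" using B Z by auto
have BG': "subgroup BG ?G" by(rule subgroup_incl[OF BG ZG BZ])
have co: "BG #>\<^bsub>?G\<^esub> x=BG #>\<^bsub>G\<^esub> x" for x by(simp add: r_coset_def)
have cl: "BG #>\<^bsub>?G\<^esub> x=lcls G l B (l x)" if "x:ZG" for x
 unfolding co by(rule r_coset_lcls[OF G B(1,3)]) (use that Z(3) in simp)
have img: "l ` ZG=Z" using Z(2,3) lemb_image[OF G] by force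
have c1: "carrier (?G Mod BG)=lcls G l B ` Z"
proof -
 have "carrier (?G Mod BG)=(%x. BG #>\<^bsub>?G\<^esub> x) ` ZG" by(simp add: carrier_FactGroup)
 also have "... = (%x. lcls G l B (l x)) ` ZG" by(rule image_cong) (simp_all only: cl)
 finally show ?thesis by(simp add: image_image flip: img)
qed
have c2: "lcls G l B z \<otimes>\<^bsub>?G Mod BG\<^esub> lcls G l B w=lcls G l B (z + w)" if zw: "z:Z" "w:Z" for z w
proof -
 obtain x y where xy: "x:ZG" "l x=z" "y:ZG" "l y=w" using zw unfolding img[symmetric] by blast
 have "(BG #>\<^bsub>?G\<^esub> x) \<otimes>\<^bsub>?G Mod BG\<^esub> (BG #>\<^bsub>?G\<^esub> y)=BG #>\<^bsub>?G\<^esub> (x \<otimes>\<^bsub>?G\<^esub> y)"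
  using normal.rcos_sum[OF G'.subgroup_imp_normal[OF BG'], of x y] xy by simp
 moreover have "l (x \<otimes>\<^bsub>?G\<^esub> y)=z + w" using xy Z(3) by(simp add: lemb_mult[OF G])
 moreover have "x \<otimes>\<^bsub>?G\<^esub> y:ZG" using G'.m_closed[of x y] xy by simp
 ultimately show ?thesis using xy cl by metis
qed
have c3: "lcls G l B z=lcls G l B w \<longleftrightarrow> z - w:B" if zw: "z:Z" "w:Z" for z w
proof
 assume e: "lcls G l B z=lcls G l B w"
 obtain x where "x:ZG" "l x=z" using zw unfolding img[symmetric] by blast
 hence "x:lcls G l B z" using Z(3) addsubD(1)[OF B(1)] by(simp add: lcls_def)
 thus "z - w:B" unfolding e using \<open>l x=z\<close> by(simp add: lcls_def)
next
 assume h: "z - w:B"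
 have "v - z:B \<longleftrightarrow> v - w:B" for v
  using addsubD(4)[OF B(1) _ h, of "v - z"] addsubD(2)[OF B(1) _ h, of "v - w"] by auto
 thus "lcls G l B z=lcls G l B w" by(simp add: lcls_def)
qed
show ?thesis unfolding qpres_def by(intro conjI ballI G'.abelian_FactGroup[OF BG'] Z(1) c1 c2 c3)
qed

lemma lemb_generate:
assumes G: "lemb G l c" and T: "T <= carrier G" "!!y. c y ~= 0 ==> \<exists>t\<in>T. l t=sc (c y) (bs y)"
shows "generate G T=carrier G"
proof (rule lemb_full_subgroup[OF G])
show "subgroup (generate G T) G" by(rule group.generate_is_subgroup[OF lemb_group[OF G] T(1)])
show "\<exists>t\<in>generate G T. l t=sc (c y) (bs y)" if "c y ~= 0" for y
 using T(2)[OF that] generate.incl by metis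
qed

lemma fst_image_pairs: "fst ` {(f a b, g a b) | a b. P a b} = {f a b | a b. P a b}" by force

lemma set_drop_nth: "set (drop_nth t xs) <= set xs" by(auto simp: drop_nth_def dest: in_set_takeD in_set_dropD)

lemma keys_frag_sum: "(!!k. k:K ==> s k:S) ==> keys (\<Sum>k\<in>K. frag_cmul (a k) (frag_of (s k))) <= S"
proof (rule order.trans[OF keys_sum UN_least])
fix k assume "!!k. k:K ==> s k:S" "k:K"
thus "keys (frag_cmul (a k) (frag_of (s k))) <= S" using keys_cmul[of "a k" "frag_of (s k)"] by auto
qed

section \<open>The dual de Rham complex as a lattice complex\<close>

lemma keys_frag_three: "keys (frag_of a - frag_of b - frag_of d) <= {a, b, d}"
using keys_diff[of "frag_of a - frag_of b" "frag_of d"] keys_diff[of "frag_of a" "frag_of b"] by auto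

lemma tensor_presentation:
assumes "group G" "group H" shows "presentation (carrier G \<times> carrier H) (tensor_relators G H)"
proof
interpret G: group G by fact
interpret H: group H by fact
fix r assume "r:tensor_relators G H"
thus "keys r <= carrier G \<times> carrier H" unfolding tensor_relators_def
proof (elim UnE CollectE exE conjE)
 fix x x' y assume "r=frag_of (x \<otimes>\<^bsub>G\<^esub> x', y) - frag_of (x, y) - frag_of (x', y)"
  "x:carrier G" "x':carrier G" "y:carrier H"
 thus ?thesis using keys_frag_three[of "(x \<otimes>\<^bsub>G\<^esub> x', y)" "(x, y)" "(x', y)"] by auto
next
 fix x y y' assume "r=frag_of (x, y \<otimes>\<^bsub>H\<^esub> y') - frag_of (x, y) - frag_of (x, y')"
  "x:carrier G" "y:carrier H" "y':carrier H"
 thus ?thesis using keys_frag_three[of "(x, y \<otimes>\<^bsub>H\<^esub> y')" "(x, y)" "(x, y')"] by auto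
qed
qed

lemma tensor_kill:
assumes G: "lemb G l c" and H: "lemb H m d"
 and B: "!!w. linmap (%v. B v w)" "!!v. linmap (B v)" and r: "r:tensor_relators G H"
shows "ev (%(x, y). B (l x) (m y)) r=0" using r unfolding tensor_relators_def
proof (elim UnE CollectE exE conjE)
fix x x' y assume "r=frag_of (x \<otimes>\<^bsub>G\<^esub> x', y) - frag_of (x, y) - frag_of (x', y)"
 "x:carrier G" "x':carrier G" "y:carrier H"
thus ?thesis using linmap_add[OF B(1)] by(simp add: lemb_mult[OF G])
next
fix x y y' assume "r=frag_of (x, y \<otimes>\<^bsub>H\<^esub> y') - frag_of (x, y) - frag_of (x, y')"
 "x:carrier G" "y:carrier H" "y':carrier H"
thus ?thesis using linmap_add[OF B(2)] by(simp add: lemb_mult[OF H])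
qed

text \<open>A bilinear map of lattices taking pairs of basis vectors bijectively to basis vectors identifies
  the tensor product.\<close>

lemma tensor_lemb:
fixes B :: "'y vec \<Rightarrow> 'z vec \<Rightarrow> 'k vec"
assumes G: "lemb G l c" and H: "lemb H m d"
 and B: "\<And>w. linmap (\<lambda>v. B v w)" "\<And>v. linmap (B v)"
 and e: "\<And>k. e k \<noteq> 0 \<Longrightarrow> c (qa k) \<noteq> 0 \<and> d (qb k) \<noteq> 0 \<and> e k = c (qa k) * d (qb k) \<and> B (bs (qa k)) (bs (qb k)) = bs k"
 and q: "\<And>y z. c y \<noteq> 0 \<Longrightarrow> d z \<noteq> 0 \<Longrightarrow> \<exists>k. e k \<noteq> 0 \<and> qa k = y \<and> qb k = z"
shows "lemb (tensor G H) (presentation.pe (\<lambda>(x, y). B (l x) (m y))) e"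
proof -
interpret G: comm_group G by(rule lemb_comm[OF G])
interpret H: comm_group H by(rule lemb_comm[OF H])
interpret presentation "carrier G \<times> carrier H" "tensor_relators G H"
 by(rule tensor_presentation[OF G.is_group H.is_group])
define bG where "bG = (\<lambda>y. trm G l (sc (c y) (bs y)))"
define bH where "bH = (\<lambda>z. trm H m (sc (d z) (bs z)))"
have bG: "bG y \<in> carrier G" "l (bG y) = sc (c y) (bs y)" for y
 unfolding bG_def using trm_in[OF G lat_basis] trm_eq[OF G lat_basis] by blast+
have bH: "bH z \<in> carrier H" "m (bH z) = sc (d z) (bs z)" for z
 unfolding bH_def using trm_in[OF H lat_basis] trm_eq[OF H lat_basis] by blast+
let ?g = "\<lambda>k. (bG (qa k), bH (qb k))"
let ?Y = "?g ` {k. e k \<noteq> 0}"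
have base: "frag_of (bG y, bH z) \<in> spn ?Y" if "c y \<noteq> 0" "d z \<noteq> 0" for y z
 using q[OF that] by(intro spn_of) force
have r1: "frag_of (x \<otimes>\<^bsub>G\<^esub> x', y) - (frag_of (x, y) + frag_of (x', y)) \<in> gen (carrier G \<times> carrier H) (tensor_relators G H)"
 if "x \<in> carrier G" "x' \<in> carrier G" "y \<in> carrier H" for x x' y
proof -
 have "frag_of (x \<otimes>\<^bsub>G\<^esub> x', y) - frag_of (x, y) - frag_of (x', y) \<in> tensor_relators G H"
  using that unfolding tensor_relators_def by blast
 from gen_R[OF this] show ?thesis by(simp add: algebra_simps)
qed
have r2: "frag_of (x, y \<otimes>\<^bsub>H\<^esub> y') - (frag_of (x, y) + frag_of (x, y')) \<in> gen (carrier G \<times> carrier H) (tensor_relators G H)"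
 if "x \<in> carrier G" "y \<in> carrier H" "y' \<in> carrier H" for x y y'
proof -
 have "frag_of (x, y \<otimes>\<^bsub>H\<^esub> y') - frag_of (x, y) - frag_of (x, y') \<in> tensor_relators G H"
  using that unfolding tensor_relators_def by blast
 from gen_R[OF this] show ?thesis by(simp add: algebra_simps)
qed
have sg: "subgroup {x \<in> carrier K. f x \<in> spn ?Y} K"
 if K: "comm_group K" and f: "\<And>x x'. x \<in> carrier K \<Longrightarrow> x' \<in> carrier K \<Longrightarrow> f (x \<otimes>\<^bsub>K\<^esub> x') - (f x + f x') \<in> gen (carrier G \<times> carrier H) (tensor_relators G H)"
 for K :: "('w, 'u) monoid_scheme" and f
proof -
 interpret K: comm_group K by(rule K)
 have "- f \<one>\<^bsub>K\<^esub> \<in> gen (carrier G \<times> carrier H) (tensor_relators G H)" using f[of "\<one>\<^bsub>K\<^esub>" "\<one>\<^bsub>K\<^esub>"] by simp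
 hence "f \<one>\<^bsub>K\<^esub> - 0 \<in> gen (carrier G \<times> carrier H) (tensor_relators G H)" using gen_uminus by fastforce
 hence one: "f \<one>\<^bsub>K\<^esub> \<in> spn ?Y" using spn_cong spn_0 by blast
 show ?thesis
 proof (rule K.subgroupI)
  fix a b assume "a \<in> {x \<in> carrier K. f x \<in> spn ?Y}" "b \<in> {x \<in> carrier K. f x \<in> spn ?Y}"
  thus "a \<otimes>\<^bsub>K\<^esub> b \<in> {x \<in> carrier K. f x \<in> spn ?Y}"
   using spn_cong[OF f[of a b] spn_add] by auto
 next
  fix a assume a: "a \<in> {x \<in> carrier K. f x \<in> spn ?Y}"
  have "f (inv\<^bsub>K\<^esub> a) - (f \<one>\<^bsub>K\<^esub> - f a) \<in> gen (carrier G \<times> carrier H) (tensor_relators G H)"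
   using gen_uminus[OF f[of a "inv\<^bsub>K\<^esub> a"]] a by(simp add: algebra_simps)
  thus "inv\<^bsub>K\<^esub> a \<in> {x \<in> carrier K. f x \<in> spn ?Y}" using spn_cong[OF _ spn_diff[OF one]] a by auto
 qed (use one in auto)
qed
have 1: "frag_of (x, bH z) \<in> spn ?Y" if z: "d z \<noteq> 0" and x: "x \<in> carrier G" for x z
proof -
 have "{x \<in> carrier G. frag_of (x, bH z) \<in> spn ?Y} = carrier G"
 proof (rule lemb_full_subgroup[OF G])
  show "subgroup {x \<in> carrier G. frag_of (x, bH z) \<in> spn ?Y} G"
   by(rule sg[OF G.comm_group_axioms r1]) (use bH in auto)
  show "\<exists>t\<in>{x \<in> carrier G. frag_of (x, bH z) \<in> spn ?Y}. l t = sc (c y) (bs y)" if "c y \<noteq> 0" for y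
   by(rule bexI[of _ "bG y"]) (use bG base[OF that z] in auto)
 qed
 thus ?thesis using x by blast
qed
have 2: "frag_of (x, y) \<in> spn ?Y" if x: "x \<in> carrier G" and y: "y \<in> carrier H" for x y
proof -
 have "{y \<in> carrier H. frag_of (x, y) \<in> spn ?Y} = carrier H"
 proof (rule lemb_full_subgroup[OF H])
  show "subgroup {y \<in> carrier H. frag_of (x, y) \<in> spn ?Y} H"
   by(rule sg[OF H.comm_group_axioms r2]) (use x in auto)
  show "\<exists>t\<in>{y \<in> carrier H. frag_of (x, y) \<in> spn ?Y}. m t = sc (d z) (bs z)" if "d z \<noteq> 0" for z
   by(rule bexI[of _ "bH z"]) (use bH 1[OF that x] in auto)
 qed
 thus ?thesis using y by blast
qed
show ?thesis unfolding tensor_def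
proof (rule presented_lemb_indexed[where g = ?g])
 show "ev (\<lambda>(x, y). B (l x) (m y)) r = 0" if "r \<in> tensor_relators G H" for r
  by(rule tensor_kill[OF G H B that])
 show "?g k \<in> carrier G \<times> carrier H \<and> (case ?g k of (x, y) \<Rightarrow> B (l x) (m y)) = sc (e k) (bs k)" if "e k \<noteq> 0" for k
  using e[OF that] bG bH by(simp add: linmap_sc[OF B(1)] linmap_sc[OF B(2)])
 show "frag_of s \<in> spn ?Y" if "s \<in> carrier G \<times> carrier H" for s using 2 that by auto
qed
qed

definition dRw :: "'x::linorder set => nat => nat => 'x list \<times> 'x multiset => rat" where
"dRw X n i=(%(I, u). if srt I & length I=i & deg X n (mset I + u) then 1 / mfact u else 0)"

lemma lat_dRw: "lat (dRw X n i)=dR X n i" by(simp add: dRw_def gl_def)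

lemma prod_lessThan_append:
"(\<Prod>l<length (us@vs). F l ((us@vs) ! l))=(\<Prod>l<length us. F l (us ! l)) * (\<Prod>l<length vs. F (length us + l) (vs ! l))"
for F :: "nat => 'w => 'r::comm_monoid_mult"
proof (induction us arbitrary: F)
case (Cons u us)
show ?case
 using Cons[of "%l. F (Suc l)"] by(simp add: prod.lessThan_Suc_shift mult.assoc del: prod.lessThan_Suc)
qed simp

lemma prod_lessThan_list: "(\<Prod>l<length us. h (us ! l))=prod_list (map h us)" for h :: "'w => 'r::comm_monoid_mult"
by(induction us) (simp_all add: prod.lessThan_Suc_shift del: prod.lessThan_Suc)

lemma drop_nth_map: "drop_nth t (map f xs)=map f (drop_nth t xs)" by(simp add: drop_nth_def take_map drop_map)

lemma f_exponents_prod: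
fixes g :: "nat => 'w => 'r::comm_monoid_mult"
assumes "t <= i" "i < length xs"
shows "(\<Prod>l<length xs. g (if l <= i & l ~= t then a else b) (xs ! l)) =
 g b (xs ! t) * prod_list (map (g a) (drop_nth t (take (Suc i) xs))) * prod_list (map (g b) (drop (Suc i) xs))"
proof -
define us where "us=take t xs"
define vs where "vs=drop (Suc t) (take (Suc i) xs)"
define ws where "ws=drop (Suc i) xs"
have xs: "xs=us@[xs ! t]@vs@ws"
proof -
 have "xs=take (Suc i) xs@ws" by(simp add: ws_def)
 also have "take (Suc i) xs=take t (take (Suc i) xs)@(take (Suc i) xs ! t)#vs"
  unfolding vs_def by(rule id_take_nth_drop) (use assms in simp)
 finally show ?thesis using assms by(simp add: us_def min_def)
qed
have len: "length us=t" "length vs=i - t" using assms by(simp_all add: us_def vs_def)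
have dn: "drop_nth t (take (Suc i) xs)=us@vs" using assms by(simp add: drop_nth_def us_def vs_def min_def)
let ?F = "%l x. g (if l <= i & l ~= t then a else b) x"
have 1: "(\<Prod>l<length us. ?F l (us ! l))=prod_list (map (g a) us)"
 unfolding prod_lessThan_list[symmetric] by(rule prod.cong) (use len assms in auto)
have 2: "(\<Prod>l<length vs. ?F (Suc t + l) (vs ! l))=prod_list (map (g a) vs)"
 unfolding prod_lessThan_list[symmetric] by(rule prod.cong) (use len assms in auto)
have 3: "(\<Prod>l<length ws. ?F (Suc t + (length vs + l)) (ws ! l))=prod_list (map (g b) ws)"
 unfolding prod_lessThan_list[symmetric] by(rule prod.cong) (use len assms in auto)
have "(\<Prod>l<length xs. ?F l (xs ! l))=(\<Prod>l<length (us@[xs ! t]@vs@ws). ?F l ((us@[xs ! t]@vs@ws) ! l))"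
 by(rule arg_cong[OF xs])
also have "... = (\<Prod>l<length us. ?F l (us ! l)) * (\<Prod>l<length ([xs ! t]@vs@ws). ?F (t + l) (([xs ! t]@vs@ws) ! l))"
 unfolding prod_lessThan_append[of ?F us "[xs ! t]@vs@ws"] len(1) by(rule refl)
also have "(\<Prod>l<length ([xs ! t]@vs@ws). ?F (t + l) (([xs ! t]@vs@ws) ! l)) =
  g b (xs ! t) * (\<Prod>l<length (vs@ws). ?F (Suc t + l) ((vs@ws) ! l))"
 using prod_lessThan_append[of "%l. ?F (t + l)" "[xs ! t]" "vs@ws"] by simp
also have "(\<Prod>l<length (vs@ws). ?F (Suc t + l) ((vs@ws) ! l)) =
  (\<Prod>l<length vs. ?F (Suc t + l) (vs ! l)) * (\<Prod>l<length ws. ?F (Suc t + (length vs + l)) (ws ! l))"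
 by(rule prod_lessThan_append[of "%l. ?F (Suc t + l)" vs ws])
finally have "(\<Prod>l<length xs. ?F l (xs ! l)) =
  prod_list (map (g a) us) * (g b (xs ! t) * (prod_list (map (g a) vs) * prod_list (map (g b) ws)))"
 unfolding 1 2 3 .
thus ?thesis unfolding dn ws_def[symmetric] by(simp add: ac_simps)
qed

context latgroup
begin

definition dRl :: "'a dR => 'x kos" where
"dRl=presentation.pe (%(x, y). MP (lg y) (presentation.pe le x))"

lemma tensor_dR_lemb:
assumes "i <= n" shows "lemb (tensor (ext_power A i) (Gamma (n - i) A)) dRl (dRw X n i)" unfolding dRl_def
proof (rule tensor_lemb[OF ext_lemb Gamma_lemb, where qa = "%(J, u). (J, {#})" and qb=snd])
show "linmap (%v. MP w v)" "linmap (%w. MP w v)" for v :: "'x kos" and w by(auto intro: lin)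
fix k :: "'x list \<times> 'x multiset" assume k: "dRw X n i k ~= 0"
obtain J u where Ju: "k=(J, u)" by fastforce
have "srt J" "length J=i" "size (mset J + u)=n" "set J <= X" "set_mset u <= X"
 using k by(auto simp: dRw_def Ju split: if_splits)
thus "lext_c i (case k of (J, u) => (J, {#})) ~= 0 & lg_c (n - i) (snd k) ~= 0 &
  dRw X n i k=lext_c i (case k of (J, u) => (J, {#})) * lg_c (n - i) (snd k) &
  MP (bs (snd k)) (bs (case k of (J, u) => (J, {#})))=bs k"
 using k by(auto simp: Ju lext_c_def lg_c_def dRw_def split: if_splits)
next
fix y :: "'x list \<times> 'x multiset" and z assume h: "lext_c i y ~= 0" "lg_c (n - i) z ~= 0"
then obtain J where J: "y=(J, {#})" "srt J" "length J=i" "set J <= X"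
 by(auto simp: lext_c_def split: if_splits prod.splits)
have z: "size z=n - i" "set_mset z <= X" "1 / mfact z ~= 0" using h(2) by(auto simp: lg_c_def split: if_splits)
show "\<exists>k. dRw X n i k ~= 0 & (case k of (J, u) => (J, {#}))=y & snd k=z"
 by(rule exI[of _ "(J, z)"]) (use J z assms in "auto simp: dRw_def")
qed

lemma dR_lemb: "lemb (dR_group A n i) dRl (dRw X n i)"
proof (cases "i <= n")
case True
thus ?thesis using tensor_dR_lemb by(simp add: dR_group_def Let_def)
next
case False
let ?T = "tensor (ext_power A i) (Gamma (n - i) A)"
have T: "lemb ?T dRl (dRw X (n - i + i) i)" using tensor_dR_lemb[of i "n - i + i"] by simp
interpret T: comm_group ?T by(rule lemb_comm[OF T])
have "dRw X n i k=0" for k using False by(auto simp: dRw_def split: prod.splits)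
hence w: "lat (dRw X n i) = {0}" by(auto simp: lat_def intro: pm_eqI)
have cg: "comm_group (?T\<lparr>carrier := {\<one>\<^bsub>?T\<^esub>}\<rparr>)" by(rule comm_groupI) auto
thus ?thesis using False lemb_one[OF T] T.l_one[OF T.one_closed] by(simp add: dR_group_def Let_def lemb_def w)
qed

lemma dR_emb_in: "x:carrier (dR_group A n i) ==> dRl x:dR X n i"
using lemb_lat[OF dR_lemb] by(simp add: lat_dRw)

lemma dRl_class: "dRl (tensor_class (ext_power A i) (Gamma j A) c)=ev (%(x, y). MP (lg y) (presentation.pe le x)) c"
unfolding dRl_def tensor_class_def
proof (rule presentation.pe_class[OF tensor_presentation])
show "group (ext_power A i)" "group (Gamma j A)" using lemb_group ext_lemb Gamma_lemb by blast+
show "ev (%(x, y). MP (lg y) (presentation.pe le x)) r=0" if "r:tensor_relators (ext_power A i) (Gamma j A)" for r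
 by(rule tensor_kill[OF ext_lemb Gamma_lemb _ _ that]) (auto intro: lin)
qed

lemma tensor_class_in:
assumes "i <= n" "keys c <= carrier (ext_power A i) \<times> carrier (Gamma (n - i) A)"
shows "tensor_class (ext_power A i) (Gamma (n - i) A) c:carrier (dR_group A n i)"
proof -
have "group (ext_power A i)" "group (Gamma (n - i) A)" using lemb_group ext_lemb Gamma_lemb by blast+
from presentation.carrier_presented[OF tensor_presentation[OF this]] show ?thesis
 using assms by(simp add: dR_group_def tensor_def tensor_class_def)
qed

lemma dRl_wedge:
assumes "!!k. k:K ==> b k:words A i"
shows "dRl (tensor_class (ext_power A i) (Gamma j A) (\<Sum>k\<in>K. frag_cmul (a k) (frag_of (wedge A (b k), Y k)))) =
 (\<Sum>k\<in>K. sc (of_int (a k)) (Qe (map cv (b k)) (lg (Y k))))"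
proof -
have "MP P (presentation.pe le (wedge A (b k)))=Qe (map cv (b k)) P" if "k:K" for k P
 using wedge_emb[OF assms[OF that]] Qe_MP[of "map cv (b k)" P 1] by simp
thus ?thesis by(simp add: dRl_class ev_sum)
qed

lemma dR_generators:
assumes "i <= n"
shows "generate (dR_group A n i) {tensor_class (ext_power A i) (Gamma (n - i) A) (frag_of (wedge A bs, Y)) | bs Y.
 bs:words A i & Y:carrier (Gamma (n - i) A)} = carrier (dR_group A n i)" (is "generate _ ?T=_")
proof (rule lemb_generate[OF dR_lemb])
show "?T <= carrier (dR_group A n i)" using wedge_in by(auto intro!: tensor_class_in[OF assms])
fix k assume k: "dRw X n i k ~= 0"
obtain J u where Ju: "k=(J, u)" by fastforce
have J: "srt J" "length J=i" "size (mset J + u)=n" "set J <= X" "set_mset u <= X"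
 using k by(auto simp: dRw_def Ju split: if_splits)
have c: "dRw X n i k=lg_c (n - i) u" using k J by(auto simp: Ju dRw_def lg_c_def split: if_splits)
define Y where "Y=trm (Gamma (n - i) A) lg (sc (lg_c (n - i) u) (bs u))"
have Y: "Y:carrier (Gamma (n - i) A)" "lg Y=sc (lg_c (n - i) u) (bs u)"
 unfolding Y_def using trm_in[OF Gamma_lemb lat_basis] trm_eq[OF Gamma_lemb lat_basis] by blast+
have w: "map be J:words A i" using be_list(1)[OF J(4)] J(2) by(simp add: words_def)
have "Qe (map bs J) (bs u)=bs (J, u)" using Qe_MP[of "map bs J" "bs u" 1] Qe_bs_srt[OF J(1)] by simp
moreover have "dRl (tensor_class (ext_power A i) (Gamma (n - i) A) (frag_of (wedge A (map be J), Y)))=Qe (map cv (map be J)) (lg Y)"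
 using dRl_wedge[of "{0::nat}" "%_. map be J" i "n - i" "%_. 1" "%_. Y"] w by simp
ultimately have "dRl (tensor_class (ext_power A i) (Gamma (n - i) A) (frag_of (wedge A (map be J), Y)))=sc (dRw X n i k) (bs k)"
 by(simp only: be_list(2)[OF J(4)] Y(2) c[unfolded Ju] Ju linmap_sc[OF linmap_Qe[OF linmap_id]])
thus "\<exists>t\<in>?T. dRl t=sc (dRw X n i k) (bs k)" using w Y(1) by blast
qed

lemma dR_diff_emb:
assumes x: "x:carrier (dR_group A n (Suc i))"
shows "dR_diff A n (Suc i) x:carrier (dR_group A n i)" "dRl (dR_diff A n (Suc i) x) = - kd (dRl x)"
proof -
let ?G = "dR_group A n (Suc i)" and ?H = "dR_group A n i"
have "dR_diff A n (Suc i) x:carrier ?H & dRl (dR_diff A n (Suc i) x) = - kd (dRl x)"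
proof (cases "Suc i <= n")
 case False
 interpret H: comm_group ?H by(rule lemb_comm[OF dR_lemb])
 have "x = \<one>\<^bsub>?G\<^esub>" using x False by(simp add: dR_group_def Let_def)
 hence "dRl x=0" using lemb_one[OF dR_lemb, of n "Suc i"] by simp
 thus ?thesis using False x lemb_one[OF dR_lemb, of n i] by(simp add: dR_diff_def kd_simps)
next
 case True
 have kdin: "- kd z:lat (dRw X n i)" if "z:lat (dRw X n (Suc i))" for z
  using kd_gl that by(auto simp: lat_dRw intro: gl_uminus)
 define f where "f=(%x. trm ?H dRl (- kd (dRl x)))"
 have f: "f:hom ?G ?H" unfolding f_def
  by(rule trm_hom[OF dR_lemb dR_lemb _ kdin]) (rule linmapI; simp add: kd_simps sc_uminus)
 let ?VV = "{(tensor_class (ext_power A (Suc i)) (Gamma (n - Suc i) A) (frag_of (wedge A bs, Y)),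
     tensor_class (ext_power A i) (Gamma (n - i) A)
      (\<Sum>k<Suc i. frag_cmul ((- 1) ^ Suc k)
        (frag_of (wedge A (drop_nth k bs), gamma A 1 (bs ! k) \<otimes>\<^bsub>Gamma_ring A\<^esub> Y)))) | bs Y.
     bs:words A (Suc i) & Y:carrier (Gamma (n - Suc i) A)}"
 have "hom_with_values ?G ?H ?VV=restrict f (carrier ?G)"
 proof (rule hom_with_values_eq[OF lemb_group[OF dR_lemb] lemb_group[OF dR_lemb] f])
  have fst: "fst ` ?VV = {tensor_class (ext_power A (Suc i)) (Gamma (n - Suc i) A) (frag_of (wedge A bs, Y)) | bs Y.
    bs:words A (Suc i) & Y:carrier (Gamma (n - Suc i) A)}" by(rule fst_image_pairs)
  show "generate ?G (fst ` ?VV)=carrier ?G" unfolding fst by(rule dR_generators[OF True])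
  show "fst ` ?VV <= carrier ?G" unfolding fst using wedge_in by(auto intro!: tensor_class_in[OF True])
  fix x y assume "(x, y):?VV"
  then obtain bs Y where x: "x=tensor_class (ext_power A (Suc i)) (Gamma (n - Suc i) A) (frag_of (wedge A bs, Y))"
   and y: "y=tensor_class (ext_power A i) (Gamma (n - i) A)
      (\<Sum>k<Suc i. frag_cmul ((- 1) ^ Suc k)
        (frag_of (wedge A (drop_nth k bs), gamma A 1 (bs ! k) \<otimes>\<^bsub>Gamma_ring A\<^esub> Y)))"
   and b: "bs:words A (Suc i)" and Y: "Y:carrier (Gamma (n - Suc i) A)" by blast
  have n: "Suc (n - Suc i)=n - i" using True by simp
  have len: "length bs=Suc i" and bsA: "set bs <= carrier A" using b by(auto simp: words_def)
  have dn: "drop_nth k bs:words A i" if "k < Suc i" for k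
   using that len bsA set_take_subset[of k bs] set_drop_subset[of "Suc k" bs] by(auto simp: words_def drop_nth_def)
  have bk: "bs ! k:carrier A" if "k < Suc i" for k using that len bsA nth_mem[of k bs] by auto
  have gm: "gamma A 1 (bs ! k) \<otimes>\<^bsub>Gamma_ring A\<^esub> Y:carrier (Gamma (n - i) A)"
   "lg (gamma A 1 (bs ! k) \<otimes>\<^bsub>Gamma_ring A\<^esub> Y)=lp (cv (bs ! k)) * lg Y" if "k < Suc i" for k
   using gamma_mult_emb[OF bk[OF that] Y] by(simp_all only: n)
  have xin: "x:carrier ?G" unfolding x using wedge_in[OF b] Y by(intro tensor_class_in[OF True]) auto
  have yin: "y:carrier ?H" unfolding y by(intro tensor_class_in keys_frag_sum) (use True wedge_in dn gm in auto)
  have lx: "dRl x=Qe (map cv bs) (lg Y)"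
   using dRl_wedge[of "{0::nat}" "%_. bs" "Suc i" "n - Suc i" "%_. 1" "%_. Y"] b by(simp add: x)
  have "dRl y=(\<Sum>k<Suc i. sc (of_int ((- 1) ^ Suc k)) (Qe (map cv (drop_nth k bs)) (lg (gamma A 1 (bs ! k) \<otimes>\<^bsub>Gamma_ring A\<^esub> Y))))"
   unfolding y by(rule dRl_wedge) (use dn in simp)
  also have "... = (\<Sum>k<Suc i. - sc ((- 1) ^ k) (Qe (drop_nth k (map cv bs)) (lp (map cv bs ! k) * lg Y)))"
   by(rule sum.cong) (use gm len in "auto simp: drop_nth_map sc_minus1")
  also have "... = - kd (dRl x)" by(simp only: lx kd_Qe length_map len sum_negf)
  finally have "dRl y=dRl (f x)"
   unfolding f_def using trm_eq[OF dR_lemb kdin[OF lemb_lat[OF dR_lemb xin]]] by simp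
  moreover have "f x:carrier ?H" using f xin by(auto simp: hom_def)
  ultimately show "f x=y" using lemb_inj[OF dR_lemb _ yin] by metis
 qed
 hence "dR_diff A n (Suc i)=restrict f (carrier ?G)" using True by(simp add: dR_diff_def)
 moreover have "dRl (f x) = - kd (dRl x)" unfolding f_def by(rule trm_eq[OF dR_lemb kdin[OF lemb_lat[OF dR_lemb x]]])
 moreover have "f x:carrier ?H" using f x by(auto simp: hom_def)
 ultimately show ?thesis using x by simp
qed
thus "dR_diff A n (Suc i) x:carrier ?H" "dRl (dR_diff A n (Suc i) x) = - kd (dRl x)" by auto
qed

subsection \<open>Homology\<close>

abbreviation "dRZ n i == {z:dR X n i. kd z=0}"
abbreviation "dRB n i == kd ` dR X n (Suc i)"
abbreviation "dRcls n i == lcls (dR_group A n i) dRl (dRB n i)"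

lemma dR_boundaries: "boundaries (dR_group A n) (dR_diff A n) i = {x:carrier (dR_group A n i). dRl x:dRB n i}"
proof (intro equalityI subsetI)
fix x assume "x:boundaries (dR_group A n) (dR_diff A n) i"
then obtain y where y: "y:carrier (dR_group A n (Suc i))" "x=dR_diff A n (Suc i) y" by(auto simp: boundaries_def)
have "- kd (dRl y)=kd (- dRl y)" by(simp add: kd_simps)
thus "x : {x:carrier (dR_group A n i). dRl x:dRB n i}"
 using dR_diff_emb[OF y(1)] gl_uminus[OF dR_emb_in[OF y(1)]] by(auto simp: y(2))
next
fix x assume x: "x : {x:carrier (dR_group A n i). dRl x:dRB n i}"
then obtain z where z: "z:dR X n (Suc i)" "dRl x=kd z" by blast
obtain y where y: "y:carrier (dR_group A n (Suc i))" "dRl y = - z"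
 by(rule lemb_obtain[OF dR_lemb, of "- z" n "Suc i"]) (use z gl_uminus in "auto simp: lat_dRw")
have "dRl (dR_diff A n (Suc i) y)=dRl x" using dR_diff_emb(2)[OF y(1)] y(2) z(2) by(simp add: kd_simps)
hence "x=dR_diff A n (Suc i) y" using lemb_inj[OF dR_lemb] dR_diff_emb(1)[OF y(1)] x by(metis (mono_tags) mem_Collect_eq)
thus "x:boundaries (dR_group A n) (dR_diff A n) i" unfolding boundaries_def using y(1) by blast
qed

lemma dR_cycles:
assumes "0 < i" shows "cycles (dR_group A n) (dR_diff A n) i = {x:carrier (dR_group A n i). dRl x:dRZ n i}"
proof -
obtain j where j: "i=Suc j" using assms by(cases i) auto
have "dR_diff A n i x = \<one>\<^bsub>dR_group A n (i - 1)\<^esub> \<longleftrightarrow> kd (dRl x)=0" if "x:carrier (dR_group A n i)" for x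
 using lemb_eq_one_iff[OF dR_lemb dR_diff_emb(1)[of x n j]] dR_diff_emb(2)[of x n j] that by(simp add: j)
thus ?thesis using assms dR_emb_in by(auto simp: cycles_def kernel_def)
qed

lemma addsub_dRZ: "addsub (dRZ n i)" and addsub_dRB: "addsub (dRB n i)"
unfolding lat_dRw[symmetric] by(intro addsub_cycles addsub_image addsub_lat linmap_kd0)+

lemma dRB_sub: "dRB n i <= dRZ n i" using kd_gl by(auto simp: kd_kd)

text \<open>The embeddings of the exterior and divided power factors are compatible with the differentials.\<close>

lemma dR_qpres: "0 < i ==> qpres (dR_homology A n i) (dRcls n i) (dRZ n i) (dRB n i)"
unfolding dR_homology_def homology_def by(rule subquotient_qpres[OF dR_lemb addsub_dRZ _ _ addsub_dRB dRB_sub])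
  (auto simp: dR_cycles dR_boundaries lat_dRw)

lemma dR_homology_class: "x:carrier (dR_group A n i) ==>
 homology_class (dR_group A n) (dR_diff A n) i x=dRcls n i (dRl x)"
unfolding homology_class_def by(rule r_coset_lcls[OF dR_lemb addsub_dRB dR_boundaries])

lemma f_cycle_emb:
assumes p: "p > 0" and n: "n = p * m" and i: "i < m" and xs: "xs \<in> words A m"
shows "f_cycle A n p i xs \<in> carrier (dR_group A n i)"
 "dRl (f_cycle A n p i xs) = ff p (map cv (take (Suc i) xs)) (map cv (drop (Suc i) xs))"
proof -
have len: "length xs = m" and xA: "set xs \<subseteq> carrier A" using xs by(auto simp: words_def)
have xl: "xs ! l \<in> carrier A" if "l < m" for l using that len xA nth_mem[of l xs] by auto
define G where "G = (\<lambda>t. \<Prod>l<length xs. gamma_symbol (if l \<le> i \<and> l \<noteq> t then p - 1 else p) (xs ! l))"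
have i_n: "i \<le> n" using i p by(auto simp: n intro: order.trans[of i m])
have dn: "drop_nth t (take (Suc i) xs) \<in> words A i" if "t \<le> i" for t
proof -
 have "set (drop_nth t (take (Suc i) xs)) \<subseteq> carrier A"
  using set_drop_nth[of t "take (Suc i) xs"] set_take_subset[of "Suc i" xs] xA by blast
 thus ?thesis using that len i by(simp add: words_def length_drop_nth)
qed
have GPR: "G t \<in> carrier PR" for t unfolding G_def using xl len by(intro PR_closed_more symbol_carrier) auto
have deg: "tdeg M = n - i" if t: "t \<le> i" and M: "M \<in> keys (G t)" for t M
proof -
 have fr: "(\<Prod>l\<in>T. gamma_symbol (a l) (x l)) = frag_of (\<Sum>l\<in>T. {#(a l, x l)#})" if "finite T" for T and a :: "nat \<Rightarrow> nat" and x :: "nat \<Rightarrow> 'a"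
  using that by(induction T) (auto simp: mult_single gamma_symbol_def)
 have td: "tdeg (\<Sum>l\<in>T. {#(a l, x l)#}) = (\<Sum>l\<in>T. a l)" if "finite T" for T and a :: "nat \<Rightarrow> nat" and x :: "nat \<Rightarrow> 'a"
  using that by(induction T) (auto simp: tdeg_def)
 let ?a = "\<lambda>l. if l \<le> i \<and> l \<noteq> t then p - 1 else p"
 have "tdeg M = (\<Sum>l<m. ?a l)" using M by(simp add: G_def fr td len)
 moreover have "(\<Sum>l<m. ?a l) + i = n"
 proof -
  have "(\<Sum>l<m. if l \<le> i \<and> l \<noteq> t then 1 else 0::nat) = card {l \<in> {..<m}. l \<le> i \<and> l \<noteq> t}"
   by(simp add: sum.If_cases Int_def)
  also have "{l \<in> {..<m}. l \<le> i \<and> l \<noteq> t} = {..i} - {t}" using i by auto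
  finally have "(\<Sum>l<m. if l \<le> i \<and> l \<noteq> t then 1 else 0::nat) = i" using t by simp
  hence "(\<Sum>l<m. ?a l) + i = (\<Sum>l<m. ?a l + (if l \<le> i \<and> l \<noteq> t then 1 else 0))" by(simp only: sum.distrib)
  also have "\<dots> = (\<Sum>l<m. p)" by(rule sum.cong) (use p in auto)
  finally show ?thesis by(simp add: n)
 qed
 ultimately show ?thesis by simp
qed
have cl: "Gamma_class A (G t) \<in> carrier (Gamma (n - i) A)" if "t \<le> i" for t
 using Gamma_class_in[OF GPR deg[OF that]] .
have eq: "f_cycle A n p i xs = tensor_class (ext_power A i) (Gamma (n - i) A)
  (\<Sum>t\<le>i. frag_cmul ((- 1) ^ Suc t) (frag_of (wedge A (drop_nth t (take (Suc i) xs)), Gamma_class A (G t))))"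
 by(simp only: f_cycle_def G_def)
show "f_cycle A n p i xs \<in> carrier (dR_group A n i)"
 unfolding eq by(intro tensor_class_in[OF i_n] keys_frag_sum) (use wedge_in dn cl in auto)
let ?bl = "map cv (take (Suc i) xs)" and ?ws = "map cv (drop (Suc i) xs)"
have lb: "length ?bl = Suc i" using len i by simp
have "dRl (f_cycle A n p i xs) = (\<Sum>t\<le>i. sc (of_int ((- 1) ^ Suc t)) (Qe (map cv (drop_nth t (take (Suc i) xs))) (lg (Gamma_class A (G t)))))"
 unfolding eq by(rule dRl_wedge) (use dn in simp)
also have "\<dots> = (\<Sum>t<length ?bl. sc ((- 1) ^ Suc t)
 (Qe (drop_nth t ?bl) (gpl ((p, ?bl ! t) # map (Pair (p - 1)) (drop_nth t ?bl) @ map (Pair p) ?ws))))"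
proof (rule sum.cong)
 show "{..i} = {..<length ?bl}" using lb by(auto simp del: length_map)
 fix t assume "t \<in> {..<length ?bl}"
 hence t: "t \<le> i" using lb by(simp del: length_map)
 have "lg (Gamma_class A (G t)) = (\<Prod>l<length xs. (\<lambda>e x. gp e (cv x)) (if l \<le> i \<and> l \<noteq> t then p - 1 else p) (xs ! l))"
  by(simp add: G_def em_prod)
 also have "\<dots> = gp p (cv (xs ! t)) * prod_list (map (\<lambda>x. gp (p - 1) (cv x)) (drop_nth t (take (Suc i) xs))) *
   prod_list (map (\<lambda>x. gp p (cv x)) (drop (Suc i) xs))" by(rule f_exponents_prod) (use t i len in auto)
 also have "\<dots> = gpl ((p, ?bl ! t) # map (Pair (p - 1)) (drop_nth t ?bl) @ map (Pair p) ?ws)"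
  using t i len by(simp add: gpl_def drop_nth_map comp_def mult.assoc)
 finally show "sc (of_int ((- 1) ^ Suc t)) (Qe (map cv (drop_nth t (take (Suc i) xs))) (lg (Gamma_class A (G t)))) =
  sc ((- 1) ^ Suc t) (Qe (drop_nth t ?bl) (gpl ((p, ?bl ! t) # map (Pair (p - 1)) (drop_nth t ?bl) @ map (Pair p) ?ws)))"
  by(simp add: drop_nth_map)
qed
also have "\<dots> = ff p ?bl ?ws" by(rule ff_eq[OF p, symmetric])
finally show "dRl (f_cycle A n p i xs) = ff p (map cv (take (Suc i) xs)) (map cv (drop (Suc i) xs))" .
qed

end

section \<open>Symmetric powers of embedded groups\<close>

definition spl :: "('g => 'y vec) => 'g multiset => 'y multiset \<Rightarrow>\<^sub>0 rat" where
"spl l M=prod_mset (image_mset (%x. lp (l x)) M)"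

definition spc :: "nat => ('y => rat) => 'y multiset => rat" where
"spc m c N=(if size N=m then prod_mset (image_mset c N) else 0)"

definition spe :: "('g => 'y vec) => ('g multiset \<Rightarrow>\<^sub>0 int) set => 'y multiset \<Rightarrow>\<^sub>0 rat" where
"spe l=presentation.pe (spl l)"

lemma SP_presentation:
assumes "group G" shows "presentation (monomials G m) (SP_relators m G)"
proof
interpret group G by(rule assms)
fix r assume "r:SP_relators m G"
then obtain x y M where r: "r=frag_of (add_mset (x \<otimes>\<^bsub>G\<^esub> y) M) - frag_of (add_mset x M) - frag_of (add_mset y M)"
 "add_mset x M:monomials G m" "y:carrier G" unfolding SP_relators_def by blast
hence "add_mset (x \<otimes>\<^bsub>G\<^esub> y) M:monomials G m" "add_mset y M:monomials G m" by(auto simp: monomials_def)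
thus "keys r <= monomials G m"
 using r keys_frag_three[of "add_mset (x \<otimes>\<^bsub>G\<^esub> y) M" "add_mset x M" "add_mset y M"] by blast
qed

lemma SP_kill:
assumes G: "lemb G l c" and r: "r:SP_relators m G" shows "ev (spl l) r=0"
proof -
obtain x y M where r: "r=frag_of (add_mset (x \<otimes>\<^bsub>G\<^esub> y) M) - frag_of (add_mset x M) - frag_of (add_mset y M)"
 "add_mset x M:monomials G m" "y:carrier G" using r unfolding SP_relators_def by blast
hence "l (x \<otimes>\<^bsub>G\<^esub> y)=l x + l y" by(intro lemb_mult[OF G]) (auto simp: monomials_def)
thus ?thesis by(simp add: r(1) spl_def lp_simps algebra_simps)
qed

text \<open>The relators express multiadditivity, so monomials in basis elements span; their images are distinct
 monomials.\<close>

lemma SP_lemb: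
fixes l :: "'g => 'y vec"
assumes G: "lemb G l c" shows "lemb (SP m G) (spe l) (spc m c)"
proof -
interpret G: comm_group G by(rule lemb_comm[OF G])
interpret presentation "monomials G m" "SP_relators m G" by(rule SP_presentation[OF G.is_group])
define b where "b=(%y. trm G l (sc (c y) (bs y)))"
have b: "b y:carrier G" "l (b y)=sc (c y) (bs y)" for y
 unfolding b_def using trm_in[OF G lat_basis] trm_eq[OF G lat_basis] by blast+
let ?Y = "image_mset b ` {k. spc m c k ~= 0}"
have red: "frag_of (M + image_mset b N):spn ?Y"
 if "set_mset M <= carrier G" "\<forall>y\<in>#N. c y ~= 0" "size M + size N=m" for M N using that
proof (induction M arbitrary: N)
 case empty
 hence "spc m c N ~= 0" by(auto simp: spc_def prod_mset_zero_iff)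
 thus ?case by(intro spn_of) simp
next
 case (add x M)
 let ?f = "%x. frag_of (add_mset x (M + image_mset b N))"
 let ?K = "{x:carrier G. ?f x:spn ?Y}"
 have M: "set_mset M <= carrier G" "size M + size N + 1=m" "x:carrier G" using add.prems by auto
 have rel: "?f (x \<otimes>\<^bsub>G\<^esub> y) - (?f x + ?f y):gen (monomials G m) (SP_relators m G)" if "x:carrier G" "y:carrier G" for x y
 proof -
  have "add_mset x (M + image_mset b N):monomials G m" using M b that by(auto simp: monomials_def)
  hence "?f (x \<otimes>\<^bsub>G\<^esub> y) - ?f x - ?f y:SP_relators m G" using that unfolding SP_relators_def by blast
  from gen_R[OF this] show ?thesis by(simp add: algebra_simps)
 qed
 have "- ?f \<one>\<^bsub>G\<^esub> : gen (monomials G m) (SP_relators m G)" using rel[of "\<one>\<^bsub>G\<^esub>" "\<one>\<^bsub>G\<^esub>"] by simp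
 hence "?f \<one>\<^bsub>G\<^esub> - 0:gen (monomials G m) (SP_relators m G)" using gen_uminus by fastforce
 hence one: "?f \<one>\<^bsub>G\<^esub> : spn ?Y" using spn_cong spn_0 by blast
 have "subgroup ?K G"
 proof (rule G.subgroupI)
  fix x y assume "x:?K" "y:?K"
  thus "x \<otimes>\<^bsub>G\<^esub> y:?K" using spn_cong[OF rel[of x y] spn_add] by auto
 next
  fix x assume x: "x:?K"
  have "?f (inv\<^bsub>G\<^esub> x) - (?f \<one>\<^bsub>G\<^esub> - ?f x):gen (monomials G m) (SP_relators m G)"
   using gen_uminus[OF rel[of x "inv\<^bsub>G\<^esub> x"]] x by(simp add: algebra_simps)
  thus "inv\<^bsub>G\<^esub> x:?K" using spn_cong[OF _ spn_diff[OF one]] x by auto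
 qed (use one in auto)
 hence "?K=carrier G"
 proof (rule lemb_full_subgroup[OF G])
  fix y assume y: "c y ~= 0"
  have "frag_of (M + image_mset b (add_mset y N)):spn ?Y" using add.prems y M by(intro add.IH) auto
  thus "\<exists>t\<in>?K. l t=sc (c y) (bs y)" using b by(intro bexI[of _ "b y"]) auto
 qed
 thus ?case using M(3) by auto
qed
show ?thesis unfolding SP_def spe_def
proof (rule presented_lemb_indexed[where g = "image_mset b"])
 show "ev (spl l) r=0" if "r:SP_relators m G" for r by(rule SP_kill[OF G that])
 show "image_mset b k:monomials G m & spl l (image_mset b k)=sc (spc m c k) (bs k)" if "spc m c k ~= 0" for k
 proof -
  have "size k=m" using that by(simp add: spc_def split: if_splits)
  moreover have "spl l (image_mset b N)=sc (prod_mset (image_mset c N)) (bs N)" for N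
   by(induction N) (auto simp: spl_def b lp_simps bs_mult sc_mult_left sc_mult_right ac_simps)
  ultimately show ?thesis using b by(auto simp: monomials_def spc_def)
 qed
 show "frag_of s:spn ?Y" if "s:monomials G m" for s using red[of s "{#}"] that by(auto simp: monomials_def)
qed
qed

lemma spe_class: "lemb G l c ==> spe l (SP_class m G x)=ev (spl l) x" unfolding spe_def SP_class_def
by(rule presentation.pe_class[OF SP_presentation SP_kill]) (auto intro: lemb_group)

lemma SP_class_in: "group G ==> keys x <= monomials G m ==> SP_class m G x:carrier (SP m G)"
unfolding SP_def SP_class_def by(simp add: presentation.carrier_presented[OF SP_presentation])

lemma SP_map_emb:
assumes G: "lemb G l c" and H: "lemb H l' c'" and \<phi>: "!!x. x:carrier G ==> \<phi> x:carrier H"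
 and T: "linmap T" "!!M. set_mset M <= carrier G ==> T (spl l M)=spl l' (image_mset \<phi> M)"
 and x: "x:carrier (SP m G)"
shows "SP_map m G H \<phi> x:carrier (SP m H)" "spe l' (SP_map m G H \<phi> x)=T (spe l x)"
proof -
let ?VV = "{(SP_class m G (frag_of M), SP_class m H (frag_of (image_mset \<phi> M))) | M. M:monomials G m}"
note eG=SP_lemb[OF G, of m] and eH=SP_lemb[OF H, of m]
have cG: "group G" and cH: "group H" using lemb_group G H by blast+
have im: "image_mset \<phi> M:monomials H m" if "M:monomials G m" for M using that \<phi> by(auto simp: monomials_def)
have val: "spe l' (SP_class m H (frag_of (image_mset \<phi> M)))=T (spe l (SP_class m G (frag_of M)))" if "M:monomials G m" for M
 using T(2)[of M] that by(simp add: spe_class[OF G] spe_class[OF H] monomials_def)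
have clG: "SP_class m G (frag_of M):carrier (SP m G)" if "M:monomials G m" for M
 using that by(intro SP_class_in[OF cG]) simp
have clH: "SP_class m H (frag_of (image_mset \<phi> M)):carrier (SP m H)" if "M:monomials G m" for M
 using im[OF that] by(intro SP_class_in[OF cH]) simp
have gens: "generate (SP m G) {SP_class m G (frag_of M) | M. M:monomials G m} = carrier (SP m G)"
proof -
 have "presented_class (monomials G m) (SP_relators m G) ` frag_of ` monomials G m = {SP_class m G (frag_of M) | M. M:monomials G m}"
  by(auto simp: SP_class_def)
 with presentation.presented_generate[OF SP_presentation[OF cG], of m] show ?thesis by(simp add: SP_def)
qed
have inK: "spe l z:lat (spc m c) & T (spe l z):lat (spc m c')" if "z:carrier (SP m G)" for z
proof -
 interpret SG: group "SP m G" by(rule lemb_group[OF eG])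
 have "z:generate (SP m G) {SP_class m G (frag_of M) | M. M:monomials G m}" using that gens by simp
 hence "z:carrier (SP m G) & T (spe l z):lat (spc m c')"
 proof (induction rule: generate.induct)
  case one
  show ?case by(simp add: lemb_one[OF eG] linmap_0[OF T(1)])
 next
  case (incl h)
  then obtain M where M: "M:monomials G m" "h=SP_class m G (frag_of M)" by blast
  thus ?case using clG[OF M(1)] lemb_lat[OF eH clH[OF M(1)]] by(simp add: val)
 next
  case (inv h)
  then obtain M where M: "M:monomials G m" "h=SP_class m G (frag_of M)" by blast
  hence "T (spe l h):lat (spc m c')" "h:carrier (SP m G)" using clG[OF M(1)] lemb_lat[OF eH clH[OF M(1)]] by(simp_all add: val)
  thus ?case by(simp add: lemb_inv[OF eG] linmap_uminus[OF T(1)])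
 next
  case (eng h k)
  thus ?case by(simp add: lemb_mult[OF eG] linmap_add[OF T(1)] lat_add)
 qed
 thus ?thesis using lemb_lat[OF eG that] by blast
qed
have Tl: "T z:lat (spc m c')" if "z:lat (spc m c)" for z using lemb_obtain[OF eG that] inK by metis
define f where "f=(%x. trm (SP m H) (spe l') (T (spe l x)))"
have f: "f:hom (SP m G) (SP m H)" unfolding f_def by(rule trm_hom[OF eG eH T(1) Tl])
have "SP_map m G H \<phi> = restrict f (carrier (SP m G))" unfolding SP_map_def
proof (rule hom_with_values_eq[OF lemb_group[OF eG] lemb_group[OF eH] f])
 have fst: "fst ` ?VV = {SP_class m G (frag_of M) | M. M:monomials G m}" by force
 show "generate (SP m G) (fst ` ?VV)=carrier (SP m G)" unfolding fst by(rule gens)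
 show "fst ` ?VV <= carrier (SP m G)" unfolding fst using clG by blast
 fix y z assume "(y, z):?VV"
 then obtain M where M: "M:monomials G m" "y=SP_class m G (frag_of M)" "z=SP_class m H (frag_of (image_mset \<phi> M))" by blast
 show "f y=z" unfolding f_def M(2,3) val[OF M(1), symmetric] by(rule trm_emb[OF eH clH[OF M(1)]])
qed
moreover have "f x:carrier (SP m H)" using f x by(auto simp: hom_def)
moreover have "spe l' (f x)=T (spe l x)" unfolding f_def using trm_eq[OF eH] inK[OF x] by blast
ultimately show "SP_map m G H \<phi> x:carrier (SP m H)" "spe l' (SP_map m G H \<phi> x)=T (spe l x)" using x by simp_all
qed

section \<open>Reduction modulo a prime\<close>

lemma frag_eval_superset:
assumes "comm_group B" "finite T" "keys c <= T" "T <= carrier B"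
shows "frag_eval B c=(\<Otimes>\<^bsub>B\<^esub>x\<in>T. x [^]\<^bsub>B\<^esub> lookup c x)"
proof -
interpret comm_group B by(rule assms)
show ?thesis unfolding frag_eval_def
 by(rule finprod_mono_neutral_cong_left) (use assms in "auto simp: in_keys_iff subset_iff")
qed

lemma frag_eval_closed:
assumes "comm_group B" "keys c <= carrier B" shows "frag_eval B c:carrier B"
proof -
interpret comm_group B by(rule assms)
show ?thesis unfolding frag_eval_def by(rule finprod_closed) (use assms in auto)
qed

lemma frag_eval_add:
assumes B: "comm_group B" and a: "keys a <= carrier B" and b: "keys b <= carrier B"
shows "frag_eval B (a + b)=frag_eval B a \<otimes>\<^bsub>B\<^esub> frag_eval B b"
proof -
interpret comm_group B by(rule B)
let ?T = "keys a \<union> keys b"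
have T: "finite ?T" "?T <= carrier B" using a b by auto
have "frag_eval B (a + b)=(\<Otimes>\<^bsub>B\<^esub>x\<in>?T. x [^]\<^bsub>B\<^esub> lookup (a + b) x)"
 by(rule frag_eval_superset[OF B T(1) keys_add T(2)])
also have "... = (\<Otimes>\<^bsub>B\<^esub>x\<in>?T. x [^]\<^bsub>B\<^esub> lookup a x \<otimes>\<^bsub>B\<^esub> x [^]\<^bsub>B\<^esub> lookup b x)"
 by(rule finprod_cong') (use T in "auto simp: lookup_add int_pow_mult subset_iff")
also have "... = (\<Otimes>\<^bsub>B\<^esub>x\<in>?T. x [^]\<^bsub>B\<^esub> lookup a x) \<otimes>\<^bsub>B\<^esub> (\<Otimes>\<^bsub>B\<^esub>x\<in>?T. x [^]\<^bsub>B\<^esub> lookup b x)"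
 by(rule finprod_multf) (use T in auto)
also have "... = frag_eval B a \<otimes>\<^bsub>B\<^esub> frag_eval B b"
 using frag_eval_superset[OF B T(1) _ T(2), of a] frag_eval_superset[OF B T(1) _ T(2), of b] by simp
finally show ?thesis .
qed

lemma frag_eval_simps:
assumes B: "comm_group B"
shows "frag_eval B 0 = \<one>\<^bsub>B\<^esub>" "x:carrier B ==> frag_eval B (frag_of x)=x"
proof -
interpret comm_group B by(rule B)
show "frag_eval B 0 = \<one>\<^bsub>B\<^esub>" by(simp add: frag_eval_def)
show "x:carrier B ==> frag_eval B (frag_of x)=x" by(simp add: frag_eval_def)
qed

lemma frag_cmul_Suc_add: "(f - g - h) + (g - frag_cmul (int k) h)=f - frag_cmul (int (Suc k)) h"
by(rule poly_mapping_eqI) (simp add: lookup_add lookup_minus algebra_simps)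

context latgroup
begin

context
fixes p :: nat
assumes p: "p >= 2"
begin

interpretation Z: group "integer_mod_group p" by simp

interpretation T: presentation "carrier A \<times> carrier (integer_mod_group p)" "tensor_relators A (integer_mod_group p)"
by(rule tensor_presentation) (auto intro: A.is_group)

abbreviation (input) "GT == gen (carrier A \<times> carrier (integer_mod_group p)) (tensor_relators A (integer_mod_group p))"

lemma Zp: "k:carrier (integer_mod_group p) \<longleftrightarrow> 0 <= k & k < int p"
using p by(simp add: carrier_integer_mod_group)

lemma mod_p_comm_group: "comm_group (mod_p A p)" unfolding mod_p_def tensor_def by(rule T.presented_comm_group)

lemma GT1: "x:carrier A ==> y:carrier A ==> 0 <= k ==> k < int p ==>
 frag_of (x \<otimes>\<^bsub>A\<^esub> y, k) - frag_of (x, k) - frag_of (y, k):GT"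
using Zp by(intro T.gen_R) (auto simp: tensor_relators_def)

lemma GT2: "x:carrier A ==> 0 <= j ==> j < int p ==> 0 <= k ==> k < int p ==>
 frag_of (x, (j + k) mod int p) - frag_of (x, j) - frag_of (x, k):GT"
proof (intro T.gen_R)
assume "x:carrier A" "0 <= j" "j < int p" "0 <= k" "k < int p"
hence "x:carrier A & j:carrier (integer_mod_group p) & k:carrier (integer_mod_group p)" using Zp by auto
thus "frag_of (x, (j + k) mod int p) - frag_of (x, j) - frag_of (x, k):tensor_relators A (integer_mod_group p)"
 unfolding tensor_relators_def by(intro UnI2 CollectI exI[of _ x] exI[of _ j] exI[of _ k]) simp
qed

lemma GT_zero: "x:carrier A ==> frag_of (x, 0):GT" using T.gen_uminus[OF GT2[of x 0 0]] p by simp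

lemma GT_mult: "x:carrier A ==> frag_of (x, int k mod int p) - frag_cmul (int k) (frag_of (x, 1)):GT"
proof (induction k)
case 0
thus ?case using GT_zero by simp
next
case (Suc k)
have "frag_of (x, (int k mod int p + 1) mod int p) - frag_of (x, int k mod int p) - frag_of (x, 1):GT"
 using Suc.prems p by(intro GT2) auto
moreover have "(int k mod int p + 1) mod int p=int (Suc k) mod int p" by(simp add: mod_simps ac_simps)
ultimately have "frag_of (x, int (Suc k) mod int p) - frag_of (x, int k mod int p) - frag_of (x, 1):GT" by(simp only:)
from T.gen_add[OF this Suc.IH[OF Suc.prems]] show ?case unfolding frag_cmul_Suc_add .
qed

lemma GT_one: "frag_of (\<one>\<^bsub>A\<^esub>, 1):GT"
using T.gen_uminus[OF GT1[of "\<one>\<^bsub>A\<^esub>" "\<one>\<^bsub>A\<^esub>" 1]] p by simp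

lemma GT_pow: "x:carrier A ==> frag_of (x [^]\<^bsub>A\<^esub> (k::nat), 1) - frag_cmul (int k) (frag_of (x, 1)):GT"
proof (induction k)
case 0
thus ?case using GT_one by simp
next
case (Suc k)
have "frag_of (x [^]\<^bsub>A\<^esub> k \<otimes>\<^bsub>A\<^esub> x, 1) - frag_of (x [^]\<^bsub>A\<^esub> k, 1) - frag_of (x, 1):GT"
 using Suc.prems p by(intro GT1) auto
from T.gen_add[OF this Suc.IH[OF Suc.prems]] show ?case unfolding frag_cmul_Suc_add by simp
qed

lemma red_eq_GT: "red_p A p x=red_p A p y \<longleftrightarrow> frag_of (x, 1) - frag_of (y, 1):GT"
unfolding red_p_def tensor_class_def by(rule T.class_eq_iff)

lemma red_in: "x:carrier A ==> red_p A p x:carrier (mod_p A p)"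
unfolding red_p_def tensor_class_def mod_p_def tensor_def T.carrier_presented using Zp p by auto

lemma red_mult: "x:carrier A ==> y:carrier A ==>
 red_p A p (x \<otimes>\<^bsub>A\<^esub> y)=red_p A p x \<otimes>\<^bsub>mod_p A p\<^esub> red_p A p y"
proof -
assume xy: "x:carrier A" "y:carrier A"
have "red_p A p x \<otimes>\<^bsub>mod_p A p\<^esub> red_p A p y=tensor_class A (integer_mod_group p) (frag_of (x, 1) + frag_of (y, 1))"
 unfolding red_p_def tensor_class_def mod_p_def tensor_def using xy Zp p by(intro T.presented_mult) auto
thus ?thesis
 using GT1[OF xy, of 1] p T.class_eq_iff[of "frag_of (x \<otimes>\<^bsub>A\<^esub> y, 1)" "frag_of (x, 1) + frag_of (y, 1)"]
 by(simp add: red_p_def tensor_class_def algebra_simps)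
qed

lemma red_surj: assumes "b:carrier (mod_p A p)" shows "\<exists>x\<in>carrier A. b=red_p A p x"
proof -
obtain c where c: "keys c <= carrier A \<times> carrier (integer_mod_group p)"
 "b=tensor_class A (integer_mod_group p) c"
 using assms unfolding mod_p_def tensor_def T.carrier_presented tensor_class_def by blast
have "\<exists>x\<in>carrier A. c - frag_of (x, 1):GT" using c(1)
proof (induction c rule: frag_induction)
 case zero
 show ?case using T.gen_uminus[OF GT_one] by(intro bexI[of _ "\<one>\<^bsub>A\<^esub>"]) auto
next
 case (one y)
 obtain x k where y: "y=(x, k)" by fastforce
 have x: "x:carrier A" and k: "0 <= k" "k < int p" using one Zp by(auto simp: y)
 have kk: "int (nat k) mod int p=k" "int (nat k)=k" using k by auto
 from T.gen_diff[OF GT_mult[OF x, of "nat k"] GT_pow[OF x, of "nat k"]]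
 have "frag_of y - frag_of (x [^]\<^bsub>A\<^esub> nat k, 1):GT" unfolding kk y using k by simp
 thus ?case using x by(intro bexI[of _ "x [^]\<^bsub>A\<^esub> nat k"]) auto
next
 case (diff a b)
 then obtain x y where xy: "x:carrier A" "a - frag_of (x, 1):GT" "y:carrier A" "b - frag_of (y, 1):GT" by blast
 have "frag_of ((x \<otimes>\<^bsub>A\<^esub> inv\<^bsub>A\<^esub> y) \<otimes>\<^bsub>A\<^esub> y, 1) - frag_of (x \<otimes>\<^bsub>A\<^esub> inv\<^bsub>A\<^esub> y, 1) - frag_of (y, 1):GT"
  using xy p by(intro GT1) auto
 moreover have "(x \<otimes>\<^bsub>A\<^esub> inv\<^bsub>A\<^esub> y) \<otimes>\<^bsub>A\<^esub> y=x" using xy by(simp add: A.m_assoc)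
 ultimately have "frag_of (x, 1) - frag_of (x \<otimes>\<^bsub>A\<^esub> inv\<^bsub>A\<^esub> y, 1) - frag_of (y, 1):GT" by simp
 from T.gen_add[OF T.gen_diff[OF xy(2,4)] this]
 have "a - b - frag_of (x \<otimes>\<^bsub>A\<^esub> inv\<^bsub>A\<^esub> y, 1):GT" by(simp add: algebra_simps)
 thus ?case using xy by(intro bexI[of _ "x \<otimes>\<^bsub>A\<^esub> inv\<^bsub>A\<^esub> y"]) auto
qed
thus ?thesis using c(2) T.class_eq_iff unfolding red_p_def tensor_class_def by blast
qed

lemma red_eq_iff:
assumes x: "x:carrier A" and y: "y:carrier A"
shows "red_p A p x=red_p A p y \<longleftrightarrow> (\<exists>v\<in>vecs X. cv x - cv y=sc (of_nat p) v)"
proof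
let ?l = "%(x, k). sc (of_int k) (cv x)"
let ?V = "sc (of_nat p) ` vecs X"
have V: "addsub ?V" unfolding vecs_def by(intro addsub_image addsub_lat lin)
have "ev ?l c:?V" if "c:GT" for c using that
proof (induction rule: generate.induct)
 case one
 thus ?case using addsubD(1)[OF V] by simp
next
 case (incl r)
 thus ?case unfolding tensor_relators_def
 proof (elim UnE CollectE exE conjE)
  fix x x' k assume "r=frag_of (x \<otimes>\<^bsub>A\<^esub> x', k) - frag_of (x, k) - frag_of (x', k)" "x:carrier A" "x':carrier A"
  thus ?thesis using addsubD(1)[OF V] by(simp add: lemb_mult[OF cv] sc_add)
 next
  fix x j k assume r: "r=frag_of (x, j \<otimes>\<^bsub>integer_mod_group p\<^esub> k) - frag_of (x, j) - frag_of (x, k)" "x:carrier A"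
  have "(j + k) mod int p - j - k=int p * (- ((j + k) div int p))"
   using div_mult_mod_eq[of "j + k" "int p"] by(simp add: algebra_simps)
  hence "rat_of_int ((j + k) mod int p) - of_int j - of_int k = of_nat p * of_int (- ((j + k) div int p))"
   by(metis of_int_diff of_int_mult of_int_of_nat_eq)
  hence "ev ?l r=sc (of_nat p) (sc (of_int (- ((j + k) div int p))) (cv x))"
   by(simp only: r) (simp add: sc_diff_left[symmetric])
  moreover have "sc (of_int (- ((j + k) div int p))) (cv x):vecs X"
   using cv_vecs[OF r(2)] unfolding vecs_def by(rule lat_sc_int)
  ultimately show ?thesis by blast
 qed
next
 case (inv r)
 hence "inv\<^bsub>FA (carrier A \<times> carrier (integer_mod_group p))\<^esub> r = - r" using T.R by simp
 moreover have "ev ?l r:?V" using inv unfolding tensor_relators_def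
 proof (elim UnE CollectE exE conjE)
  fix x x' k assume "r=frag_of (x \<otimes>\<^bsub>A\<^esub> x', k) - frag_of (x, k) - frag_of (x', k)" "x:carrier A" "x':carrier A"
  thus ?thesis using addsubD(1)[OF V] by(simp add: lemb_mult[OF cv] sc_add)
 next
  fix x j k assume r: "r=frag_of (x, j \<otimes>\<^bsub>integer_mod_group p\<^esub> k) - frag_of (x, j) - frag_of (x, k)" "x:carrier A"
  have "(j + k) mod int p - j - k=int p * (- ((j + k) div int p))"
   using div_mult_mod_eq[of "j + k" "int p"] by(simp add: algebra_simps)
  hence "rat_of_int ((j + k) mod int p) - of_int j - of_int k = of_nat p * of_int (- ((j + k) div int p))"
   by(metis of_int_diff of_int_mult of_int_of_nat_eq)
  hence "ev ?l r=sc (of_nat p) (sc (of_int (- ((j + k) div int p))) (cv x))"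
   by(simp only: r) (simp add: sc_diff_left[symmetric])
  moreover have "sc (of_int (- ((j + k) div int p))) (cv x):vecs X"
   using cv_vecs[OF r(2)] unfolding vecs_def by(rule lat_sc_int)
  ultimately show ?thesis by blast
 qed
 ultimately show ?case using addsubD(3)[OF V] by simp
next
 case (eng r r')
 thus ?case using addsubD(4)[OF V] by simp
qed
moreover assume "red_p A p x=red_p A p y"
ultimately have "ev ?l (frag_of (x, 1) - frag_of (y, 1)):?V" unfolding red_eq_GT by blast
thus "\<exists>v\<in>vecs X. cv x - cv y=sc (of_nat p) v" by auto
next
assume "\<exists>v\<in>vecs X. cv x - cv y=sc (of_nat p) v"
then obtain v where v: "v:vecs X" "cv x - cv y=sc (of_nat p) v" by blast
obtain z where z: "z:carrier A" "cv z=v" using lemb_obtain[OF cv v(1)[unfolded vecs_def]] .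
have "cv x=cv (y \<otimes>\<^bsub>A\<^esub> z [^]\<^bsub>A\<^esub> p)"
 using v(2) z y by(simp add: lemb_mult[OF cv] lemb_nat_pow[OF cv] algebra_simps)
hence xe: "x=y \<otimes>\<^bsub>A\<^esub> z [^]\<^bsub>A\<^esub> p" using x y z by(intro lemb_inj[OF cv]) auto
have 1: "frag_of (y \<otimes>\<^bsub>A\<^esub> z [^]\<^bsub>A\<^esub> p, 1) - frag_of (y, 1) - frag_of (z [^]\<^bsub>A\<^esub> p, 1):GT"
 using y z p by(intro GT1) auto
have 2: "frag_of (z [^]\<^bsub>A\<^esub> p, 1) - frag_cmul (int p) (frag_of (z, 1)):GT" by(rule GT_pow[OF z(1)])
have 3: "frag_of (z, 0) - frag_cmul (int p) (frag_of (z, 1)):GT" using GT_mult[OF z(1), of p] by simp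
from T.gen_add[OF T.gen_diff[OF T.gen_add[OF 1 2] 3] GT_zero[OF z(1)]]
show "red_p A p x=red_p A p y" unfolding red_eq_GT xe by simp
qed

end

end

section \<open>The index type\<close>

text \<open>Basis vectors of the canonical resolution of \<open>A \<otimes> \<int>/p\<close> adapted to the inclusion of the relations:
  \<open>Gen\<close> for those whose \<open>p\<close>-fold is a relation and \<open>Rel\<close> for those which are relations themselves.
  The order puts the relations first and is arbitrary otherwise.\<close>

datatype ('a, 'b) idx=Rel 'b | Gen 'a

definition wo :: "('z \<times> 'z) set" where "wo=(SOME r. Well_order r & Field r=UNIV)"

lemma wo_linear:
"refl (wo :: ('z \<times> 'z) set)" "trans (wo :: ('z \<times> 'z) set)" "antisym (wo :: ('z \<times> 'z) set)" "total (wo :: ('z \<times> 'z) set)"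
proof -
have W: "Well_order (wo :: ('z \<times> 'z) set) & Field (wo :: ('z \<times> 'z) set)=UNIV"
 unfolding wo_def by(rule someI_ex[OF well_ordering])
hence F: "Field (wo :: ('z \<times> 'z) set)=UNIV" by blast
have "well_order_on UNIV (wo :: ('z \<times> 'z) set)" using conjunct1[OF W] unfolding F .
thus "refl (wo :: ('z \<times> 'z) set)" "trans (wo :: ('z \<times> 'z) set)" "antisym (wo :: ('z \<times> 'z) set)" "total (wo :: ('z \<times> 'z) set)"
 unfolding well_order_on_def linear_order_on_def partial_order_on_def preorder_on_def by blast+
qed

lemma wo_total: "(a, b):wo | (b, a):wo" using wo_linear(1,4) unfolding refl_on_def total_on_def by(metis UNIV_I)

instantiation idx :: (type, type) linorder
begin

fun less_eq_idx :: "('a, 'b) idx => ('a, 'b) idx => bool" where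
"less_eq_idx (Rel a) (Rel b)=((a, b):wo)"
| "less_eq_idx (Rel a) (Gen b)=True"
| "less_eq_idx (Gen a) (Rel b)=False"
| "less_eq_idx (Gen a) (Gen b)=((a, b):wo)"

definition less_idx :: "('a, 'b) idx => ('a, 'b) idx => bool" where
"less_idx x y=(x <= y & \<not> y <= x)"

instance
proof
fix x y z :: "('a, 'b) idx"
show "(x < y)=(x <= y & \<not> y <= x)" by(rule less_idx_def)
show "x <= x" by(cases x) (use wo_linear(1) in "auto simp: refl_on_def")
show "x <= z" if "x <= y" "y <= z"
 using that by(cases x; cases y; cases z) (auto intro: transD[OF wo_linear(2)])
show "x=y" if "x <= y" "y <= x" using that by(cases x; cases y) (auto intro: antisymD[OF wo_linear(3)])
show "x <= y | y <= x" by(cases x; cases y) (simp_all add: wo_total)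
qed

end

section \<open>Coordinates on a free abelian group\<close>

type_synonym 'a ix = "('a, ('a \<times> int \<Rightarrow>\<^sub>0 int) set) idx"

lemma lookup_ev: "lookup (ev l c) y=(\<Sum>s\<in>keys c. of_int (lookup c s) * lookup (l s) y)"
unfolding ev_def lext_def lookup_sum by simp

lemma ev_frag_eq: "ev l c=(\<Sum>s\<in>keys c. sc (of_int (lookup c s)) (l s))"
unfolding ev_def lext_def by simp

lemma lookup_ev_bs:
assumes "inj f" shows "lookup (ev (%s. bs (f s)) c) (f s) = of_int (lookup c s)"
 "y ~: range f ==> lookup (ev (%s. bs (f s)) c) y=0"
proof -
have "lookup (ev (%s. bs (f s)) c) (f s)=(\<Sum>t\<in>keys c. if t=s then of_int (lookup c s) else 0)"
 unfolding lookup_ev using assms by(intro sum.cong) (auto simp: lookup_single when_def dest: injD)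
thus "lookup (ev (%s. bs (f s)) c) (f s) = of_int (lookup c s)" by(simp add: in_keys_iff)
show "lookup (ev (%s. bs (f s)) c) y=0" if "y ~: range f"
 unfolding lookup_ev using that by(intro sum.neutral) (auto simp: lookup_single when_def)
qed

lemma lemb_finprod:
assumes G: "lemb G l c" and f: "!!s. s:T ==> f s:carrier G" and T: "finite T"
shows "l (\<Otimes>\<^bsub>G\<^esub>s\<in>T. f s)=(\<Sum>s\<in>T. l (f s))"
proof -
interpret comm_group G by(rule lemb_comm[OF G])
show ?thesis using T f
proof (induction T)
 case (insert s T)
 have "(\<Otimes>\<^bsub>G\<^esub>s\<in>insert s T. f s)=f s \<otimes>\<^bsub>G\<^esub> (\<Otimes>\<^bsub>G\<^esub>s\<in>T. f s)"
  using insert by(intro finprod_insert) auto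
 moreover have "(\<Otimes>\<^bsub>G\<^esub>s\<in>T. f s):carrier G" using insert by(intro finprod_closed) auto
 ultimately show ?case using insert by(simp add: lemb_mult[OF G])
qed (simp add: lemb_one[OF G])
qed

lemma sub_lemb:
assumes G: "lemb G l c" and K: "K = {x:carrier G. l x:lat c'}" "lat c' <= lat c"
shows "lemb (G\<lparr>carrier := K\<rparr>) l c'"
proof -
interpret comm_group G by(rule lemb_comm[OF G])
have sub: "subgroup K G"
 unfolding K(1) by(rule subgroupI) (use lemb_one[OF G] in \<open>auto simp: lemb_inv[OF G] lemb_mult[OF G] lat_add intro!: exI[of _ "\<one>\<^bsub>G\<^esub>"]\<close>)
have "comm_group (G\<lparr>carrier := K\<rparr>)"
 by(rule group.group_comm_groupI[OF subgroup.subgroup_is_group[OF sub is_group]]) (use K(1) m_comm in auto)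
moreover have "l ` K=lat c'" using K lemb_image[OF G] by force
moreover have "inj_on l K" using lemb_inj[OF G] K(1) by(auto intro!: inj_onI)
ultimately show ?thesis using K(1) by(simp add: lemb_def lemb_mult[OF G])
qed

locale freegroup =
fixes A :: "('a, 'm) monoid_scheme" and S :: "'a set"
assumes A: "comm_group A" and S: "S <= carrier A" and iso: "frag_eval A:iso (FA S) A"
begin

definition co :: "'a => 'a \<Rightarrow>\<^sub>0 int" where "co a=inv_into (carrier (FA S)) (frag_eval A) a"

definition cw :: "'a => 'a ix vec" where "cw a=ev (%s. bs (Gen s)) (co a)"

lemma bij: "bij_betw (frag_eval A) (carrier (FA S)) (carrier A)" using iso by(simp add: iso_def)

lemma co: "a:carrier A ==> keys (co a) <= S" "a:carrier A ==> frag_eval A (co a)=a"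
proof -
have "co a:carrier (FA S)" if "a:carrier A"
 unfolding co_def by(rule inv_into_into) (use that bij in "simp add: bij_betw_def")
thus "a:carrier A ==> keys (co a) <= S" by(simp only: carrier_free_Abelian_group_iff)
show "a:carrier A ==> frag_eval A (co a)=a"
 unfolding co_def by(rule f_inv_into_f) (use bij in "simp add: bij_betw_def")
qed

lemma co_frag_eval: "keys c <= S ==> co (frag_eval A c)=c"
unfolding co_def by(rule inv_into_f_f) (use bij in "simp_all add: bij_betw_def carrier_free_Abelian_group_iff")

lemma co_mult: "a:carrier A ==> b:carrier A ==> co (a \<otimes>\<^bsub>A\<^esub> b)=co a + co b"
proof -
assume ab: "a:carrier A" "b:carrier A"
have k: "keys (co a + co b) <= S" using co(1)[OF ab(1)] co(1)[OF ab(2)] keys_add[of "co a" "co b"] by blast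
have "frag_eval A (co a + co b)=a \<otimes>\<^bsub>A\<^esub> b"
 using frag_eval_add[OF A, of "co a" "co b"] co ab S by(metis order.trans)
thus ?thesis using co_frag_eval[OF k] by simp
qed

lemma inj_Gen: "inj Gen" by(simp add: inj_def)

lemma cw_lemb: "lemb A cw (%x. if x:Gen ` S then 1 else 0)" unfolding lemb_def
proof (intro conjI ballI)
show "comm_group A" by(rule A)
show "cw (x \<otimes>\<^bsub>A\<^esub> y)=cw x + cw y" if "x:carrier A" "y:carrier A" for x y
 using that by(simp add: cw_def co_mult)
show "inj_on cw (carrier A)"
proof (rule inj_onI)
 fix x y assume xy: "x:carrier A" "y:carrier A" "cw x=cw y"
 have "lookup (co x) s=lookup (co y) s" for s
  using arg_cong[OF xy(3)[unfolded cw_def], of "%z. lookup z (Gen s)"] unfolding lookup_ev_bs(1)[OF inj_Gen] by simp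
 hence "co x=co y" by(intro poly_mapping_eqI) simp
 thus "x=y" using co(2) xy by metis
qed
show "cw ` carrier A=lat (%x. if x:Gen ` S then 1 else 0)"
proof (intro equalityI subsetI)
 fix z assume "z:cw ` carrier A"
 then obtain a where a: "a:carrier A" "z=cw a" by blast
 have "z=(\<Sum>s\<in>keys (co a). sc (of_int (lookup (co a) s)) (bs (Gen s)))" by(simp add: a cw_def ev_frag_eq)
 also have "... : lat (%x. if x:Gen ` S then 1 else 0)"
 proof (intro lat_sum lat_sc_int)
  fix s assume "s:keys (co a)"
  hence "s:S" using co(1)[OF a(1)] by blast
  thus "bs (Gen s :: 'a ix):lat (%x. if x:Gen ` S then 1 else 0)"
   using lat_basis'[of 1 1 "%x. if x:Gen ` S then 1 else 0" "Gen s"] by simp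
 qed
 finally show "z:lat (%x. if x:Gen ` S then 1 else 0)" .
next
 fix z :: "'a ix vec" assume z: "z:lat (%x. if x:Gen ` S then 1 else 0)"
 obtain k :: "_ => int" where k: "z=(\<Sum>y\<in>keys z. sc (of_int (k y)) (sc (if y:Gen ` S then 1 else 0) (bs y)))"
  using lat_decomp[OF z] .
 define g where "g=(%y :: 'a ix. case y of Gen s => s | Rel b => undefined)"
 have g: "Gen (g y)=y" "g y:S" "y:Gen ` S" if "y:keys z" for y
  using lat_keys[OF z that] by(auto simp: g_def split: if_splits)
 let ?c = "\<Sum>y\<in>keys z. frag_cmul (k y) (frag_of (g y))"
 have c: "keys ?c <= S" by(rule keys_frag_sum) (rule g(2))
 have "cw (frag_eval A ?c)=ev (%s. bs (Gen s)) ?c" unfolding cw_def co_frag_eval[OF c] ..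
 also have "... = z" by(subst (2) k) (use g in "auto simp: ev_sum intro!: sum.cong")
 finally have "z=cw (frag_eval A ?c)" ..
 moreover have "frag_eval A ?c:carrier A" using c S by(intro frag_eval_closed[OF A]) blast
 ultimately show "z:cw ` carrier A" by blast
qed
qed

sublocale latgroup A cw "Gen ` S" by unfold_locales (rule cw_lemb)

lemma cw_S: "s:S ==> cw s=bs (Gen s)"
proof -
assume s: "s:S"
have "co (frag_eval A (frag_of s))=frag_of s" using s by(intro co_frag_eval) simp
thus ?thesis using frag_eval_simps(2)[OF A, of s] s S by(auto simp: cw_def)
qed

end

section \<open>The canonical resolution\<close>

definition pg :: "'a ix vec => 'a ix vec" where
"pg=lext (%x. case x of Gen s => bs (Gen s) | Rel b => 0)"

lemma linmap_pg [lin]: "linmap F ==> linmap (%z. pg (F z))" unfolding pg_def by(intro lin)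

lemmas linmap_pg0=linmap_pg[OF linmap_id]
lemmas pg_simps=linmap_simps[OF linmap_pg0]

lemma lookup_pg: "lookup (pg z) x=(case x of Gen s => lookup z x | Rel b => 0)"
proof -
have "lookup (pg z) x=(\<Sum>y\<in>keys z. if y=x then (case x of Gen s => lookup z x | Rel b => 0) else 0)"
 unfolding pg_def lext_def lookup_sum by(rule sum.cong) (auto simp: lookup_single when_def split: idx.splits)
also have "... = (case x of Gen s => lookup z x | Rel b => 0)" by(auto simp: in_keys_iff split: idx.splits)
finally show ?thesis .
qed

lemma pg_bs [simp]: "pg (bs (Gen s))=bs (Gen s)" "pg (bs (Rel b))=0" by(simp_all add: pg_def)

definition pp :: "nat => 'a ix => int" where
"pp p x=(case x of Gen s => int p | Rel b => 1)"

lemma pp_simps [simp]: "pp p (Gen s)=int p" "pp p (Rel b)=1" by(simp_all add: pp_def)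

definition lev :: "nat => 'x vec => (nat \<times> 'x) vec" where
"lev k v=lext (%x. bs (k, x)) v"

lemma linmap_lev [lin]: "linmap F ==> linmap (%z. lev k (F z))" unfolding lev_def by(intro lin)

lemmas linmap_lev0=linmap_lev[OF linmap_id]
lemmas lev_simps=linmap_simps[OF linmap_lev0]

lemma lev_bs [simp]: "lev k (bs x)=bs (k, x)" by(simp add: lev_def)

lemma lookup_lev: "lookup (lev k v) (j, x)=(if j=k then lookup v x else 0)"
proof -
have "lookup (lev k v) (j, x)=(\<Sum>y\<in>keys v. if y=x then (if j=k then lookup v x else 0) else 0)"
 unfolding lev_def lext_def lookup_sum by(rule sum.cong) (auto simp: lookup_single when_def)
thus ?thesis by(auto simp: in_keys_iff)
qed

definition prt :: "nat => (nat \<times> 'x) vec => 'x vec" where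
"prt k z=lext (%(j, x). if j=k then bs x else 0) z"

lemma lookup_prt: "lookup (prt k z) x=lookup z (k, x)"
proof -
have "lookup (prt k z) x=(\<Sum>y\<in>keys z. if y=(k, x) then lookup z (k, x) else 0)"
 unfolding prt_def lext_def lookup_sum by(rule sum.cong) (auto simp: lookup_single when_def split: if_splits)
thus ?thesis by(simp add: in_keys_iff)
qed

definition du :: "(nat => 'x vec) => nat => 'x vec" where
"du w l=(if l=0 then w 0 else w l - w (l - 1))"

definition DL :: "nat \<Rightarrow> (nat \<Rightarrow> 'x vec) \<Rightarrow> (nat \<times> 'x) vec" where
"DL n w = (\<Sum>l\<le>n. lev l (du w l))"

lemma lookup_DL: "lookup (DL n w) (q, x)=(if q <= n then lookup (du w q) x else 0)"
unfolding DL_def lookup_sum by(simp add: lookup_lev)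

definition sublin :: "(nat => nat option) => (nat \<times> 'x) vec => (nat \<times> 'x) vec" where
"sublin \<alpha> = lext (%(k, x). case \<alpha> k of None => 0 | Some k' => bs (k', x))"

lemma linmap_sublin [lin]: "linmap F ==> linmap (%z. sublin \<alpha> (F z))" unfolding sublin_def by(intro lin)

lemma lp_sublin: "lp (sublin \<alpha> v)=sub \<alpha> (lp v)"
by(rule linmap_eqI[of "%v. lp (sublin \<alpha> v)"])
  (auto intro!: lin simp: sublin_def subm_def lp_simps split: option.splits)

lemma lookup_sublin_lev: "lookup (sublin \<alpha> (lev k v)) (q, x)=(if \<alpha> k=Some q then lookup v x else 0)"
proof -
have "sublin \<alpha> (lev k v)=(case \<alpha> k of None => 0 | Some k' => lev k' v)"
proof (cases "\<alpha> k")
 case None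
 have "sublin \<alpha> (lev k v)=(%_. 0) v"
  by(rule linmap_eqI[of "%v. sublin \<alpha> (lev k v)"]) (auto intro!: lin linmapI simp: sublin_def None)
 thus ?thesis by(simp add: None)
next
 case (Some q)
 have "sublin \<alpha> (lev k v)=lev q v"
  by(rule linmap_eqI[of "%v. sublin \<alpha> (lev k v)"]) (auto intro!: lin simp: sublin_def Some)
 thus ?thesis by(simp add: Some)
qed
thus ?thesis by(auto simp: lookup_lev split: option.splits)
qed

lemma face_preimage:
assumes "j <= Suc m" "q <= m"
shows "{l. l <= Suc m & tf (Suc m) j l=Some q} = (if q < j then {q} else if q=j then {q, Suc q} else {Suc q})"
using assms by(auto simp: tf_def Let_def split: if_splits)

lemma DL_face:
assumes j: "j \<le> Suc m"
shows "DL m (\<lambda>t. w (if t < j then t else Suc t)) = sublin (tf (Suc m) j) (DL (Suc m) w)"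
proof (rule pm_eqI)
fix y :: "nat \<times> 'a"
obtain q x where y: "y = (q, x)" by fastforce
have "lookup (sublin (tf (Suc m) j) (DL (Suc m) w)) y = (\<Sum>l\<le>Suc m. if tf (Suc m) j l = Some q then lookup (du w l) x else 0)"
 unfolding DL_def linmap_sum[OF linmap_sublin[OF linmap_id]] lookup_sum y lookup_sublin_lev ..
also have "\<dots> = (\<Sum>l\<in>{l. l \<le> Suc m \<and> tf (Suc m) j l = Some q}. lookup (du w l) x)"
proof -
 have "{l. l \<le> Suc m \<and> tf (Suc m) j l = Some q} = {l \<in> {..Suc m}. tf (Suc m) j l = Some q}" by auto
 thus ?thesis by(simp only: sum.inter_filter[OF finite_atMost])
qed
also have "\<dots> = lookup (DL m (\<lambda>t. w (if t < j then t else Suc t))) y"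
proof (cases "q \<le> m")
 case True
 show ?thesis unfolding face_preimage[OF j True] y lookup_DL using True by(auto simp: du_def lookup_minus)
next
 case False
 hence "{l. l \<le> Suc m \<and> tf (Suc m) j l = Some q} = {}" by(auto simp: tf_def Let_def split: if_splits)
 thus ?thesis using False by(simp only: y lookup_DL) simp
qed
finally show "lookup (DL m (\<lambda>t. w (if t < j then t else Suc t))) y = lookup (sublin (tf (Suc m) j) (DL (Suc m) w)) y" ..
qed

locale modp=freegroup A S for A :: "('a, 'm) monoid_scheme" and S :: "'a set" +
fixes p :: nat
assumes prime: "prime p"
begin

lemma p2: "p >= 2" using prime by(rule prime_ge_2_nat)

abbreviation "Bp == mod_p A p"
abbreviation "rd == red_p A p"

lemmas Bp_comm=mod_p_comm_group[OF p2]
lemmas rd_in=red_in[OF p2] and rd_mult=red_mult[OF p2] and rd_surj=red_surj[OF p2] and rd_eq_iff=red_eq_iff[OF p2]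

sublocale Bp: comm_group Bp by(rule Bp_comm)

lemma rd_hom: "group_hom A Bp rd"
using rd_in rd_mult A.is_group Bp.is_group by(auto simp: group_hom_def group_hom_axioms_def hom_def)

lemma inj_rd: "inj_on rd S"
proof (rule inj_onI)
fix s t assume st: "s:S" "t:S" "rd s=rd t"
then obtain v where v: "v:vecs (Gen ` S)" "cw s - cw t=sc (of_nat p) v" using rd_eq_iff[of s t] S by blast
show "s=t"
proof (rule ccontr)
 assume "s ~= t"
 hence "lookup (cw s - cw t) (Gen s)=1" using st by(simp add: cw_S lookup_minus lookup_single)
 moreover obtain k :: int where "lookup v (Gen s) = of_int k * (if (Gen s :: 'a ix):Gen ` S then 1 else 0)"
  using v(1) unfolding vecs_def lat_def by blast
 hence "lookup v (Gen s) = of_int k" using st by simp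
 ultimately have "1=rat_of_int (int p * k)" using v(2) by simp
 hence "int p * k=1" by(metis of_int_eq_1_iff)
 thus False using p2 by(simp add: zmult_eq_1_iff)
qed
qed

definition EE where "EE=rd ` S"

definition lf where "lf b=(if b:EE then inv_into S rd b else (SOME a. a:carrier A & rd a=b))"

lemma lf: "b:carrier Bp ==> lf b:carrier A & rd (lf b)=b"
proof (cases "b:EE")
case True
thus ?thesis using inv_into_into[of b rd S] f_inv_into_f[of b rd S] S by(auto simp: lf_def EE_def)
next
case False
assume b: "b:carrier Bp"
have "(SOME a. a:carrier A & rd a=b):carrier A & rd (SOME a. a:carrier A & rd a=b)=b"
 by(rule someI_ex) (use rd_surj[OF b] in blast)
thus ?thesis using False by(simp add: lf_def)
qed

lemma lf_red: "s:S ==> lf (rd s)=s" using inv_into_f_f[OF inj_rd] by(auto simp: lf_def EE_def)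

definition l0 :: "_ => 'a ix vec" where "l0 b=cw (lf b) + (if b:EE then 0 else bs (Rel b))"

definition lw :: "_ => 'a ix vec" where "lw c=ev l0 c"

lemma lw_simps [simp]: "lw 0=0" "lw (a + b)=lw a + lw b" "lw (a - b)=lw a - lw b" "lw (- a) = - lw a"
"lw (frag_cmul k a)=sc (of_int k) (lw a)" "lw (frag_of e)=l0 e" by(simp_all add: lw_def)

definition XX :: "'a ix set" where "XX=Gen ` S \<union> Rel ` (carrier Bp - EE)"

lemma l0_red: "s:S ==> l0 (rd s)=bs (Gen s)" by(simp add: l0_def lf_red cw_S EE_def)

lemma cw_lookup_Rel: "a:carrier A ==> lookup (cw a) (Rel b)=0"
unfolding cw_def by(rule lookup_ev_bs(2)[OF inj_Gen]) auto

lemma lookup_lw_Rel: "keys c <= carrier Bp ==> lookup (lw c) (Rel b)=(if b:EE then 0 else of_int (lookup c b))"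
proof -
assume c: "keys c <= carrier Bp"
have "lookup (l0 a) (Rel b)=(if a=b & b ~: EE then 1 else 0)" if "a:keys c" for a
 using cw_lookup_Rel[of "lf a" b] lf[of a] c that by(auto simp: l0_def lookup_add lookup_single when_def)
hence "lookup (lw c) (Rel b)=(\<Sum>a\<in>keys c. if a=b then (if b:EE then 0 else of_int (lookup c b)) else 0)"
 unfolding lw_def lookup_ev by(intro sum.cong) auto
thus ?thesis by(auto simp: in_keys_iff)
qed

lemma pg_cw: "a:carrier A ==> pg (cw a)=cw a"
by(rule pm_eqI) (auto simp: lookup_pg cw_lookup_Rel split: idx.splits)

lemma pg_l0: "b:carrier Bp ==> pg (l0 b)=cw (lf b)" using lf[of b] by(simp add: l0_def pg_simps pg_cw)

lemma vecs_sub_XX: "v:vecs (Gen ` S) ==> v:vecs XX"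
unfolding vecs_def by(rule lat_coarser) (auto simp: XX_def split: if_splits intro!: exI[of _ 1])

lemma l0_vecs: "b:carrier Bp ==> l0 b:vecs XX"
proof -
assume b: "b:carrier Bp"
have "cw (lf b):vecs XX" using lf[OF b] by(intro vecs_sub_XX cv_vecs) simp
thus ?thesis using b by(auto simp: l0_def XX_def intro!: vecs_add vecs_bs)
qed

abbreviation "RG == res_group Bp"

lemma RG_simps [simp]: "x \<otimes>\<^bsub>RG k\<^esub> y=x + y" "\<one>\<^bsub>RG k\<^esub> = 0"
by(simp_all add: res_group_def Let_def)

lemma RG0_carrier: "c:carrier (RG 0) \<longleftrightarrow> keys c <= carrier Bp"
by(simp add: res_group_def Let_def carrier_free_Abelian_group_iff)

definition wP :: "nat => 'a ix => rat" where
"wP k x=(if x:XX then (if k=0 then 1 else if k=1 then of_int (pp p x) else 0) else 0)"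

lemma RG0_lemb: "lemb (RG 0) lw (wP 0)"
proof -
have "wP 0=(%x. if x:XX then 1 else 0)" by(rule ext) (simp add: wP_def)
hence w0: "lat (wP 0)=vecs XX" by(simp add: vecs_def)
have "comm_group (RG 0)" unfolding res_group_def Let_def by(simp add: abelian_free_Abelian_group)
moreover have "inj_on lw (carrier (RG 0))"
proof (rule inj_onI)
 fix a b assume ab: "a:carrier (RG 0)" "b:carrier (RG 0)" "lw a=lw b"
 define d where "d=a - b"
 have d: "keys d <= carrier Bp" "lw d=0" using ab keys_diff[of a b] by(auto simp: RG0_carrier d_def)
 have E: "b:EE" if "b:keys d" for b
  using lookup_lw_Rel[OF d(1), of b] d(2) that by(auto simp: in_keys_iff split: if_splits)
 have "lookup d (rd s)=0" if s: "s:S" for s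
 proof -
  have "lookup (lw d) (Gen s)=(\<Sum>b\<in>keys d. if b=rd s then of_int (lookup d (rd s)) else 0)"
   unfolding lw_def lookup_ev
  proof (rule sum.cong)
   fix b assume "b:keys d"
   then obtain t where t: "t:S" "b=rd t" using E by(auto simp: EE_def)
   thus "of_int (lookup d b) * lookup (l0 b) (Gen s)=(if b=rd s then of_int (lookup d (rd s)) else 0)"
    using inj_rd s by(auto simp: l0_red lookup_single when_def dest: inj_onD)
  qed simp
  thus ?thesis using d(2) by(auto simp: in_keys_iff split: if_splits)
 qed
 hence "lookup d b=0" for b using E[of b] by(cases "b:keys d") (auto simp: EE_def in_keys_iff)
 hence "d=0" by(intro poly_mapping_eqI) simp
 thus "a=b" by(simp add: d_def)
qed
moreover have "lw ` carrier (RG 0)=vecs XX"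
proof (intro equalityI subsetI)
 fix z assume "z:lw ` carrier (RG 0)"
 then obtain c where c: "keys c <= carrier Bp" "z=lw c" by(auto simp: RG0_carrier)
 show "z:vecs XX" unfolding c(2) lw_def ev_frag_eq vecs_def
  by(intro lat_sum lat_sc_int) (use c(1) l0_vecs in "auto simp: vecs_def")
next
 let ?I = "lw ` carrier (RG 0)"
 have add: "v + w:?I" if vw: "v:?I" "w:?I" for v w
 proof -
  obtain a b where ab: "a:carrier (RG 0)" "v=lw a" "b:carrier (RG 0)" "w=lw b" using vw by blast
  hence "a + b:carrier (RG 0)" using keys_add[of a b] by(auto simp: RG0_carrier)
  thus ?thesis using ab by(metis image_eqI lw_simps(2))
 qed
 have um: "- v:?I" if v: "v:?I" for v
 proof -
  obtain a where a: "a:carrier (RG 0)" "v=lw a" using v by blast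
  hence "- a:carrier (RG 0)" by(simp add: RG0_carrier)
  thus ?thesis using a by(metis image_eqI lw_simps(4))
 qed
 have zero: "0:?I" by(rule image_eqI[of _ _ 0]) (auto simp: RG0_carrier)
 have G: "bs (Gen s):?I" if "s:S" for s
  by(rule image_eqI[of _ _ "frag_of (rd s)"]) (use that S rd_in in "auto simp: l0_red RG0_carrier")
 have V: "v:?I" if "v:vecs (Gen ` S)" for v
  using that by(induction v rule: vecs_induct) (use zero G add um in auto)
 fix z assume "z:vecs XX"
 thus "z:?I"
 proof (induction z rule: vecs_induct)
  case (basis x)
  then consider s where "s:S" "x=Gen s" | b where "b:carrier Bp" "b ~: EE" "x=Rel b" by(auto simp: XX_def)
  thus ?case
  proof cases
   case 2
   have "l0 b:?I" by(rule image_eqI[of _ _ "frag_of b"]) (use 2 in "auto simp: RG0_carrier")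
   moreover have "- cw (lf b):?I" using lf[OF 2(1)] by(intro um V cv_vecs) simp
   ultimately have "l0 b + - cw (lf b):?I" by(rule add)
   thus ?thesis using 2 by(simp add: l0_def)
  qed (use G in simp)
 qed (use zero add um in auto)
qed
ultimately show ?thesis by(simp add: lemb_def w0)
qed

lemma frag_eval_lift:
assumes "keys c <= carrier Bp" shows "\<exists>a\<in>carrier A. frag_eval Bp c=rd a & cw a=pg (lw c)"
proof -
interpret rd: group_hom A Bp rd by(rule rd_hom)
have "keys c <= carrier Bp & (\<exists>a\<in>carrier A. frag_eval Bp c=rd a & cw a=pg (lw c))" using assms
proof (induction c rule: frag_induction)
 case zero
 have "frag_eval Bp 0=rd \<one>\<^bsub>A\<^esub>" "cw \<one>\<^bsub>A\<^esub> = pg (lw 0)"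
  by(simp_all only: frag_eval_simps(1)[OF Bp_comm] rd.hom_one lemb_one[OF cw_lemb] lw_simps linmap_0[OF linmap_pg0])
 thus ?case by(intro conjI bexI[of _ "\<one>\<^bsub>A\<^esub>"]) simp_all
next
 case (one b)
 have "frag_eval Bp (frag_of b)=rd (lf b)" "cw (lf b)=pg (lw (frag_of b))"
  using frag_eval_simps(2)[OF Bp_comm one] lf[OF one] pg_l0[OF one] by simp_all
 thus ?case using lf[OF one] one by(intro conjI bexI[of _ "lf b"]) simp_all
next
 case (diff a b)
 then obtain x y where x: "x:carrier A" "frag_eval Bp a=rd x" "cw x=pg (lw a)"
  and y: "y:carrier A" "frag_eval Bp b=rd y" "cw y=pg (lw b)" by blast
 have kb: "keys b <= carrier Bp" and ka: "keys a <= carrier Bp" using diff by blast+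
 have k: "keys (a - b) <= carrier Bp" using ka kb keys_diff[of a b] by blast
 have e: "rd x=frag_eval Bp (a - b) \<otimes>\<^bsub>Bp\<^esub> rd y"
  using frag_eval_add[OF Bp_comm k kb] x(2) y(2) by(simp only: diff_add_cancel)
 have "frag_eval Bp (a - b)=rd x \<otimes>\<^bsub>Bp\<^esub> inv\<^bsub>Bp\<^esub> rd y"
  by(rule iffD2[OF Bp.inv_solve_right[OF frag_eval_closed[OF Bp_comm k] rd_in[OF x(1)] rd_in[OF y(1)]] e])
 hence "frag_eval Bp (a - b)=rd (x \<otimes>\<^bsub>A\<^esub> inv\<^bsub>A\<^esub> y)" using x(1) y(1) by(simp add: rd_mult rd.hom_inv)
 moreover have "cw (x \<otimes>\<^bsub>A\<^esub> inv\<^bsub>A\<^esub> y)=pg (lw (a - b))"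
  using x y by(simp add: lemb_mult[OF cw_lemb] lemb_inv[OF cw_lemb] pg_simps)
 ultimately show ?case using x(1) y(1) k by(intro conjI bexI[of _ "x \<otimes>\<^bsub>A\<^esub> inv\<^bsub>A\<^esub> y"]) simp_all
qed
thus ?thesis by blast
qed

lemma kernel_lat:
assumes c: "c:carrier (RG 0)" shows "frag_eval Bp c = \<one>\<^bsub>Bp\<^esub> \<longleftrightarrow> lw c:lat (wP 1)"
proof -
interpret rd: group_hom A Bp rd by(rule rd_hom)
obtain a where a: "a:carrier A" "frag_eval Bp c=rd a" "cw a=pg (lw c)"
 using frag_eval_lift[of c] c unfolding RG0_carrier by blast
have "frag_eval Bp c = \<one>\<^bsub>Bp\<^esub> \<longleftrightarrow> rd a=rd \<one>\<^bsub>A\<^esub>" using a(2) rd.hom_one by simp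
also have "... \<longleftrightarrow> (\<exists>v\<in>vecs (Gen ` S). pg (lw c)=sc (of_nat p) v)"
 using rd_eq_iff[OF a(1) A.one_closed] lemb_one[OF cw_lemb] a(3) by simp
also have "... \<longleftrightarrow> lw c:lat (wP 1)"
proof
 assume "\<exists>v\<in>vecs (Gen ` S). pg (lw c)=sc (of_nat p) v"
 then obtain v where v: "v:vecs (Gen ` S)" "pg (lw c)=sc (of_nat p) v" by blast
 show "lw c:lat (wP 1)" unfolding lat_def
 proof (intro CollectI allI)
  fix y
  show "\<exists>k::int. lookup (lw c) y = of_int k * wP 1 y"
  proof (cases y)
   case (Gen s)
   obtain k :: int where "lookup v y = of_int k * (if y:Gen ` S then 1 else 0)"
    using v(1) unfolding vecs_def lat_def by blast
   moreover have "lookup (lw c) y = of_nat p * lookup v y"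
    using arg_cong[OF v(2), of "%z. lookup z y"] by(simp add: lookup_pg Gen)
   ultimately show ?thesis by(auto simp: wP_def XX_def Gen intro!: exI[of _ k])
  next
   case (Rel b)
   thus ?thesis using lookup_lw_Rel[of c b] c unfolding RG0_carrier
    by(cases "b:carrier Bp") (auto simp: wP_def XX_def in_keys_iff subset_iff intro!: exI[of _ "lookup c b"])
  qed
 qed
next
 assume h: "lw c:lat (wP 1)"
 have "sc (1 / of_nat p) (pg (lw c)):vecs (Gen ` S)" unfolding vecs_def lat_def
 proof (intro CollectI allI)
  fix y
  obtain k :: int where "lookup (lw c) y = of_int k * wP 1 y" using h unfolding lat_def by blast
  thus "\<exists>k::int. lookup (sc (1 / of_nat p) (pg (lw c))) y = of_int k * (if y:Gen ` S then 1 else 0)"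
   using p2 by(cases y) (auto simp: lookup_pg wP_def XX_def intro!: exI[of _ k])
 qed
 moreover have "pg (lw c)=sc (of_nat p) (sc (1 / of_nat p) (pg (lw c)))" using p2 by simp
 ultimately show "\<exists>v\<in>vecs (Gen ` S). pg (lw c)=sc (of_nat p) v" by blast
qed
finally show ?thesis .
qed

lemma wP1_sub: "lat (wP 1) <= lat (wP 0)"
by(intro subsetI, rule lat_coarser) (auto simp: wP_def split: if_splits)

text \<open>The basis is adapted to the inclusion of the relations: they are divisible by \<open>p\<close> at the letters of
 \<open>A\<close> and arbitrary at the other letters.\<close>

lemma RG_lemb: "lemb (RG k) lw (wP k)"
proof -
consider "k=0" | "k=1" | "k >= 2" by linarith
thus ?thesis
proof cases
 case 2
 have r: "RG 1=(RG 0)\<lparr>carrier := kernel (free_Abelian_group (carrier Bp)) Bp (frag_eval Bp)\<rparr>"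
  by(simp add: res_group_def Let_def)
 have K: "kernel (free_Abelian_group (carrier Bp)) Bp (frag_eval Bp) = {x:carrier (RG 0). lw x:lat (wP 1)}"
  using kernel_lat by(auto simp: kernel_def RG0_carrier carrier_free_Abelian_group_iff)
 show ?thesis unfolding 2 r by(rule sub_lemb[OF RG0_lemb K wP1_sub])
next
 case 3
 have r: "RG k=(RG 0)\<lparr>carrier := {0}\<rparr>" using 3 by(simp add: res_group_def Let_def)
 have l: "lat (wP k) = {0}" using 3 by(auto simp: lat_def wP_def intro: pm_eqI)
 have K: "{0} = {x:carrier (RG 0). lw x:lat (wP k)}"
  unfolding l using lemb_inj[OF RG0_lemb, of _ 0] by(auto simp: RG0_carrier)
 show ?thesis unfolding r by(rule sub_lemb[OF RG0_lemb K]) (simp add: l)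
qed (use RG0_lemb in simp)
qed

lemma RG1_sub: "x:carrier (RG 1) ==> x:carrier (RG 0)" by(simp add: res_group_def Let_def kernel_def)

lemma RG_big: "k >= 2 ==> x:carrier (RG k) \<longleftrightarrow> x=0" by(simp add: res_group_def Let_def)

lemma RG_zero: "0:carrier (RG k)"
using RG_lemb[of k] lemb_group group.is_monoid monoid.one_closed RG_simps(2) by metis

subsection \<open>Its simplicial group\<close>

abbreviation "DG == DK RG res_diff"

definition dkok :: "nat \<Rightarrow> (nat set \<Rightarrow> _) \<Rightarrow> bool" where
"dkok n c \<longleftrightarrow> c \<in> extensional (nd_simplices n) \<and> (\<forall>k\<le>n. c {k} \<in> carrier (RG 0)) \<and>
  (\<forall>a b. a < b \<and> b \<le> n \<longrightarrow> c {a, b} \<in> carrier (RG 1) \<and> lw (c {a, b}) = lw (c {b}) - lw (c {a})) \<and>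
  (\<forall>T\<in>nd_simplices n. card T \<ge> 3 \<longrightarrow> c T = 0)"

lemma card_2_lt: "card T=2 ==> \<exists>a b::nat. a < b & T = {a, b}"
by(metis card_2_iff insert_commute nat_neq_iff)

lemma card_3_lt: assumes "card T=3" shows "\<exists>a b e::nat. a < b & b < e & T = {a, b, e}"
proof -
have T: "finite T" "T ~= {}" using assms by(auto intro: card_ge_0_finite)
define a where "a=Min T"
have "card (T - {a})=2" using T assms by(simp add: a_def)
then obtain b e where be: "b < e" "T - {a} = {b, e}" using card_2_lt by blast
have "b:T" "b ~= a" using be by auto
hence "a < b" using T unfolding a_def by(metis Min_le le_neq_implies_less)
moreover have "T = {a, b, e}" using be T unfolding a_def by(metis Min_in insert_Diff)
ultimately show ?thesis using be by blast
qed

lemma nd_finite: "T:nd_simplices n ==> finite T & card T > 0"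
by(auto simp: nd_simplices_def card_gt_0_iff dest: finite_subset)

lemma bd_sum_2: "a < b ==> (\<Sum>s\<in>{a, b}. sc (of_int ((- 1) ^ card {t : {a, b}. t < s})) (f ({a, b} - {s})))=f {b} - f {a}"
for f :: "nat set => 'y vec"
proof -
assume ab: "a < b"
have e: "{t : {a, b}. t < a} = {}" "{t : {a, b}. t < b} = {a}" "{a, b} - {a} = {b}" "{a, b} - {b} = {a}" using ab by auto
have s: "sum g {a, b} = g a + g b" for g :: "nat => 'y vec" using ab by simp
show ?thesis unfolding s e by(simp add: sc_minus1)
qed

lemma bd_sum_3: "a < b ==> b < e ==> (\<Sum>s\<in>{a, b, e}. sc (of_int ((- 1) ^ card {t : {a, b, e}. t < s})) (f ({a, b, e} - {s}))) =
 f {b, e} - f {a, e} + f {a, b}"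
for f :: "nat set => 'y vec"
proof -
assume abe: "a < b" "b < e"
have e: "{t : {a, b, e}. t < a} = {}" "{t : {a, b, e}. t < b} = {a}" "{t : {a, b, e}. t < e} = {a, b}"
 "{a, b, e} - {a} = {b, e}" "{a, b, e} - {b} = {a, e}" "{a, b, e} - {e} = {a, b}" using abe by auto
have s: "sum g {a, b, e} = g a + (g b + g e)" for g :: "nat => 'y vec" using abe by simp
have "card {a, b} = 2" using abe by simp
thus ?thesis unfolding s e by(simp add: sc_minus1)
qed

lemma DK_carrier: "c:carrier (DG n) \<longleftrightarrow> dkok n c"
proof -
define Pi where "Pi \<longleftrightarrow> c:(\<Pi>\<^sub>E T\<in>nd_simplices n. carrier (RG (card T - 1)))"
define bc where "bc=(%T. res_diff (card T - 1) (c T) =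
     (\<Otimes>\<^bsub>RG (card T - 2)\<^esub>s\<in>T. c (T - {s}) [^]\<^bsub>RG (card T - 2)\<^esub> ((- 1) ^ card {t:T. t < s} :: int)))"
have carr: "c:carrier (DG n) \<longleftrightarrow> Pi & (\<forall>T\<in>nd_simplices n. card T >= 2 --> bc T)"
 by(simp only: DK_def Pi_def bc_def partial_object.select_convs mem_Collect_eq)
have bc_iff: "bc T \<longleftrightarrow> lw (res_diff (card T - 1) (c T))=(\<Sum>s\<in>T. sc (of_int ((- 1) ^ card {t:T. t < s})) (lw (c (T - {s}))))"
 if P: "Pi" and T: "T:nd_simplices n" "card T >= 2" for T
proof -
 note e=RG_lemb[of "card T - 2"]
 have fT: "finite T" using nd_finite[OF T(1)] by simp
 have in1: "c (T - {s}):carrier (RG (card T - 2))" if "s:T" for s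
 proof -
  have c1: "card (T - {s})=card T - 1" using fT that by simp
  hence "card (T - {s}) > 0" using T(2) by simp
  hence "T - {s} ~= {}" by(simp add: card_gt_0_iff)
  hence "T - {s} : nd_simplices n" using T(1) by(auto simp: nd_simplices_def)
  hence "c (T - {s}):carrier (RG (card (T - {s}) - 1))" using P unfolding Pi_def by blast
  thus ?thesis unfolding c1 by(simp add: numeral_2_eq_2)
 qed
 interpret R: comm_group "RG (card T - 2)" by(rule lemb_comm[OF e])
 have in2: "c (T - {s}) [^]\<^bsub>RG (card T - 2)\<^esub> k:carrier (RG (card T - 2))" if "s:T" for s and k :: int
  using in1[OF that] by(rule R.int_pow_closed)
 have in3: "res_diff (card T - 1) (c T):carrier (RG (card T - 2))"
 proof (cases "card T=2")
  case True
  have "c T:carrier (RG (card T - 1))" using P T(1) unfolding Pi_def by blast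
  hence "c T:carrier (RG 1)" using True by simp
  from RG1_sub[OF this] show ?thesis using True by(simp add: res_diff_def)
 next
  case False
  hence "card T - 1 ~= 1" using T(2) by linarith
  hence "res_diff (card T - 1) (c T)=0" by(simp only: res_diff_def if_False)
  thus ?thesis by(simp only: RG_zero)
 qed
 have in4: "(\<Otimes>\<^bsub>RG (card T - 2)\<^esub>s\<in>T. c (T - {s}) [^]\<^bsub>RG (card T - 2)\<^esub> ((- 1) ^ card {t:T. t < s} :: int)):carrier (RG (card T - 2))"
  by(rule R.finprod_closed) (use in2 in auto)
 have "bc T \<longleftrightarrow> lw (res_diff (card T - 1) (c T)) =
   lw (\<Otimes>\<^bsub>RG (card T - 2)\<^esub>s\<in>T. c (T - {s}) [^]\<^bsub>RG (card T - 2)\<^esub> ((- 1) ^ card {t:T. t < s} :: int))"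
  unfolding bc_def by(rule iffI, erule arg_cong, rule lemb_inj[OF e in3 in4], assumption)
 also have "lw (\<Otimes>\<^bsub>RG (card T - 2)\<^esub>s\<in>T. c (T - {s}) [^]\<^bsub>RG (card T - 2)\<^esub> ((- 1) ^ card {t:T. t < s} :: int)) =
   (\<Sum>s\<in>T. lw (c (T - {s}) [^]\<^bsub>RG (card T - 2)\<^esub> ((- 1) ^ card {t:T. t < s} :: int)))"
  by(rule lemb_finprod[OF e in2 fT])
 also have "... = (\<Sum>s\<in>T. sc (of_int ((- 1) ^ card {t:T. t < s})) (lw (c (T - {s}))))"
  by(rule sum.cong[OF refl]) (rule lemb_int_pow[OF e in1])
 finally show ?thesis .
qed
show ?thesis
proof
 assume "c:carrier (DG n)"
 hence P: Pi and B: "!!T. T:nd_simplices n ==> card T >= 2 ==> bc T" using carr by blast+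
 have m: "c T:carrier (RG (card T - 1))" if "T:nd_simplices n" for T using P that unfolding Pi_def by blast
 show "dkok n c" unfolding dkok_def
 proof (intro conjI allI impI ballI)
  show "c:extensional (nd_simplices n)" using P unfolding Pi_def by(simp add: PiE_def)
  show "c {k} : carrier (RG 0)" if "k <= n" for k using m[of "{k}"] that by(simp add: nd_simplices_def)
  fix a b assume ab: "a < b & b <= n"
  hence T: "{a, b} : nd_simplices n" "card {a, b} = 2" by(auto simp: nd_simplices_def)
  show "c {a, b} : carrier (RG 1)" using m[OF T(1)] T(2) by simp
  have ge: "card {a, b} >= 2" unfolding T(2) by simp
  note iffD1[OF bc_iff[OF P T(1) ge] B[OF T(1) ge]]
  also have "(\<Sum>s\<in>{a, b}. sc (of_int ((- 1) ^ card {t : {a, b}. t < s})) (lw (c ({a, b} - {s}))))=lw (c {b}) - lw (c {a})"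
   by(rule bd_sum_2[of a b "%T. lw (c T)"]) (rule conjunct1[OF ab])
  finally show "lw (c {a, b})=lw (c {b}) - lw (c {a})" using T(2) by(simp add: res_diff_def)
 next
  fix T assume "T:nd_simplices n" "card T >= 3"
  thus "c T=0" using m[of T] RG_big[of "card T - 1"] by simp
 qed
next
 assume ok: "dkok n c"
 have v: "c {k} : carrier (RG 0)" if "k <= n" for k using ok that unfolding dkok_def by blast
 have e1: "c {a, b} : carrier (RG 1)" and e2: "lw (c {a, b})=lw (c {b}) - lw (c {a})" if "a < b" "b <= n" for a b
  using ok that unfolding dkok_def by blast+
 have z: "c T=0" if "T:nd_simplices n" "card T >= 3" for T using ok that unfolding dkok_def by blast
 have ab: "\<exists>a b. a < b & b <= n & T = {a, b}" if "T:nd_simplices n" "card T=2" for T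
  using card_2_lt[OF that(2)] that(1) by(auto simp: nd_simplices_def)
 have P: Pi unfolding Pi_def
 proof (rule PiE_I)
  fix T assume T: "T:nd_simplices n"
  consider "card T=1" | "card T=2" | "card T >= 3" using nd_finite[OF T] by linarith
  thus "c T:carrier (RG (card T - 1))"
  proof cases
   case 1
   then obtain k where "T = {k}" by(auto simp: card_1_singleton_iff)
   thus ?thesis using v[of k] T by(simp add: nd_simplices_def)
  next
   case 2
   then obtain a b where "a < b" "b <= n" "T = {a, b}" using ab[OF T] by blast
   thus ?thesis using e1[of a b] 2 by simp
  next
   case 3
   thus ?thesis using z[OF T 3] RG_zero by simp
  qed
 qed (use ok in "auto simp: dkok_def extensional_def")
 moreover have "bc T" if T: "T:nd_simplices n" "card T >= 2" for T
 proof -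
  consider "card T=2" | "card T=3" | "card T >= 4" using T(2) by linarith
  thus ?thesis
  proof cases
   case 1
   then obtain a b where ab: "a < b" "b <= n" "T = {a, b}" using ab[OF T(1)] by blast
   have r: "res_diff (card T - 1) (c T)=c T" by(simp add: 1 res_diff_def)
   have "(\<Sum>s\<in>T. sc (of_int ((- 1) ^ card {t:T. t < s})) (lw (c (T - {s}))))=lw (c {b}) - lw (c {a})"
    unfolding ab(3) by(rule bd_sum_2[OF ab(1), of "%T. lw (c T)"])
   thus ?thesis unfolding bc_iff[OF P T] r using e2[OF ab(1,2)] ab(3) by simp
  next
   case 2
   then obtain a b e where abe: "a < b" "b < e" "T = {a, b, e}" using card_3_lt by blast
   hence "e <= n" using T(1) by(auto simp: nd_simplices_def)
   hence "lw (c {b, e}) - lw (c {a, e}) + lw (c {a, b})=0" using e2[of a b] e2[of a e] e2[of b e] abe by simp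
   moreover have "(\<Sum>s\<in>T. sc (of_int ((- 1) ^ card {t:T. t < s})) (lw (c (T - {s})))) =
     lw (c {b, e}) - lw (c {a, e}) + lw (c {a, b})"
    unfolding abe(3) by(rule bd_sum_3[OF abe(1,2), of "%T. lw (c T)"])
   moreover have "res_diff (card T - 1) (c T)=0" unfolding 2 by(simp add: res_diff_def)
   ultimately show ?thesis unfolding bc_iff[OF P T] by simp
  next
   case 3
   have "card T - 1 ~= 1" using 3 by linarith
   hence "res_diff (card T - 1) (c T)=0" by(simp only: res_diff_def if_False)
   moreover have "c (T - {s})=0" if "s:T" for s
   proof -
    have c1: "card (T - {s})=card T - 1" using nd_finite[OF T(1)] that by simp
    hence "card (T - {s}) > 0" using 3 by simp
    hence "T - {s} ~= {}" by(simp add: card_gt_0_iff)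
    hence "T - {s} : nd_simplices n" using T(1) by(auto simp: nd_simplices_def)
    thus ?thesis using z c1 3 by simp
   qed
   ultimately show ?thesis unfolding bc_iff[OF P T] by simp
  qed
 qed
 ultimately show "c:carrier (DG n)" using carr by blast
qed
qed

definition Dl :: "nat => (nat set => _) => (nat \<times> 'a ix) vec" where
"Dl n c=DL n (%k. lw (c {k}))"

definition DKc :: "nat => nat \<times> 'a ix => rat" where
"DKc n=(%(k, x). if k <= n then wP (if k=0 then 0 else 1) x else 0)"

lemma DG_mult: "c \<otimes>\<^bsub>DG n\<^esub> c'=(\<lambda>T\<in>nd_simplices n. c T + c' T)" and DG_one: "\<one>\<^bsub>DG n\<^esub> = (\<lambda>T\<in>nd_simplices n. 0)"
by(simp_all add: DK_def)

lemma nd_mem: "k <= n ==> {k} : nd_simplices n" "a < b ==> b <= n ==> {a, b} : nd_simplices n"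
by(auto simp: nd_simplices_def)

lemma RG_closed: "x:carrier (RG k) ==> y:carrier (RG k) ==> x + y:carrier (RG k)"
"x:carrier (RG k) ==> - x:carrier (RG k)"
proof -
interpret comm_group "RG k" by(rule lemb_comm[OF RG_lemb])
show "x:carrier (RG k) ==> y:carrier (RG k) ==> x + y:carrier (RG k)" using m_closed[of x y] by simp
show "- x:carrier (RG k)" if x: "x:carrier (RG k)"
proof -
 have "x + inv\<^bsub>RG k\<^esub> x=0" using r_inv[OF x] by simp
 hence "- x=inv\<^bsub>RG k\<^esub> x" by(rule minus_unique)
 thus ?thesis using inv_closed[OF x] by simp
qed
qed

lemma dkok_restrict:
assumes "!!k. k <= n ==> f {k} : carrier (RG 0)"
 "!!a b. a < b ==> b <= n ==> f {a, b} : carrier (RG 1) & lw (f {a, b})=lw (f {b}) - lw (f {a})"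
 "!!T. T:nd_simplices n ==> card T >= 3 ==> f T=0"
shows "dkok n (restrict f (nd_simplices n))" unfolding dkok_def
proof (intro conjI allI impI ballI)
show "restrict f (nd_simplices n) {k} : carrier (RG 0)" if "k <= n" for k
 using assms(1)[OF that] that by(simp add: nd_mem)
fix a b assume ab: "a < b & b <= n"
hence "a < b" "b <= n" "a <= n" by auto
with assms(2)[OF this(1,2)] show "restrict f (nd_simplices n) {a, b} : carrier (RG 1)"
 "lw (restrict f (nd_simplices n) {a, b})=lw (restrict f (nd_simplices n) {b}) - lw (restrict f (nd_simplices n) {a})"
 by(simp_all add: nd_mem)
qed (use assms(3) in simp_all)

lemma DG_comm: "comm_group (DG n)"
proof (rule comm_groupI)
show "c \<otimes>\<^bsub>DG n\<^esub> c':carrier (DG n)" if "c:carrier (DG n)" "c':carrier (DG n)" for c c'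
 using that unfolding DK_carrier DG_mult by(intro dkok_restrict) (simp_all add: dkok_def RG_closed)
show "\<one>\<^bsub>DG n\<^esub> : carrier (DG n)" unfolding DK_carrier DG_one by(intro dkok_restrict) (simp_all add: RG_zero)
show "\<exists>c'\<in>carrier (DG n). c' \<otimes>\<^bsub>DG n\<^esub> c = \<one>\<^bsub>DG n\<^esub>" if c: "c:carrier (DG n)" for c
proof (rule bexI)
 show "(\<lambda>T\<in>nd_simplices n. - c T) \<otimes>\<^bsub>DG n\<^esub> c = \<one>\<^bsub>DG n\<^esub>" unfolding DG_mult DG_one by(rule restrict_ext) simp
 show "(\<lambda>T\<in>nd_simplices n. - c T):carrier (DG n)"
  using c unfolding DK_carrier by(intro dkok_restrict) (simp_all add: dkok_def RG_closed)
qed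
show "\<one>\<^bsub>DG n\<^esub> \<otimes>\<^bsub>DG n\<^esub> c=c" if "c:carrier (DG n)" for c
 unfolding DG_mult DG_one by(rule extensionalityI[where A = "nd_simplices n"]) (use that in "auto simp: DK_carrier dkok_def")
show "c \<otimes>\<^bsub>DG n\<^esub> c' \<otimes>\<^bsub>DG n\<^esub> c''=c \<otimes>\<^bsub>DG n\<^esub> (c' \<otimes>\<^bsub>DG n\<^esub> c'')" for c c' c''
 unfolding DG_mult by(rule restrict_ext) (simp add: add.assoc)
show "c \<otimes>\<^bsub>DG n\<^esub> c'=c' \<otimes>\<^bsub>DG n\<^esub> c" for c c'
 unfolding DG_mult by(rule restrict_ext) (simp add: add.commute)
qed

text \<open>A simplex is determined by its values on vertices. Their successive differences are coordinates, of
 which those of positive level range over the relations.\<close>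

lemma DK_lemb: "lemb (DG n) (Dl n) (DKc n)"
proof -
have mult: "Dl n (c \<otimes>\<^bsub>DG n\<^esub> c') = Dl n c + Dl n c'" for c c'
proof (rule pm_eqI)
 fix y :: "nat \<times> 'a ix"
 obtain q x where y: "y = (q, x)" by fastforce
 show "lookup (Dl n (c \<otimes>\<^bsub>DG n\<^esub> c')) y = lookup (Dl n c + Dl n c') y"
  unfolding y Dl_def lookup_add lookup_DL DG_mult by(auto simp: du_def nd_mem lookup_add lookup_minus)
qed
moreover have "inj_on (Dl n) (carrier (DG n))"
proof (rule inj_onI)
 fix c c' assume cc: "c \<in> carrier (DG n)" "c' \<in> carrier (DG n)" "Dl n c = Dl n c'"
 hence ok: "dkok n c" "dkok n c'" by(simp_all add: DK_carrier)
 have du: "du (\<lambda>k. lw (c {k})) l = du (\<lambda>k. lw (c' {k})) l" if "l \<le> n" for l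
 proof (rule pm_eqI)
  fix x show "lookup (du (\<lambda>k. lw (c {k})) l) x = lookup (du (\<lambda>k. lw (c' {k})) l) x"
   using arg_cong[OF cc(3), of "\<lambda>z. lookup z (l, x)"] that by(simp add: Dl_def lookup_DL)
 qed
 have lv: "lw (c {k}) = lw (c' {k})" if "k \<le> n" for k using that
 proof (induction k)
  case 0
  thus ?case using du[of 0] by(simp add: du_def)
 next
  case (Suc k)
  thus ?case using du[of "Suc k"] by(simp add: du_def)
 qed
 show "c = c'"
 proof (rule extensionalityI)
  show "c \<in> extensional (nd_simplices n)" "c' \<in> extensional (nd_simplices n)" using ok by(simp_all add: dkok_def)
  fix T assume T: "T \<in> nd_simplices n"
  consider "card T = 1" | "card T = 2" | "card T \<ge> 3" using nd_finite[OF T] by linarith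
  thus "c T = c' T"
  proof cases
   case 1
   then obtain k where k: "T = {k}" by(auto simp: card_1_singleton_iff)
   hence "k \<le> n" using T by(simp add: nd_simplices_def)
   thus ?thesis unfolding k using lv ok by(intro lemb_inj[OF RG0_lemb]) (auto simp: dkok_def)
  next
   case 2
   then obtain a b where ab: "a < b" "T = {a, b}" using card_2_lt by blast
   hence "b \<le> n" using T by(simp add: nd_simplices_def)
   thus ?thesis unfolding ab(2) using ab(1) lv ok by(intro lemb_inj[OF RG_lemb[of 1]]) (auto simp: dkok_def)
  next
   case 3
   thus ?thesis using ok T by(simp add: dkok_def)
  qed
 qed
qed
moreover have "Dl n ` carrier (DG n) = lat (DKc n)"
proof (intro equalityI subsetI)
 fix z assume "z \<in> Dl n ` carrier (DG n)"
 then obtain c where c: "dkok n c" "z = Dl n c" by(auto simp: DK_carrier)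
 have v: "lw (c {k}) \<in> lat (wP 0)" if "k \<le> n" for k using c(1) that lemb_lat[OF RG0_lemb] by(auto simp: dkok_def)
 have u: "lw (c {b}) - lw (c {a}) \<in> lat (wP 1)" if "a < b" "b \<le> n" for a b
 proof -
  have "c {a, b} \<in> carrier (RG 1)" "lw (c {a, b}) = lw (c {b}) - lw (c {a})" using c(1) that unfolding dkok_def by blast+
  thus ?thesis using lemb_lat[OF RG_lemb[of 1]] by metis
 qed
 have "du (\<lambda>k. lw (c {k})) l \<in> lat (wP (if l = 0 then 0 else 1))" if "l \<le> n" for l
  using v[of 0] u[of "l - 1" l] that by(simp add: du_def)
 hence dk: "\<exists>k::int. lookup (du (\<lambda>k. lw (c {k})) l) x = of_int k * wP (if l = 0 then 0 else 1) x" if "l \<le> n" for l x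
  using that unfolding lat_def by blast
 show "z \<in> lat (DKc n)" unfolding c(2) Dl_def lat_def
 proof (intro CollectI allI)
  fix y :: "nat \<times> 'a ix"
  obtain q x where y: "y = (q, x)" by fastforce
  show "\<exists>k::int. lookup (DL n (\<lambda>k. lw (c {k}))) y = of_int k * DKc n y"
  proof (cases "q \<le> n")
   case True
   obtain k :: int where "lookup (du (\<lambda>k. lw (c {k})) q) x = of_int k * wP (if q = 0 then 0 else 1) x" using dk[OF True] by blast
   thus ?thesis using True by(intro exI[of _ k]) (simp only: y lookup_DL DKc_def prod.case if_True)
  next
   case False
   thus ?thesis by(intro exI[of _ 0]) (simp add: y lookup_DL)
  qed
 qed
next
 fix z assume z: "z \<in> lat (DKc n)"
 have zl: "prt l z \<in> lat (wP (if l = 0 then 0 else 1))" if "l \<le> n" for l unfolding lat_def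
 proof (intro CollectI allI)
  fix x
  obtain k :: int where "lookup z (l, x) = of_int k * DKc n (l, x)" using z unfolding lat_def by blast
  thus "\<exists>k::int. lookup (prt l z) x = of_int k * wP (if l = 0 then 0 else 1) x"
   using that by(auto simp: lookup_prt DKc_def)
 qed
 define t where "t = (\<lambda>k. \<Sum>l\<le>k. prt l z)"
 have t0: "t k \<in> lat (wP 0)" if "k \<le> n" for k unfolding t_def
 proof (rule lat_sum)
  fix l assume "l \<in> {..k}"
  hence "prt l z \<in> lat (wP (if l = 0 then 0 else 1))" using that by(intro zl) simp
  thus "prt l z \<in> lat (wP 0)" using wP1_sub by(cases "l = 0") auto
 qed
 have t1: "t b - t a \<in> lat (wP 1)" if ab: "a < b" "b \<le> n" for a b
 proof -
  have "{..b} = {..a} \<union> {a<..b}" "{..a} \<inter> {a<..b} = {}" using ab by auto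
  hence "t b - t a = (\<Sum>l\<in>{a<..b}. prt l z)" unfolding t_def by(simp add: sum.union_disjoint)
  also have "\<dots> \<in> lat (wP 1)"
  proof (rule lat_sum)
   fix l assume "l \<in> {a<..b}"
   hence "l \<le> n" "l \<noteq> 0" using ab by auto
   thus "prt l z \<in> lat (wP 1)" using zl[of l] by simp
  qed
  finally show ?thesis .
 qed
 define c where "c = (\<lambda>T\<in>nd_simplices n. if card T = 1 then trm (RG 0) lw (t (Max T))
  else if card T = 2 then trm (RG 1) lw (t (Max T) - t (Min T)) else 0)"
 have c1: "c {k} = trm (RG 0) lw (t k)" if "k \<le> n" for k using that by(simp add: c_def nd_mem)
 have c2: "c {a, b} = trm (RG 1) lw (t b - t a)" if "a < b" "b \<le> n" for a b
  using that by(simp add: c_def nd_mem max_def min_def)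
 have lc: "lw (c {k}) = t k" if "k \<le> n" for k unfolding c1[OF that] by(rule trm_eq[OF RG0_lemb t0[OF that]])
 have "dkok n c" unfolding dkok_def
 proof (intro conjI allI impI ballI)
  show "c \<in> extensional (nd_simplices n)" by(simp add: c_def)
  show "c {k} \<in> carrier (RG 0)" if "k \<le> n" for k unfolding c1[OF that] by(rule trm_in[OF RG0_lemb t0[OF that]])
  fix a b assume ab: "a < b \<and> b \<le> n"
  hence ab': "a < b" "b \<le> n" "a \<le> n" by auto
  show "c {a, b} \<in> carrier (RG 1)" unfolding c2[OF ab'(1,2)] by(rule trm_in[OF RG_lemb t1[OF ab'(1,2)]])
  show "lw (c {a, b}) = lw (c {b}) - lw (c {a})"
   unfolding c2[OF ab'(1,2)] trm_eq[OF RG_lemb t1[OF ab'(1,2)]] lc[OF ab'(2)] lc[OF ab'(3)] ..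
 next
  fix T assume "T \<in> nd_simplices n" "3 \<le> card T"
  thus "c T = 0" by(simp add: c_def)
 qed
 moreover have "Dl n c = z"
 proof (rule pm_eqI)
  fix y :: "nat \<times> 'a ix"
  obtain q x where y: "y = (q, x)" by fastforce
  have "lookup (du (\<lambda>k. lw (c {k})) q) x = lookup z (q, x)" if "q \<le> n"
  proof (cases q)
   case 0
   thus ?thesis using lc[of 0] by(simp add: du_def t_def lookup_prt)
  next
   case (Suc l)
   thus ?thesis using lc[of q] lc[of l] that by(simp add: du_def t_def lookup_minus lookup_add lookup_prt)
  qed
  moreover have "lookup z (q, x) = 0" if "\<not> q \<le> n"
  proof -
   obtain k :: int where "lookup z (q, x) = of_int k * DKc n (q, x)" using z unfolding lat_def by blast
   thus ?thesis using that by(simp add: DKc_def)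
  qed
  ultimately show "lookup (Dl n c) y = lookup z y" by(auto simp: y Dl_def lookup_DL)
 qed
 ultimately show "z \<in> Dl n ` carrier (DG n)" by(auto simp: DK_carrier)
qed
ultimately show ?thesis using DG_comm by(simp add: lemb_def)
qed

text \<open>In the coordinates by successive differences, a face merges two neighbouring levels.\<close>

lemma DK_face_emb:
assumes c: "c:carrier (DG (Suc n))" and j: "j <= Suc n"
shows "DK_face RG (Suc n) j c:carrier (DG n)" "Dl n (DK_face RG (Suc n) j c)=sublin (tf (Suc n) j) (Dl (Suc n) c)"
proof -
let ?\<theta> = "%t. if t < j then t else Suc t"
have mono: "?\<theta> a < ?\<theta> b" if "a < b" for a b using that by auto
have inj: "inj_on ?\<theta> T" for T by(rule inj_onI) (auto split: if_splits)
have ok: "dkok (Suc n) c" using c by(simp add: DK_carrier)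
have le: "?\<theta> t <= Suc n" if "t <= n" for t using that by auto
have eq: "DK_face RG (Suc n) j c=(\<lambda>T\<in>nd_simplices n. c (?\<theta> ` T))"
 unfolding DK_face_def DK_op_def using inj by(auto intro!: restrict_ext)
have im: "?\<theta> ` T:nd_simplices (Suc n)" if "T:nd_simplices n" for T using that by(auto simp: nd_simplices_def)
have v: "DK_face RG (Suc n) j c {k} = c {?\<theta> k}" if "k <= n" for k unfolding eq using that by(simp add: nd_mem)
have e: "DK_face RG (Suc n) j c {a, b} = c {?\<theta> a, ?\<theta> b}" if "a < b" "b <= n" for a b unfolding eq using that by(simp add: nd_mem)
show "DK_face RG (Suc n) j c:carrier (DG n)" unfolding DK_carrier dkok_def
proof (intro conjI allI impI ballI)
 show "DK_face RG (Suc n) j c:extensional (nd_simplices n)" by(simp add: eq)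
 show "DK_face RG (Suc n) j c {k} : carrier (RG 0)" if "k <= n" for k
  unfolding v[OF that] using ok le[OF that] unfolding dkok_def by blast
 fix a b assume "a < b & b <= n"
 hence ab: "a < b" "b <= n" "a <= n" by auto
 show "DK_face RG (Suc n) j c {a, b} : carrier (RG 1)"
  unfolding e[OF ab(1,2)] using ok mono[OF ab(1)] le[OF ab(2)] unfolding dkok_def by blast
 show "lw (DK_face RG (Suc n) j c {a, b})=lw (DK_face RG (Suc n) j c {b}) - lw (DK_face RG (Suc n) j c {a})"
  unfolding e[OF ab(1,2)] v[OF ab(2)] v[OF ab(3)] using ok mono[OF ab(1)] le[OF ab(2)] unfolding dkok_def by blast
next
 fix T assume T: "T:nd_simplices n" "3 <= card T"
 have "card (?\<theta> ` T)=card T" by(rule card_image[OF inj])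
 hence "c (?\<theta> ` T)=0" using ok im[OF T(1)] T(2) unfolding dkok_def by metis
 thus "DK_face RG (Suc n) j c T=0" by(simp add: eq T)
qed
have "Dl n (DK_face RG (Suc n) j c)=DL n (%t. lw (c {?\<theta> t}))"
proof (rule pm_eqI)
 fix y :: "nat \<times> 'a ix"
 obtain q x where y: "y=(q, x)" by fastforce
 show "lookup (Dl n (DK_face RG (Suc n) j c)) y=lookup (DL n (%t. lw (c {?\<theta> t}))) y"
  unfolding y Dl_def lookup_DL using v[of q] v[of "q - 1"] v[of 0] by(simp add: du_def)
qed
also have "... = sublin (tf (Suc n) j) (Dl (Suc n) c)" unfolding Dl_def by(rule DL_face[OF j])
finally show "Dl n (DK_face RG (Suc n) j c)=sublin (tf (Suc n) j) (Dl (Suc n) c)" .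
qed

lemma DK_vertex_emb:
assumes v: "v:carrier (RG 0)"
shows "DK_vertex RG i v:carrier (DG i)" "Dl i (DK_vertex RG i v)=lev 0 (lw v)"
proof -
have eq: "DK_vertex RG i v T=(if card T=1 then v else 0)" if T: "T:nd_simplices i" for T
proof (cases "card T=1")
 case True
 then obtain k where "T = {k}" by(auto simp: card_1_singleton_iff)
 thus ?thesis using T by(simp add: DK_vertex_def DK_op_def nd_simplices_def)
next
 case False
 have "\<not> inj_on (%_. 0::nat) T"
 proof
  assume "inj_on (%_. 0::nat) T"
  hence "card T=card ((%_. 0::nat) ` T)" by(simp add: card_image)
  also have "... <= card {0::nat}" by(rule card_mono) auto
  finally show False using False nd_finite[OF T] by simp
 qed
 thus ?thesis using False T by(simp add: DK_vertex_def DK_op_def)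
qed
show "DK_vertex RG i v:carrier (DG i)" unfolding DK_carrier dkok_def using v
 by(auto simp: eq nd_mem RG_zero) (simp add: DK_vertex_def DK_op_def)
show "Dl i (DK_vertex RG i v)=lev 0 (lw v)"
proof (rule pm_eqI)
 fix y :: "nat \<times> 'a ix"
 obtain q x where y: "y=(q, x)" by fastforce
 show "lookup (Dl i (DK_vertex RG i v)) y=lookup (lev 0 (lw v)) y"
  unfolding y Dl_def lookup_DL lookup_lev by(simp add: du_def eq nd_mem)
qed
qed

lemma DK_edge_emb:
assumes u: "u:carrier (RG 1)" and k: "k < i"
shows "DK_edge RG res_diff i k u:carrier (DG i)" "Dl i (DK_edge RG res_diff i k u)=lev (Suc k) (lw u)"
proof -
let ?c = "DK_edge RG res_diff i k u"
have v: "?c {t} = (if t <= k then 0 else u)" if "t <= i" for t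
 using that by(simp add: DK_edge_def DK_op_def nd_mem nd_simplices_def[of 1] res_diff_def)
have e: "?c {a, b} = (if a <= k & k < b then u else 0)" if "a < b" "b <= i" for a b
 using that by(auto simp: DK_edge_def DK_op_def nd_mem nd_simplices_def[of 1] inj_on_def)
have z: "?c T=0" if T: "T:nd_simplices i" "card T >= 3" for T
proof -
 have "\<not> inj_on (%t. if t <= k then 0 else 1::nat) T"
 proof
  assume h: "inj_on (%t. if t <= k then 0 else 1::nat) T"
  have "card T=card ((%t. if t <= k then 0 else 1::nat) ` T)" by(rule card_image[OF h, symmetric])
  also have "... <= card {0, 1::nat}" by(rule card_mono) auto
  finally show False using T(2) by simp
 qed
 thus ?thesis using T by(simp add: DK_edge_def DK_op_def)
qed
show "?c:carrier (DG i)" unfolding DK_carrier dkok_def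
proof (intro conjI allI impI ballI)
 show "?c:extensional (nd_simplices i)" by(simp add: DK_edge_def DK_op_def)
 show "?c {t} : carrier (RG 0)" if "t <= i" for t using v[OF that] RG_zero RG1_sub[OF u] by simp
 fix a b assume "a < b & b <= i"
 hence ab: "a < b" "b <= i" "a <= i" by auto
 show "?c {a, b} : carrier (RG 1)" using e[OF ab(1,2)] u RG_zero by simp
 show "lw (?c {a, b})=lw (?c {b}) - lw (?c {a})" using e[OF ab(1,2)] v[OF ab(2)] v[OF ab(3)] ab by simp
qed (rule z)
show "Dl i ?c=lev (Suc k) (lw u)"
proof (rule pm_eqI)
 fix y :: "nat \<times> 'a ix"
 obtain q x where y: "y=(q, x)" by fastforce
 show "lookup (Dl i ?c) y=lookup (lev (Suc k) (lw u)) y"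
  unfolding y Dl_def lookup_DL lookup_lev using v[of q] v[of "q - 1"] v[of 0] k by(auto simp: du_def)
qed
qed

end

section \<open>The derived functors of symmetric powers\<close>

lemma tf_comm: "Option.bind (tf (Suc (Suc n)) 0 l) (tf (Suc n) j)=Option.bind (tf (Suc (Suc n)) (Suc j) l) (tf (Suc n) 0)"
by(cases l) (auto simp: tf_def Let_def split: if_splits)

lemma fac_fac0: "fac (Suc n) j (fac (Suc (Suc n)) 0 g)=fac (Suc n) 0 (fac (Suc (Suc n)) (Suc j) g)"
unfolding sub_sub by(rule sub_cong) (rule tf_comm)

lemma linmap_fac0: "linmap (sub \<alpha>)" by(rule linmap_sub0)

context modp
begin

abbreviation "QX m == deg XX m"
abbreviation "SG m n == SP m (DG n)"
abbreviation "se n == spe (Dl n)"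

lemma spc_pl: "lat (spc m (DKc n))=pl (pp p) (QX m) n"
proof -
have "spc m (DKc n) N=(if lvs n N & QX m (lv N) then of_int (prod_mset (image_mset (pp p) (lv (dn N)))) else 0)" for N
proof -
 define g where "g=(%N :: (nat \<times> 'a ix) multiset. prod_mset (image_mset (pp p) (lv (dn N))))"
 have gs: "g (add_mset (k, x) N)=(if k=0 then g N else pp p x * g N)" "g {#} = 1" for k x N
  by(simp_all add: g_def dn_def)
 have dkc: "DKc n (k, x)=(if k <= n & x:XX then (if k=0 then 1 else of_int (pp p x)) else 0)" for k x
  by(simp add: DKc_def wP_def)
 have 1: "prod_mset (image_mset (DKc n) N)=(if lvs n N & set_mset (lv N) <= XX then of_int (g N) else 0)"
 proof (induction N)
  case (add y N)
  obtain k x where y: "y=(k, x)" by fastforce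
  have "prod_mset (image_mset (DKc n) (add_mset y N))=DKc n (k, x) * (if lvs n N & set_mset (lv N) <= XX then of_int (g N) else 0)"
   by(simp add: add.IH y del: set_image_mset)
  thus ?case unfolding dkc y gs by simp
 qed (simp add: gs)
 show ?thesis unfolding spc_def 1 g_def by simp
qed
hence "spc m (DKc n)=(%N. if lvs n N & QX m (lv N) then of_int (prod_mset (image_mset (pp p) (lv (dn N)))) else 0)" ..
thus ?thesis unfolding pl_def by simp
qed

lemma SG_lemb: "lemb (SG m n) (se n) (spc m (DKc n))" by(rule SP_lemb[OF DK_lemb])

lemma se_in: "x:carrier (SG m n) ==> se n x:pl (pp p) (QX m) n" using lemb_lat[OF SG_lemb] by(simp add: spc_pl)

lemma SPK_face_emb:
assumes x: "x:carrier (SG m (Suc n))" and j: "j <= Suc n"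
shows "SPK_face RG res_diff m (Suc n) j x:carrier (SG m n)"
 "se n (SPK_face RG res_diff m (Suc n) j x)=fac (Suc n) j (se (Suc n) x)"
proof -
have T: "fac (Suc n) j (spl (Dl (Suc n)) M)=spl (Dl n) (image_mset (DK_face RG (Suc n) j) M)"
 if "set_mset M <= carrier (DG (Suc n))" for M using that
proof (induction M)
 case (add c M)
 thus ?case by(simp add: spl_def sub_mult DK_face_emb[OF _ j] lp_sublin)
qed (simp add: spl_def)
have e: "SPK_face RG res_diff m (Suc n) j=SP_map m (DG (Suc n)) (DG n) (DK_face RG (Suc n) j)"
 by(simp add: SPK_face_def)
show "SPK_face RG res_diff m (Suc n) j x:carrier (SG m n)"
 "se n (SPK_face RG res_diff m (Suc n) j x)=fac (Suc n) j (se (Suc n) x)"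
 unfolding e using SP_map_emb[OF DK_lemb DK_lemb DK_face_emb(1)[OF _ j] linmap_fac0 T x] by blast+
qed

definition LZ :: "nat => nat => ((nat \<times> 'a ix) multiset \<Rightarrow>\<^sub>0 rat) => bool" where
"LZ m i f \<longleftrightarrow> f:pl (pp p) (QX m) i & moore i f & fac i 0 f=0"

definition LN :: "nat => nat => ((nat \<times> 'a ix) multiset \<Rightarrow>\<^sub>0 rat) => bool" where
"LN m i f \<longleftrightarrow> f:pl (pp p) (QX m) i & moore i f"

abbreviation "LZs m i == {f. LZ m i f}"
abbreviation "LBs m i == fac (Suc i) 0 ` {f. LN m (Suc i) f}"

lemma moore_diff: "moore n f ==> moore n g ==> moore n (f - g)" by(simp add: moore_def sub_simps)

lemma addsub_LN: "addsub {f. LN m i f}"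
using moore_diff by(auto simp: addsub_def LN_def pl_def sub_simps intro: lat_diff simp: moore_def)

lemma addsub_LZ: "addsub (LZs m i)"
using moore_diff by(auto simp: addsub_def LZ_def pl_def sub_simps intro: lat_diff simp: moore_def)

lemma addsub_LB: "addsub (LBs m i)" by(rule addsub_image[OF linmap_fac0 addsub_LN])

lemma LB_sub: "LBs m (Suc k) <= LZs m (Suc k)"
proof clarify
fix g assume g: "LN m (Suc (Suc k)) g"
hence gl: "g:lat (spc m (DKc (Suc (Suc k))))" by(simp add: spc_pl LN_def)
obtain x where x: "x:carrier (SG m (Suc (Suc k)))" "se (Suc (Suc k)) x=g" using lemb_obtain[OF SG_lemb gl] .
have 1: "fac (Suc (Suc k)) 0 g:pl (pp p) (QX m) (Suc k)"
 using se_in[OF SPK_face_emb(1)[OF x(1), of 0]] SPK_face_emb(2)[OF x(1), of 0] x(2) by simp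
have 2: "fac (Suc k) j (fac (Suc (Suc k)) 0 g)=0" if "j <= Suc k" for j
 using g that unfolding fac_fac0 by(simp add: LN_def moore_def sub_simps)
show "LZ m (Suc k) (fac (Suc (Suc k)) 0 g)" using 1 2 by(simp add: LZ_def moore_def)
qed

abbreviation "MG m == moore_group (SPK_group RG res_diff m) (SPK_face RG res_diff m)"

lemma moore_iff:
assumes x: "x:carrier (SG m n)"
shows "(\<forall>j\<in>{1..n}. SPK_face RG res_diff m n j x = \<one>\<^bsub>SG m (n - 1)\<^esub>) \<longleftrightarrow> moore n (se n x)"
proof (cases n)
case 0
thus ?thesis by(simp add: moore_def)
next
case (Suc k)
have "SPK_face RG res_diff m n j x = \<one>\<^bsub>SG m (n - 1)\<^esub> \<longleftrightarrow> fac n j (se n x)=0" if "j <= n" for j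
 using lemb_eq_one_iff[OF SG_lemb SPK_face_emb(1)[of x m k j]] SPK_face_emb(2)[of x m k j] x that by(simp add: Suc)
thus ?thesis by(auto simp: moore_def)
qed

lemma MG_carrier: "x:carrier (MG m n) \<longleftrightarrow> x:carrier (SG m n) & LN m n (se n x)"
using moore_iff[of x m n] se_in[of x m n] by(auto simp: moore_group_def SPK_group_def LN_def)

lemma MG_one: "\<one>\<^bsub>MG m n\<^esub> = \<one>\<^bsub>SG m n\<^esub>"
by(simp add: moore_group_def SPK_group_def)

lemma MG_cycles: "cycles (MG m) (%n. SPK_face RG res_diff m n 0) (Suc k) = {x:carrier (SG m (Suc k)). se (Suc k) x:LZs m (Suc k)}"
proof -
have "SPK_face RG res_diff m (Suc k) 0 x = \<one>\<^bsub>SG m k\<^esub> \<longleftrightarrow> fac (Suc k) 0 (se (Suc k) x)=0" if "x:carrier (SG m (Suc k))" for x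
 using lemb_eq_one_iff[OF SG_lemb SPK_face_emb(1)[OF that, of 0]] SPK_face_emb(2)[OF that, of 0] by simp
thus ?thesis by(auto simp: cycles_def kernel_def MG_carrier MG_one LN_def LZ_def)
qed

lemma MG_boundaries: "boundaries (MG m) (%n. SPK_face RG res_diff m n 0) i = {x:carrier (SG m i). se i x:LBs m i}"
proof (intro equalityI subsetI)
fix x assume "x:boundaries (MG m) (%n. SPK_face RG res_diff m n 0) i"
then obtain y where y: "y:carrier (SG m (Suc i))" "LN m (Suc i) (se (Suc i) y)" "x=SPK_face RG res_diff m (Suc i) 0 y"
 by(auto simp: boundaries_def MG_carrier)
thus "x : {x:carrier (SG m i). se i x:LBs m i}" using SPK_face_emb[OF y(1), of 0] by auto
next
fix x assume x: "x : {x:carrier (SG m i). se i x:LBs m i}"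
then obtain g where g: "LN m (Suc i) g" "se i x=fac (Suc i) 0 g" by blast
hence "g:lat (spc m (DKc (Suc i)))" by(simp add: spc_pl LN_def)
then obtain y where y: "y:carrier (SG m (Suc i))" "se (Suc i) y=g" using lemb_obtain[OF SG_lemb] by metis
have "SPK_face RG res_diff m (Suc i) 0 y=x"
 using SPK_face_emb[OF y(1), of 0] x g(2) y(2) by(intro lemb_inj[OF SG_lemb]) auto
moreover have "y:carrier (MG m (Suc i))" using y g(1) by(simp add: MG_carrier)
ultimately show "x:boundaries (MG m) (%n. SPK_face RG res_diff m n 0) i" unfolding boundaries_def by blast
qed

abbreviation "Lcls m i == lcls (SG m i) (se i) (LBs m i)"

text \<open>The symmetric power of the simplicial group is a bar construction on the levels, so the derived
 functor is cycles modulo boundaries in a lattice of polynomials.\<close>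

lemma L_qpres: "qpres (L_SP (Suc k) m Bp) (Lcls m (Suc k)) (LZs m (Suc k)) (LBs m (Suc k))"
proof -
have "L_SP (Suc k) m Bp=(SG m (Suc k))\<lparr>carrier := {x:carrier (SG m (Suc k)). se (Suc k) x:LZs m (Suc k)}\<rparr> Mod
  {x:carrier (SG m (Suc k)). se (Suc k) x:LBs m (Suc k)}"
 unfolding L_SP_def homotopy_group_def homology_def MG_cycles MG_boundaries
 by(simp add: moore_group_def SPK_group_def)
moreover have "LZs m (Suc k) <= lat (spc m (DKc (Suc k)))" by(auto simp: spc_pl LZ_def)
ultimately show ?thesis using subquotient_qpres[OF SG_lemb addsub_LZ _ refl addsub_LB LB_sub refl] by simp
qed

lemma L_homotopy_class:
assumes "x:carrier (SG m i)"
shows "homotopy_class (SPK_group RG res_diff m) (SPK_face RG res_diff m) i x=Lcls m i (se i x)"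
proof -
have "homotopy_class (SPK_group RG res_diff m) (SPK_face RG res_diff m) i x =
  {x:carrier (SG m i). se i x:LBs m i} #>\<^bsub>SG m i\<^esub> x"
 unfolding homotopy_class_def homology_class_def MG_boundaries r_coset_def by(simp add: moore_group_def SPK_group_def)
thus ?thesis using r_coset_lcls[OF SG_lemb addsub_LB refl assms] by simp
qed

subsection \<open>Beta cycles\<close>

text \<open>The cycle \<open>\<beta>\<close> in coordinates.\<close>

definition bet :: "nat \<Rightarrow> 'a ix vec list \<Rightarrow> 'a ix vec list \<Rightarrow> (nat \<times> 'a ix) multiset \<Rightarrow>\<^sub>0 rat" where
"bet i bl ws = (\<Sum>t\<le>i. \<Sum>\<sigma> | \<sigma> permutes {..<i}. sc (of_int ((- 1) ^ Suc t * sign \<sigma>))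
  (lp (lev 0 (bl ! t)) * (\<Prod>j<i. lp (lev (Suc (\<sigma> j)) (sc (of_nat p) (drop_nth t bl ! j)))) * prod_list (map (\<lambda>w. lp (lev 0 w)) ws)))"

lemma frag_RG: "b:carrier Bp ==> frag_of b:carrier (RG 0)" by(simp add: RG0_carrier)

lemma p_frag_RG:
assumes b: "b:carrier Bp" shows "frag_cmul (int p) (frag_of b):carrier (RG 1)"
proof -
have "lw (frag_cmul (int p) (frag_of b)):lat (wP 1)"
proof -
 have "sc (of_nat p) (l0 b):lat (wP 1)"
 proof (rule lat_linmap[where F = "sc (of_nat p)" and c = "%x. if x:XX then 1 else 0"])
  show "l0 b:lat (%x. if x:XX then 1 else 0)" using l0_vecs[OF b] by(simp add: vecs_def)
  fix y assume "(if y:XX then 1 else 0 :: rat) ~= 0"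
  hence "y:XX" by(simp split: if_splits)
  thus "sc (if y:XX then 1 else 0) (sc (of_nat p) (bs y)):lat (wP 1)"
   by(cases y) (auto simp: lat_bs_iff wP_def intro!: exI[of _ 1] exI[of _ "int p"])
 qed (rule lin, rule lin)
 thus ?thesis by simp
qed
moreover have z: "frag_cmul (int p) (frag_of b):carrier (RG 0)" using b keys_cmul[of "int p" "frag_of b"] by(auto simp: RG0_carrier)
ultimately have "frag_eval Bp (frag_cmul (int p) (frag_of b)) = \<one>\<^bsub>Bp\<^esub>" using kernel_lat by blast
with z show ?thesis by(simp add: res_group_def Let_def kernel_def)
qed

lemma length_drop_nth': "t <= i ==> length bl=Suc i ==> length (drop_nth t bl)=i" by(simp add: length_drop_nth)

lemma beta_cycle_emb:
assumes b: "set bl \<subseteq> carrier Bp" "length bl = Suc i" and w: "set ws \<subseteq> carrier Bp"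
shows "beta Bp (int p) bl ws = Lcls (Suc i + length ws) i (bet i (map l0 bl) (map l0 ws))"
 "bet i (map l0 bl) (map l0 ws) \<in> pl (pp p) (QX (Suc i + length ws)) i"
proof -
let ?us = "map (\<lambda>b. frag_cmul (int p) (frag_of b)) bl" and ?vs = "map frag_of bl" and ?ws = "map frag_of ws"
let ?m = "Suc i + length ws"
define M where "M = (\<lambda>t \<sigma>. {#DK_vertex RG i (?vs ! t)#}
       + mset (map (\<lambda>j. DK_edge RG res_diff i (\<sigma> j) (drop_nth t ?us ! j)) [0..<i])
       + mset (map (DK_vertex RG i) ?ws))"
define x where "x = SP_class ?m (DG i) (\<Sum>t\<le>i. \<Sum>\<sigma> | \<sigma> permutes {..<i}. frag_cmul ((- 1) ^ Suc t * sign \<sigma>) (frag_of (M t \<sigma>)))"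
have bt: "bl ! t \<in> carrier Bp" if "t \<le> i" for t using b that nth_mem[of t bl] by auto
have dt: "drop_nth t bl ! j \<in> carrier Bp" if "t \<le> i" "j < i" for t j
proof -
 have "drop_nth t bl ! j \<in> set (drop_nth t bl)" using length_drop_nth'[OF that(1) b(2)] that(2) by(intro nth_mem) simp
 thus ?thesis using set_drop_nth[of t bl] b(1) by blast
qed
have du: "drop_nth t ?us ! j = frag_cmul (int p) (frag_of (drop_nth t bl ! j))" if "t \<le> i" "j < i" for t j
 unfolding drop_nth_map using length_drop_nth'[OF that(1) b(2)] that(2) by simp
have sj: "\<sigma> j < i" if "\<sigma> permutes {..<i}" "j < i" for \<sigma> j
 using permutes_in_image[OF that(1), of j] that(2) by simp
have V: "DK_vertex RG i (frag_of c) \<in> carrier (DG i)" "Dl i (DK_vertex RG i (frag_of c)) = lev 0 (l0 c)" if "c \<in> carrier Bp" for c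
 using DK_vertex_emb[OF frag_RG[OF that]] by simp_all
have E: "DK_edge RG res_diff i k (frag_cmul (int p) (frag_of c)) \<in> carrier (DG i)"
 "Dl i (DK_edge RG res_diff i k (frag_cmul (int p) (frag_of c))) = lev (Suc k) (sc (of_nat p) (l0 c))" if "c \<in> carrier Bp" "k < i" for c k
 using DK_edge_emb[OF p_frag_RG[OF that(1)] that(2)] by simp_all
have Mm: "M t \<sigma> \<in> monomials (DG i) ?m" if "t \<le> i" "\<sigma> permutes {..<i}" for t \<sigma>
 using that b w bt V E dt sj by(auto simp: monomials_def M_def du)
have spl: "spl (Dl i) (M t \<sigma>) = lp (lev 0 (map l0 bl ! t)) *
  (\<Prod>j<i. lp (lev (Suc (\<sigma> j)) (sc (of_nat p) (drop_nth t (map l0 bl) ! j)))) * prod_list (map (\<lambda>w. lp (lev 0 w)) (map l0 ws))"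
 if t: "t \<le> i" and s: "\<sigma> permutes {..<i}" for t \<sigma>
proof -
 have pm: "prod_mset (image_mset f (mset xs)) = prod_list (map f xs)" for f :: "_ \<Rightarrow> (nat \<times> 'a ix) multiset \<Rightarrow>\<^sub>0 rat" and xs :: "(nat set \<Rightarrow> _) list"
  by(metis mset_map prod_mset_prod_list)
 have 1: "prod_list (map (\<lambda>c. lp (Dl i c)) (map (\<lambda>j. DK_edge RG res_diff i (\<sigma> j) (drop_nth t ?us ! j)) [0..<i])) =
   (\<Prod>j<i. lp (lev (Suc (\<sigma> j)) (sc (of_nat p) (drop_nth t (map l0 bl) ! j))))"
 proof -
  have "prod_list (map (\<lambda>c. lp (Dl i c)) (map (\<lambda>j. DK_edge RG res_diff i (\<sigma> j) (drop_nth t ?us ! j)) [0..<i])) =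
    (\<Prod>j<i. lp (Dl i (DK_edge RG res_diff i (\<sigma> j) (drop_nth t ?us ! j))))"
   using prod_lessThan_list[of "\<lambda>j. lp (Dl i (DK_edge RG res_diff i (\<sigma> j) (drop_nth t ?us ! j)))" "[0..<i]"]
   by(simp add: comp_def)
  also have "\<dots> = (\<Prod>j<i. lp (lev (Suc (\<sigma> j)) (sc (of_nat p) (drop_nth t (map l0 bl) ! j))))"
  proof (rule prod.cong)
   fix j assume "j \<in> {..<i}"
   hence j: "j < i" by simp
   have "drop_nth t (map l0 bl) ! j = l0 (drop_nth t bl ! j)"
    unfolding drop_nth_map using length_drop_nth'[OF t b(2)] j by simp
   thus "lp (Dl i (DK_edge RG res_diff i (\<sigma> j) (drop_nth t ?us ! j))) =
     lp (lev (Suc (\<sigma> j)) (sc (of_nat p) (drop_nth t (map l0 bl) ! j)))"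
    using E(2)[OF dt[OF t j] sj[OF s j]] du[OF t j] by simp
  qed simp
  finally show ?thesis .
 qed
 have 2: "prod_list (map (\<lambda>c. lp (Dl i c)) (map (DK_vertex RG i) ?ws)) = prod_list (map (\<lambda>w. lp (lev 0 w)) (map l0 ws))"
 proof -
  have "map (\<lambda>c. lp (Dl i c)) (map (DK_vertex RG i) ?ws) = map (\<lambda>w. lp (lev 0 w)) (map l0 ws)"
   using w V(2) by auto
  thus ?thesis by(rule arg_cong)
 qed
 have 3: "lp (Dl i (DK_vertex RG i (?vs ! t))) = lp (lev 0 (map l0 bl ! t))"
  using V(2)[OF bt[OF t]] t b(2) by simp
 show ?thesis unfolding spl_def M_def image_mset_union prod_mset_Un pm 1 2 by(simp add: 3)
qed
have keys: "keys (\<Sum>t\<le>i. \<Sum>\<sigma> | \<sigma> permutes {..<i}. frag_cmul ((- 1) ^ Suc t * sign \<sigma>) (frag_of (M t \<sigma>))) \<subseteq> monomials (DG i) ?m"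
 by(intro order.trans[OF keys_sum UN_least] keys_frag_sum) (use Mm in auto)
have xin: "x \<in> carrier (SG ?m i)" unfolding x_def
 by(rule SP_class_in[OF comm_group.axioms(2)[OF DG_comm] keys])
have sx: "se i x = bet i (map l0 bl) (map l0 ws)" unfolding x_def spe_class[OF DK_lemb] bet_def ev_sum
 by(intro sum.cong refl) (use spl in simp)
show "beta Bp (int p) bl ws = Lcls ?m i (bet i (map l0 bl) (map l0 ws))"
proof -
 have "beta Bp (int p) bl ws = homotopy_class (SPK_group RG res_diff ?m) (SPK_face RG res_diff ?m) i x"
  unfolding beta_def beta_cycle_def Let_def x_def M_def using b(2) by simp
 thus ?thesis unfolding L_homotopy_class[OF xin] sx .
qed
show "bet i (map l0 bl) (map l0 ws) \<in> pl (pp p) (QX ?m) i" using se_in[OF xin] sx by simp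
qed

end

section \<open>The comparison map in coordinates\<close>

lemma addsub_sum: "addsub Z ==> (!!k. k:K ==> f k:Z) ==> sum f K:Z"
by(induction K rule: infinite_finite_induct) (auto intro: addsubD)

lemma addsub_sc_int:
assumes Z: "addsub Z" and z: "z:Z" shows "sc (of_int k) z:Z"
proof -
have n: "sc (of_nat n) z:Z" for n
proof (induction n)
 case 0
 thus ?case using addsubD(1)[OF Z] by simp
next
 case (Suc n)
 thus ?case using addsubD(4)[OF Z z Suc] by(simp add: sc_add_left)
qed
show ?thesis
proof (cases "k >= 0")
 case True
 thus ?thesis using n[of "nat k"] by simp
next
 case False
 hence "sc (of_int k) z = - sc (of_nat (nat (- k))) z" by(simp add: sc_minus1)
 thus ?thesis using addsubD(3)[OF Z n] by simp
qed
qed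

lemma qpres_subgroup_addsub:
assumes Q: "qpres Q cls Z B" and H: "subgroup H Q" shows "addsub {z:Z. cls z:H}"
proof -
interpret comm_group Q by(rule qpres_comm[OF Q])
note Z=qpres_addsub[OF Q]
have "cls (z - w):H" if "z:Z" "w:Z" "cls z:H" "cls w:H" for z w
proof -
 have d: "z - w:Z" using addsubD(2)[OF Z] that by blast
 have "cls z=cls (z - w) \<otimes>\<^bsub>Q\<^esub> cls w" using qpres_mult[OF Q d that(2)] by simp
 hence "cls (z - w)=cls z \<otimes>\<^bsub>Q\<^esub> inv\<^bsub>Q\<^esub> cls w"
  using inv_solve_right[of "cls (z - w)" "cls z" "cls w"] qpres_in[OF Q] d that by simp
 thus ?thesis using that H by(simp add: subgroup.m_closed subgroup.m_inv_closed)
qed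
moreover have "cls 0:H" using subgroup.one_closed[OF H] qpres_one[OF Q] by simp
ultimately show ?thesis using addsubD(1,2)[OF Z] by(auto simp: addsub_def)
qed

subsection \<open>The shuffle cycles in low degrees\<close>

lemma sub_lp_lev: "sub \<alpha> (lp (lev k v))=(case \<alpha> k of None => 0 | Some q => lp (lev q v))"
proof (cases "\<alpha> k")
case None
have "sub \<alpha> (lp (lev k v))=(%_. 0) v"
 by(rule linmap_eqI[of "%v. sub \<alpha> (lp (lev k v))"]) (auto intro!: lin linmapI simp: None subm_def)
thus ?thesis by(simp add: None)
next
case (Some q)
have "sub \<alpha> (lp (lev k v))=lp (lev q v)"
 by(rule linmap_eqI[of "%v. sub \<alpha> (lp (lev k v))"]) (auto intro!: lin simp: Some subm_def)
thus ?thesis by(simp add: Some)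
qed

abbreviation "W0 ws == prod_list (map (%w. lp (lev 0 w)) ws)"

lemma ph_lp0: "ph n (lp (lev 0 v) * f)=MP (lp v) (ph n f)"
proof (rule linmap_eqI[of "%v. ph n (lp (lev 0 v) * f)"])
fix x show "ph n (lp (lev 0 (bs x)) * f)=MP (lp (bs x)) (ph n f)" using ph_V[of n "{#x#}" f] by(simp add: V_def)
qed (intro lin)+

lemma ph_W0: "ph n (W0 ws * f)=MP (prod_list (map lp ws)) (ph n f)"
by(induction ws) (simp_all add: mult.assoc ph_lp0 MP_mult)

lemma ph_1: "ph (Suc 0) (lp (lev (Suc 0) v))=Ev v (bs ([], {#}))"
by(rule linmap_eqI[of "%v. ph (Suc 0) (lp (lev (Suc 0) v))"])
  (auto intro!: lin simp: dn_def lev0_def sl_def)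

declare ph.simps [simp del]

lemma ph_2: "ph two (lp (lev (Suc 0) v) * lp (lev two w)) - ph two (lp (lev two v) * lp (lev (Suc 0) w)) =
 Ev v (Ev w (bs ([], {#})))"
proof (rule linmap_eqI[of "%v. ph two (lp (lev (Suc 0) v) * lp (lev two w)) - ph two (lp (lev two v) * lp (lev (Suc 0) w))"])
fix x
show "ph two (lp (lev (Suc 0) (bs x)) * lp (lev two w)) - ph two (lp (lev two (bs x)) * lp (lev (Suc 0) w)) =
  Ev (bs x) (Ev w (bs ([], {#})))"
proof (rule linmap_eqI[of "%w. ph two (lp (lev (Suc 0) (bs x)) * lp (lev two w)) - ph two (lp (lev two (bs x)) * lp (lev (Suc 0) w))"])
 fix y
 have p: "ph two (bs ({#(Suc 0, x)#} + {#(two, y)#}))=(if x < y then bs ([x, y], {#}) else 0)" for x y :: 'a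
 proof -
  have d: "dn ({#(Suc 0, x)#} + {#(two, y)#}) = {#(0, x)#} + {#(Suc 0, y)#}" "dn ({#(0, x)#} + {#(Suc 0, y)#}) = {#(0, y)#}"
   by(simp_all add: dn_def)
  have l: "lev0 ({#(Suc 0, x)#} + {#(two, y)#}) = {#}" "lev0 ({#(0, x)#} + {#(Suc 0, y)#}) = {#x#}" "lev0 {#(0, y)#} = {#y#}"
   by(simp_all add: lev0_def)
  have v: "lvs 0 {#(0 :: nat, y)#}" by simp
  have "ph two (bs ({#(Suc 0, x)#} + {#(two, y)#}))=ks (Mo {#x#} (ks (bs ([], {#y#}))))"
   by(simp only: ph.simps lext_bs d l if_P[OF v] Mo_empty)
  also have "ks (bs ([], {#y#}))=bs ([y], {#})" by(simp add: sl_def)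
  finally show ?thesis by(simp add: sl_def)
 qed
 show "ph two (lp (lev (Suc 0) (bs x)) * lp (lev two (bs y))) - ph two (lp (lev two (bs x)) * lp (lev (Suc 0) (bs y))) =
  Ev (bs x) (Ev (bs y) (bs ([], {#})))"
 proof -
  have c: "{#(two, x)#} + {#(Suc 0, y)#} = {#(Suc 0, y)#} + {#(two, x)#}" by(rule add.commute)
  have m: "lp (lev (Suc 0) (bs x)) * lp (lev two (bs y))=bs ({#(Suc 0, x)#} + {#(two, y)#})"
   "lp (lev two (bs x)) * lp (lev (Suc 0) (bs y))=bs ({#(Suc 0, y)#} + {#(two, x)#})"
   unfolding lev_bs lp_bs bs_mult c by(rule refl)+
  show ?thesis unfolding m p by(auto simp: cns_def)
 qed
qed (intro lin)+
qed (intro lin)+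

lemma perms_1: "{\<sigma>. \<sigma> permutes {..<Suc 0}} = {id}" by(simp add: lessThan_Suc)

lemma perms_2: "{\<sigma>. \<sigma> permutes {..<two}} = {id, transpose 0 (Suc 0)}"
proof -
have "{..<two} = {0, Suc 0}" by auto
thus ?thesis by(simp only: permutes_doubleton_iff) auto
qed

context modp
begin

lemma bet_1: "bet (Suc 0) [a, b] ws=W0 ws * sc (of_nat p)
 (lp (lev 0 b) * lp (lev (Suc 0) a) - lp (lev 0 a) * lp (lev (Suc 0) b))" unfolding bet_def perms_1
by(simp add: lev_simps lp_simps sc_mult_left sc_mult_right sc_minus1 algebra_simps sc_diff)

lemma bet_2: "bet two [a, b, c] ws=W0 ws * sc (of_nat p * of_nat p)
 (lp (lev 0 b) * (lp (lev (Suc 0) a) * lp (lev two c) - lp (lev two a) * lp (lev (Suc 0) c))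
 - lp (lev 0 a) * (lp (lev (Suc 0) b) * lp (lev two c) - lp (lev two b) * lp (lev (Suc 0) c))
 - lp (lev 0 c) * (lp (lev (Suc 0) a) * lp (lev two b) - lp (lev two a) * lp (lev (Suc 0) b)))"
proof -
have ne: "id ~= transpose 0 (Suc 0)" by(metis id_apply transpose_apply_first zero_neq_one One_nat_def)
have s: "sum g {id, transpose 0 (Suc 0)} = g id + g (transpose 0 (Suc 0))" for g :: "(nat => nat) => (nat \<times> 'a ix) multiset \<Rightarrow>\<^sub>0 rat"
 using ne by simp
have sg: "sign (transpose 0 (Suc 0)) = - 1" by(simp add: sign_swap_id)
show ?thesis unfolding bet_def perms_2 s sg
 by(simp add: lev_simps lp_simps sc_mult_left sc_mult_right sc_minus1 algebra_simps sc_diff sc_add transpose_apply_first transpose_apply_second)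
qed

lemma ph_bet:
assumes "i=Suc 0 | i=two" "length bl=Suc i"
shows "ph i (bet i bl ws)=sc (- (of_nat p ^ i)) (kd (Qe bl (prod_list (map lp ws))))" using assms(1)
proof
assume i: "i=Suc 0"
then obtain a b where bl: "bl=[a, b]" using assms(2) by(auto simp: length_Suc_conv)
let ?W = "prod_list (map lp ws)"
have q: "Qe [v] (lp u * ?W)=MP ?W (MP (lp u) (Ev v (bs ([], {#}))))" for u v
 by(simp add: Ev_MP MP_mult MP_commute[of "lp u"])
have r: "ph (Suc 0) (lp (lev 0 u) * lp (lev (Suc 0) v))=MP (lp u) (Ev v (bs ([], {#})))" for u v
 unfolding ph_lp0 ph_1 ..
have k: "kd (Qe [a, b] ?W)=Qe [b] (lp a * ?W) - Qe [a] (lp b * ?W)"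
 unfolding kd_Qe by(simp add: sc_minus1 lessThan_Suc del: Qe_simps)
show ?thesis unfolding i bl bet_1 ph_W0 ph_simps(2) ph_simps(5) r k q MP_simps
 by(rule pm_eqI) (simp add: lookup_add lookup_minus algebra_simps)
next
assume i: "i=two"
then obtain a b c where bl: "bl=[a, b, c]" using assms(2) by(auto simp: length_Suc_conv)
let ?W = "prod_list (map lp ws)"
have q: "Qe [v, w] (lp u * ?W)=MP ?W (MP (lp u) (Ev v (Ev w (bs ([], {#})))))" for u v w
 by(simp add: Ev_MP MP_mult MP_commute[of "lp u"])
have r: "ph two (lp (lev 0 u) * (lp (lev (Suc 0) v) * lp (lev two w) - lp (lev two v) * lp (lev (Suc 0) w))) =
  MP (lp u) (Ev v (Ev w (bs ([], {#}))))" for u v w unfolding ph_lp0 ph_simps(5) ph_2 ..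
have k: "kd (Qe [a, b, c] ?W)=Qe [b, c] (lp a * ?W) - Qe [a, c] (lp b * ?W) + Qe [a, b] (lp c * ?W)"
 unfolding kd_Qe by(simp add: sc_minus1 lessThan_Suc del: Qe_simps)
show ?thesis unfolding i bl bet_2 ph_W0 ph_simps(2) ph_simps(5) r k q MP_simps
 by(rule pm_eqI) (simp add: lookup_add lookup_minus algebra_simps)
qed

lemma bet_faces:
assumes "i=Suc 0 | i=two" "length bl=Suc i" "j <= i"
shows "fac i j (bet i bl ws)=0" using assms(1)
proof
assume i: "i=Suc 0"
then obtain a b where bl: "bl=[a, b]" using assms(2) by(auto simp: length_Suc_conv)
have "j=0 | j=Suc 0" using assms(3) i by auto
thus ?thesis
proof
 assume j: "j=0"
 show ?thesis unfolding i bl bet_1 j sub_mult sub_simps(2) sub_simps(5) sub_lp_lev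
  by(simp add: tf_def algebra_simps)
next
 assume j: "j=Suc 0"
 show ?thesis unfolding i bl bet_1 j sub_mult sub_simps(2) sub_simps(5) sub_lp_lev
  by(simp add: tf_def algebra_simps)
qed
next
assume i: "i=two"
then obtain a b c where bl: "bl=[a, b, c]" using assms(2) by(auto simp: length_Suc_conv)
have "j=0 | j=Suc 0 | j=two" using assms(3) i by auto
thus ?thesis
proof (elim disjE)
 assume j: "j=0"
 show ?thesis unfolding i bl bet_2 j sub_mult sub_simps(2) sub_simps(5) sub_lp_lev
  by(simp add: tf_def algebra_simps)
next
 assume j: "j=Suc 0"
 show ?thesis unfolding i bl bet_2 j sub_mult sub_simps(2) sub_simps(5) sub_lp_lev
  by(simp add: tf_def algebra_simps)
next
 assume j: "j=two"
 show ?thesis unfolding i bl bet_2 j sub_mult sub_simps(2) sub_simps(5) sub_lp_lev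
  by(simp add: tf_def algebra_simps)
qed
qed

subsection \<open>Cycles and boundaries\<close>

abbreviation "GG == (%w :: 'a ix multiset. \<forall>x\<in>#w. pp p x=int p)"

lemma pp_cases: "pp p x=1 | pp p x=int p" by(cases x) auto

lemma pp_Gen: "pp p x=int p \<longleftrightarrow> x:range Gen" using p2 by(cases x) auto

lemma pp_order: "x < y ==> pp p y=1 ==> pp p x=1" using p2 by(cases x; cases y) (auto simp: less_idx_def)

lemma p_ne: "int p ~= 0" "int p ~= 1" using p2 by auto

lemma resc: "rescale p (pp p) GG (QX m) (deg (Gen ` S) (p * m))"
proof
show "p > 0" using p2 by simp
fix w assume w: "QX m w" "GG w"
have "x:Gen ` S" if "x \<in># w" for x
proof -
 have "x:XX" "x:range Gen" using w that pp_Gen by auto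
 thus ?thesis by(auto simp: XX_def)
qed
thus "deg (Gen ` S) (p * m) (repeat_mset p w)" using w(1) by(auto simp: set_mset_repeat_mset)
qed simp

lemma small_cond:
assumes "m <= 3" "QX m w" "distinct I" "length I=Suc i" "i > 0" "mset I <=# w"
shows "\<forall>x\<in>set_mset w - set I. count w x=1"
proof
fix x assume x: "x:set_mset w - set I"
obtain r where r: "w=mset I + r" using assms(6) by(metis subset_mset.add_diff_inverse)
hence "size r <= 1" using assms by auto
moreover have "count w x=count r x" using x r by(simp add: count_mset_0_iff)
moreover have "count r x <= size r" by(rule count_le_size)
moreover have "count w x > 0" using x by simp
ultimately show "count w x=1" by linarith
qed

lemma ph_cycle: "LZ m (Suc k) f ==> ph (Suc k) f:kl (pp p) (QX m) (Suc k)" "LZ m (Suc k) f ==> kd (ph (Suc k) f)=0"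
proof -
assume f: "LZ m (Suc k) f"
hence pl: "f:pl (pp p) (QX m) (Suc k)" and mo: "moore (Suc k) f" and z: "fac (Suc k) 0 f=0" by(auto simp: LZ_def)
show "ph (Suc k) f:kl (pp p) (QX m) (Suc k)" by(rule ph_kl[OF pl])
have "kd (ph (Suc k) f)=ph k (bd k f)" by(rule ph_bd[OF U_pl[OF pl]])
thus "kd (ph (Suc k) f)=0" unfolding moore_bd[OF mo] z by(simp add: linmap_0[OF linmap_ph0])
qed

lemma ph_boundary:
assumes "f:LBs m (Suc k)"
obtains y where "y:kl (pp p) (QX m) (Suc (Suc k))" "ph (Suc k) f=kd y"
proof -
obtain g where g: "LN m (Suc (Suc k)) g" "f=fac (Suc (Suc k)) 0 g" using assms by blast
hence pl: "g:pl (pp p) (QX m) (Suc (Suc k))" and mo: "moore (Suc (Suc k)) g" by(auto simp: LN_def)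
have "kd (ph (Suc (Suc k)) g)=ph (Suc k) (bd (Suc k) g)" by(rule ph_bd[OF U_pl[OF pl]])
hence "ph (Suc k) f=kd (ph (Suc (Suc k)) g)" unfolding moore_bd[OF mo] g(2) ..
thus ?thesis using that ph_kl[OF pl] by blast
qed

lemma boundaryI:
assumes f: "LZ m (Suc k) f" and y: "y:kl (pp p) (QX m) (Suc (Suc k))" "ph (Suc k) f=kd y"
shows "f:LBs m (Suc k)"
proof -
have "f:pl (pp p) (QX m) (Suc k)" "moore (Suc k) f" "fac (Suc k) 0 f=0" using f by(auto simp: LZ_def)
from moore_boundary[OF this y] obtain g where "g:pl (pp p) (QX m) (Suc (Suc k))" "moore (Suc (Suc k)) g" "fac (Suc (Suc k)) 0 g=f" .
hence "LN m (Suc (Suc k)) g" "f=fac (Suc (Suc k)) 0 g" by(auto simp: LN_def)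
thus ?thesis by blast
qed

lemma ph_decomp:
assumes f: "LZ m (Suc k) f"
obtains y' y where "y':kl (pp p) (QX m) (Suc (Suc k))" "y:kl (pp p) (%w. QX m w & GG w) (Suc (Suc k))"
 "ph (Suc k) f=kd y' + sc (1 / of_nat p) (kd y)"
proof -
obtain y' y where "y':kl (pp p) (QX m) (Suc (Suc k))" "y:kl (pp p) (%w. QX m w & GG w) (Suc (Suc k))"
 "ph (Suc k) f=kd y' + sc (1 / of_int (int p)) (kd y)"
 by(rule kl_cycle[OF ph_cycle(1)[OF f] ph_cycle(2)[OF f] zero_less_Suc pp_cases pp_order p_ne])
thus ?thesis by(intro that) simp_all
qed

lemma LZ_torsion: "LZ m (Suc k) f ==> sc (of_nat p) f:LBs m (Suc k)"
proof -
assume f: "LZ m (Suc k) f"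
obtain y' y where y: "y':kl (pp p) (QX m) (Suc (Suc k))" "y:kl (pp p) (%w. QX m w & GG w) (Suc (Suc k))"
 "ph (Suc k) f=kd y' + sc (1 / of_nat p) (kd y)" using ph_decomp[OF f] .
have "y:kl (pp p) (QX m) (Suc (Suc k))" using y(2) by(rule kl_mono) simp
hence 1: "sc (of_int (int p)) y' + y:kl (pp p) (QX m) (Suc (Suc k))" using y(1) by(intro kl_add kl_sc)
have 2: "LZ m (Suc k) (sc (of_int (int p)) f)" using addsub_sc_int[OF addsub_LZ, of f m "Suc k" "int p"] f by simp
have "ph (Suc k) (sc (of_int (int p)) f)=kd (sc (of_int (int p)) y' + y)"
 unfolding ph_simps(2) y(3) using p2 by(simp add: sc_add kd_simps)
from boundaryI[OF 2 1 this] show ?thesis by simp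
qed

lemma LZ_trivial: "LZ m (Suc k) f ==> m <= Suc k ==> f:LBs m (Suc k)"
proof -
assume f: "LZ m (Suc k) f" and m: "m <= Suc k"
have z: "z=0" if z: "z:kl (pp p) (QX m) (Suc (Suc k))" for z
proof (rule ccontr)
 assume "z ~= 0"
 then obtain y where "y:keys z" by(metis keys_eq_empty ex_in_conv)
 moreover obtain I u where "y=(I, u)" by fastforce
 ultimately have "length I=Suc (Suc k)" "size (mset I + u)=m" using kl_keys[OF z, of I u] by auto
 thus False using m by simp
qed
obtain y' y where y: "y':kl (pp p) (QX m) (Suc (Suc k))" "y:kl (pp p) (%w. QX m w & GG w) (Suc (Suc k))"
 "ph (Suc k) f=kd y' + sc (1 / of_nat p) (kd y)" using ph_decomp[OF f] .
have "y:kl (pp p) (QX m) (Suc (Suc k))" using y(2) by(rule kl_mono) simp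
hence "y=0" "y'=0" using z y(1) by blast+
hence "ph (Suc k) f=kd 0" using y(3) by(simp add: kd_simps)
thus ?thesis by(intro boundaryI[OF f, of 0]) simp_all
qed

subsection \<open>The homomorphism\<close>

definition Ff :: "nat => ((nat \<times> 'a ix) multiset \<Rightarrow>\<^sub>0 rat) => 'a ix kos" where
"Ff i f=chi p GG (ph i f)"

lemma linmap_Ff: "linmap (Ff i)" unfolding Ff_def by(intro lin)

lemma Ff_cycle: "LZ m (Suc k) f ==> Ff (Suc k) f:dRZ (p * m) (Suc k)"
using rescale.chi_gl[OF resc ph_cycle(1)] ph_cycle(2)[of m k f]
by(auto simp: Ff_def linmap_0[OF linmap_chi0] simp flip: chi_kd)

lemma Ff_boundary: "f:LBs m (Suc k) ==> Ff (Suc k) f:dRB (p * m) (Suc k)"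
proof -
assume "f:LBs m (Suc k)"
then obtain y where y: "y:kl (pp p) (QX m) (Suc (Suc k))" "ph (Suc k) f=kd y" using ph_boundary by blast
have "Ff (Suc k) f=kd (chi p GG y)" by(simp add: Ff_def y(2) chi_kd)
thus ?thesis using rescale.chi_gl[OF resc y(1)] by blast
qed

text \<open>The symmetric degree is at most \<open>3\<close> and a chain in positive degree that contributes a boundary has at
 least two exterior letters. At most one letter is left, so its divided powers cost no denominator.\<close>

lemma Ff_injective:
assumes f: "LZ m (Suc k) f" and m: "m <= 3" and B: "Ff (Suc k) f:dRB (p * m) (Suc k)"
shows "f:LBs m (Suc k)"
proof -
obtain Y where Y: "Y:dR (Gen ` S) (p * m) (Suc (Suc k))" "chi p GG (ph (Suc k) f)=kd Y" using B by(auto simp: Ff_def)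
have c: "\<forall>x\<in>set_mset w - set I. count w x=1" if "QX m w" "distinct I" "length I=Suc (Suc k)" "mset I <=# w" for w I
 by(rule small_cond[OF m that(1-3) _ that(4)]) simp
obtain x where x: "x:kl (pp p) (%w. QX m w & GG w) (Suc (Suc k))" "kd x=res GG (ph (Suc k) f)"
 by(rule rescale.chi_reflects_boundary[OF resc ph_cycle(1)[OF f] Y c])
obtain y' y where y: "y':kl (pp p) (QX m) (Suc (Suc k))" "y:kl (pp p) (%w. QX m w & GG w) (Suc (Suc k))"
 "ph (Suc k) f=kd y' + sc (1 / of_nat p) (kd y)" using ph_decomp[OF f] .
have ry: "res GG y=y"
proof (rule res_id)
 fix z assume "z:keys y"
 moreover obtain I u where "z=(I, u)" by fastforce
 ultimately show "GG (wt z)" using kl_keys[OF y(2), of I u] by(simp add: wt_def)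
qed
have ry': "res GG y':kl (pp p) (QX m) (Suc (Suc k))" using y(1) unfolding kl_def by(rule res_lat)
have xk: "x:kl (pp p) (QX m) (Suc (Suc k))" using x(1) by(rule kl_mono) simp
have "kd x=kd (res GG y') + sc (1 / of_nat p) (kd y)" unfolding x(2) y(3) res_simps kd_res[symmetric] ry ..
hence "ph (Suc k) f=kd (y' + (x - res GG y'))" unfolding y(3) by(simp add: kd_simps)
moreover have "y' + (x - res GG y'):kl (pp p) (QX m) (Suc (Suc k))"
 using y(1) xk ry' unfolding kl_def by(intro lat_add lat_diff)
ultimately show ?thesis by(intro boundaryI[OF f])
qed

subsection \<open>Cycles of classes in the kernel of reduction\<close>

lemma il_wt: "y:keys (il x I) ==> wt y=add_mset x (mset I)"
proof (induction I arbitrary: y)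
case Nil
thus ?case by(simp add: wt_def)
next
case (Cons z I)
consider "x < z" | "x=z" | "\<not> x < z" "x ~= z" by blast
thus ?case
proof cases
 case 1
 thus ?thesis using Cons.prems by(simp add: wt_def)
next
 case 2
 thus ?thesis using Cons.prems by simp
next
 case 3
 hence "y:keys (cns z (il x I))" using Cons.prems by(simp add: in_keys_iff)
 hence "\<exists>v\<in>keys (il x I). y:keys ((%(J, u). bs (z#J, u)) v)" unfolding cns_def by(rule keys_lext)
 then obtain v where v: "v:keys (il x I)" "y:keys ((%(J, u). bs (z#J, u)) v)" by(rule bexE)
 obtain J u where Ju: "v=(J, u)" by fastforce
 have "y=(z#J, u)" using v(2) by(simp add: Ju)
 thus ?thesis using Cons.IH[OF v(1)] by(simp add: wt_def Ju)
qed
qed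

lemma resc_bs: "res P (bs y)=(if P (wt y) then bs y else 0)" by(simp add: res_def)

lemma res_Ev: "res GG (Ev v z)=Ev (pg v) (res GG z)"
proof (rule linmap_eqI[of "%v. res GG (Ev v z)"])
fix x :: "'a ix"
show "res GG (Ev (bs x) z)=Ev (pg (bs x)) (res GG z)"
proof (rule linmap_eqI[of "%z. res GG (Ev (bs x) z)"])
 fix y :: "'a ix list \<times> 'a ix multiset"
 obtain I u where y: "y=(I, u)" by fastforce
 have e: "res (%w. GG (w + u)) (il x I)=(if GG (add_mset x (mset I) + u) then il x I else 0)"
 proof (cases "GG (add_mset x (mset I) + u)")
  case True
  have r: "res (%w. GG (w + u)) (il x I)=il x I"
  proof (rule res_id)
   fix v assume "v:keys (il x I)"
   from il_wt[OF this] show "GG (wt v + u)" using True by simp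
  qed
  show ?thesis unfolding if_P[OF True] by(rule r)
 next
  case False
  have r: "res (%w. GG (w + u)) (il x I)=0"
  proof (rule res_zero)
   fix v assume "v:keys (il x I)"
   from il_wt[OF this] show "\<not> GG (wt v + u)" using False by simp
  qed
  show ?thesis unfolding if_not_P[OF False] by(rule r)
 qed
 have l: "res GG (Ev (bs x) (bs y))=(if GG (add_mset x (mset I) + u) then Mo u (il x I) else 0)"
  unfolding y Ev_bs Ei_bs res_Mo e by(simp only: if_distrib[of "Mo u"] linmap_0[OF linmap_Mo0])
 have r: "res GG (bs y)=(if GG (mset I + u) then bs y else 0)" unfolding resc_bs by(simp add: y wt_def)
 show "res GG (Ev (bs x) (bs y))=Ev (pg (bs x)) (res GG (bs y))"
 proof (cases x)
  case (Gen s)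
  hence "GG (add_mset x (mset I) + u) \<longleftrightarrow> GG (mset I + u)" by simp
  thus ?thesis unfolding l r using Gen by(simp add: y Ev_simps linmap_0[OF linmap_Ei0])
 next
  case (Rel b)
  hence ng: "\<not> GG (add_mset x (mset I) + u)" using p2 by simp
  show ?thesis unfolding l if_not_P[OF ng] using Rel by(simp add: Ev_simps')
 qed
qed (intro lin)+
qed (intro lin)+

lemma res_lp: "res GG (MP (lp v) z)=MP (lp (pg v)) (res GG z)"
proof (rule linmap_eqI[of "%v. res GG (MP (lp v) z)"])
fix x
show "res GG (MP (lp (bs x)) z)=MP (lp (pg (bs x))) (res GG z)"
proof (cases x)
 case (Gen s)
 thus ?thesis by(simp add: res_Mo)
next
 case (Rel b)
 have "res (%w. GG (w + {#x#})) z=0" by(rule res_zero) (use Rel p2 in simp)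
 thus ?thesis by(simp add: Rel res_Mo lp_simps MP_simps' Mo_simps)
qed
qed (intro lin)+

lemma res_Qe: "res GG (Qe bl (prod_list (map lp ws)))=Qe (map pg bl) (prod_list (map lp (map pg ws)))"
proof (induction bl)
case Nil
have "res GG (MP (prod_list (map lp ws)) (bs ([], {#})))=MP (prod_list (map lp (map pg ws))) (bs ([], {#}))"
 by(induction ws) (simp_all add: MP_mult res_lp resc_bs wt_def)
thus ?case by simp
qed (simp add: res_Ev)

lemma gg_pg: "gg p GG bl ws=gg p GG (map pg bl) (map pg ws)"
proof -
have "chi p GG (kd (Qe bl (prod_list (map lp ws))))=chi p GG (res GG (kd (Qe bl (prod_list (map lp ws)))))"
 by(rule rescale.chi_res[OF resc, symmetric])
also have "... = chi p GG (kd (Qe (map pg bl) (prod_list (map lp (map pg ws)))))"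
 unfolding kd_res[symmetric] res_Qe ..
finally show ?thesis by(simp add: gg_def)
qed

lemma Ff_bet: "i=Suc 0 | i=two ==> length bl=Suc i ==> Ff i (bet i bl ws)=gg p GG (map pg bl) (map pg ws)"
unfolding Ff_def ph_bet gg_pg[symmetric] by(simp add: gg_def chi_simps)

abbreviation "gd i xs == gg p GG (take (Suc i) xs) (drop (Suc i) xs)"

lemma gd_add: "gd i (us@(x + y)#vs)=gd i (us@x#vs) + gd i (us@y#vs)"
proof (cases "length us <= i")
case True
hence "take (Suc i) (us@z#vs)=us@z#take (i - length us) vs" "drop (Suc i) (us@z#vs)=drop (i - length us) vs" for z
 by(simp_all add: Suc_diff_le)
thus ?thesis by(simp add: gg_add_exterior)
next
case False
then obtain q where q: "length us - Suc i=q" "length us >= Suc i" by simp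
hence "take (Suc i) (us@z#vs)=take (Suc i) us" "drop (Suc i) (us@z#vs)=drop (Suc i) us@z#vs" for z by simp_all
thus ?thesis by(simp add: gg_add_symmetric)
qed

lemma gd_sc: "gd i (us@sc (of_nat k) v#vs)=sc (of_nat k) (gd i (us@v#vs))"
proof (induction k)
case 0
show ?case using gd_add[of i us 0 0 vs] by simp
next
case (Suc k)
have "sc (of_nat (Suc k)) v=v + sc (of_nat k) v" by(simp add: sc_add_left)
thus ?case using gd_add[of i us v "sc (of_nat k) v" vs] Suc by(simp add: sc_add_left)
qed

lemma gd_torsion:
assumes xs: "set xs <= vecs (Gen ` S)" "length xs=m" and i: "i < m"
shows "sc (of_nat p) (gd i xs):dRB (p * m) i"
proof (rule multiadditive_vanish[where X = "Gen ` S" and m=m and D = "%xs. sc (of_nat p) (gd i xs)", OF _ _ _ _ _ xs])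
show "0:dRB (p * m) i" by(rule addsubD(1)[OF addsub_dRB])
show "a + b:dRB (p * m) i" if "a:dRB (p * m) i" "b:dRB (p * m) i" for a b by(rule addsubD(4)[OF addsub_dRB that])
show "- a:dRB (p * m) i" if "a:dRB (p * m) i" for a by(rule addsubD(3)[OF addsub_dRB that])
show "sc (of_nat p) (gd i (us@(x + y)#vs)) - sc (of_nat p) (gd i (us@x#vs)) - sc (of_nat p) (gd i (us@y#vs)):dRB (p * m) i"
 for us x y vs unfolding gd_add sc_add using addsubD(1)[OF addsub_dRB] by simp
fix l :: "'a ix list" assume l: "set l <= Gen ` S" "length l=m"
let ?J = "take (Suc i) l" and ?v = "mset (drop (Suc i) l)"
have J: "length ?J=Suc i" using l i by simp
have w: "mset ?J + ?v=mset l" by(metis append_take_drop_id mset_append)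
have "prod_list (map lp (map bs (drop (Suc i) l)))=bs ?v"
 using prod_list_bs[of "%x. {#x#}" "drop (Suc i) l"] by(simp add: comp_def)
hence g: "gd i (map bs l)=sc (- (of_nat p ^ i)) (chi p GG (kd (Qe (map bs ?J) (bs ?v))))"
 using J by(simp add: gg_def take_map drop_map)
have hl: "Qe (map bs ?J) (bs ?v):hl (Suc i) (mset l)"
 using Mo_hl[OF Qe_bs_hl[of ?J], of ?v] unfolding Qe_bs_Mo J w .
have Q: "QX m (mset l)" "GG (mset l)" using l by(auto simp: XX_def)
have "sc (of_nat p ^ Suc i) (Qe (map bs ?J) (bs ?v)):kl (pp p) (QX m) (Suc i)" unfolding kl_def
proof (rule lat_linmap[where F = "sc (of_nat p ^ Suc i)", OF _ hl[unfolded hl_def]])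
 fix y assume "y:keys (Qe (map bs ?J) (bs ?v))"
 obtain I u where y: "y=(I, u)" by fastforce
 assume "(case y of (I, u) => if srt I & length I=Suc i & mset I + u=mset l then 1 else (0 :: rat)) ~= 0"
 hence I: "srt I" "length I=Suc i" "mset I + u=mset l" by(auto simp: y split: if_splits)
 have "\<forall>x\<in>#mset I. pp p x=int p" using Q(2) unfolding I(3)[symmetric] by simp
 hence "image_mset (pp p) (mset I)=image_mset (%_. int p) (mset I)" by(intro image_mset_cong) simp
 hence pm: "prod_mset (image_mset (pp p) (mset I))=int p ^ Suc i" using I(2) by(simp add: prod_mset_constant)
 have QI: "QX m (mset I + u)" using Q(1) unfolding I(3) .
 have "sc (of_nat p ^ Suc i) (bs (I, u)) \<in>
   lat (%(I, u). if srt I & length I=Suc i & QX m (mset I + u) then rat_of_int (prod_mset (image_mset (pp p) (mset I))) else 0)"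
  by(rule lat_basis'[where k=1]) (use I(1,2) QI pm in simp)
 thus "sc (case y of (I, u) => if srt I & length I=Suc i & mset I + u=mset l then 1 else 0) (sc (of_nat p ^ Suc i) (bs y)) \<in>
   lat (%(I, u). if srt I & length I=Suc i & QX m (mset I + u) then rat_of_int (prod_mset (image_mset (pp p) (mset I))) else 0)"
  using I by(simp add: y)
qed (rule lin, rule lin)
hence "chi p GG (sc (of_nat p ^ Suc i) (Qe (map bs ?J) (bs ?v))):dR (Gen ` S) (p * m) (Suc i)"
 by(rule rescale.chi_gl[OF resc])
moreover have "sc (of_nat p) (gd i (map bs l))=kd (- chi p GG (sc (of_nat p ^ Suc i) (Qe (map bs ?J) (bs ?v))))"
 unfolding g chi_kd[symmetric] kd_simps chi_simps by(simp add: sc_minus1 sc_uminus)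
ultimately show "sc (of_nat p) (gd i (map bs l)):dRB (p * m) i" by(simp only:) (intro imageI gl_uminus)
qed

lemma gd_cong:
assumes "length xs=length ys" "length us + length ys=m" "i < m"
 and "set us <= vecs (Gen ` S)" "set ys <= vecs (Gen ` S)"
 and "!!k. k < length ys ==> \<exists>v\<in>vecs (Gen ` S). xs ! k - ys ! k=sc (of_nat p) v"
shows "gd i (us@xs) - gd i (us@ys):dRB (p * m) i" using assms
proof (induction xs ys arbitrary: us rule: list_induct2)
case Nil
thus ?case using addsubD(1)[OF addsub_dRB] by simp
next
case (Cons x xs y ys)
obtain v where v: "v:vecs (Gen ` S)" "x - y=sc (of_nat p) v" using Cons.prems(5)[of 0] by auto
have sc: "sc (of_nat p) v:vecs (Gen ` S)" using v(1) lat_sc_int[of v _ "int p"] unfolding vecs_def by simp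
have xy: "x=y + sc (of_nat p) v" using v(2) by(simp add: algebra_simps)
have xsv: "set xs <= vecs (Gen ` S)"
proof
 fix z assume "z:set xs"
 then obtain k where k: "k < length xs" "z=xs ! k" by(metis in_set_conv_nth)
 obtain v' where v': "v':vecs (Gen ` S)" "xs ! k - ys ! k=sc (of_nat p) v'"
  using Cons.prems(5)[of "Suc k"] k Cons.hyps by auto
 have "ys ! k:vecs (Gen ` S)" using Cons.prems(4) Cons.hyps k by auto
 moreover have "sc (of_nat p) v':vecs (Gen ` S)" using v'(1) lat_sc_int[of v' _ "int p"] unfolding vecs_def by simp
 moreover have "z=ys ! k + sc (of_nat p) v'" using v'(2) k by(simp add: algebra_simps)
 ultimately show "z:vecs (Gen ` S)" by(simp add: vecs_add)
qed
have "gd i (us@x#xs) - gd i (us@y#xs)=sc (of_nat p) (gd i (us@v#xs))" unfolding xy gd_add gd_sc by simp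
also have "... : dRB (p * m) i" by(rule gd_torsion) (use Cons.prems Cons.hyps v(1) xsv in auto)
finally have 1: "gd i (us@x#xs) - gd i (us@y#xs):dRB (p * m) i" .
have 2: "gd i ((us@[y])@xs) - gd i ((us@[y])@ys):dRB (p * m) i"
proof (rule Cons.IH)
 show "\<exists>v\<in>vecs (Gen ` S). xs ! k - ys ! k=sc (of_nat p) v" if "k < length ys" for k
  using Cons.prems(5)[of "Suc k"] that by simp
qed (use Cons.prems in auto)
from addsubD(4)[OF addsub_dRB 1 2] show ?case by simp
qed

end

section \<open>The comparison theorem\<close>

context modp
begin

lemma gg_value:
assumes xs: "xs:words A m" and i: "0 < i" "i < m" "p * m <= 7"
shows "ff p (map cw (take (Suc i) xs)) (map cw (drop (Suc i) xs)) -
 Ff i (bet i (map l0 (map rd (take (Suc i) xs))) (map l0 (map rd (drop (Suc i) xs)))):dRB (p * m) i"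
proof -
have len: "length xs=m" and xA: "set xs <= carrier A" using xs by(auto simp: words_def)
have m3: "m <= 3" and p3: "p <= 3"
proof -
 have "2 * m <= p * m" using p2 by simp
 thus "m <= 3" using i by linarith
 have "p * 2 <= p * m" using i by simp
 thus "p <= 3" using i by linarith
qed
have i2: "i=Suc 0 | i=two" using i m3 by linarith
have p23: "p=2 | p=3" using p2 p3 by linarith
let ?v = "%x. pg (l0 (rd x))"
have v: "?v x=cw (lf (rd x))" "lf (rd x):carrier A" "rd (lf (rd x))=rd x" if "x:carrier A" for x
 using pg_l0[OF rd_in[OF that]] lf[OF rd_in[OF that]] by auto
have "Ff i (bet i (map l0 (map rd (take (Suc i) xs))) (map l0 (map rd (drop (Suc i) xs)))) =
  gg p GG (map pg (map l0 (map rd (take (Suc i) xs)))) (map pg (map l0 (map rd (drop (Suc i) xs))))"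
 by(rule Ff_bet[OF i2]) (use len i in simp)
also have "... = gd i (map ?v xs)" by(simp add: take_map drop_map comp_def)
finally have 1: "Ff i (bet i (map l0 (map rd (take (Suc i) xs))) (map l0 (map rd (drop (Suc i) xs))))=gd i (map ?v xs)" .
have 2: "ff p (take (Suc i) (map cw xs)) (drop (Suc i) (map cw xs)) - gd i (map cw xs):dRB (p * m) i"
 by(rule ff_gg[OF prime p23 cv_list_vecs[OF xA]]) (use len i in auto)
have 3: "gd i ([]@map cw xs) - gd i ([]@map ?v xs):dRB (p * m) i"
proof (rule gd_cong)
 show "set (map ?v xs) <= vecs (Gen ` S)" using v xA cv_vecs by auto
 fix k assume "k < length (map ?v xs)"
 hence k: "k < length xs" "xs ! k:carrier A" using xA by auto
 have "rd (xs ! k)=rd (lf (rd (xs ! k)))" using v(3)[OF k(2)] by simp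
 then obtain w where "w:vecs (Gen ` S)" "cw (xs ! k) - cw (lf (rd (xs ! k)))=sc (of_nat p) w"
  using rd_eq_iff[OF k(2) v(2)[OF k(2)]] by blast
 thus "\<exists>w\<in>vecs (Gen ` S). map cw xs ! k - map ?v xs ! k=sc (of_nat p) w"
  using k v(1)[OF k(2)] by auto
qed (use len i in auto)
from addsubD(4)[OF addsub_dRB 2 3] show ?thesis unfolding 1 by(simp add: take_map drop_map)
qed

lemma bet_LZ:
assumes i: "i=Suc 0 | i=two" and b: "set bl <= carrier Bp" "length bl=Suc i" and w: "set ws <= carrier Bp"
shows "LZ (Suc i + length ws) i (bet i (map l0 bl) (map l0 ws))" unfolding LZ_def moore_def
using beta_cycle_emb(2)[OF b w] bet_faces[OF i, of "map l0 bl" _ "map l0 ws"] b(2) by auto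

definition TT :: "nat => nat => _" where
"TT m i = {beta Bp (int p) (map rd (take (Suc i) xs)) (map rd (drop (Suc i) xs)) | xs. xs:words A m}"

lemma beta_word:
assumes i: "i=Suc 0 | i=two" "i < m" and xs: "xs:words A m"
shows "beta Bp (int p) (map rd (take (Suc i) xs)) (map rd (drop (Suc i) xs)) =
  Lcls m i (bet i (map l0 (map rd (take (Suc i) xs))) (map l0 (map rd (drop (Suc i) xs))))"
 "LZ m i (bet i (map l0 (map rd (take (Suc i) xs))) (map l0 (map rd (drop (Suc i) xs))))"
proof -
have len: "length xs=m" and xA: "set xs <= carrier A" using xs by(auto simp: words_def)
have 1: "set (map rd (take (Suc i) xs)) <= carrier Bp" "set (map rd (drop (Suc i) xs)) <= carrier Bp"
 using xA rd_in by(auto dest!: in_set_takeD in_set_dropD)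
have 2: "length (map rd (take (Suc i) xs))=Suc i" "Suc i + length (map rd (drop (Suc i) xs))=m" using len i(2) by auto
show "beta Bp (int p) (map rd (take (Suc i) xs)) (map rd (drop (Suc i) xs)) =
  Lcls m i (bet i (map l0 (map rd (take (Suc i) xs))) (map l0 (map rd (drop (Suc i) xs))))"
 using beta_cycle_emb(1)[OF 1(1) 2(1) 1(2)] unfolding 2(2) .
show "LZ m i (bet i (map l0 (map rd (take (Suc i) xs))) (map l0 (map rd (drop (Suc i) xs))))"
 using bet_LZ[OF i(1) 1(1) 2(1) 1(2)] unfolding 2(2) .
qed

lemma beta_span:
assumes i: "i=Suc 0 | i=two" "i < m" and K: "subgroup K (L_SP i m Bp)" "TT m i <= K"
 and y: "y:kl (pp p) (%w. QX m w & GG w) (Suc i)"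
obtains f where "LZ m i f" "Lcls m i f:K" "ph i f=sc (1 / of_nat p) (kd y)"
proof -
obtain k where k: "i=Suc k" using i(1) by blast
let ?Z = "{f:LZs m i. Lcls m i f:K}"
let ?F = "%y. sc (1 / of_nat p) (kd y)"
have Z: "addsub ?Z" using qpres_subgroup_addsub[OF L_qpres[of k m]] K(1) unfolding k by blast
have PH: "addsub (ph i ` ?Z)" by(rule addsub_image[OF linmap_ph0 Z])
let ?c = "%(I, u). if srt I & length I=Suc i & QX m (mset I + u) & GG (mset I + u)
              then of_int (prod_mset (image_mset (pp p) (mset I))) else (0 :: rat)"
have yl: "y:lat ?c" using y unfolding kl_def .
obtain c :: "_ => int" where c: "y=(\<Sum>j\<in>keys y. sc (of_int (c j)) (sc (?c j) (bs j)))"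
 using lat_decomp[OF yl] .
have gen: "?F (sc (?c j) (bs j)):ph i ` ?Z" if j: "j:keys y" for j
proof -
 obtain I u where Iu: "j=(I, u)" by fastforce
 have I: "srt I" "length I=Suc i" "QX m (mset I + u)" "GG (mset I + u)"
  using kl_keys[OF y j[unfolded Iu]] by blast+
 have "image_mset (pp p) (mset I)=image_mset (%_. int p) (mset I)" using I(4) by(intro image_mset_cong) simp
 hence cj: "?c j = of_nat p ^ Suc i" using I by(simp add: Iu prod_mset_constant)
 obtain us where us: "mset us=u" using ex_mset by blast
 let ?L = "I@us"
 have lenL: "length ?L=m"
 proof -
  have "size (mset ?L)=m" using I(3) us by simp
  thus ?thesis by(simp only: size_mset)
 qed
 have L: "x:Gen ` S" if "x:set ?L" for x
 proof -
  have "x \<in># mset I + u" using that us by auto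
  hence "x:XX" "x:range Gen" using I(3,4) pp_Gen by blast+
  thus ?thesis by(auto simp: XX_def)
 qed
 define un where "un=(%x :: 'a ix. case x of Gen s => s | Rel b => undefined)"
 have un: "un x:S" "l0 (rd (un x))=bs x" if "x:set ?L" for x using L[OF that] by(auto simp: un_def l0_red)
 let ?xs = "map un ?L"
 have xs: "?xs:words A m" using un(1) S lenL by(auto simp: words_def)
 have t: "take (Suc i) ?xs=map un I" "drop (Suc i) ?xs=map un us" using I(2) by simp_all
 have b: "map l0 (map rd (map un I))=map bs I" "map l0 (map rd (map un us))=map bs us" using un(2) by auto
 note bw=beta_word[OF i xs, unfolded t b]
 have "beta Bp (int p) (map rd (map un I)) (map rd (map un us)):TT m i" unfolding TT_def using xs t by force
 hence "Lcls m i (bet i (map bs I) (map bs us)):K" using K(2) bw(1) by auto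
 hence "ph i (bet i (map bs I) (map bs us)):ph i ` ?Z" using bw(2) by blast
 moreover have "ph i (bet i (map bs I) (map bs us))=sc (- (of_nat p ^ i)) (kd (bs (I, u)))"
 proof -
  have "prod_list (map lp (map bs us))=bs u" using prod_list_bs[of "%x. {#x#}" us] us by(simp add: comp_def)
  moreover have "Qe (map bs I) (bs u)=bs (I, u)" unfolding Qe_bs_Mo Qe_bs_srt[OF I(1)] by simp
  ultimately show ?thesis using ph_bet[OF i(1), of "map bs I" "map bs us"] I(2) by simp
 qed
 ultimately have "sc (- (of_nat p ^ i)) (kd (bs (I, u))):ph i ` ?Z" by(simp only:)
 from addsubD(3)[OF PH this] have "sc (of_nat p ^ i) (kd (bs (I, u))):ph i ` ?Z" by(simp only: sc_minus1 minus_minus)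
 moreover have "?F (sc (?c j) (bs j))=sc (of_nat p ^ i) (kd (bs (I, u)))"
  unfolding cj unfolding Iu kd_simps using p2 by simp
 ultimately show ?thesis by(simp only:)
qed
have F: "linmap ?F" by(intro lin)
have "?F y = ?F (\<Sum>j\<in>keys y. sc (of_int (c j)) (sc (?c j) (bs j)))" by(rule arg_cong[OF c])
also have "... = (\<Sum>j\<in>keys y. sc (of_int (c j)) (?F (sc (?c j) (bs j))))"
 by(simp only: linmap_sum[OF F] linmap_sc[OF F])
also have "... : ph i ` ?Z" by(intro addsub_sum[OF PH] addsub_sc_int[OF PH] gen)
finally obtain f where "f:?Z" "?F y=ph i f" by blast
thus ?thesis by(intro that[of f]) auto
qed

lemma TT_sub: "i=Suc 0 | i=two ==> i < m ==> TT m i <= carrier (L_SP i m Bp)"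
proof
fix x assume i: "i=Suc 0 | i=two" "i < m" and "x:TT m i"
then obtain xs where xs: "xs:words A m" "x=beta Bp (int p) (map rd (take (Suc i) xs)) (map rd (drop (Suc i) xs))"
 unfolding TT_def by blast
obtain k where k: "i=Suc k" using i(1) by blast
show "x:carrier (L_SP i m Bp)"
 unfolding xs(2) beta_word(1)[OF i xs(1)] using qpres_in[OF L_qpres[of k m]] beta_word(2)[OF i xs(1)] unfolding k by simp
qed

lemma L_generate:
assumes i: "i=Suc 0 | i=two" "i < m"
shows "generate (L_SP i m Bp) (TT m i)=carrier (L_SP i m Bp)"
proof
obtain k where k: "i=Suc k" using i(1) by blast
note Q=L_qpres[of k m, folded k]
interpret L: comm_group "L_SP i m Bp" by(rule qpres_comm[OF Q])
let ?K = "generate (L_SP i m Bp) (TT m i)"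
show "?K <= carrier (L_SP i m Bp)" by(rule L.generate_incl[OF TT_sub[OF i]])
have K: "subgroup ?K (L_SP i m Bp)" "TT m i <= ?K"
 by(rule L.generate_is_subgroup[OF TT_sub[OF i]], rule subsetI, rule generate.incl)
show "carrier (L_SP i m Bp) <= ?K"
proof
 fix x assume x: "x:carrier (L_SP i m Bp)"
 obtain f where f': "f:LZs m i" "x=Lcls m i f" using qpres_obtain[OF Q x] .
 have f: "LZ m i f" "x=Lcls m i f" using f' by simp_all
 obtain y' y where y: "y':kl (pp p) (QX m) (Suc i)" "y:kl (pp p) (%w. QX m w & GG w) (Suc i)"
  "ph i f=kd y' + sc (1 / of_nat p) (kd y)" by(rule ph_decomp[of m k f, folded k, OF f(1)])
 obtain g where g: "LZ m i g" "Lcls m i g:?K" "ph i g=sc (1 / of_nat p) (kd y)" by(rule beta_span[OF i K y(2)])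
 have d: "LZ m i (f - g)" using addsubD(2)[OF addsub_LZ, of f m i g] f(1) g(1) by simp
 have "ph i (f - g)=kd y'" using y(3) g(3) by(simp add: linmap_diff[OF linmap_ph0])
 hence "f - g:LBs m i" by(rule boundaryI[of m k "f - g", folded k, OF d y(1)])
 hence "Lcls m i f=Lcls m i g" using qpres_eq[OF Q, of f g] f(1) g(1) by simp
 thus "x:?K" using f(2) g(2) by simp
qed
qed

text \<open>The homomorphism is determined by its values on beta classes, which generate; the map given in
 coordinates has the same values.\<close>

lemma f_component_eq:
assumes i: "0 < i" "p * m <= 7" and f: "LZ m i f"
shows "f_component A (p * m) p i (Lcls m i f)=dRcls (p * m) i (Ff i f)"
proof -
obtain k where k: "i=Suc k" using i(1) by(cases i) auto
note Q=L_qpres[of k m, folded k] and R=dR_qpres[OF i(1), of "p * m"]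
have F: "Ff i (z - w)=Ff i z - Ff i w" "z:LZs m i ==> Ff i z:dRZ (p * m) i" "z:LBs m i ==> Ff i z:dRB (p * m) i" for z w
 using linmap_diff[OF linmap_Ff, of i z w] Ff_cycle[of m k z] Ff_boundary[where f=z and m=m and k=k] unfolding k by auto
have div: "p * m div p=m" using p2 by simp
have fin: "Lcls m i f:carrier (L_SP i m Bp)" using qpres_in[OF Q] f by simp
show ?thesis
proof (cases "i < m")
 case True
 have m3: "m <= 3"
 proof -
  have "2 * m <= p * m" using p2 by simp
  thus "m <= 3" using i by linarith
 qed
 have i2: "i=Suc 0 | i=two" using i(1) True m3 by linarith
 define q where "q=qmap (Lcls m i) (LZs m i) (dRcls (p * m) i) (Ff i)"
 have qh: "q:hom (L_SP i m Bp) (dR_homology A (p * m) i)" unfolding q_def by(rule qmap_hom[OF Q R F])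
 have qc: "q (Lcls m i g)=dRcls (p * m) i (Ff i g)" if "LZ m i g" for g
  unfolding q_def by(rule qmap_cls[OF Q R F]) (use that in simp_all)
 let ?VV = "{(beta Bp (int p) (map rd (take (Suc i) xs)) (map rd (drop (Suc i) xs)),
     homology_class (dR_group A (p * m)) (dR_diff A (p * m)) i (f_cycle A (p * m) p i xs)) | xs. xs:words A m}"
 have fst: "fst ` ?VV=TT m i" unfolding TT_def by force
 have "hom_with_values (L_SP i m Bp) (dR_homology A (p * m) i) ?VV=restrict q (carrier (L_SP i m Bp))"
 proof (rule hom_with_values_eq)
  show "group (L_SP i m Bp)" "group (dR_homology A (p * m) i)" using qpres_comm[OF Q] qpres_comm[OF R] by(simp_all add: comm_group.axioms(2))
  show "q:hom (L_SP i m Bp) (dR_homology A (p * m) i)" by(rule qh)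
  show "fst ` ?VV <= carrier (L_SP i m Bp)" unfolding fst by(rule TT_sub[OF i2 True])
  show "generate (L_SP i m Bp) (fst ` ?VV)=carrier (L_SP i m Bp)" unfolding fst by(rule L_generate[OF i2 True])
  fix x y assume "(x, y):?VV"
  then obtain xs where xs: "xs:words A m" and x: "x=beta Bp (int p) (map rd (take (Suc i) xs)) (map rd (drop (Suc i) xs))"
   and y: "y=homology_class (dR_group A (p * m)) (dR_diff A (p * m)) i (f_cycle A (p * m) p i xs)" by blast
  let ?b = "bet i (map l0 (map rd (take (Suc i) xs))) (map l0 (map rd (drop (Suc i) xs)))"
  let ?f = "ff p (map cw (take (Suc i) xs)) (map cw (drop (Suc i) xs))"
  have p0: "p > 0" using p2 by simp
  note bw=beta_word[OF i2 True xs]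
  note fc=f_cycle_emb[OF p0 refl True xs]
  have fZ: "?f:dRZ (p * m) i" using dR_emb_in[OF fc(1)] unfolding fc(2) by(simp add: kd_ff)
  have bZ: "Ff i ?b:dRZ (p * m) i" using F(2) bw(2) by simp
  have "dRcls (p * m) i ?f=dRcls (p * m) i (Ff i ?b)"
   unfolding qpres_eq[OF R fZ bZ] by(rule gg_value[OF xs i(1) True i(2)])
  thus "q x=y" unfolding x y bw(1) qc[OF bw(2)] dR_homology_class[OF fc(1)] fc(2) ..
 qed
 hence "f_component A (p * m) p i=restrict q (carrier (L_SP i m Bp))"
  using True unfolding f_component_def div by simp
 thus ?thesis using fin qc[OF f] by simp
next
 case False
 hence "f_component A (p * m) p i (Lcls m i f) = \<one>\<^bsub>dR_homology A (p * m) i\<^esub>"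
  using fin unfolding f_component_def div by simp
 also have "... = dRcls (p * m) i 0" by(rule qpres_one[OF R])
 also have "... = dRcls (p * m) i (Ff i f)"
 proof -
  have "f:LBs m i" using LZ_trivial[of m k f] f False unfolding k by simp
  hence "Ff i f:dRB (p * m) i" by(rule F(3))
  hence "dRcls (p * m) i (Ff i f)=dRcls (p * m) i 0"
   using qpres_eq[OF R F(2)[of f] addsubD(1)[OF addsub_dRZ]] f by simp
  thus ?thesis ..
 qed
 finally show ?thesis .
qed
qed

lemma Ff_surjective:
fixes Y :: "'a ix kos"
assumes i: "0 < i" "p * m <= 7"
 and Y: "Y:gl (%w. deg (Gen ` S) (p * m) w & (\<exists>w'. w=repeat_mset p w')) (Suc i)"
shows "\<exists>f\<in>LZs m i. Ff i f=sc (1 / of_nat p) (kd Y)"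
proof -
obtain k where k: "i=Suc k" using i(1) by(cases i) auto
note Q=L_qpres[of k m, folded k]
have m3: "m <= 3"
proof -
 have "2 * m <= p * m" using p2 by simp
 thus "m <= 3" using i by linarith
qed
have Y': "Y:gl (%v. \<exists>w. v=repeat_mset p w & QX m w & GG w) (Suc i)"
proof (rule gl_mono[OF Y])
 fix v :: "'a ix multiset" assume "deg (Gen ` S) (p * m) v & (\<exists>w'. v=repeat_mset p w')"
 then obtain w :: "'a ix multiset" where w: "v=repeat_mset p w" "size v=p * m" "set_mset v <= Gen ` S" by blast
 have "size w=m" using w(1,2) p2 by simp
 moreover have "set_mset w <= Gen ` S" using w(1,3) p2 by(simp add: set_mset_repeat_mset split: if_splits)
 hence "set_mset w <= XX" "GG w" by(auto simp: XX_def)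
 ultimately show "\<exists>w. v=repeat_mset p w & QX m w & GG w" using w(1) by blast
qed
have c: "\<forall>x\<in>set_mset w - set I. count w x=1" if "QX m w" "distinct I" "length I=Suc i" "mset I <=# w" for w I
 by(rule small_cond[OF m3 that(1-3) i(1) that(4)])
obtain z where z: "z:kl (pp p) (%w. QX m w & GG w) (Suc i)" "chi p GG z=Y"
 by(rule rescale.chi_surj[OF resc Y' c])
show ?thesis
proof (cases "i < m")
 case True
 have i2: "i=Suc 0 | i=two" using i(1) True m3 by linarith
 interpret L: comm_group "L_SP i m Bp" by(rule qpres_comm[OF Q])
 obtain f where f: "LZ m i f" "ph i f=sc (1 / of_nat p) (kd z)"
  by(rule beta_span[OF i2 True L.subgroup_self TT_sub[OF i2 True] z(1)])
 have "Ff i f=sc (1 / of_nat p) (kd Y)" unfolding Ff_def f(2) chi_simps chi_kd z(2) ..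
 thus ?thesis using f(1) by blast
next
 case False
 have "z=0"
 proof (rule ccontr)
  assume "z ~= 0"
  then obtain y where "y:keys z" by(metis keys_eq_empty ex_in_conv)
  moreover obtain I u where "y=(I, u)" by fastforce
  ultimately have "length I=Suc i" "size (mset I + u)=m" using kl_keys[OF z(1), of I u] by auto
  thus False using False by simp
 qed
 hence "Y=0" using z(2) by(simp add: linmap_0[OF linmap_chi0])
 hence "Ff i 0=sc (1 / of_nat p) (kd Y)" by(simp add: linmap_0[OF linmap_Ff] kd_simps)
 moreover have "0:LZs m i" by(rule addsubD(1)[OF addsub_LZ])
 ultimately show ?thesis by blast
qed
qed

lemma component_summary:
assumes i: "0 < i" "p * m <= 7"
shows "\<exists>cl Z B (F :: ((nat \<times> 'a ix) multiset \<Rightarrow>\<^sub>0 rat) => 'a ix kos). qpres (L_SP i m Bp) cl Z B & linmap F &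
 (\<forall>z\<in>Z. F z:dRZ (p * m) i & sc (of_nat p) (F z):dRB (p * m) i & (F z:dRB (p * m) i --> z:B) &
  f_component A (p * m) p i (cl z)=dRcls (p * m) i (F z)) &
 (\<forall>Y\<in>gl (%w. deg (Gen ` S) (p * m) w & (\<exists>w'. w=repeat_mset p w')) (Suc i). \<exists>z\<in>Z. F z=sc (1 / of_nat p) (kd Y))"
proof -
obtain k where k: "i=Suc k" using i(1) by(cases i) auto
have m3: "m <= 3"
proof -
 have "2 * m <= p * m" using p2 by simp
 thus "m <= 3" using i by linarith
qed
have 1: "Ff i z:dRZ (p * m) i & sc (of_nat p) (Ff i z):dRB (p * m) i & (Ff i z:dRB (p * m) i --> z:LBs m i) &
  f_component A (p * m) p i (Lcls m i z)=dRcls (p * m) i (Ff i z)" if z: "z:LZs m i" for z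
proof -
 have z': "LZ m (Suc k) z" using z k by simp
 have "sc (of_nat p) (Ff i z)=Ff i (sc (of_nat p) z)" by(rule linmap_sc[OF linmap_Ff, symmetric])
 thus ?thesis
  using Ff_cycle[OF z'] Ff_boundary[OF LZ_torsion[OF z']] Ff_injective[OF z' m3] f_component_eq[OF i, of z] z
  unfolding k by simp
qed
have 2: "qpres (L_SP i m Bp) (Lcls m i) (LZs m i) (LBs m i)" unfolding k by(rule L_qpres)
have 3: "\<forall>Y\<in>gl (%w. deg (Gen ` S) (p * m) w & (\<exists>w'. w=repeat_mset p w')) (Suc i).
  \<exists>f\<in>LZs m i. Ff i f=sc (1 / of_nat p) (kd Y)" by(rule ballI) (rule Ff_surjective[OF i])
show ?thesis
 apply (rule exI[of _ "Lcls m i"])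
 apply (rule exI[of _ "LZs m i"])
 apply (rule exI[of _ "LBs m i"])
 apply (rule exI[of _ "Ff i"])
 apply (rule conjI[OF 2 conjI[OF linmap_Ff conjI[OF _ 3]]])
 apply (rule ballI)
 apply (rule 1)
 apply assumption
 done
qed

end

text \<open>Multiplication by the product of the other primes kills all summands but one. That summand is also
 killed by its own prime, and the two multipliers are coprime.\<close>

lemma coprime_torsion:
assumes B: "addsub B" and P: "finite P" "!!p. p:P ==> prime (p :: nat)"
 and t: "!!p. p:P ==> sc (of_nat p) (z p):B" and s: "(\<Sum>p\<in>P. z p):B" and q: "q:P"
shows "z q:B"
proof -
define N where "N = \<Prod>(P - {q})"
have "coprime p q" if "p:P - {q}" for p using primes_coprime[OF P(2) P(2)] q that by blast
hence "coprime N q" unfolding N_def by(intro prod_coprime_left) auto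
hence "coprime (int N) (int q)" by simp
then obtain a b where ab: "a * int N + b * int q=1" using bezout_int[of "int N" "int q"] by auto
have div: "sc (of_nat N) (z p):B" if p: "p:P - {q}" for p
proof -
 have "p dvd N" unfolding N_def using p P(1) by(intro dvd_prodI) auto
 then obtain r where r: "N=p * r" by blast
 have "sc (of_int (int r)) (sc (of_nat p) (z p)):B" by(rule addsub_sc_int[OF B t]) (use p in simp)
 thus ?thesis by(simp add: r mult.commute)
qed
have "sc (of_nat N) (\<Sum>p\<in>P. z p)=sc (of_nat N) (z q) + (\<Sum>p\<in>P - {q}. sc (of_nat N) (z p))"
 by(simp only: sum.remove[OF P(1) q] sc_add sc_sum)
moreover have "sc (of_int (int N)) (\<Sum>p\<in>P. z p):B" by(rule addsub_sc_int[OF B s])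
moreover have "(\<Sum>p\<in>P - {q}. sc (of_nat N) (z p)):B" by(rule addsub_sum[OF B div])
ultimately have Nq: "sc (of_nat N) (z q):B" using addsubD(2)[OF B] by(metis add_diff_cancel_right' of_int_of_nat_eq)
have "sc (of_int a) (sc (of_nat N) (z q)) + sc (of_int b) (sc (of_nat q) (z q)):B"
 by(intro addsubD(4)[OF B] addsub_sc_int[OF B] Nq t q)
moreover have "sc (of_int a) (sc (of_nat N) (z q)) + sc (of_int b) (sc (of_nat q) (z q))=z q"
proof -
 have "rat_of_int a * of_nat N + of_int b * of_nat q=1" using arg_cong[OF ab, of rat_of_int] by simp
 thus ?thesis by(simp flip: sc_add_left)
qed
ultimately show ?thesis by simp
qed

lemma qpres_finprod:
assumes Q: "qpres Q cls Z B" and P: "finite P" "!!p. p:P ==> z p:Z"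
shows "(\<Otimes>\<^bsub>Q\<^esub>p\<in>P. cls (z p))=cls (\<Sum>p\<in>P. z p) & (\<Sum>p\<in>P. z p):Z" using P
proof (induction P)
case empty
interpret comm_group Q by(rule qpres_comm[OF Q])
show ?case using qpres_one[OF Q] addsubD(1)[OF qpres_addsub[OF Q]] by simp
next
case (insert p P)
interpret comm_group Q by(rule qpres_comm[OF Q])
have "(\<Otimes>\<^bsub>Q\<^esub>p\<in>insert p P. cls (z p))=cls (z p) \<otimes>\<^bsub>Q\<^esub> (\<Otimes>\<^bsub>Q\<^esub>p\<in>P. cls (z p))"
 using insert qpres_in[OF Q] by(intro finprod_insert) auto
thus ?case using insert qpres_mult[OF Q] addsubD(4)[OF qpres_addsub[OF Q]] by simp
qed

context freegroup
begin

lemma f_map_iso: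
assumes i: "0 < i" and n: "1 <= n" "n <= 7"
shows "f_map A n i:iso (f_source A n i) (dR_homology A n i)"
proof -
let ?P = "{p. prime p & p dvd n}"
let ?L = "%p. L_SP i (n div p) (mod_p A p)"
let ?H = "dR_homology A n i"
have P: "finite ?P" using n by(intro finite_subset[OF _ finite_divisors_nat[of n]]) auto
note R=dR_qpres[OF i, of n]
interpret H: comm_group ?H by(rule qpres_comm[OF R])
define Ph where "Ph=(%p cl Z B (F :: ((nat \<times> 'a ix) multiset \<Rightarrow>\<^sub>0 rat) => 'a ix kos). qpres (?L p) cl Z B & linmap F &
 (\<forall>z\<in>Z. F z:dRZ n i & sc (of_nat p) (F z):dRB n i & (F z:dRB n i --> z:B) &
  f_component A n p i (cl z)=dRcls n i (F z)) &
 (\<forall>Y\<in>gl (%w. deg (Gen ` S) n w & (\<exists>w'. w=repeat_mset p w')) (Suc i).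
  \<exists>z\<in>Z. F z=sc (1 / of_nat p) (kd (Y :: 'a ix kos))))"
have ex: "\<exists>cl Z B (F :: ((nat \<times> 'a ix) multiset \<Rightarrow>\<^sub>0 rat) => 'a ix kos). Ph p cl Z B F" if p: "p:?P" for p
proof -
 interpret modp A S p by(rule modp.intro[OF freegroup_axioms]) (use p in "simp add: modp_axioms_def")
 have e: "p * (n div p)=n" using p by simp
 show ?thesis unfolding Ph_def by(rule component_summary[OF i, of "n div p", unfolded e, OF n(2)])
qed
obtain cl Z B and F :: "nat => ((nat \<times> 'a ix) multiset \<Rightarrow>\<^sub>0 rat) => 'a ix kos" where X: "!!p. p:?P ==> Ph p (cl p) (Z p) (B p) (F p)"
 using ex by metis
note X'=X[unfolded Ph_def]
note Q=X'[THEN conjunct1] and F=X'[THEN conjunct2, THEN conjunct1]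
note Xz=X'[THEN conjunct2, THEN conjunct2, THEN conjunct1, THEN bspec]
note FZ=Xz[THEN conjunct1] and Ft=Xz[THEN conjunct2, THEN conjunct1]
 and FB=Xz[THEN conjunct2, THEN conjunct2, THEN conjunct1, THEN mp]
 and fc=Xz[THEN conjunct2, THEN conjunct2, THEN conjunct2]
note Fs=X'[THEN conjunct2, THEN conjunct2, THEN conjunct2, THEN bspec]
have carr: "carrier (f_source A n i)=(\<Pi>\<^sub>E p\<in>?P. carrier (?L p))"
proof -
 have "carrier (f_source A n i) = {x : \<Pi>\<^sub>E p\<in>?P. carrier (?L p). finite {p:?P. x p ~= \<one>\<^bsub>?L p\<^esub>}}"
  unfolding f_source_def by(rule carrier_sum_group) (rule comm_group.axioms(2)[OF qpres_comm[OF Q]])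
 also have "... = (\<Pi>\<^sub>E p\<in>?P. carrier (?L p))"
 proof (intro equalityI subsetI CollectI conjI)
  fix x
  show "finite {p:?P. x p ~= \<one>\<^bsub>?L p\<^esub>}" by(rule finite_subset[OF _ P]) (rule Collect_restrict)
 qed (erule CollectE, erule conjunct1)
 finally show ?thesis .
qed
have mk: "(\<lambda>p\<in>?P. cl p (z p)):carrier (f_source A n i)" if "\<forall>p\<in>?P. z p:Z p" for z
 unfolding carr using qpres_in[OF Q] that by(intro restrict_PiE_iff[THEN iffD2]) blast
have val: "f_map A n i (\<lambda>p\<in>?P. cl p (z p))=dRcls n i (\<Sum>p\<in>?P. F p (z p))"
 and valZ: "(\<Sum>p\<in>?P. F p (z p)):dRZ n i" if z: "\<forall>p\<in>?P. z p:Z p" for z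
proof -
 have fz: "F p (z p):dRZ n i" if "p:?P" for p by(rule FZ[OF that bspec[OF z that]])
 have fp: "(\<Otimes>\<^bsub>?H\<^esub>p\<in>?P. dRcls n i (F p (z p)))=dRcls n i (\<Sum>p\<in>?P. F p (z p)) & (\<Sum>p\<in>?P. F p (z p)):dRZ n i"
  by(rule qpres_finprod[OF R P fz])
 have "f_map A n i (\<lambda>p\<in>?P. cl p (z p))=(\<Otimes>\<^bsub>?H\<^esub>p\<in>?P. f_component A n p i ((\<lambda>p\<in>?P. cl p (z p)) p))"
  unfolding f_map_def using mk[OF z] by simp
 also have "... = (\<Otimes>\<^bsub>?H\<^esub>p\<in>?P. dRcls n i (F p (z p)))"
 proof (rule H.finprod_cong')
  show "(%p. dRcls n i (F p (z p))):?P \<rightarrow> carrier ?H" using qpres_in[OF R fz] by blast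
  fix p assume p: "p:?P"
  thus "f_component A n p i ((\<lambda>p\<in>?P. cl p (z p)) p)=dRcls n i (F p (z p))" using fc[OF p bspec[OF z p]] by simp
 qed simp
 finally show "f_map A n i (\<lambda>p\<in>?P. cl p (z p))=dRcls n i (\<Sum>p\<in>?P. F p (z p))" using fp by simp
 show "(\<Sum>p\<in>?P. F p (z p)):dRZ n i" using fp by simp
qed
have rep: "\<exists>z. (\<forall>p\<in>?P. z p:Z p) & x=(\<lambda>p\<in>?P. cl p (z p))" if x: "x:carrier (f_source A n i)" for x
proof -
 have "\<exists>z. z:Z p & x p=cl p z" if p: "p:?P" for p
 proof -
  have "x p:carrier (?L p)" using x p unfolding carr by(rule PiE_mem)
  thus ?thesis using qpres_obtain[OF Q[OF p]] by metis
 qed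
 then obtain z where z: "\<forall>p\<in>?P. z p:Z p & x p=cl p (z p)" by metis
 have "x=(\<lambda>p\<in>?P. cl p (z p))"
  by(rule extensionalityI[where A = ?P]) (use x z in "auto simp: carr PiE_def")
 thus ?thesis using z by blast
qed
have hom: "f_map A n i:hom (f_source A n i) ?H"
proof (rule homI)
 fix x assume "x:carrier (f_source A n i)"
 then obtain z where z: "\<forall>p\<in>?P. z p:Z p" "x=(\<lambda>p\<in>?P. cl p (z p))" using rep by blast
 show "f_map A n i x:carrier ?H" unfolding z(2) val[OF z(1)] by(rule qpres_in[OF R valZ[OF z(1)]])
next
 fix x y assume "x:carrier (f_source A n i)" "y:carrier (f_source A n i)"
 then obtain z w where z: "\<forall>p\<in>?P. z p:Z p" "x=(\<lambda>p\<in>?P. cl p (z p))"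
  and w: "\<forall>p\<in>?P. w p:Z p" "y=(\<lambda>p\<in>?P. cl p (w p))" using rep by blast
 have zw: "z p + w p:Z p" if "p:?P" for p
  by(rule addsubD(4)[OF qpres_addsub[OF Q[OF that]] bspec[OF z(1) that] bspec[OF w(1) that]])
 have "x \<otimes>\<^bsub>f_source A n i\<^esub> y=(\<lambda>p\<in>?P. cl p (z p + w p))"
  unfolding f_source_def mult_sum_group z(2) w(2) by(rule restrict_ext) (use qpres_mult[OF Q] z(1) w(1) in simp)
 hence "f_map A n i (x \<otimes>\<^bsub>f_source A n i\<^esub> y)=dRcls n i (\<Sum>p\<in>?P. F p (z p + w p))"
  using val[of "%p. z p + w p"] zw by simp
 also have "(\<Sum>p\<in>?P. F p (z p + w p))=(\<Sum>p\<in>?P. F p (z p)) + (\<Sum>p\<in>?P. F p (w p))"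
  unfolding sum.distrib[symmetric] by(rule sum.cong) (use linmap_add[OF F] in auto)
 also have "dRcls n i ... = f_map A n i x \<otimes>\<^bsub>?H\<^esub> f_map A n i y"
  unfolding z(2) w(2) val[OF z(1)] val[OF w(1)] by(rule qpres_mult[OF R valZ[OF z(1)] valZ[OF w(1)], symmetric])
 finally show "f_map A n i (x \<otimes>\<^bsub>f_source A n i\<^esub> y)=f_map A n i x \<otimes>\<^bsub>?H\<^esub> f_map A n i y" .
qed
moreover have "bij_betw (f_map A n i) (carrier (f_source A n i)) (carrier ?H)" unfolding bij_betw_def
proof
 show "inj_on (f_map A n i) (carrier (f_source A n i))"
 proof (rule inj_onI)
  fix x y assume xy: "x:carrier (f_source A n i)" "y:carrier (f_source A n i)" "f_map A n i x=f_map A n i y"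
  then obtain z w where z: "\<forall>p\<in>?P. z p:Z p" "x=(\<lambda>p\<in>?P. cl p (z p))"
   and w: "\<forall>p\<in>?P. w p:Z p" "y=(\<lambda>p\<in>?P. cl p (w p))" using rep by blast
  have zw: "z p - w p:Z p" if "p:?P" for p
   by(rule addsubD(2)[OF qpres_addsub[OF Q[OF that]] bspec[OF z(1) that] bspec[OF w(1) that]])
  have "(\<Sum>p\<in>?P. F p (z p)) - (\<Sum>p\<in>?P. F p (w p)):dRB n i"
   using xy(3) unfolding z(2) w(2) val[OF z(1)] val[OF w(1)] qpres_eq[OF R valZ[OF z(1)] valZ[OF w(1)]] .
  moreover have "(\<Sum>p\<in>?P. F p (z p)) - (\<Sum>p\<in>?P. F p (w p))=(\<Sum>p\<in>?P. F p (z p - w p))"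
   unfolding sum_subtractf[symmetric] by(rule sum.cong) (use linmap_diff[OF F] in auto)
  ultimately have s: "(\<Sum>p\<in>?P. F p (z p - w p)):dRB n i" by simp
  have "cl p (z p)=cl p (w p)" if p: "p:?P" for p
  proof -
   have "F p (z p - w p):dRB n i" by(rule coprime_torsion[OF addsub_dRB P _ _ s p]) (use Ft zw in auto)
   hence "z p - w p:B p" by(rule FB[OF p zw[OF p]])
   thus ?thesis using qpres_eq[OF Q[OF p] bspec[OF z(1) p] bspec[OF w(1) p]] by simp
  qed
  thus "x=y" unfolding z(2) w(2) by(rule restrict_ext)
 qed
 show "f_map A n i ` carrier (f_source A n i)=carrier ?H"
 proof
  show "f_map A n i ` carrier (f_source A n i) <= carrier ?H" using hom by(auto simp: hom_def)
  show "carrier ?H <= f_map A n i ` carrier (f_source A n i)"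
  proof
   fix C assume "C:carrier ?H"
   then obtain c where c: "c:dRZ n i" "C=dRcls n i c" using qpres_obtain[OF R] by blast
   have c1: "c:gl (deg (Gen ` S) n) i" "kd c=0" using c(1) by simp_all
   obtain y0 Y where y: "y0:gl (deg (Gen ` S) n) (Suc i)"
    "!!p. Y p:gl (%w. deg (Gen ` S) n w & (\<exists>w'. w=repeat_mset p w')) (Suc i)"
    "c=kd y0 + (\<Sum>p\<in>?P. sc (1 / of_nat p) (kd (Y p)))" by(rule gl_cycle[OF c1 i, of n]) (use n in auto)
   have "\<forall>p\<in>?P. \<exists>z. z:Z p & F p z=sc (1 / of_nat p) (kd (Y p))" using Fs[OF _ y(2)] by blast
   from bchoice[OF this] obtain z where
    z0: "\<forall>p\<in>?P. z p:Z p & F p (z p)=sc (1 / of_nat p) (kd (Y p))" by(rule exE)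
   have z: "\<forall>p\<in>?P. z p:Z p" by(rule ballI) (rule bspec[OF z0, THEN conjunct1])
   have z2: "F p (z p)=sc (1 / of_nat p) (kd (Y p))" if "p:?P" for p using bspec[OF z0 that] by(rule conjunct2)
   have "(\<Sum>p\<in>?P. F p (z p))=(\<Sum>p\<in>?P. sc (1 / of_nat p) (kd (Y p)))" by(rule sum.cong) (use z2 in auto)
   hence "c - (\<Sum>p\<in>?P. F p (z p))=kd y0" using y(3) by simp
   hence "c - (\<Sum>p\<in>?P. F p (z p)):dRB n i" using y(1) by simp
   hence "C=f_map A n i (\<lambda>p\<in>?P. cl p (z p))" unfolding c(2) val[OF z] qpres_eq[OF R c(1) valZ[OF z]] .
   thus "C:f_map A n i ` carrier (f_source A n i)" by(rule image_eqI[OF _ mk[OF z]])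
  qed
 qed
qed
ultimately show ?thesis by(simp add: iso_def)
qed

end

theorem theorem0p1:
  fixes A :: "('a, 'm) monoid_scheme" and i n :: nat
  assumes "free_abelian A"
    and "0 < i"
    and "1 \<le> n" and "n \<le> 7"
  shows "f_map A n i \<in> iso (f_source A n i) (dR_homology A n i)"
proof -
  obtain S where S: "comm_group A" "S \<subseteq> carrier A" "frag_eval A \<in> iso (free_Abelian_group S) A"
    using assms(1) unfolding free_abelian_def by blast
  interpret freegroup A S by (rule freegroup.intro) (rule S)+
  show ?thesis by (rule f_map_iso[OF assms(2-4)])
qed

end
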